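(* Let $\beta>0$, $\beta'=\beta/2$, and let $\mathrm d\in\mathbb C$ with $\Re\,\mathrm d\ge0$. For each $n$ let $U_n$ be a random matrix with law $\mathrm{CJ}^{(n)}_{\delta(n),\beta}$ where $\delta(n)=\beta'n\,\mathrm d$, let $e^{\mathrm i\theta^{(n)}_1},\dots,e^{\mathrm i\theta^{(n)}_n}$ be its eigenvalues and let $\mu^{(n)}_{\mathtt{esd}}=\frac1n\sum_{k=1}^n\delta_{e^{\mathrm i\theta^{(n)}_k}}$ be its empirical spectral distribution. Then, as $n\to\infty$, $$\lim_n\mu^{(n)}_{\mathtt{esd}}=\mu_{\mathrm d}\quad\text{(in probability)},$$ for the weak topology on probability measures on $\mathbb T$.
   Context: $\mathbb D=\{|z|<1\}$, $\mathbb T=\{|z|=1\}$. Weak convergence in probability of random probability measures $\nu_n$ on $\mathbb T$ to a deterministic $\nu$ means: for a distance $d$ metrizing weak convergence (e.g. the Lévy distance), $d(\nu_n,\nu)\to0$ in probability. The measure $\mu_{\mathrm d}$: put $\alpha_{\mathrm d}=-\frac{\bar{\mathrm d}}{1+\bar{\mathrm d}}$, let $\theta_{\mathrm d}\in[0,\pi)$ and $\xi_{\mathrm d}\in[-\theta_{\mathrm d},\theta_{\mathrm d}]$ be such that $\sin\frac{\theta_{\mathrm d}}2=\left|\frac{\mathrm d}{1+\mathrm d}\right|$ and $e^{\mathrm i\xi_{\mathrm d}}=\frac{1+\mathrm d}{1+\bar{\mathrm d}}$. If $\mathrm d\ne0$, $d\mu_{\mathrm d}(\zeta)=w_{\mathrm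 d}(\theta)\frac{d\theta}{2\pi}$ ($\zeta=e^{\mathrm i\theta}$), with $$w_{\mathrm d}(\theta)=\frac{\sqrt{\sin^2((\theta-\xi_{\mathrm d})/2)-\sin^2(\theta_{\mathrm d}/2)}}{|1+\alpha_{\mathrm d}|\sin(\theta/2)}\quad\text{if }\theta\in(\theta_{\mathrm d}+\xi_{\mathrm d},\,2\pi-\theta_{\mathrm d}+\xi_{\mathrm d}),$$ and $w_{\mathrm d}(\theta)=0$ otherwise; $\mu_0$ is the normalized Haar measure on $\mathbb T$. The law $\mathrm{CJ}^{(n)}_{\delta,\beta}$ ($\Re\,\delta>-1/2$): for a probability measure $\mu$ on $\mathbb T$ supported at $n$ points $e^{\mathrm i\theta_j}$, let $\Phi_0,\dots,\Phi_{n-1}$ be its monic orthogonal polynomials, $\Phi_n(z)=\prod_j(z-e^{\mathrm i\theta_j})$, $\Phi_j^*(z)=z^j\overline{\Phi_j(1/\bar z)}$; its Verblunsky coefficients $(\alpha_0,\dots,\alpha_{n-1})\in\mathbb D^{n-1}\times\mathbb T$ are given by $\Phi_{j+1}(z)=z\Phi_j(z)-\bar\alpha_j\Phi_j^*(z)$, and this is a bijection. The GGT matrix $\mathcal G(\alpha_0,\dots,\alpha_{n-1})$ is the matrix of $f(z)\mapsto zf(z)$ on $L^2(\mathbb T,\mu)$ in the basis of orthonormal polynomials $\Phi_j/\|\Phi_j\|$, $0\le j\le n-1$. For $s>1$, $\nu_s$ is the probability measure on $\mathbb D$ with density $\frac{s-1}{2\pi}(1-|z|^2)^{(s-3)/2}$,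 and $\nu_1$ is uniform on $\mathbb T$. $\mathrm{CJ}^{(n)}_{0,\beta}$ is the law of $\mathcal G(\alpha_0,\dots,\alpha_{n-1})$ when the $\alpha_k$ are independent with $\alpha_k\sim\nu_{\beta(n-k-1)+1}$. $\mathrm{CJ}^{(n)}_{\delta,\beta}$ is the probability measure whose density with respect to $\mathrm{CJ}^{(n)}_{0,\beta}$ is proportional to $\det_\delta(U)=\det(\mathrm{Id}-U)^{\bar\delta}\det(\mathrm{Id}-\overline U)^{\delta}$, i.e. the product over the eigenvalues $\zeta$ of $U$ of $(1-\zeta)^{\bar\delta}(1-\bar\zeta)^{\delta}$ (principal logarithm). Under this law the eigenvalue angles have joint density on $(0,2\pi)^n$ proportional to $\prod_{k<l}|e^{\mathrm i\theta_k}-e^{\mathrm i\theta_l}|^\beta\prod_j(1-e^{-\mathrm i\theta_j})^{\delta}(1-e^{\mathrm i\theta_j})^{\bar\delta}$. *)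

theory Defs
  imports
    "HOL-Probability.Probability"
    "Jordan_Normal_Form.Char_Poly"
    "Jordan_Normal_Form.Schur_Decomposition"
begin

section \<open>Probability measures on the unit circle and weak convergence in probability\<close>

definition circle_borel :: "complex measure" where
  "circle_borel = restrict_space borel (sphere 0 1)"

abbreviation circle_probs :: "complex measure set" where
  "circle_probs \<equiv> space (prob_algebra circle_borel)"

definition circle_haar :: "complex measure" where
  "circle_haar = distr (uniform_measure lborel {0..<2 * pi}) circle_borel cis"

definition circle_weak_conv :: "(nat \<Rightarrow> complex measure) \<Rightarrow> complex measure \<Rightarrow> bool" where
  "circle_weak_conv \<nu> \<mu> \<longleftrightarrow>
     (\<forall>f :: complex \<Rightarrow> real. continuous_on (sphere 0 1) f \<longrightarrow>
        (\<lambda>n. integral\<^sup>L (\<nu> n) f) \<longlonglongrightarrow> integral\<^sup>L \<mu> f)"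

definition metrizes_circle_weak_conv :: "(complex measure \<Rightarrow> complex measure \<Rightarrow> real) \<Rightarrow> bool" where
  "metrizes_circle_weak_conv D \<longleftrightarrow>
     Metric_space circle_probs D \<and>
     (\<forall>\<nu> \<mu>. (\<forall>n. \<nu> n \<in> circle_probs) \<longrightarrow> \<mu> \<in> circle_probs \<longrightarrow>
        (circle_weak_conv \<nu> \<mu> \<longleftrightarrow> (\<lambda>n. D (\<nu> n) \<mu>) \<longlonglongrightarrow> 0))"

text \<open>
  Metrics of the weak topology exist, e.g. the sum of the \<open>2\<^sup>-\<^sup>k\<close>-weighted distances of the \<open>k\<close>-th
  moments, so quantifying over all of them is not vacuous.
\<close>

context begin

private lemma circle_probsD:
  assumes "\<mu> \<in> circle_probs"
  shows "prob_space \<mu>" "sets \<mu> = sets circle_borel" "space \<mu> = sphere 0 1"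
proof -
  show "prob_space \<mu>" and s: "sets \<mu> = sets circle_borel"
    using assms by (auto simp: space_prob_algebra)
  show "space \<mu> = sphere 0 1"
    using sets_eq_imp_space_eq[OF s] by (simp add: circle_borel_def space_restrict_space)
qed

private lemma circle_integrable:
  fixes h :: "complex \<Rightarrow> 'b :: {banach, second_countable_topology}"
  assumes "\<mu> \<in> circle_probs" "continuous_on (sphere 0 1) h"
  shows "integrable \<mu> h"
proof -
  interpret prob_space \<mu> by (rule circle_probsD(1)[OF assms(1)])
  have "bounded (h ` sphere 0 1)"
    using assms(2) by (intro compact_imp_bounded compact_continuous_image) auto
  then obtain B where B: "\<And>z. z \<in> sphere 0 1 \<Longrightarrow> norm (h z) \<le> B"
    unfolding bounded_iff by blast
  have "h \<in> borel_measurable circle_borel"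
    unfolding circle_borel_def by (rule borel_measurable_continuous_on_restrict[OF assms(2)])
  then have "h \<in> borel_measurable \<mu>"
    by (simp cong: measurable_cong_sets add: measurable_cong_sets[OF circle_probsD(2)[OF assms(1)] refl])
  then show ?thesis
    using B circle_probsD(3)[OF assms(1)] by (intro integrable_const_bound[of h B]) auto
qed

private definition mom_conv :: "(nat \<Rightarrow> complex measure) \<Rightarrow> complex measure \<Rightarrow> (complex \<Rightarrow> complex) \<Rightarrow> bool" where
  "mom_conv \<nu> \<mu> h \<longleftrightarrow> continuous_on (sphere 0 1) h \<and>
     (\<forall>a b. (\<lambda>n. integral\<^sup>L (\<nu> n) (\<lambda>z. h z * (z ^ a * cnj z ^ b)))
        \<longlonglongrightarrow> integral\<^sup>L \<mu> (\<lambda>z. h z * (z ^ a * cnj z ^ b)))"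

private lemma mom_conv_add:
  assumes "\<And>n. \<nu> n \<in> circle_probs" "\<mu> \<in> circle_probs" "mom_conv \<nu> \<mu> h" "mom_conv \<nu> \<mu> k"
  shows "mom_conv \<nu> \<mu> (\<lambda>z. h z + k z)"
proof -
  have c: "continuous_on (sphere 0 1) h" "continuous_on (sphere 0 1) k"
    using assms by (auto simp: mom_conv_def)
  have "integral\<^sup>L N (\<lambda>z. (h z + k z) * (z ^ a * cnj z ^ b)) =
     integral\<^sup>L N (\<lambda>z. h z * (z ^ a * cnj z ^ b)) + integral\<^sup>L N (\<lambda>z. k z * (z ^ a * cnj z ^ b))"
    if "N \<in> circle_probs" for N a b
    unfolding distrib_right
    by (intro Bochner_Integration.integral_add circle_integrable[OF that] continuous_intros c)
  then show ?thesis
    using assms c unfolding mom_conv_def by (auto intro!: tendsto_add continuous_intros)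
qed

private lemma mom_conv_shift:
  assumes "mom_conv \<nu> \<mu> h"
  shows "mom_conv \<nu> \<mu> (\<lambda>z. c * (z ^ i * cnj z ^ j) * h z)"
proof -
  have "integral\<^sup>L N (\<lambda>z. c * (z ^ i * cnj z ^ j) * h z * (z ^ a * cnj z ^ b)) =
     c * integral\<^sup>L N (\<lambda>z. h z * (z ^ (i + a) * cnj z ^ (j + b)))" for N a b
    by (subst integral_mult_right_zero[symmetric]) (simp add: power_add algebra_simps)
  then show ?thesis
    using assms unfolding mom_conv_def by (auto intro!: tendsto_mult continuous_intros)
qed

private lemma mom_conv_poly:
  fixes g :: "complex \<Rightarrow> real"
  assumes P: "\<And>n. \<nu> n \<in> circle_probs" "\<mu> \<in> circle_probs"
  shows "real_polynomial_function g \<Longrightarrow> mom_conv \<nu> \<mu> h \<Longrightarrow> mom_conv \<nu> \<mu> (\<lambda>z. complex_of_real (g z) * h z)"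
proof (induction g arbitrary: h rule: real_polynomial_function.induct)
  case (linear f)
  define c where "c = Complex (f 1 / 2) (- f \<i> / 2)"
  have f: "complex_of_real (f z) = c * z + cnj c * cnj z" for z
  proof -
    have "f z = f (Re z *\<^sub>R 1 + Im z *\<^sub>R \<i>)"
      by (rule arg_cong[where f = f]) (simp add: complex_eq_iff)
    also have "\<dots> = Re z * f 1 + Im z * f \<i>"
      using bounded_linear.linear[OF linear.hyps] by (simp only: linear_add linear_scale real_scaleR_def)
    finally show ?thesis by (simp add: c_def complex_eq_iff algebra_simps)
  qed
  have "mom_conv \<nu> \<mu> (\<lambda>z. c * (z ^ 1 * cnj z ^ 0) * h z + cnj c * (z ^ 0 * cnj z ^ 1) * h z)"
    by (intro mom_conv_add P mom_conv_shift linear)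
  then show ?case by (simp add: f algebra_simps)
next
  case (const c)
  then show ?case using mom_conv_shift[of \<nu> \<mu> h "complex_of_real c" 0 0] by simp
next
  case (add f g)
  then show ?case by (simp add: distrib_right mom_conv_add P)
next
  case (mult f g)
  then show ?case by (simp add: mult.assoc)
qed

private lemma moments_imp_weak:
  assumes P: "\<And>n. \<nu> n \<in> circle_probs" "\<mu> \<in> circle_probs"
    and mom: "\<And>k. (\<lambda>n. integral\<^sup>L (\<nu> n) (\<lambda>z. z ^ k)) \<longlonglongrightarrow> integral\<^sup>L \<mu> (\<lambda>z. z ^ k)"
  shows "circle_weak_conv \<nu> \<mu>"
  unfolding circle_weak_conv_def
proof safe
  fix f :: "complex \<Rightarrow> real" assume f: "continuous_on (sphere 0 1) f"
  have mono: "(\<lambda>n. integral\<^sup>L (\<nu> n) (\<lambda>z. z ^ a * cnj z ^ b)) \<longlonglongrightarrow> integral\<^sup>L \<mu> (\<lambda>z. z ^ a * cnj z ^ b)" for a b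
  proof (cases "b \<le> a")
    case True
    have "integral\<^sup>L N (\<lambda>z. z ^ a * cnj z ^ b) = integral\<^sup>L N (\<lambda>z. z ^ (a - b))" if "N \<in> circle_probs" for N
    proof (rule Bochner_Integration.integral_cong)
      fix z assume "z \<in> space N"
      then have "z * cnj z = 1" using circle_probsD(3)[OF that] complex_norm_square[of z] by simp
      moreover have "z ^ a * cnj z ^ b = z ^ (a - b) * (z * cnj z) ^ b"
        using power_add[of z "a - b" b] True by (simp add: power_mult_distrib)
      ultimately show "z ^ a * cnj z ^ b = z ^ (a - b)" by simp
    qed simp
    then show ?thesis using mom P by simp
  next
    case False
    have "integral\<^sup>L N (\<lambda>z. z ^ a * cnj z ^ b) = cnj (integral\<^sup>L N (\<lambda>z. z ^ (b - a)))" if "N \<in> circle_probs" for N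
      unfolding Bochner_Integration.integral_cnj[symmetric, of N "\<lambda>z. z ^ (b - a)"]
    proof (rule Bochner_Integration.integral_cong[OF refl])
      fix z assume "z \<in> space N"
      then have "z * cnj z = 1" using circle_probsD(3)[OF that] complex_norm_square[of z] by simp
      moreover have "z ^ a * cnj z ^ b = cnj z ^ (b - a) * (z * cnj z) ^ a"
        using power_add[of "cnj z" "b - a" a] False by (simp add: power_mult_distrib)
      ultimately show "z ^ a * cnj z ^ b = cnj (z ^ (b - a))" by simp
    qed
    then show ?thesis using mom P by (simp add: tendsto_cnj)
  qed
  have one: "mom_conv \<nu> \<mu> (\<lambda>_. 1)" using mono by (simp add: mom_conv_def)
  show "(\<lambda>n. integral\<^sup>L (\<nu> n) f) \<longlonglongrightarrow> integral\<^sup>L \<mu> f"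
  proof (rule LIMSEQ_I)
    fix e :: real assume e: "e > 0"
    obtain g where g: "real_polynomial_function g" "\<And>z. z \<in> sphere 0 1 \<Longrightarrow> \<bar>f z - g z\<bar> < e / 4"
      using Stone_Weierstrass_real_polynomial_function[of "sphere 0 1 :: complex set" f "e / 4"] f e by auto
    have gc: "continuous_on (sphere 0 1) g"
      using continuous_real_polymonial_function[OF g(1)] by (simp add: continuous_at_imp_continuous_on)
    have "mom_conv \<nu> \<mu> (\<lambda>z. complex_of_real (g z) * 1)"
      by (rule mom_conv_poly[OF P g(1) one])
    then have "(\<lambda>n. integral\<^sup>L (\<nu> n) (\<lambda>z. complex_of_real (g z) * 1 * (z ^ 0 * cnj z ^ 0)))
        \<longlonglongrightarrow> integral\<^sup>L \<mu> (\<lambda>z. complex_of_real (g z) * 1 * (z ^ 0 * cnj z ^ 0))"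
      unfolding mom_conv_def by blast
    then have "(\<lambda>n. complex_of_real (integral\<^sup>L (\<nu> n) g)) \<longlonglongrightarrow> complex_of_real (integral\<^sup>L \<mu> g)"
      by simp
    then have "(\<lambda>n. integral\<^sup>L (\<nu> n) g) \<longlonglongrightarrow> integral\<^sup>L \<mu> g"
      using tendsto_of_real_iff by blast
    then obtain n0 where n0: "\<And>n. n \<ge> n0 \<Longrightarrow> \<bar>integral\<^sup>L (\<nu> n) g - integral\<^sup>L \<mu> g\<bar> < e / 4"
      using LIMSEQ_D[of _ _ "e / 4"] e by (metis divide_pos_pos real_norm_def zero_less_numeral)
    have close: "\<bar>integral\<^sup>L N f - integral\<^sup>L N g\<bar> \<le> e / 4" if "N \<in> circle_probs" for N
    proof -
      interpret prob_space N by (rule circle_probsD(1)[OF that])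
      have i: "integrable N f" "integrable N g" using circle_integrable[OF that] f gc by auto
      have "\<bar>integral\<^sup>L N f - integral\<^sup>L N g\<bar> = \<bar>integral\<^sup>L N (\<lambda>z. f z - g z)\<bar>" using i by simp
      also have "\<dots> \<le> integral\<^sup>L N (\<lambda>z. \<bar>f z - g z\<bar>)" by (rule integral_abs_bound)
      also have "\<dots> \<le> integral\<^sup>L N (\<lambda>z. e / 4)"
        using i g(2) circle_probsD(3)[OF that] by (intro integral_mono) (auto intro: less_imp_le)
      finally show ?thesis by (simp add: prob_space)
    qed
    show "\<exists>n0. \<forall>n\<ge>n0. norm (integral\<^sup>L (\<nu> n) f - integral\<^sup>L \<mu> f) < e"
    proof (intro exI allI impI)
      fix n assume "n \<ge> n0"
      from n0[OF this] close[OF P(1)[of n]] close[OF P(2)]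
      show "norm (integral\<^sup>L (\<nu> n) f - integral\<^sup>L \<mu> f) < e"
        unfolding real_norm_def by linarith
    qed
  qed
qed

private lemma moments_eqI:
  assumes P: "\<nu> \<in> circle_probs" "\<mu> \<in> circle_probs"
    and mom: "\<And>k. integral\<^sup>L \<nu> (\<lambda>z. z ^ k) = integral\<^sup>L \<mu> (\<lambda>z. z ^ k)"
  shows "\<nu> = \<mu>"
proof -
  have "circle_weak_conv (\<lambda>_. \<nu>) \<mu>"
    using P mom by (intro moments_imp_weak) auto
  then have eq: "integral\<^sup>L \<nu> f = integral\<^sup>L \<mu> f" if "continuous_on (sphere 0 1) f" for f :: "complex \<Rightarrow> real"
    using that unfolding circle_weak_conv_def by (simp add: LIMSEQ_const_iff)
  have closed: "emeasure \<nu> (C \<inter> sphere 0 1) = emeasure \<mu> (C \<inter> sphere 0 1)" if C: "closed C" for C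
  proof (cases "C = {}")
    case False
    define f :: "nat \<Rightarrow> complex \<Rightarrow> real" where "f m z = max 0 (1 - real m * infdist z C)" for m z
    have fc: "continuous_on (sphere 0 1) (f m)" for m
      unfolding f_def by (intro continuous_intros)
    have lim: "(\<lambda>m. f m z) \<longlonglongrightarrow> indicator C z" for z
    proof (cases "z \<in> C")
      case True
      then show ?thesis by (simp add: f_def)
    next
      case z: False
      then have pos: "infdist z C > 0"
        using C False by (metis in_closed_iff_infdist_zero infdist_nonneg less_eq_real_def)
      obtain m0 where m0: "1 / infdist z C < real m0" using reals_Archimedean2 by blast
      have "f m z = 0" if "m \<ge> m0" for m
      proof -
        have "1 / infdist z C < real m" using m0 that by linarith
        then show ?thesis using pos by (simp add: f_def pos_divide_less_eq)
      qed
      then show ?thesis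
        using z tendsto_eventually[of "\<lambda>m. f m z" 0 sequentially] by (auto simp: eventually_sequentially)
    qed
    have "(\<lambda>m. integral\<^sup>L N (f m)) \<longlonglongrightarrow> measure N (C \<inter> sphere 0 1)" if N: "N \<in> circle_probs" for N
    proof -
      interpret prob_space N by (rule circle_probsD(1)[OF N])
      note sp = circle_probsD(3)[OF N] and se = circle_probsD(2)[OF N]
      have m: "C \<inter> sphere 0 1 \<in> sets N"
        unfolding se circle_borel_def sets_restrict_space
        by (rule image_eqI[of _ _ C]) (use C in \<open>simp_all add: Int_commute borel_closed\<close>)
      have "(\<lambda>m. integral\<^sup>L N (f m)) \<longlonglongrightarrow> integral\<^sup>L N (indicator (C \<inter> sphere 0 1) :: _ \<Rightarrow> real)"
      proof (rule integral_dominated_convergence[where w = "\<lambda>_. 1"])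
        show "AE z in N. (\<lambda>m. f m z) \<longlonglongrightarrow> indicator (C \<inter> sphere 0 1) z"
          using lim by (intro AE_I2) (auto simp: sp indicator_def)
        show "f i \<in> borel_measurable N" for i
          using circle_integrable[OF N fc] by auto
        show "AE z in N. norm (f i z) \<le> 1" for i
          by (intro AE_I2) (auto simp: f_def infdist_nonneg)
      qed (use m in auto)
      then show ?thesis using m by simp
    qed
    from this[OF P(1)] this[OF P(2)] have "measure \<nu> (C \<inter> sphere 0 1) = measure \<mu> (C \<inter> sphere 0 1)"
      unfolding eq[OF fc] by (rule LIMSEQ_unique)
    moreover have "finite_measure \<nu>" "finite_measure \<mu>"
      using P circle_probsD(1) prob_space.finite_measure by blast+
    ultimately show ?thesis by (simp add: finite_measure.emeasure_eq_measure)
  qed simp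
  have idm: "(\<lambda>z. z) \<in> borel_measurable N" if "N \<in> circle_probs" for N
    using circle_integrable[OF that, of "\<lambda>z. z"] by auto
  have "distr \<nu> borel (\<lambda>z. z) = distr \<mu> borel (\<lambda>z. z)"
  proof (rule measure_eqI_generator_eq[where E = "Collect closed" and \<Omega> = UNIV and A = "\<lambda>_. UNIV"])
    show "Int_stable (Collect closed)" by (auto simp: Int_stable_def)
    show "emeasure (distr \<nu> borel (\<lambda>z. z)) X = emeasure (distr \<mu> borel (\<lambda>z. z)) X"
      if "X \<in> Collect closed" for X :: "complex set"
      using that closed idm P by (simp add: emeasure_distr circle_probsD(3))
    show "emeasure (distr \<nu> borel (\<lambda>z. z)) UNIV \<noteq> \<infinity>"
      using P idm prob_space.emeasure_space_1[OF circle_probsD(1)[OF P(1)]]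
      by (simp add: emeasure_distr)
  qed (auto simp: borel_eq_closed)
  show ?thesis
  proof (rule measure_eqI)
    show "sets \<nu> = sets \<mu>" using P circle_probsD(2) by simp
    fix A assume "A \<in> sets \<nu>"
    then have A: "A \<subseteq> sphere 0 1" "A \<in> sets borel"
      using circle_probsD(2)[OF P(1)] by (auto simp: circle_borel_def sets_restrict_space)
    have "emeasure N A = emeasure (distr N borel (\<lambda>z. z)) A" if "N \<in> circle_probs" for N
      using A idm[OF that] circle_probsD(3)[OF that] by (simp add: emeasure_distr Int_absorb2)
    then show "emeasure \<nu> A = emeasure \<mu> A"
      using P \<open>distr \<nu> borel (\<lambda>z. z) = _\<close> by simp
  qed
qed

lemma metrizes_circle_weak_conv_exists: "\<exists>D. metrizes_circle_weak_conv D"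
proof
  define t where "t N N' k = cmod (integral\<^sup>L N (\<lambda>z. z ^ k) - integral\<^sup>L N' (\<lambda>z. z ^ k)) * (1 / 2) ^ k"
    for N N' :: "complex measure" and k
  define D where "D N N' = (if N \<in> circle_probs \<and> N' \<in> circle_probs then suminf (t N N') else 0)"
    for N N'
  have m1: "cmod (integral\<^sup>L N (\<lambda>z. z ^ k)) \<le> 1" if "N \<in> circle_probs" for N k
  proof -
    interpret prob_space N by (rule circle_probsD(1)[OF that])
    have "cmod (integral\<^sup>L N (\<lambda>z. z ^ k)) \<le> integral\<^sup>L N (\<lambda>z. cmod (z ^ k))"
      by (rule integral_norm_bound)
    also have "\<dots> = integral\<^sup>L N (\<lambda>z. 1)"
      by (rule Bochner_Integration.integral_cong) (auto simp: circle_probsD(3)[OF that] norm_power)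
    finally show ?thesis by (simp add: prob_space)
  qed
  have t0: "0 \<le> t N N' k" for N N' k by (simp add: t_def)
  have tb: "t N N' k \<le> 2 * (1 / 2) ^ k" if "N \<in> circle_probs" "N' \<in> circle_probs" for N N' k
    unfolding t_def using norm_triangle_ineq4[of "integral\<^sup>L N (\<lambda>z. z ^ k)" "integral\<^sup>L N' (\<lambda>z. z ^ k)"]
      m1[OF that(1), of k] m1[OF that(2), of k] by (intro mult_right_mono) auto
  have sg: "summable (\<lambda>k. 2 * (1 / 2) ^ k :: real)"
    by (intro summable_mult summable_geometric) auto
  have st: "summable (t N N')" if "N \<in> circle_probs" "N' \<in> circle_probs" for N N'
    using tb[OF that] t0 by (intro summable_comparison_test[OF _ sg]) (auto intro!: exI[of _ 0])
  have tD: "t N N' k \<le> D N N'" if "N \<in> circle_probs" "N' \<in> circle_probs" for N N' k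
    using sum_le_suminf[OF st[OF that], of "{k}"] t0 that by (simp add: D_def)
  have "Metric_space circle_probs D"
  proof
    show "0 \<le> D N N'" for N N' by (auto simp: D_def intro!: suminf_nonneg st t0)
    have "t N N' = t N' N" for N N' by (auto simp: t_def norm_minus_commute)
    then show "D N N' = D N' N" for N N' by (auto simp: D_def)
    show "(D N N' = 0) = (N = N')" if N: "N \<in> circle_probs" "N' \<in> circle_probs" for N N'
    proof
      assume "D N N' = 0"
      then have "t N N' k = 0" for k using tD[OF N, of k] t0[of N N' k] by simp
      then show "N = N'" by (intro moments_eqI N) (simp add: t_def)
    next
      assume "N = N'"
      moreover have "t N' N' = (\<lambda>_. 0)" by (simp add: t_def fun_eq_iff)
      ultimately show "D N N' = 0" by (simp add: D_def)
    qed
    show "D N L \<le> D N N' + D N' L"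
      if "N \<in> circle_probs" "N' \<in> circle_probs" "L \<in> circle_probs" for N N' L
    proof -
      have "suminf (t N L) \<le> (\<Sum>k. t N N' k + t N' L k)"
      proof (intro suminf_le st that summable_add)
        show "t N L k \<le> t N N' k + t N' L k" for k
          unfolding t_def distrib_right[symmetric]
          by (intro mult_right_mono, unfold dist_norm[symmetric]) (auto intro: dist_triangle)
      qed
      then show ?thesis using that by (simp add: D_def suminf_add st)
    qed
  qed
  moreover have "circle_weak_conv \<nu> \<mu> \<longleftrightarrow> (\<lambda>n. D (\<nu> n) \<mu>) \<longlonglongrightarrow> 0"
    if "\<And>n. \<nu> n \<in> circle_probs" "\<mu> \<in> circle_probs" for \<nu> \<mu>
  proof
    assume w: "circle_weak_conv \<nu> \<mu>"
    have c: "continuous_on (sphere 0 1) (\<lambda>z :: complex. z ^ k)" for k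
      by (intro continuous_on_power continuous_on_id)
    have re: "(\<lambda>n. integral\<^sup>L (\<nu> n) (\<lambda>z. Re (z ^ k))) \<longlonglongrightarrow> integral\<^sup>L \<mu> (\<lambda>z. Re (z ^ k))"
      and im: "(\<lambda>n. integral\<^sup>L (\<nu> n) (\<lambda>z. Im (z ^ k))) \<longlonglongrightarrow> integral\<^sup>L \<mu> (\<lambda>z. Im (z ^ k))" for k
      using w continuous_on_Re[OF c[of k]] continuous_on_Im[OF c[of k]]
      unfolding circle_weak_conv_def by blast+
    have "integral\<^sup>L N (\<lambda>z. z ^ k) = Complex (integral\<^sup>L N (\<lambda>z. Re (z ^ k))) (integral\<^sup>L N (\<lambda>z. Im (z ^ k)))"
      if "N \<in> circle_probs" for N k
      using circle_integrable[OF that c[of k]] by (simp add: complex_eq_iff)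
    then have mom: "(\<lambda>n. integral\<^sup>L (\<nu> n) (\<lambda>z. z ^ k)) \<longlonglongrightarrow> integral\<^sup>L \<mu> (\<lambda>z. z ^ k)" for k
      using re[of k] im[of k] that by (simp add: tendsto_Complex)
    have "(\<lambda>n. suminf (t (\<nu> n) \<mu>)) \<longlonglongrightarrow> suminf (\<lambda>k::nat. 0 :: real)"
    proof (rule tannerys_theorem[THEN conjunct2, THEN conjunct2])
      show "(\<lambda>n. t (\<nu> n) \<mu> k) \<longlonglongrightarrow> 0" for k
        unfolding t_def using mom[of k] by (intro tendsto_mult_left_zero tendsto_norm_zero LIM_zero)
      show "eventually (\<lambda>(k, n). norm (t (\<nu> n) \<mu> k) \<le> 2 * (1 / 2) ^ k) (at_top \<times>\<^sub>F sequentially)"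
        using tb that t0 by (intro always_eventually) auto
    qed (use sg in auto)
    then show "(\<lambda>n. D (\<nu> n) \<mu>) \<longlonglongrightarrow> 0" using that by (simp add: D_def)
  next
    assume D0: "(\<lambda>n. D (\<nu> n) \<mu>) \<longlonglongrightarrow> 0"
    show "circle_weak_conv \<nu> \<mu>"
    proof (rule moments_imp_weak[OF that])
      fix k
      have "(\<lambda>n. t (\<nu> n) \<mu> k) \<longlonglongrightarrow> 0"
        by (rule tendsto_sandwich[OF _ _ tendsto_const D0]) (auto intro!: always_eventually t0 tD that)
      then have "(\<lambda>n. t (\<nu> n) \<mu> k * 2 ^ k) \<longlonglongrightarrow> 0 * 2 ^ k"
        by (intro tendsto_mult tendsto_const)
      then have "(\<lambda>n. cmod (integral\<^sup>L (\<nu> n) (\<lambda>z. z ^ k) - integral\<^sup>L \<mu> (\<lambda>z. z ^ k))) \<longlonglongrightarrow> 0"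
        by (simp add: t_def power_one_over)
      then show "(\<lambda>n. integral\<^sup>L (\<nu> n) (\<lambda>z. z ^ k)) \<longlonglongrightarrow> integral\<^sup>L \<mu> (\<lambda>z. z ^ k)"
        by (rule LIM_zero_cancel[OF tendsto_norm_zero_cancel])
    qed
  qed
  ultimately show "metrizes_circle_weak_conv D"
    unfolding metrizes_circle_weak_conv_def by blast
qed

end

text \<open>
  The random measures \<open>\<nu> n\<close> may live on different probability spaces \<open>M n\<close>. The distance \<open>D\<close> to the
  limit has to tend to 0 in probability for every metric \<open>D\<close> of the weak topology; the choice of
  \<open>D\<close> does not matter, because all of them are uniformly equivalent on the compact space of
  probability measures on the circle. Measurability is demanded because \<^const>\<open>measure\<close> is 0 on
  nonmeasurable sets; only large \<open>n\<close> count, as there is nothing to say about \<open>n = 0\<close>.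
\<close>
definition circle_weak_conv_in_prob ::
    "(nat \<Rightarrow> 'a measure) \<Rightarrow> (nat \<Rightarrow> 'a \<Rightarrow> complex measure) \<Rightarrow> complex measure \<Rightarrow> bool" where
  "circle_weak_conv_in_prob M \<nu> \<mu> \<longleftrightarrow>
     \<mu> \<in> circle_probs \<and>
     (\<forall>\<^sub>F n in sequentially. \<forall>\<omega> \<in> space (M n). \<nu> n \<omega> \<in> circle_probs) \<and>
     (\<forall>D. metrizes_circle_weak_conv D \<longrightarrow>
        (\<forall>\<^sub>F n in sequentially. (\<lambda>\<omega>. D (\<nu> n \<omega>) \<mu>) \<in> borel_measurable (M n)) \<and>
        (\<forall>\<epsilon>>0. (\<lambda>n. measure (M n) {\<omega> \<in> space (M n). D (\<nu> n \<omega>) \<mu> > \<epsilon>}) \<longlonglongrightarrow> 0))"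


section \<open>The limiting measure\<close>

definition \<alpha>\<^sub>d :: "complex \<Rightarrow> complex" where
  "\<alpha>\<^sub>d d = - (cnj d / (1 + cnj d))"

definition \<theta>\<^sub>d :: "complex \<Rightarrow> real" where
  "\<theta>\<^sub>d d = (THE \<theta>. 0 \<le> \<theta> \<and> \<theta> < pi \<and> sin (\<theta> / 2) = cmod (d / (1 + d)))"

definition \<xi>\<^sub>d :: "complex \<Rightarrow> real" where
  "\<xi>\<^sub>d d = (THE \<xi>. - \<theta>\<^sub>d d \<le> \<xi> \<and> \<xi> \<le> \<theta>\<^sub>d d \<and> cis \<xi> = (1 + d) / (1 + cnj d))"

lemma one_plus_nonzero: "Re d \<ge> 0 \<Longrightarrow> 1 + d \<noteq> 0" "Re d \<ge> 0 \<Longrightarrow> 1 + cnj d \<noteq> 0"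
  by (auto simp: complex_eq_iff)

lemma
  assumes "Re d \<ge> 0"
  shows \<theta>\<^sub>d_ex1: "\<exists>!\<theta>. 0 \<le> \<theta> \<and> \<theta> < pi \<and> sin (\<theta> / 2) = cmod (d / (1 + d))"
    and \<theta>\<^sub>d_props: "0 \<le> \<theta>\<^sub>d d" "\<theta>\<^sub>d d < pi" "sin (\<theta>\<^sub>d d / 2) = cmod (d / (1 + d))"
proof -
  have "(cmod d)\<^sup>2 < (cmod (1 + d))\<^sup>2"
    unfolding cmod_power2 using assms by (simp add: power2_eq_square algebra_simps)
  then have lt: "cmod (d / (1 + d)) < 1"
    using power2_less_imp_less[of "cmod d" "cmod (1 + d)"] by (simp add: norm_divide divide_less_eq)
  show ex1: "\<exists>!\<theta>. 0 \<le> \<theta> \<and> \<theta> < pi \<and> sin (\<theta> / 2) = cmod (d / (1 + d))"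
  proof (rule ex1I[of _ "2 * arcsin (cmod (d / (1 + d)))"], safe)
    let ?r = "cmod (d / (1 + d))"
    show "0 \<le> 2 * arcsin ?r" using lt arcsin_nonneg[of ?r] by simp
    show "2 * arcsin ?r < pi"
      using arcsin_lt_bounded[of ?r] lt norm_ge_zero[of "d / (1 + d)"] by linarith
    show "sin (2 * arcsin ?r / 2) = ?r"
      using sin_arcsin[of ?r] lt order.trans[OF _ norm_ge_zero, of "-1" "d / (1 + d)"] by (simp del: norm_divide)
    fix \<theta> :: real assume "0 \<le> \<theta>" "\<theta> < pi" "sin (\<theta> / 2) = ?r"
    then show "\<theta> = 2 * arcsin ?r" using arcsin_sin[of "\<theta> / 2"] by simp
  qed
  from theI'[OF ex1] show "0 \<le> \<theta>\<^sub>d d" "\<theta>\<^sub>d d < pi" "sin (\<theta>\<^sub>d d / 2) = cmod (d / (1 + d))"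
    unfolding \<theta>\<^sub>d_def by blast+
qed

lemma
  assumes "Re d \<ge> 0"
  shows \<xi>\<^sub>d_ex1: "\<exists>!\<xi>. - \<theta>\<^sub>d d \<le> \<xi> \<and> \<xi> \<le> \<theta>\<^sub>d d \<and> cis \<xi> = (1 + d) / (1 + cnj d)"
    and \<xi>\<^sub>d_props: "- \<theta>\<^sub>d d \<le> \<xi>\<^sub>d d" "\<xi>\<^sub>d d \<le> \<theta>\<^sub>d d" "cis (\<xi>\<^sub>d d) = (1 + d) / (1 + cnj d)"
proof -
  note \<theta> = \<theta>\<^sub>d_props[OF assms] and nz = one_plus_nonzero[OF assms]
  define a where "a = Arg (1 + d)"
  have pos: "Re (1 + d) > 0" using assms by simp
  have a: "1 + d = rcis (cmod (1 + d)) a" by (simp add: a_def rcis_cmod_Arg)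
  have ab: "\<bar>a\<bar> < pi / 2" using pos Arg_Re_pos[of "1 + d"] nz by (simp add: a_def)
  have sa: "cmod (1 + d) * sin a = Im d"
    using arg_cong[OF a, of Im] by simp
  have "\<bar>sin a\<bar> = \<bar>Im d\<bar> / cmod (1 + d)"
    using nz by (simp add: sa[symmetric] abs_mult)
  also have "\<dots> \<le> cmod (d / (1 + d))"
    using abs_Im_le_cmod[of d] by (simp add: norm_divide divide_right_mono)
  finally have s: "\<bar>sin a\<bar> \<le> sin (\<theta>\<^sub>d d / 2)" using \<theta>(3) by simp
  have ba: "\<bar>2 * a\<bar> \<le> \<theta>\<^sub>d d"
  proof -
    have "sin a \<le> sin (\<theta>\<^sub>d d / 2)" "sin (- a) \<le> sin (\<theta>\<^sub>d d / 2)"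
      using s by (auto simp: abs_le_iff)
    then have "a \<le> \<theta>\<^sub>d d / 2" "- a \<le> \<theta>\<^sub>d d / 2"
      using \<theta>(1,2) ab sin_mono_le_eq[of a "\<theta>\<^sub>d d / 2"] sin_mono_le_eq[of "- a" "\<theta>\<^sub>d d / 2"]
      by linarith+
    then show ?thesis by (simp add: abs_le_iff)
  qed
  have ca: "cis (2 * a) = (1 + d) / (1 + cnj d)"
  proof -
    have e: "1 + cnj d = rcis (cmod (1 + d)) (- a)"
      using arg_cong[OF a, of cnj] by (simp add: rcis_def cis_cnj)
    have "(1 + d) / (1 + cnj d) = rcis (cmod (1 + d)) a / rcis (cmod (1 + d)) (- a)"
      using a e by metis
    also have "\<dots> = cis (2 * a)" using nz by (simp add: rcis_divide rcis_def cis_divide)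
    finally show ?thesis by simp
  qed
  show ex1: "\<exists>!\<xi>. - \<theta>\<^sub>d d \<le> \<xi> \<and> \<xi> \<le> \<theta>\<^sub>d d \<and> cis \<xi> = (1 + d) / (1 + cnj d)"
  proof (rule ex1I[of _ "2 * a"])
    show "- \<theta>\<^sub>d d \<le> 2 * a \<and> 2 * a \<le> \<theta>\<^sub>d d \<and> cis (2 * a) = (1 + d) / (1 + cnj d)"
      using ba ca by (simp add: abs_le_iff)
    fix \<xi> assume x: "- \<theta>\<^sub>d d \<le> \<xi> \<and> \<xi> \<le> \<theta>\<^sub>d d \<and> cis \<xi> = (1 + d) / (1 + cnj d)"
    then have "\<xi> \<in> {-pi<..pi}" "2 * a \<in> {-pi<..pi}"
      using \<theta>(2) ba by (auto simp: abs_le_iff)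
    then have "Arg (cis \<xi>) = \<xi>" "Arg (cis (2 * a)) = 2 * a"
      by (simp_all only: Arg_cis)
    then show "\<xi> = 2 * a" using x ca by metis
  qed
  from theI'[OF ex1] show "- \<theta>\<^sub>d d \<le> \<xi>\<^sub>d d" "\<xi>\<^sub>d d \<le> \<theta>\<^sub>d d" "cis (\<xi>\<^sub>d d) = (1 + d) / (1 + cnj d)"
    unfolding \<xi>\<^sub>d_def by blast+
qed

definition w\<^sub>d :: "complex \<Rightarrow> real \<Rightarrow> real" where
  "w\<^sub>d d \<theta> =
     (if \<theta> \<in> {\<theta>\<^sub>d d + \<xi>\<^sub>d d <..< 2 * pi - \<theta>\<^sub>d d + \<xi>\<^sub>d d}
      then sqrt ((sin ((\<theta> - \<xi>\<^sub>d d) / 2))\<^sup>2 - (sin (\<theta>\<^sub>d d / 2))\<^sup>2) / (cmod (1 + \<alpha>\<^sub>d d) * sin (\<theta> / 2))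
      else 0)"

definition \<mu>\<^sub>d :: "complex \<Rightarrow> complex measure" where
  "\<mu>\<^sub>d d = (if d = 0 then circle_haar
     else distr (density lborel (\<lambda>\<theta>. ennreal (w\<^sub>d d \<theta> / (2 * pi)))) circle_borel cis)"


section \<open>Verblunsky coefficients and GGT matrices\<close>

text \<open>A probability measure supported at \<open>n\<close> points of the circle is encoded as a \<^typ>\<open>complex pmf\<close>.\<close>
definition npoint_circle_pmf :: "nat \<Rightarrow> complex pmf \<Rightarrow> bool" where
  "npoint_circle_pmf n \<mu> \<longleftrightarrow> set_pmf \<mu> \<subseteq> sphere 0 1 \<and> finite (set_pmf \<mu>) \<and> card (set_pmf \<mu>) = n"

definition L2_inner :: "complex pmf \<Rightarrow> complex poly \<Rightarrow> complex poly \<Rightarrow> complex" where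
  "L2_inner \<mu> p q = measure_pmf.expectation \<mu> (\<lambda>z. cnj (poly p z) * poly q z)"

definition L2_norm :: "complex pmf \<Rightarrow> complex poly \<Rightarrow> real" where
  "L2_norm \<mu> p = sqrt (measure_pmf.expectation \<mu> (\<lambda>z. (cmod (poly p z))\<^sup>2))"

definition monic_OP :: "complex pmf \<Rightarrow> nat \<Rightarrow> complex poly" where
  "monic_OP \<mu> k =
     (if k < card (set_pmf \<mu>)
      then THE p. degree p = k \<and> lead_coeff p = 1 \<and> (\<forall>j<k. L2_inner \<mu> (Polynomial.monom 1 j) p = 0)
      else \<Prod>\<zeta>\<in>set_pmf \<mu>. [:- \<zeta>, 1:])"

text \<open>For \<open>p\<close> of degree \<open>j\<close> this is \<open>p\<^sup>*(z) = z^j cnj (p (1 / cnj z))\<close>.\<close>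
definition reversed_poly :: "complex poly \<Rightarrow> complex poly" where
  "reversed_poly p = reflect_poly (map_poly cnj p)"

definition verblunsky_coeffs :: "nat \<Rightarrow> complex pmf \<Rightarrow> (nat \<Rightarrow> complex) \<Rightarrow> bool" where
  "verblunsky_coeffs n \<mu> \<alpha> \<longleftrightarrow>
     (\<forall>j<n. monic_OP \<mu> (Suc j) =
        [:0, 1:] * monic_OP \<mu> j - Polynomial.smult (cnj (\<alpha> j)) (reversed_poly (monic_OP \<mu> j)))"

text \<open>
  Well defined for \<open>\<alpha> 0, \<dots>, \<alpha> (n - 2)\<close> in the open disc and \<open>\<alpha> (n - 1)\<close> on the circle.
\<close>
definition verblunsky_measure :: "nat \<Rightarrow> (nat \<Rightarrow> complex) \<Rightarrow> complex pmf" where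
  "verblunsky_measure n \<alpha> = (THE \<mu>. npoint_circle_pmf n \<mu> \<and> verblunsky_coeffs n \<mu> \<alpha>)"

definition orthonormal_OP :: "complex pmf \<Rightarrow> nat \<Rightarrow> complex poly" where
  "orthonormal_OP \<mu> j = Polynomial.smult (complex_of_real (1 / L2_norm \<mu> (monic_OP \<mu> j))) (monic_OP \<mu> j)"

definition GGT :: "nat \<Rightarrow> (nat \<Rightarrow> complex) \<Rightarrow> complex mat" where
  "GGT n \<alpha> =
     (let \<mu> = verblunsky_measure n \<alpha>
      in mat n n (\<lambda>(i, j). L2_inner \<mu> (orthonormal_OP \<mu> i) ([:0, 1:] * orthonormal_OP \<mu> j)))"


section \<open>The circular Jacobi ensemble\<close>

text \<open>
  The Borel space of the unitary group, with the \<open>\<sigma>\<close>-algebra generated by the matrix entries.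
\<close>
definition unitary_mats :: "nat \<Rightarrow> complex mat set" where
  "unitary_mats n = {A \<in> carrier_mat n n. mat_adjoint A * A = 1\<^sub>m n}"

definition unitary_borel :: "nat \<Rightarrow> complex mat measure" where
  "unitary_borel n = vimage_algebra (unitary_mats n)
     (\<lambda>A. \<lambda>ij \<in> {..<n} \<times> {..<n}. A $$ ij) (\<Pi>\<^sub>M ij \<in> {..<n} \<times> {..<n}. borel)"

text \<open>
  The space of \<open>disc_law s\<close> is the open unit disc for \<open>s > 1\<close> and the unit circle for \<open>s = 1\<close>.
\<close>
definition disc_law :: "real \<Rightarrow> complex measure" where
  "disc_law s = (if s = 1 then circle_haar
     else density (restrict_space lborel (ball 0 1))
       (\<lambda>z. ennreal ((s - 1) / (2 * pi) * (1 - (cmod z)\<^sup>2) powr ((s - 3) / 2))))"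

definition CJ0 :: "nat \<Rightarrow> real \<Rightarrow> complex mat measure" where
  "CJ0 n \<beta> = distr (\<Pi>\<^sub>M k \<in> {..<n}. disc_law (\<beta> * (real n - real k - 1) + 1)) (unitary_borel n) (GGT n)"

definition eigvals_mset :: "complex mat \<Rightarrow> complex multiset" where
  "eigvals_mset A = proots (char_poly A)"

definition det_delta :: "complex \<Rightarrow> complex mat \<Rightarrow> complex" where
  "det_delta \<delta> A = (\<Prod>\<zeta> \<in># eigvals_mset A. (1 - \<zeta>) powr (cnj \<delta>) * (1 - cnj \<zeta>) powr \<delta>)"

text \<open>
  On unitary matrices \<^const>\<open>det_delta\<close> is a nonnegative real, so taking \<^const>\<open>Re\<close> loses nothing.
\<close>
definition CJ :: "nat \<Rightarrow> complex \<Rightarrow> real \<Rightarrow> complex mat measure" where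
  "CJ n \<delta> \<beta> = density (CJ0 n \<beta>)
     (\<lambda>A. ennreal (Re (det_delta \<delta> A)) / (\<integral>\<^sup>+ B. ennreal (Re (det_delta \<delta> B)) \<partial>CJ0 n \<beta>))"

text \<open>
  \<^const>\<open>pmf_of_multiset\<close> gives mass \<open>1 / n\<close> to each eigenvalue, counted with multiplicity.
\<close>
definition esd :: "complex mat \<Rightarrow> complex measure" where
  "esd A = restrict_space (distr (measure_pmf (pmf_of_multiset (eigvals_mset A))) borel (\<lambda>z. z)) (sphere 0 1)"

end

theory Submission
  imports Defs "HOL-Complex_Analysis.Complex_Analysis"
begin

text \<open>
  Write \<open>n = m + 1\<close>, let \<open>\<alpha>\<^sub>0, \<dots>, \<alpha>\<^sub>m\<close> be the Verblunsky coefficients of the random matrix and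
  \<open>\<phi>\<^sub>k\<close>, \<open>\<psi>\<^sub>k\<close> its monic orthogonal polynomials and their reversals. The proof replaces the eigenvalues,
  which interact, by coefficients that are independent and concentrate.

  \<^emph>\<open>Independence.\<close> Put \<open>\<gamma>\<^sub>k = cnj \<alpha>\<^sub>k * (cnj (\<phi>\<^sub>k 1) / \<phi>\<^sub>k 1)\<close>. The reversed polynomial factorizes along
  the recursion, so \<open>\<Sum> log (1 - cnj \<zeta> * z)\<close> over the eigenvalues \<open>\<zeta>\<close> is a sum over \<open>k\<close>
  (\<open>Ln_sum_identity\<close>), and at \<open>z = 1\<close> the \<open>k\<close>-th term depends on \<open>\<gamma>\<^sub>k\<close> alone. Thus \<open>det_delta\<close> is a product
  of functions of the single \<open>\<gamma>\<^sub>k\<close> (\<open>jacobi_weight_product\<close>). Given its predecessors, \<open>\<gamma>\<^sub>k\<close> is a reflected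
  rotation of \<open>\<alpha>\<^sub>k\<close>, whose law is invariant under such maps; hence under the Jacobi ensemble the \<open>\<gamma>\<^sub>k\<close> are
  independent, with the law of \<open>\<alpha>\<^sub>k\<close> tilted by the Jacobi weight (\<open>nn_integral_deformed\<close>,
  \<open>CJ_markov_bound\<close>).

  \<^emph>\<open>Concentration.\<close> With \<open>\<delta> = \<beta> / 2 * n * d\<close> and \<open>s = (m - k) / n\<close>, both the exponent of
  \<open>1 - (cmod z)\<^sup>2\<close> in the law of \<open>\<alpha>\<^sub>k\<close> and the exponent of the tilt grow linearly in \<open>n\<close>. Integration by
  parts on the disc shows that \<open>\<gamma>\<^sub>k\<close> is within \<open>O (1 / sqrt n)\<close> of the mode \<open>- d / (s + cnj d)\<close>,
  uniformly for \<open>s\<close> bounded away from \<open>0\<close> (\<open>disc_law_concentration\<close>).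

  \<^emph>\<open>The limiting recursion.\<close> The ratios \<open>b\<^sub>k z = (\<phi>\<^sub>k z / \<psi>\<^sub>k z) * (\<psi>\<^sub>k 1 / \<phi>\<^sub>k 1)\<close> obey a Moebius recursion driven by
  \<open>\<gamma>\<^sub>k\<close>, which for \<open>cmod z \<le> 1/4\<close> is a contraction. Since the modes vary slowly in \<open>k\<close>, \<open>b\<^sub>k z\<close> follows
  the fixed point of the limiting map, and the average of \<open>log (1 - cnj \<zeta> * z)\<close> is close to the Riemann sum
  of \<open>log (1 - cnj \<gamma> * z * f)\<close> with \<open>\<gamma>\<close> the mode and \<open>f\<close> the fixed point at level \<open>s\<close>
  (\<open>chain_bound\<close>).

  \<^emph>\<open>Integration over the levels.\<close> The logarithmic derivative in \<open>z\<close> of the factor at level \<open>s\<close> turns out to be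
  an exact derivative in \<open>s\<close> (\<open>limit_factor_derivative\<close>, \<open>herglotz_derivative_s\<close>), so the integral over the levels is
  explicit: the Herglotz transform of the empirical spectral distribution approaches
  \<open>F = csqrt \<Delta> - A\<close>, with \<open>\<Delta>\<close> and \<open>A\<close> polynomials in \<open>(1 + z) / (1 - z)\<close> (\<open>riemann_sum_limit\<close>,
  \<open>power_sum_bound\<close>). Cauchy's estimate turns this into closeness of each moment.

  \<^emph>\<open>Identification.\<close> The boundary values of \<open>Re F\<close> on the circle are the density \<open>w\<^sub>d\<close>
  (\<open>herglotz_boundary\<close>, \<open>boundary_weight_eq\<close>), so the Taylor coefficients of \<open>F\<close> of positive order are twice the conjugate moments of \<open>\<mu>\<^sub>d d\<close>
  (\<open>moment_mu_d\<close>). On the circle moments determine weak convergence, hence every metric of the weak topology is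
  controlled by finitely many of them (\<open>metric_controlled_by_moments\<close>), and Markov's inequality concludes.
\<close>

section \<open>The Szego recursion\<close>

text \<open>
  The Szego recursion, evaluated at a point \<open>z\<close>: \<open>szego_phi a z j\<close> is the value of the \<open>j\<close>-th monic orthogonal
  polynomial and \<open>szego_psi a z j\<close> that of its reversal. Working with values makes both
  measurable functions of the coefficients at once.
\<close>
fun szego_phi szego_psi :: "(nat \<Rightarrow> complex) \<Rightarrow> complex \<Rightarrow> nat \<Rightarrow> complex" where
  "szego_phi a z 0 = 1"
| "szego_psi a z 0 = 1"
| "szego_phi a z (Suc j) = z * szego_phi a z j - cnj (a j) * szego_psi a z j"
| "szego_psi a z (Suc j) = szego_psi a z j - a j * z * szego_phi a z j"

text \<open>
  The squared \<open>L\<^sup>2\<close> norm of the \<open>j\<close>-th monic orthogonal polynomial.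
\<close>
definition szego_normsq :: "(nat \<Rightarrow> complex) \<Rightarrow> nat \<Rightarrow> real" where
  "szego_normsq a j = (\<Prod>l<j. 1 - (cmod (a l))\<^sup>2)"

primrec szego_poly :: "(nat \<Rightarrow> complex) \<Rightarrow> nat \<Rightarrow> complex poly" where
  "szego_poly a 0 = 1"
| "szego_poly a (Suc j) =
     [:0, 1:] * szego_poly a j - Polynomial.smult (cnj (a j)) (reversed_poly (szego_poly a j))"

lemma degree_reversed_poly_le: "degree (reversed_poly p) \<le> degree p"
proof -
  have "degree (map_poly cnj p) = degree p"
    by (rule degree_map_poly) auto
  then show ?thesis
    unfolding reversed_poly_def using degree_reflect_poly_le[of "map_poly cnj p"] by simp
qed

lemma szego_poly_monic: "degree (szego_poly a j) = j \<and> lead_coeff (szego_poly a j) = 1"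
proof (induction j)
  case (Suc j)
  define q where "q = Polynomial.smult (cnj (a j)) (reversed_poly (szego_poly a j))"
  have dq: "degree q \<le> j"
    unfolding q_def using degree_smult_le[of "cnj (a j)" "reversed_poly (szego_poly a j)"]
      degree_reversed_poly_le[of "szego_poly a j"] Suc by linarith
  have nz: "szego_poly a j \<noteq> 0"
    using Suc by auto
  have e: "[:0, 1:] * szego_poly a j = pCons 0 (szego_poly a j)" by simp
  have dp: "degree (pCons 0 (szego_poly a j)) = Suc j" using Suc nz by simp
  have s: "szego_poly a (Suc j) = pCons 0 (szego_poly a j) + - q" by (simp add: q_def)
  have d: "degree (szego_poly a (Suc j)) = Suc j"
    unfolding s using dp dq by (subst degree_add_eq_left) auto
  moreover have "coeff (szego_poly a j) j = 1" using Suc by metis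
  then have "coeff (szego_poly a (Suc j)) (Suc j) = 1"
    unfolding s using dq by (simp add: coeff_eq_0)
  ultimately show ?case by simp
qed simp

lemma poly_reversed_poly:
  assumes "z \<noteq> 0"
  shows "poly (reversed_poly p) z = z ^ degree p * cnj (poly p (1 / cnj z))"
proof -
  have "degree (map_poly cnj p) = degree p"
    by (rule degree_map_poly) auto
  then show ?thesis
    unfolding reversed_poly_def using assms by (simp add: poly_reflect_poly_nz divide_inverse)
qed

lemma poly_reversed_0: "poly (reversed_poly p) 0 = cnj (lead_coeff p)"
proof -
  have "degree (map_poly cnj p) = degree p"
    by (rule degree_map_poly) auto
  then show ?thesis
  unfolding reversed_poly_def by (simp add: coeff_map_poly)
qed

text \<open>
  Reversal conjugates the coefficients and inverts the variable, so it exchanges the two lines of the recursion;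
  at \<open>z = 0\<close>, where inversion fails, both sides are \<open>1\<close> because the polynomials are monic.
\<close>
lemma poly_szego_poly:
  "poly (szego_poly a j) z = szego_phi a z j \<and> poly (reversed_poly (szego_poly a j)) z = szego_psi a z j"
proof (induction j arbitrary: z)
  case 0
  then show ?case by (simp add: reversed_poly_def)
next
  case (Suc j)
  have 1: "poly (szego_poly a (Suc j)) z = szego_phi a z (Suc j)" for z
    using Suc[of z] by simp
  have "poly (reversed_poly (szego_poly a (Suc j))) z = szego_psi a z (Suc j)"
  proof (cases "z = 0")
    case True
    have "szego_psi a 0 i = 1" for i by (induction i) auto
    moreover have "poly (reversed_poly (szego_poly a (Suc j))) 0 = 1"
      unfolding poly_reversed_0 using szego_poly_monic[of a "Suc j"] by (metis complex_cnj_one)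
    ultimately show ?thesis using True by simp
  next
    case False
    define w where "w = 1 / cnj z"
    have r: "cnj (poly (reversed_poly (szego_poly a j)) w) = cnj (w ^ j) * poly (szego_poly a j) z"
      using False poly_reversed_poly[of w "szego_poly a j"] szego_poly_monic[of a j] by (simp add: w_def)
    have "poly (reversed_poly (szego_poly a (Suc j))) z = z ^ Suc j * cnj (poly (szego_poly a (Suc j)) w)"
      using poly_reversed_poly[OF False, of "szego_poly a (Suc j)"] szego_poly_monic[of a "Suc j"]
      by (simp add: w_def del: szego_poly.simps power_Suc)
    also have "\<dots> = z ^ Suc j * (cnj w * cnj (poly (szego_poly a j) w) - a j * (cnj (w ^ j) * poly (szego_poly a j) z))"
      using r by simp
    also have "\<dots> = z ^ j * cnj (poly (szego_poly a j) w) - a j * z * poly (szego_poly a j) z"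
      using False by (simp add: w_def field_simps power_divide)
    also have "z ^ j * cnj (poly (szego_poly a j) w) = szego_psi a z j"
      using Suc[of z] poly_reversed_poly[OF False, of "szego_poly a j"] szego_poly_monic[of a j] by (simp add: w_def)
    finally show ?thesis using Suc[of z] by simp
  qed
  then show ?case using 1 by blast
qed

text \<open>
  One step of the recursion multiplies the left-hand side, up to a term \<open>(1 - cnj w * z) * cnj \<phi> * \<phi>\<close>, by
  \<open>1 - (cmod (a j))\<^sup>2\<close>; that term is the next summand of the kernel.
\<close>
lemma christoffel_darboux:
  assumes "\<And>l. l < j \<Longrightarrow> cmod (a l) < 1"
  shows "cnj (szego_psi a w j) * szego_psi a z j - cnj w * z * cnj (szego_phi a w j) * szego_phi a z j
     = of_real (szego_normsq a j) * (1 - cnj w * z) *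
       (\<Sum>i\<le>j. cnj (szego_phi a w i) * szego_phi a z i / of_real (szego_normsq a i))"
  using assms
proof (induction j)
  case 0
  then show ?case by (simp add: szego_normsq_def)
next
  case (Suc j)
  have N: "szego_normsq a (Suc j) = szego_normsq a j * (1 - (cmod (a j))\<^sup>2)"
    by (simp add: szego_normsq_def)
  have pos: "szego_normsq a (Suc j) > 0"
    unfolding szego_normsq_def using Suc.prems
    by (intro prod_pos) (auto simp: power_less_one_iff abs_square_less_1)
  have sq: "of_real ((cmod (a j))\<^sup>2) = a j * cnj (a j)"
    by (simp only: complex_norm_square)
  have IH: "cnj (szego_psi a w j) * szego_psi a z j - cnj w * z * cnj (szego_phi a w j) * szego_phi a z j
     = of_real (szego_normsq a j) * (1 - cnj w * z) *
       (\<Sum>i\<le>j. cnj (szego_phi a w i) * szego_phi a z i / of_real (szego_normsq a i))"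
    using Suc by simp
  have "cnj (szego_psi a w (Suc j)) * szego_psi a z (Suc j) - cnj (szego_phi a w (Suc j)) * szego_phi a z (Suc j)
     = (1 - a j * cnj (a j)) *
       (cnj (szego_psi a w j) * szego_psi a z j - cnj w * z * cnj (szego_phi a w j) * szego_phi a z j)"
    by (simp add: algebra_simps)
  also have "\<dots> = of_real (szego_normsq a (Suc j)) * (1 - cnj w * z) *
       (\<Sum>i\<le>j. cnj (szego_phi a w i) * szego_phi a z i / of_real (szego_normsq a i))"
    unfolding IH N by (simp add: sq[symmetric])
  finally have e: "cnj (szego_psi a w (Suc j)) * szego_psi a z (Suc j) - cnj (szego_phi a w (Suc j)) * szego_phi a z (Suc j)
     = of_real (szego_normsq a (Suc j)) * (1 - cnj w * z) *
       (\<Sum>i\<le>j. cnj (szego_phi a w i) * szego_phi a z i / of_real (szego_normsq a i))" .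
  define P Q where "P = cnj (szego_phi a w (Suc j)) * szego_phi a z (Suc j)"
    and "Q = cnj (szego_psi a w (Suc j)) * szego_psi a z (Suc j)"
  have "Q - cnj w * z * P = of_real (szego_normsq a (Suc j)) * (1 - cnj w * z) *
       ((\<Sum>i\<le>j. cnj (szego_phi a w i) * szego_phi a z i / of_real (szego_normsq a i))
        + P / of_real (szego_normsq a (Suc j)))"
    using e pos unfolding P_def[symmetric] Q_def[symmetric] distrib_left by (simp add: algebra_simps)
  then show ?case unfolding P_def Q_def sum.atMost_Suc by (simp only: mult.assoc)
qed

lemma szego_normsq_pos:
  assumes "\<And>l. l < j \<Longrightarrow> cmod (a l) < 1" shows "szego_normsq a j > 0"
  unfolding szego_normsq_def using assms
  by (intro prod_pos) (auto simp: power_less_one_iff abs_square_less_1)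

text \<open>
  The recursion acts on \<open>\<phi> / \<psi>\<close> by multiplication with \<open>z\<close> and a disc automorphism, both of which map
  the closed unit disc to itself.
\<close>
lemma szego_phi_le_psi:
  assumes "\<And>l. l < j \<Longrightarrow> cmod (a l) < 1" "cmod z \<le> 1"
  shows "szego_psi a z j \<noteq> 0 \<and> cmod (szego_phi a z j) \<le> cmod (szego_psi a z j)"
  using assms(1)
proof (induction j)
  case (Suc j)
  then have IH: "szego_psi a z j \<noteq> 0" "cmod (szego_phi a z j) \<le> cmod (szego_psi a z j)" and aj: "cmod (a j) < 1"
    by auto
  have le: "cmod (z * szego_phi a z j) \<le> cmod (szego_psi a z j)"
    using mult_mono[OF assms(2) IH(2)] by (simp add: norm_mult)
  have "cmod (a j * z * szego_phi a z j) < cmod (szego_psi a z j)"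
  proof -
    have "cmod (a j) * cmod (z * szego_phi a z j) \<le> cmod (a j) * cmod (szego_psi a z j)"
      using le by (intro mult_left_mono) auto
    also have "\<dots> < cmod (szego_psi a z j)" using aj IH(1) by simp
    finally show ?thesis by (simp add: norm_mult mult.assoc)
  qed
  then have nz: "szego_psi a z (Suc j) \<noteq> 0" by auto
  have sq: "of_real ((cmod x)\<^sup>2) = x * cnj x" for x
    by (simp only: complex_norm_square)
  have "complex_of_real ((cmod (szego_psi a z (Suc j)))\<^sup>2 - (cmod (szego_phi a z (Suc j)))\<^sup>2)
      = of_real ((1 - (cmod (a j))\<^sup>2) * ((cmod (szego_psi a z j))\<^sup>2 - (cmod (z * szego_phi a z j))\<^sup>2))"
    unfolding of_real_mult of_real_diff sq by (simp add: algebra_simps)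
  then have e: "(cmod (szego_psi a z (Suc j)))\<^sup>2 - (cmod (szego_phi a z (Suc j)))\<^sup>2
      = (1 - (cmod (a j))\<^sup>2) * ((cmod (szego_psi a z j))\<^sup>2 - (cmod (z * szego_phi a z j))\<^sup>2)"
    by (simp only: of_real_eq_iff)
  have "0 \<le> (1 - (cmod (a j))\<^sup>2) * ((cmod (szego_psi a z j))\<^sup>2 - (cmod (z * szego_phi a z j))\<^sup>2)"
  proof (rule mult_nonneg_nonneg)
    show "0 \<le> 1 - (cmod (a j))\<^sup>2" using aj by (simp add: power_le_one)
    show "0 \<le> (cmod (szego_psi a z j))\<^sup>2 - (cmod (z * szego_phi a z j))\<^sup>2"
      using power_mono[OF le norm_ge_zero, of 2] by linarith
  qed
  then have "(cmod (szego_phi a z (Suc j)))\<^sup>2 \<le> (cmod (szego_psi a z (Suc j)))\<^sup>2"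
    using e by linarith
  then have "cmod (szego_phi a z (Suc j)) \<le> cmod (szego_psi a z (Suc j))"
    by (rule power2_le_imp_le) simp
  then show ?case using nz by simp
qed simp

section \<open>Orthogonal polynomials determine the measure\<close>

text \<open>
  Monic polynomials of degrees \<open>0, \<dots>, m - 1\<close> span all polynomials of degree less than \<open>m\<close>, so a linear functional
  vanishing on the former vanishes on the latter.
\<close>
lemma monic_family_zero:
  fixes T :: "complex poly \<Rightarrow> complex" and P :: "nat \<Rightarrow> complex poly"
  assumes add: "\<And>p q. T (p + q) = T p + T q" and smult: "\<And>c p. T (Polynomial.smult c p) = c * T p"
    and P: "\<And>j. j < m \<Longrightarrow> degree (P j) = j" "\<And>j. j < m \<Longrightarrow> lead_coeff (P j) = 1" "\<And>j. j < m \<Longrightarrow> T (P j) = 0"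
  shows "degree p < m \<or> p = 0 \<Longrightarrow> T p = 0"
  using P
proof (induction m arbitrary: p)
  case 0
  then show ?case using smult[of 0 p] by simp
next
  case (Suc m)
  define r where "r = p - Polynomial.smult (coeff p m) (P m)"
  have dm: "degree (P m) = m" "coeff (P m) m = 1" using Suc.prems(2,3)[of m] by auto
  have "degree r \<le> m"
    unfolding r_def using Suc.prems(1) dm by (intro degree_diff_le) (auto intro: order.trans[OF degree_smult_le])
  moreover have "coeff r m = 0" using dm by (simp add: r_def)
  ultimately have "degree r < m \<or> r = 0"
    by (metis eq_zero_or_degree_less)
  then have "T r = 0" using Suc.IH[of r] Suc.prems by auto
  have "p = r + Polynomial.smult (coeff p m) (P m)" by (simp add: r_def)
  then have "T p = T r + coeff p m * T (P m)" by (metis add smult)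
  then show ?case using \<open>T r = 0\<close> Suc.prems(4)[of m] by simp
qed

lemma L2_inner_sum:
  assumes "finite (set_pmf \<mu>)"
  shows "L2_inner \<mu> p q = (\<Sum>z\<in>set_pmf \<mu>. of_real (pmf \<mu> z) * (cnj (poly p z) * poly q z))"
  unfolding L2_inner_def by (subst integral_measure_pmf[OF assms]) (auto simp: scaleR_conv_of_real)

lemma
  assumes "finite (set_pmf \<mu>)"
  shows L2_inner_add: "L2_inner \<mu> p (q + r) = L2_inner \<mu> p q + L2_inner \<mu> p r"
    and L2_inner_smult: "L2_inner \<mu> p (Polynomial.smult c q) = c * L2_inner \<mu> p q"
    and L2_inner_diff: "L2_inner \<mu> p (q - r) = L2_inner \<mu> p q - L2_inner \<mu> p r"
    and L2_inner_cnj: "L2_inner \<mu> q p = cnj (L2_inner \<mu> p q)"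
    and L2_inner_psum: "L2_inner \<mu> p (\<Sum>i\<in>I. f i) = (\<Sum>i\<in>I. L2_inner \<mu> p (f i))"
proof -
  show a: "L2_inner \<mu> p (q + r) = L2_inner \<mu> p q + L2_inner \<mu> p r" for q r
    unfolding L2_inner_sum[OF assms] by (simp add: sum.distrib algebra_simps)
  show "L2_inner \<mu> p (Polynomial.smult c q) = c * L2_inner \<mu> p q"
    unfolding L2_inner_sum[OF assms] by (simp add: sum_distrib_left algebra_simps)
  show "L2_inner \<mu> p (q - r) = L2_inner \<mu> p q - L2_inner \<mu> p r"
    unfolding L2_inner_sum[OF assms] by (simp add: sum_subtractf algebra_simps)
  show "L2_inner \<mu> q p = cnj (L2_inner \<mu> p q)"
    unfolding L2_inner_sum[OF assms] by (simp add: algebra_simps)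
  have z: "L2_inner \<mu> p 0 = 0" unfolding L2_inner_sum[OF assms] by simp
  show "L2_inner \<mu> p (\<Sum>i\<in>I. f i) = (\<Sum>i\<in>I. L2_inner \<mu> p (f i))"
    by (induction I rule: infinite_finite_induct) (auto simp: a z)
qed

lemma L2_inner_self_zero:
  assumes "finite (set_pmf \<mu>)" "L2_inner \<mu> p p = 0" "degree p < card (set_pmf \<mu>)"
  shows "p = 0"
proof (rule ccontr)
  assume nz: "p \<noteq> 0"
  have "L2_inner \<mu> p p = of_real (\<Sum>z\<in>set_pmf \<mu>. pmf \<mu> z * (cmod (poly p z))\<^sup>2)"
    unfolding L2_inner_sum[OF assms(1)] of_real_sum of_real_mult complex_norm_square by (simp add: mult.commute)
  then have "(\<Sum>z\<in>set_pmf \<mu>. pmf \<mu> z * (cmod (poly p z))\<^sup>2) = 0" using assms(2) by (metis of_real_eq_0_iff)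
  then have "\<forall>z\<in>set_pmf \<mu>. pmf \<mu> z * (cmod (poly p z))\<^sup>2 = 0"
    by (subst (asm) sum_nonneg_eq_0_iff) (use assms in auto)
  then have sub: "set_pmf \<mu> \<subseteq> {z. poly p z = 0}" by (auto simp: set_pmf_iff)
  have "card (set_pmf \<mu>) \<le> card {z. poly p z = 0}"
    by (intro card_mono sub) (use poly_roots_finite[OF nz] in auto)
  also have "\<dots> \<le> degree p" using nz by (intro card_poly_roots_bound) auto
  finally show False using assms(3) by simp
qed

text \<open>
  The property that defines \<open>monic_OP\<close> through a definite description below the number of support points.
\<close>
definition is_monic_OP :: "complex pmf \<Rightarrow> nat \<Rightarrow> complex poly \<Rightarrow> bool" where
  "is_monic_OP \<mu> k p \<longleftrightarrow> degree p = k \<and> lead_coeff p = 1 \<and> (\<forall>j<k. L2_inner \<mu> (Polynomial.monom 1 j) p = 0)"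

lemma is_monic_OP_orth:
  assumes "finite (set_pmf \<mu>)" "is_monic_OP \<mu> k p" "degree q < k \<or> q = 0"
  shows "L2_inner \<mu> q p = 0"
proof -
  have "L2_inner \<mu> p (Polynomial.monom 1 j) = 0" if "j < k" for j
    using assms(2) that L2_inner_cnj[OF assms(1), of p "Polynomial.monom 1 j"] by (simp add: is_monic_OP_def)
  note o = this
  have "L2_inner \<mu> p q = 0"
    by (rule monic_family_zero[where P = "\<lambda>j. Polynomial.monom 1 j" and m = k])
       (use assms(1,3) o L2_inner_add L2_inner_smult in \<open>auto simp: degree_monom_eq\<close>)
  then show ?thesis using L2_inner_cnj[OF assms(1), of p q] by simp
qed

lemma is_monic_OP_unique:
  assumes "finite (set_pmf \<mu>)" "k < card (set_pmf \<mu>)" "is_monic_OP \<mu> k p" "is_monic_OP \<mu> k q"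
  shows "p = q"
proof -
  have "coeff (p - q) k = 0" "degree (p - q) \<le> k"
    using assms(3,4) by (auto simp: is_monic_OP_def intro!: degree_diff_le)
  then have d: "degree (p - q) < k \<or> p - q = 0" by (metis eq_zero_or_degree_less)
  have "L2_inner \<mu> (p - q) (p - q) = 0"
    unfolding L2_inner_diff[OF assms(1)] using is_monic_OP_orth[OF assms(1) _ d] assms(3,4) by simp
  then have "p - q = 0"
    using L2_inner_self_zero[OF assms(1), of "p - q"] \<open>degree (p - q) \<le> k\<close> assms(2) by linarith
  then show ?thesis by simp
qed

lemma monic_OP_eqI:
  assumes "finite (set_pmf \<mu>)" "k < card (set_pmf \<mu>)" "is_monic_OP \<mu> k p"
  shows "monic_OP \<mu> k = p"
  unfolding monic_OP_def
  using assms is_monic_OP_unique[OF assms(1,2)] by (auto simp: is_monic_OP_def[symmetric] intro!: the_equality)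

text \<open>
  Gram-Schmidt on \<open>1, z, z\<^sup>2, \<dots>\<close>.
\<close>
lemma is_monic_OP_exists:
  assumes fin: "finite (set_pmf \<mu>)"
  shows "k < card (set_pmf \<mu>) \<Longrightarrow> \<exists>p. is_monic_OP \<mu> k p"
proof (induction k rule: less_induct)
  case (less k)
  then have "\<forall>j. \<exists>p. j < k \<longrightarrow> is_monic_OP \<mu> j p" using less_trans by blast
  then obtain P where P: "\<And>j. j < k \<Longrightarrow> is_monic_OP \<mu> j (P j)" by metis
  have dP: "degree (P j) = j" "lead_coeff (P j) = 1" if "j < k" for j
    using P[OF that] by (auto simp: is_monic_OP_def)
  have nz: "L2_inner \<mu> (P j) (P j) \<noteq> 0" if "j < k" for j
    using L2_inner_self_zero[OF fin, of "P j"] dP[OF that] that less.prems by fastforce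
  have orth: "L2_inner \<mu> (P i) (P j) = 0" if "i < k" "j < k" "i \<noteq> j" for i j
  proof (cases "i < j")
    case True
    then show ?thesis using is_monic_OP_orth[OF fin P[OF that(2)], of "P i"] dP[OF that(1)] by simp
  next
    case False
    then have "L2_inner \<mu> (P j) (P i) = 0"
      using is_monic_OP_orth[OF fin P[OF that(1)], of "P j"] dP[OF that(2)] that by simp
    then show ?thesis using L2_inner_cnj[OF fin, of "P j" "P i"] by simp
  qed
  define z where "z = (Polynomial.monom 1 k :: complex poly)"
  define q where "q = (\<Sum>j<k. Polynomial.smult (L2_inner \<mu> (P j) z / L2_inner \<mu> (P j) (P j)) (P j))"
  define p where "p = z - q"
  have o: "L2_inner \<mu> (P i) p = 0" if "i < k" for i
  proof -
    have "L2_inner \<mu> (P i) q = (\<Sum>j<k. if j = i then L2_inner \<mu> (P i) z else 0)"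
      unfolding q_def L2_inner_psum[OF fin] L2_inner_smult[OF fin]
      using orth[OF that] nz[OF that] by (intro sum.cong) auto
    then show ?thesis using that by (simp add: p_def L2_inner_diff[OF fin])
  qed
  have dq: "degree q < k \<or> q = 0"
  proof (cases "k = 0")
    case False
    have "degree q \<le> k - 1"
      unfolding q_def using dP by (intro degree_sum_le) (auto intro!: order.trans[OF degree_smult_le])
    then show ?thesis using False by linarith
  qed (simp add: q_def)
  have cq: "coeff q k = 0" using dq by (auto intro: coeff_eq_0)
  have dz: "degree z = k" by (simp add: z_def degree_monom_eq)
  have "coeff p k = 1" using cq by (simp add: p_def z_def)
  moreover have "degree p \<le> k" unfolding p_def using dz dq by (intro degree_diff_le) auto
  ultimately have dp: "degree p = k" by (metis le_antisym le_degree zero_neq_one)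
  have "L2_inner \<mu> (Polynomial.monom 1 j) p = 0" if "j < k" for j
  proof -
    have "L2_inner \<mu> p (P i) = 0" if "i < k" for i
      using o[OF that] L2_inner_cnj[OF fin, of p "P i"] by simp
    note o' = this
    have "L2_inner \<mu> p (Polynomial.monom 1 j) = 0"
      by (rule monic_family_zero[where P = P and m = k])
         (use that dP o' L2_inner_add[OF fin] L2_inner_smult[OF fin] in \<open>auto simp: degree_monom_eq\<close>)
    then show ?thesis using L2_inner_cnj[OF fin, of p "Polynomial.monom 1 j"] by simp
  qed
  then show ?case using dp \<open>coeff p k = 1\<close> unfolding is_monic_OP_def by auto
qed

lemma is_monic_OP_monic_OP:
  assumes "finite (set_pmf \<mu>)" "k < card (set_pmf \<mu>)"
  shows "is_monic_OP \<mu> k (monic_OP \<mu> k)"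
  using is_monic_OP_exists[OF assms] monic_OP_eqI[OF assms] by auto

lemma verblunsky_coeffs_imp_monic_OP:
  assumes "npoint_circle_pmf n \<mu>" "verblunsky_coeffs n \<mu> a" "j \<le> n" "n > 0"
  shows "monic_OP \<mu> j = szego_poly a j"
  using assms(3)
proof (induction j)
  case 0
  have "is_monic_OP \<mu> 0 1" by (simp add: is_monic_OP_def)
  then show ?case using monic_OP_eqI[of \<mu> 0 1] assms by (simp add: npoint_circle_pmf_def)
next
  case (Suc j)
  then show ?case using assms(2) by (simp add: verblunsky_coeffs_def)
qed

text \<open>
  The coefficients determine all \<open>monic_OP\<close>, hence the support, which is the zero set of the last one, and the functional
  \<open>p \<mapsto> \<integral> p\<close> on polynomials of degree less than \<open>n\<close>, because \<open>monic_OP j\<close> is orthogonal to \<open>1\<close>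
  for \<open>j > 0\<close>. Lagrange interpolation then recovers the point masses.
\<close>
lemma verblunsky_measure_unique:
  assumes "npoint_circle_pmf n \<mu>" "verblunsky_coeffs n \<mu> a"
    and "npoint_circle_pmf n \<nu>" "verblunsky_coeffs n \<nu> a" "n > 0"
  shows "\<mu> = \<nu>"
proof -
  have fin: "finite (set_pmf \<mu>)" "finite (set_pmf \<nu>)" and card: "card (set_pmf \<mu>) = n" "card (set_pmf \<nu>) = n"
    using assms by (auto simp: npoint_circle_pmf_def)
  have supp: "set_pmf \<rho> = {z. poly (szego_poly a n) z = 0}"
    if "npoint_circle_pmf n \<rho>" "verblunsky_coeffs n \<rho> a" for \<rho>
  proof -
    have "monic_OP \<rho> n = (\<Prod>\<zeta>\<in>set_pmf \<rho>. [:- \<zeta>, 1:])"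
      using that by (simp add: monic_OP_def npoint_circle_pmf_def)
    then show ?thesis
      using verblunsky_coeffs_imp_monic_OP[OF that, of n] assms(5) that
      by (auto simp: poly_prod npoint_circle_pmf_def)
  qed
  have S: "set_pmf \<mu> = set_pmf \<nu>" using supp assms by simp
  have orth: "L2_inner \<rho> 1 (szego_poly a j) = (if j = 0 then 1 else 0)"
    if "npoint_circle_pmf n \<rho>" "verblunsky_coeffs n \<rho> a" "j < n" for \<rho> j
  proof (cases "j = 0")
    case True
    then show ?thesis by (simp add: L2_inner_def)
  next
    case False
    have f: "finite (set_pmf \<rho>)" "card (set_pmf \<rho>) = n" using that by (auto simp: npoint_circle_pmf_def)
    have "is_monic_OP \<rho> j (szego_poly a j)"
      using is_monic_OP_monic_OP[OF f(1), of j] verblunsky_coeffs_imp_monic_OP[OF that(1,2), of j] that(3) f by simp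
    then show ?thesis using False is_monic_OP_orth[OF f(1), of j "szego_poly a j" 1] by simp
  qed
  have eq: "L2_inner \<mu> 1 p = L2_inner \<nu> 1 p" if "degree p < n" for p
  proof -
    have lead: "lead_coeff (szego_poly a j) = 1" for j using szego_poly_monic by blast
    have "(\<lambda>p. L2_inner \<mu> 1 p - L2_inner \<nu> 1 p) p = 0"
    proof (rule monic_family_zero[where P = "szego_poly a" and m = n])
      show "L2_inner \<mu> 1 (szego_poly a j) - L2_inner \<nu> 1 (szego_poly a j) = 0" if "j < n" for j
        using orth[OF assms(1,2) that] orth[OF assms(3,4) that] by simp
      show "degree (szego_poly a j) = j" for j using szego_poly_monic by blast
      show "lead_coeff (szego_poly a j) = 1" for j by (rule lead)
      show "degree p < n \<or> p = 0" using that by blast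
    qed (simp_all add: L2_inner_add L2_inner_smult fin algebra_simps)
    then show ?thesis by simp
  qed
  show ?thesis
  proof (rule pmf_eqI)
    fix x
    show "pmf \<mu> x = pmf \<nu> x"
    proof (cases "x \<in> set_pmf \<mu>")
      case False
      then have "pmf \<mu> x = 0" "pmf \<nu> x = 0" unfolding pmf_eq_0_set_pmf using S by auto
      then show ?thesis by simp
    next
      case True
      define p where "p = (\<Prod>\<zeta>\<in>set_pmf \<mu> - {x}. [:- \<zeta>, 1:])"
      have "degree p = n - 1"
        unfolding p_def using True fin card by (subst degree_prod_eq_sum_degree) auto
      then have "degree p < n" using assms(5) by simp
      have nz: "poly p x \<noteq> 0" unfolding p_def using fin by (auto simp: poly_prod)
      have z: "poly p y = 0" if "y \<in> set_pmf \<mu>" "y \<noteq> x" for y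
        unfolding p_def using that fin by (auto simp: poly_prod)
      have w: "L2_inner \<rho> 1 p = of_real (pmf \<rho> x) * poly p x" if "set_pmf \<rho> = set_pmf \<mu>" for \<rho>
      proof -
        have fin': "finite (set_pmf \<rho>)" using that fin by simp
        have "L2_inner \<rho> 1 p = (\<Sum>y\<in>set_pmf \<mu>. if y = x then of_real (pmf \<rho> x) * poly p x else 0)"
          unfolding L2_inner_sum[OF fin'] that by (rule sum.cong) (use z in auto)
        then show ?thesis using True fin by simp
      qed
      have "of_real (pmf \<mu> x) * poly p x = of_real (pmf \<nu> x) * poly p x"
        using w[OF refl] w[OF S[symmetric]] eq[OF \<open>degree p < n\<close>] by metis
      then show ?thesis using nz by simp
    qed
  qed
qed

section \<open>The Christoffel-Darboux kernel and the zeros of the last polynomial\<close>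

definition cd_kernel :: "(nat \<Rightarrow> complex) \<Rightarrow> nat \<Rightarrow> complex \<Rightarrow> complex \<Rightarrow> complex" where
  "cd_kernel a m w z = (\<Sum>i\<le>m. cnj (szego_phi a w i) * szego_phi a z i / of_real (szego_normsq a i))"

text \<open>
  The diagonal of the Christoffel-Darboux kernel; its reciprocal at a zero of the last polynomial is the mass of the spectral
  measure there.
\<close>
definition christoffel :: "(nat \<Rightarrow> complex) \<Rightarrow> nat \<Rightarrow> complex \<Rightarrow> real" where
  "christoffel a m z = (\<Sum>i\<le>m. (cmod (szego_phi a z i))\<^sup>2 / szego_normsq a i)"

lemma mat_adjoint_index:
  assumes "A \<in> carrier_mat n k" "i < k" "j < n"
  shows "mat_adjoint A $$ (i, j) = cnj (A $$ (j, i))"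
  using assms by (simp add: mat_adjoint_def mat_of_rows_def)

lemma mat_adjoint_carrier: "A \<in> carrier_mat n k \<Longrightarrow> mat_adjoint A \<in> carrier_mat k n"
  by (auto simp: mat_adjoint_def)

text \<open>
  Coefficients in \<open>\<D>\<^sup>m \<times> \<T>\<close>, the parameters of a measure supported at \<open>m + 1\<close> points.
\<close>
locale verblunsky =
  fixes m :: nat and a :: "nat \<Rightarrow> complex"
  assumes disc: "\<And>k. k < m \<Longrightarrow> cmod (a k) < 1" and circ: "cmod (a m) = 1"
begin

lemma normsq_pos: "j \<le> m \<Longrightarrow> szego_normsq a j > 0"
  using disc by (intro szego_normsq_pos) auto

lemma kernel_diag: "cd_kernel a m z z = of_real (christoffel a m z)"
  unfolding cd_kernel_def christoffel_def of_real_sum of_real_divide complex_norm_square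
  by (simp add: mult.commute)

lemma christoffel_ge_1: "christoffel a m z \<ge> 1"
proof -
  have "(\<Sum>i\<in>{0}. (cmod (szego_phi a z i))\<^sup>2 / szego_normsq a i) \<le> christoffel a m z"
    unfolding christoffel_def using normsq_pos by (intro sum_mono2) (auto intro!: divide_nonneg_pos)
  then show ?thesis by (simp add: szego_normsq_def)
qed

lemma kernel_eq:
  "cnj (szego_psi a w m) * szego_psi a z m - cnj w * z * cnj (szego_phi a w m) * szego_phi a z m
     = of_real (szego_normsq a m) * (1 - cnj w * z) * cd_kernel a m w z"
  unfolding cd_kernel_def using disc by (rule christoffel_darboux)

lemma circ': "a m * cnj (a m) = 1"
  using circ complex_norm_square[of "a m"] by simp

text \<open>
  At a zero of \<open>\<phi>\<close> of index \<open>m + 1\<close>, \<open>cmod (z * \<phi>) = cmod \<psi>\<close> at index \<open>m\<close> since \<open>a m\<close> is unimodular. So the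
  left-hand side of Christoffel-Darboux vanishes on the diagonal, whereas the kernel is at least \<open>1\<close> there.
\<close>
lemma root_norm:
  assumes "szego_phi a z (Suc m) = 0" shows "cmod z = 1"
proof -
  have e: "z * szego_phi a z m = cnj (a m) * szego_psi a z m" using assms by simp
  have "cnj z * z * cnj (szego_phi a z m) * szego_phi a z m = cnj (z * szego_phi a z m) * (z * szego_phi a z m)"
    by simp
  also have "\<dots> = (a m * cnj (a m)) * (cnj (szego_psi a z m) * szego_psi a z m)"
    unfolding e by simp
  finally have "of_real (szego_normsq a m) * (1 - cnj z * z) * cd_kernel a m z z = 0"
    using kernel_eq[of z z] circ' by simp
  then have "1 - cnj z * z = 0"
    using normsq_pos[of m] christoffel_ge_1[of z] unfolding kernel_diag by auto
  then have "(cmod z)\<^sup>2 = 1"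
    using complex_norm_square[of z] by (metis eq_iff_diff_eq_0 mult.commute of_real_1 of_real_eq_iff)
  then show ?thesis using norm_ge_zero[of z] by (simp add: power2_eq_1_iff)
qed

text \<open>
  For a zero \<open>w\<close> of the last polynomial, \<open>cd_kernel a m w\<close> is, up to a constant, that polynomial divided by its linear factor at \<open>w\<close>. This
  gives orthogonality at distinct zeros and, by differentiation, simplicity of the zeros.
\<close>
lemma root_kernel:
  assumes "szego_phi a w (Suc m) = 0"
  shows "of_real (szego_normsq a m) * (1 - cnj w * z) * cd_kernel a m w z
     = - a m * cnj (szego_psi a w m) * szego_phi a z (Suc m)"
proof -
  have "cnj (w * szego_phi a w m) = a m * cnj (szego_psi a w m)" using assms by simp
  then have e: "cnj w * cnj (szego_phi a w m) = a m * cnj (szego_psi a w m)" by simp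
  have "of_real (szego_normsq a m) * (1 - cnj w * z) * cd_kernel a m w z
     = cnj (szego_psi a w m) * szego_psi a z m - (cnj w * cnj (szego_phi a w m)) * z * szego_phi a z m"
    unfolding kernel_eq[symmetric] by simp
  also have "\<dots> = cnj (szego_psi a w m) * ((a m * cnj (a m)) * szego_psi a z m - a m * z * szego_phi a z m)"
    unfolding e circ' by (simp add: algebra_simps)
  also have "\<dots> = - a m * cnj (szego_psi a w m) * szego_phi a z (Suc m)"
    by (simp add: algebra_simps)
  finally show ?thesis .
qed

lemma psi_nonzero: "cmod z \<le> 1 \<Longrightarrow> j \<le> m \<Longrightarrow> szego_psi a z j \<noteq> 0"
  using szego_phi_le_psi[of j a z] disc by auto

definition zeros :: "complex set" where "zeros = {z. szego_phi a z (Suc m) = 0}"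

lemma zeros_poly: "zeros = {z. poly (szego_poly a (Suc m)) z = 0}"
  unfolding zeros_def using poly_szego_poly[of a "Suc m"] by simp

lemma szego_rsquarefree: "rsquarefree (szego_poly a (Suc m))"
  unfolding rsquarefree_roots
proof (intro allI notI, elim conjE)
  fix w assume w: "poly (szego_poly a (Suc m)) w = 0" "poly (pderiv (szego_poly a (Suc m))) w = 0"
  have r: "szego_phi a w (Suc m) = 0" using w(1) poly_szego_poly[of a "Suc m" w] by simp
  note nw = root_norm[OF r]
  \<comment> \<open>The kernel in its second variable as a polynomial, so that the quotient identity can be differentiated at the zero.\<close>
  define K where "K = (\<Sum>i\<le>m. Polynomial.smult (cnj (szego_phi a w i) / of_real (szego_normsq a i)) (szego_poly a i))"
  have K: "poly K z = cd_kernel a m w z" for z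
    unfolding K_def cd_kernel_def using poly_szego_poly[of a] by (simp add: poly_sum)
  define c where "c = - a m * cnj (szego_psi a w m)"
  have c: "c \<noteq> 0" using psi_nonzero[of w m] nw circ by (auto simp: c_def)
  have "poly (Polynomial.smult c (szego_poly a (Suc m))) z = poly (Polynomial.smult (of_real (szego_normsq a m)) ([:1, - cnj w:] * K)) z" for z
  proof -
    have "poly (szego_poly a (Suc m)) z = szego_phi a z (Suc m)" using poly_szego_poly by blast
    then show ?thesis
      using root_kernel[OF r, of z] unfolding poly_smult poly_mult K c_def by (simp del: szego_phi.simps add: algebra_simps)
  qed
  then have e: "Polynomial.smult c (szego_poly a (Suc m)) = Polynomial.smult (of_real (szego_normsq a m)) ([:1, - cnj w:] * K)"
    by (metis poly_eq_poly_eq_iff ext)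
  have ww: "1 - cnj w * w = 0" using nw complex_norm_square[of w] by (simp add: mult.commute)
  have "0 = poly (pderiv (Polynomial.smult c (szego_poly a (Suc m)))) w"
    using w(2) by (simp add: pderiv_smult)
  also have "\<dots> = of_real (szego_normsq a m) * (- cnj w) * cd_kernel a m w w"
    unfolding e pderiv_smult pderiv_mult using ww by (simp add: K pderiv_pCons algebra_simps)
  finally show False
    using normsq_pos[of m] christoffel_ge_1[of w] nw unfolding kernel_diag by auto
qed

lemma finite_zeros: "finite zeros" and card_zeros: "card zeros = Suc m"
proof -
  define p where "p = szego_poly a (Suc m)"
  have d: "degree p = Suc m" using szego_poly_monic[of a "Suc m"] unfolding p_def by blast
  then have nz: "p \<noteq> 0" by auto
  have fin: "finite zeros" unfolding zeros_poly using poly_roots_finite[OF nz] p_def by simp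
  then show "finite zeros" .
  have mp: "proots (szego_poly a (Suc m)) = mset_set zeros"
    unfolding p_def[symmetric]
  proof (rule multiset_eqI)
    fix z
    have "Polynomial.order z p \<le> 1"
      using szego_rsquarefree unfolding p_def[symmetric] rsquarefree_def by (metis One_nat_def order_refl zero_le)
    moreover have "(Polynomial.order z p = 0) = (z \<notin> zeros)"
      unfolding zeros_poly p_def[symmetric] using nz Polynomial.order_root[of p z] by simp
    ultimately show "count (proots p) z = count (mset_set zeros) z"
      using fin nz by (cases "z \<in> zeros") auto
  qed
  have "size (mset_set zeros) = Suc m" unfolding mp[symmetric] size_proots_complex using d p_def by simp
  then show "card zeros = Suc m" using fin by simp
qed

lemma zerosD: "z \<in> zeros \<Longrightarrow> cmod z = 1" "z \<in> zeros \<Longrightarrow> szego_phi a z (Suc m) = 0"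
  using root_norm by (auto simp: zeros_def)

lemma kernel_zeros:
  assumes "w \<in> zeros" "z \<in> zeros" "w \<noteq> z" shows "cd_kernel a m w z = 0"
proof -
  have "1 - cnj w * z \<noteq> 0"
  proof
    assume "1 - cnj w * z = 0"
    then have "w * (cnj w * z) = w * 1" by simp
    moreover have "w * cnj w = 1" using zerosD(1)[OF assms(1)] complex_norm_square[of w] by simp
    ultimately show False using assms(3) by (simp add: mult.assoc[symmetric])
  qed
  then show ?thesis using root_kernel[of w z] zerosD[OF assms(1)] zerosD[OF assms(2)] normsq_pos[of m] by auto
qed

text \<open>
  The normalized orthogonal polynomials, evaluated at the zeros, form a unitary matrix: its rows are orthonormal because the kernel
  vanishes at pairs of distinct zeros. Unitarity then yields orthonormality of the columns, which is orthogonality of the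
  polynomials for the weights \<open>1 / christoffel\<close>.
\<close>
lemma dual_orthogonality:
  obtains f V where "bij_betw f {..<Suc m} zeros" "V \<in> carrier_mat (Suc m) (Suc m)"
    "mat_adjoint V * V = 1\<^sub>m (Suc m)" "V * mat_adjoint V = 1\<^sub>m (Suc m)"
    "\<And>i j. i < Suc m \<Longrightarrow> j < Suc m \<Longrightarrow>
       V $$ (i, j) = szego_phi a (f i) j / of_real (sqrt (szego_normsq a j) * sqrt (christoffel a m (f i)))"
proof -
  let ?n = "Suc m"
  obtain f where f: "bij_betw f {..<?n} zeros"
    using ex_bij_betw_nat_finite[OF finite_zeros] card_zeros by (auto simp: lessThan_atLeast0)
  define s where "s j i = sqrt (szego_normsq a j) * sqrt (christoffel a m (f i))" for j i
  define V where "V = mat ?n ?n (\<lambda>(i, j). szego_phi a (f i) j / of_real (s j i))"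
  have V: "V \<in> carrier_mat ?n ?n" by (simp add: V_def)
  have A: "mat_adjoint V \<in> carrier_mat ?n ?n" using V by (rule mat_adjoint_carrier)
  have Aij: "mat_adjoint V $$ (i, j) = cnj (V $$ (j, i))" if "i < ?n" "j < ?n" for i j
    using mat_adjoint_index[OF V] that by simp
  have "V * mat_adjoint V = 1\<^sub>m ?n"
  proof (rule eq_matI)
    fix i i' assume "i < dim_row (1\<^sub>m ?n :: complex mat)" "i' < dim_col (1\<^sub>m ?n :: complex mat)"
    then have i: "i < ?n" "i' < ?n" by auto
    then have fz: "f i \<in> zeros" "f i' \<in> zeros" using f by (auto simp: bij_betw_def)
    have K: "christoffel a m (f i) > 0" for i using christoffel_ge_1[of "f i"] by simp
    have "(V * mat_adjoint V) $$ (i, i') = (\<Sum>j<?n. V $$ (i, j) * cnj (V $$ (i', j)))"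
      using i V A Aij by (simp add: scalar_prod_def lessThan_atLeast0)
    also have "\<dots> = (\<Sum>j<?n. (cnj (szego_phi a (f i') j) * szego_phi a (f i) j / of_real (szego_normsq a j))
         / of_real (sqrt (christoffel a m (f i)) * sqrt (christoffel a m (f i'))))"
    proof (rule sum.cong[OF refl])
      fix j assume "j \<in> {..<?n}"
      then have j: "j < ?n" "szego_normsq a j > 0" using normsq_pos[of j] by auto
      have "complex_of_real (s j i) * of_real (s j i') = of_real (szego_normsq a j) *
          of_real (sqrt (christoffel a m (f i)) * sqrt (christoffel a m (f i')))"
        unfolding of_real_mult[symmetric] s_def using j(2)
        by (metis (no_types, opaque_lifting) less_imp_le mult.assoc mult.left_commute real_sqrt_mult_self abs_of_pos)
      then show "V $$ (i, j) * cnj (V $$ (i', j)) = (cnj (szego_phi a (f i') j) * szego_phi a (f i) j / of_real (szego_normsq a j))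
         / of_real (sqrt (christoffel a m (f i)) * sqrt (christoffel a m (f i')))"
        using i j by (simp add: V_def mult.commute)
    qed
    also have "\<dots> = cd_kernel a m (f i') (f i) / of_real (sqrt (christoffel a m (f i)) * sqrt (christoffel a m (f i')))"
      unfolding cd_kernel_def sum_divide_distrib lessThan_Suc_atMost ..
    also have "\<dots> = (if i = i' then 1 else 0)"
    proof (cases "i = i'")
      case True
      then show ?thesis using K[of i'] by (simp add: kernel_diag real_sqrt_mult_self flip: of_real_mult)
    next
      case False
      then have "f i \<noteq> f i'" using f i by (auto simp: bij_betw_def inj_on_def)
      then show ?thesis using kernel_zeros[OF fz(2,1)] False by simp
    qed
    finally show "(V * mat_adjoint V) $$ (i, i') = 1\<^sub>m ?n $$ (i, i')" using i by simp
  qed (use V A in auto)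
  then have "mat_adjoint V * V = 1\<^sub>m ?n" using mat_mult_left_right_inverse[OF V A] by simp
  then show ?thesis using that[of f V] f V \<open>V * mat_adjoint V = _\<close> by (auto simp: V_def s_def)
qed

end

section \<open>The spectral measure and the GGT matrix\<close>

text \<open>
  The coordinates of the reversed polynomials in the basis of the monic orthogonal polynomials.
\<close>
primrec psi_coeff :: "(nat \<Rightarrow> complex) \<Rightarrow> nat \<Rightarrow> nat \<Rightarrow> complex" where
  "psi_coeff a i 0 = (if i = 0 then 1 else 0)"
| "psi_coeff a i (Suc j) = (1 - a j * cnj (a j)) * psi_coeff a i j - a j * (if i = Suc j then 1 else 0)"

lemma psi_coeff_0: "i > j \<Longrightarrow> psi_coeff a i j = 0"
  by (induction j) auto

lemma psi_expansion: "szego_psi a z j = (\<Sum>i\<le>j. psi_coeff a i j * szego_phi a z i)"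
proof (induction j)
  case (Suc j)
  have "szego_psi a z (Suc j) = (1 - a j * cnj (a j)) * szego_psi a z j - a j * szego_phi a z (Suc j)"
    by (simp add: algebra_simps)
  also have "(1 - a j * cnj (a j)) * szego_psi a z j = (\<Sum>i\<le>j. psi_coeff a i (Suc j) * szego_phi a z i)"
    unfolding Suc sum_distrib_left by (intro sum.cong) auto
  also have "a j * szego_phi a z (Suc j) = - psi_coeff a (Suc j) (Suc j) * szego_phi a z (Suc j)"
    by (simp add: psi_coeff_0)
  finally show ?case by (simp del: szego_phi.simps szego_psi.simps psi_coeff.simps)
qed simp

lemma mat_adjoint_mult:
  fixes A B :: "complex mat"
  assumes "A \<in> carrier_mat n k" "B \<in> carrier_mat k l"
  shows "mat_adjoint (A * B) = mat_adjoint B * mat_adjoint A"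
proof (rule eq_matI)
  note c = mat_adjoint_carrier[OF assms(1)] mat_adjoint_carrier[OF assms(2)] mult_carrier_mat[OF assms]
    mat_adjoint_carrier[OF mult_carrier_mat[OF assms]]
  fix i j assume "i < dim_row (mat_adjoint B * mat_adjoint A)" "j < dim_col (mat_adjoint B * mat_adjoint A)"
  then have ij: "i < l" "j < n" using c by auto
  then show "mat_adjoint (A * B) $$ (i, j) = (mat_adjoint B * mat_adjoint A) $$ (i, j)"
    using c assms mat_adjoint_index[OF c(3) ij] mat_adjoint_index[OF assms(1) _ ij(2)] mat_adjoint_index[OF assms(2) ij(1)]
    by (simp add: scalar_prod_def mult.commute)
qed (use assms mat_adjoint_carrier[OF mult_carrier_mat[OF assms]] mat_adjoint_carrier[OF assms(1)] mat_adjoint_carrier[OF assms(2)] in auto)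

lemma mat_adjoint_adjoint:
  fixes A :: "complex mat"
  assumes "A \<in> carrier_mat n k" shows "mat_adjoint (mat_adjoint A) = A"
  using assms mat_adjoint_carrier[OF assms] mat_adjoint_carrier[OF mat_adjoint_carrier[OF assms]]
  by (intro eq_matI) (auto simp: mat_adjoint_index[OF mat_adjoint_carrier[OF assms]] mat_adjoint_index[OF assms])

lemma proots_prod_linear: "proots (\<Prod>x\<leftarrow>xs. [:- x, 1:]) = mset (xs :: complex list)"
proof (induction xs)
  case (Cons x xs)
  have "(\<Prod>x\<leftarrow>xs. [:- x, 1:]) \<noteq> (0 :: complex poly)" by (auto simp: prod_list_zero_iff)
  then have "proots ([:- x, 1:] * (\<Prod>x\<leftarrow>xs. [:- x, 1:])) = proots [:- x, 1:] + proots (\<Prod>x\<leftarrow>xs. [:- x, 1:])"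
    by (intro proots_mult) auto
  then show ?case using Cons by (simp del: mult_pCons_left)
qed simp

context verblunsky
begin

lemma phi_orthogonal:
  assumes "i \<le> m" "j \<le> m"
  shows "(\<Sum>\<zeta>\<in>zeros. cnj (szego_phi a \<zeta> i) * szego_phi a \<zeta> j / of_real (christoffel a m \<zeta>))
       = (if i = j then of_real (szego_normsq a i) else 0)"
proof -
  let ?n = "Suc m"
  obtain f V where f: "bij_betw f {..<?n} zeros" and V: "V \<in> carrier_mat ?n ?n"
    and u: "mat_adjoint V * V = 1\<^sub>m ?n" and Vij: "\<And>i j. i < ?n \<Longrightarrow> j < ?n \<Longrightarrow>
       V $$ (i, j) = szego_phi a (f i) j / of_real (sqrt (szego_normsq a j) * sqrt (christoffel a m (f i)))"
    using dual_orthogonality by metis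
  note A = mat_adjoint_carrier[OF V]
  have K: "christoffel a m z > 0" for z using christoffel_ge_1[of z] by simp
  define c where "c = complex_of_real (sqrt (szego_normsq a i) * sqrt (szego_normsq a j))"
  have c: "c \<noteq> 0" "i = j \<Longrightarrow> c = of_real (szego_normsq a i)"
    using normsq_pos assms by (auto simp: c_def less_imp_le simp flip: of_real_mult) force+
  have "(\<Sum>l<?n. cnj (szego_phi a (f l) i) * szego_phi a (f l) j / of_real (christoffel a m (f l)))
      = (\<Sum>l<?n. c * (cnj (V $$ (l, i)) * V $$ (l, j)))"
  proof (rule sum.cong[OF refl])
    fix l assume l: "l \<in> {..<?n}"
    have "complex_of_real (sqrt (christoffel a m (f l))) * of_real (sqrt (christoffel a m (f l))) = of_real (christoffel a m (f l))"
      using K[of "f l"] by (simp flip: of_real_mult)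
    then show "cnj (szego_phi a (f l) i) * szego_phi a (f l) j / of_real (christoffel a m (f l)) = c * (cnj (V $$ (l, i)) * V $$ (l, j))"
      using l assms normsq_pos[OF assms(1)] normsq_pos[OF assms(2)] K[of "f l"]
      by (simp add: Vij c_def)
  qed
  also have "\<dots> = c * (mat_adjoint V * V) $$ (i, j)"
    using V A assms
    by (simp del: sum.op_ivl_Suc sum.lessThan_Suc add: scalar_prod_def sum_distrib_left lessThan_atLeast0 mat_adjoint_index[OF V])
  also have "\<dots> = (if i = j then of_real (szego_normsq a i) else 0)"
    unfolding u using assms c(2) by simp
  finally show ?thesis using sum.reindex_bij_betw[OF f, of "\<lambda>\<zeta>. cnj (szego_phi a \<zeta> i) * szego_phi a \<zeta> j / of_real (christoffel a m \<zeta>)"]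
    by simp
qed

definition spectral_pmf :: "complex pmf" where
  "spectral_pmf = embed_pmf (\<lambda>z. if z \<in> zeros then 1 / christoffel a m z else 0)"

lemma pmf_spectral: "pmf spectral_pmf z = (if z \<in> zeros then 1 / christoffel a m z else 0)"
  unfolding spectral_pmf_def
proof (rule pmf_embed_pmf)
  show nn: "0 \<le> (if z \<in> zeros then 1 / christoffel a m z else 0)" for z
    using christoffel_ge_1[of z] by auto
  have "of_real (\<Sum>\<zeta>\<in>zeros. 1 / christoffel a m \<zeta>) = (1 :: complex)"
    using phi_orthogonal[of 0 0] by (simp add: szego_normsq_def)
  then have "(\<Sum>\<zeta>\<in>zeros. 1 / christoffel a m \<zeta>) = 1" using of_real_eq_1_iff by blast
  moreover have "(\<integral>\<^sup>+ z. ennreal (if z \<in> zeros then 1 / christoffel a m z else 0) \<partial>count_space UNIV)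
    = (\<Sum>z\<in>zeros. ennreal (if z \<in> zeros then 1 / christoffel a m z else 0))"
    using finite_zeros by (intro nn_integral_count_space'[of zeros]) (auto split: if_splits)
  ultimately show "(\<integral>\<^sup>+ z. ennreal (if z \<in> zeros then 1 / christoffel a m z else 0) \<partial>count_space UNIV) = 1"
    using nn christoffel_ge_1 by (subst (asm) sum_ennreal) (auto intro: order_trans[OF zero_le_one])
qed

lemma set_spectral: "set_pmf spectral_pmf = zeros"
proof -
  have "christoffel a m z \<noteq> 0" for z using christoffel_ge_1[of z] by linarith
  then show ?thesis by (auto simp: set_pmf_iff pmf_spectral split: if_splits)
qed

lemma finite_spectral: "finite (set_pmf spectral_pmf)" by (simp add: set_spectral finite_zeros)

lemma L2_spectral:
  "L2_inner spectral_pmf p q = (\<Sum>\<zeta>\<in>zeros. cnj (poly p \<zeta>) * poly q \<zeta> / of_real (christoffel a m \<zeta>))"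
  unfolding L2_inner_sum[OF finite_spectral] set_spectral by (intro sum.cong) (auto simp: pmf_spectral)

lemma is_monic_OP_spectral:
  assumes "j \<le> m" shows "is_monic_OP spectral_pmf j (szego_poly a j)"
proof -
  have o: "L2_inner spectral_pmf (szego_poly a j) (szego_poly a i) = 0" if "i < j" for i
    using phi_orthogonal[of j i] assms that poly_szego_poly[of a] by (simp add: L2_spectral)
  have "L2_inner spectral_pmf (szego_poly a j) (Polynomial.monom 1 i) = 0" if "i < j" for i
  proof (rule monic_family_zero[where P = "szego_poly a" and m = j])
    show "degree (szego_poly a j) = j" for j using szego_poly_monic by blast
    show "lead_coeff (szego_poly a j) = 1" for j using szego_poly_monic by blast
  qed (use that o in \<open>simp_all add: L2_inner_add[OF finite_spectral] L2_inner_smult[OF finite_spectral] degree_monom_eq\<close>)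
  then have "L2_inner spectral_pmf (Polynomial.monom 1 i) (szego_poly a j) = 0" if "i < j" for i
    using that L2_inner_cnj[OF finite_spectral, of "Polynomial.monom 1 i" "szego_poly a j"] by simp
  then show ?thesis using szego_poly_monic[of a j] unfolding is_monic_OP_def by blast
qed

lemma monic_OP_spectral: "j \<le> Suc m \<Longrightarrow> monic_OP spectral_pmf j = szego_poly a j"
proof (cases "j = Suc m")
  case True
  have "szego_poly a (Suc m) = (\<Prod>\<zeta>\<in>zeros. [:- \<zeta>, 1:])"
    using complex_poly_decompose_rsquarefree[OF szego_rsquarefree] szego_poly_monic[of a "Suc m"]
    unfolding zeros_poly by (metis smult_1_left)
  then show ?thesis using True by (simp add: monic_OP_def set_spectral card_zeros)
next
  case False
  assume "j \<le> Suc m"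
  then show ?thesis using False is_monic_OP_spectral[of j]
    by (intro monic_OP_eqI finite_spectral) (auto simp: set_spectral card_zeros)
qed

lemma verblunsky_measure_eq: "verblunsky_measure (Suc m) a = spectral_pmf"
  unfolding verblunsky_measure_def
proof (rule the_equality)
  show *: "npoint_circle_pmf (Suc m) spectral_pmf \<and> verblunsky_coeffs (Suc m) spectral_pmf a"
    using zerosD(1) by (auto simp: npoint_circle_pmf_def verblunsky_coeffs_def set_spectral finite_zeros card_zeros
        monic_OP_spectral)
  fix \<mu> assume "npoint_circle_pmf (Suc m) \<mu> \<and> verblunsky_coeffs (Suc m) \<mu> a"
  with * show "\<mu> = spectral_pmf" using verblunsky_measure_unique[of "Suc m"] by blast
qed

lemma L2_norm_spectral: "j \<le> m \<Longrightarrow> L2_norm spectral_pmf (szego_poly a j) = sqrt (szego_normsq a j)"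
proof -
  assume j: "j \<le> m"
  have "measure_pmf.expectation spectral_pmf (\<lambda>z. (cmod (poly (szego_poly a j) z))\<^sup>2)
      = (\<Sum>\<zeta>\<in>zeros. (cmod (szego_phi a \<zeta> j))\<^sup>2 / christoffel a m \<zeta>)"
    using poly_szego_poly[of a j] finite_zeros
    by (subst integral_measure_pmf[of zeros]) (auto simp: set_spectral pmf_spectral intro!: sum.cong)
  moreover have "complex_of_real (\<Sum>\<zeta>\<in>zeros. (cmod (szego_phi a \<zeta> j))\<^sup>2 / christoffel a m \<zeta>) = of_real (szego_normsq a j)"
    using phi_orthogonal[OF j j] unfolding of_real_sum of_real_divide complex_norm_square by (simp add: mult.commute)
  ultimately show ?thesis unfolding L2_norm_def by (metis of_real_eq_iff)
qed

lemma GGT_index_sum: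
  assumes "i < Suc m" "j < Suc m"
  shows "GGT (Suc m) a $$ (i, j) = (\<Sum>\<zeta>\<in>zeros. cnj (szego_phi a \<zeta> i) * (\<zeta> * szego_phi a \<zeta> j) / of_real (christoffel a m \<zeta>))
      / of_real (sqrt (szego_normsq a i) * sqrt (szego_normsq a j))"
  using assms poly_szego_poly[of a]
  by (simp add: GGT_def verblunsky_measure_eq Let_def orthonormal_OP_def monic_OP_spectral L2_norm_spectral L2_spectral
      sum_divide_distrib mult_ac)

text \<open>
  Explicit entries, polynomial in the coefficients and their conjugates up to square roots. They make the matrix a measurable function of the
  coefficients.
\<close>
lemma GGT_index:
  assumes "i < Suc m" "j < Suc m"
  shows "GGT (Suc m) a $$ (i, j) = of_real (sqrt (szego_normsq a i) / sqrt (szego_normsq a j)) *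
      ((if i = Suc j then 1 else 0) + cnj (a j) * psi_coeff a i j)"
proof -
  let ?w = "\<lambda>\<zeta>. of_real (christoffel a m \<zeta>)"
  have N: "szego_normsq a i > 0" "szego_normsq a j > 0" using assms normsq_pos by auto
  have "(\<Sum>\<zeta>\<in>zeros. cnj (szego_phi a \<zeta> i) * (\<zeta> * szego_phi a \<zeta> j) / ?w \<zeta>)
    = (\<Sum>\<zeta>\<in>zeros. cnj (szego_phi a \<zeta> i) * szego_phi a \<zeta> (Suc j) / ?w \<zeta>)
     + (\<Sum>\<zeta>\<in>zeros. \<Sum>l\<le>j. cnj (a j) * psi_coeff a l j * (cnj (szego_phi a \<zeta> i) * szego_phi a \<zeta> l / ?w \<zeta>))"
    unfolding sum.distrib[symmetric]
  proof (rule sum.cong[OF refl])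
    fix \<zeta>
    \<comment> \<open>Multiplication by the variable shifts the index up to a reversed polynomial, which is expanded in the basis.\<close>
    have e: "\<zeta> * szego_phi a \<zeta> j = szego_phi a \<zeta> (Suc j) + cnj (a j) * szego_psi a \<zeta> j" by simp
    show "cnj (szego_phi a \<zeta> i) * (\<zeta> * szego_phi a \<zeta> j) / ?w \<zeta> = cnj (szego_phi a \<zeta> i) * szego_phi a \<zeta> (Suc j) / ?w \<zeta>
       + (\<Sum>l\<le>j. cnj (a j) * psi_coeff a l j * (cnj (szego_phi a \<zeta> i) * szego_phi a \<zeta> l / ?w \<zeta>))"
      unfolding e psi_expansion
      by (simp del: szego_phi.simps add: distrib_left add_divide_distrib sum_distrib_left sum_divide_distrib mult_ac)
  qed
  also have "(\<Sum>\<zeta>\<in>zeros. \<Sum>l\<le>j. cnj (a j) * psi_coeff a l j * (cnj (szego_phi a \<zeta> i) * szego_phi a \<zeta> l / ?w \<zeta>))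
     = (\<Sum>l\<le>j. cnj (a j) * psi_coeff a l j * (if i = l then of_real (szego_normsq a i) else 0))"
    using phi_orthogonal[of i] assms
    by (subst sum.swap, unfold sum_distrib_left[symmetric], intro sum.cong) auto
  also have "\<dots> = cnj (a j) * psi_coeff a i j * of_real (szego_normsq a i)"
    by (cases "i \<le> j") (auto simp: if_distrib[of "(*) _"] psi_coeff_0 cong: if_cong)
  also have "(\<Sum>\<zeta>\<in>zeros. cnj (szego_phi a \<zeta> i) * szego_phi a \<zeta> (Suc j) / ?w \<zeta>) = (if i = Suc j then of_real (szego_normsq a i) else 0)"
  proof (cases "j = m")
    case True
    then show ?thesis using zerosD(2) assms by (simp del: szego_phi.simps)
  next
    case False
    then show ?thesis using phi_orthogonal[of i "Suc j"] assms by (simp del: szego_phi.simps)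
  qed
  finally have S: "(\<Sum>\<zeta>\<in>zeros. cnj (szego_phi a \<zeta> i) * (\<zeta> * szego_phi a \<zeta> j) / ?w \<zeta>) =
    of_real (szego_normsq a i) * ((if i = Suc j then 1 else 0) + cnj (a j) * psi_coeff a i j)"
    by (simp add: algebra_simps)
  have "of_real (szego_normsq a i) = complex_of_real (sqrt (szego_normsq a i)) * of_real (sqrt (szego_normsq a i))"
    using N by (simp flip: of_real_mult)
  then show ?thesis unfolding GGT_index_sum[OF assms] S using N by simp
qed

text \<open>
  The unitary of \<open>dual_orthogonality\<close> conjugates the matrix of multiplication by \<open>z\<close> to the diagonal matrix of the zeros.
\<close>
lemma GGT_similar:
  shows GGT_unitary: "GGT (Suc m) a \<in> unitary_mats (Suc m)"
    and eigvals_GGT: "eigvals_mset (GGT (Suc m) a) = mset_set zeros"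
proof -
  let ?n = "Suc m"
  obtain f V where f: "bij_betw f {..<?n} zeros" and V: "V \<in> carrier_mat ?n ?n"
    and u: "mat_adjoint V * V = 1\<^sub>m ?n" "V * mat_adjoint V = 1\<^sub>m ?n"
    and Vij: "\<And>i j. i < ?n \<Longrightarrow> j < ?n \<Longrightarrow>
       V $$ (i, j) = szego_phi a (f i) j / of_real (sqrt (szego_normsq a j) * sqrt (christoffel a m (f i)))"
    using dual_orthogonality by metis
  note A = mat_adjoint_carrier[OF V]
  define G where "G = GGT ?n a"
  have G: "G \<in> carrier_mat ?n ?n" by (simp add: G_def GGT_def Let_def)
  define D where "D = mat ?n ?n (\<lambda>(i, j). if i = j then f i else 0)"
  have D: "D \<in> carrier_mat ?n ?n" by (simp add: D_def)
  note DA = mat_adjoint_carrier[OF D]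
  have fz: "f i \<in> zeros" if "i < ?n" for i using f that by (auto simp: bij_betw_def)
  have GV: "G = mat_adjoint V * D * V"
  proof (rule eq_matI)
    fix i j assume "i < dim_row (mat_adjoint V * D * V)" "j < dim_col (mat_adjoint V * D * V)"
    then have ij: "i < ?n" "j < ?n" using A V by auto
    have DV: "(D * V) $$ (l, j) = f l * V $$ (l, j)" if "l < ?n" for l
    proof -
      have "(D * V) $$ (l, j) = (\<Sum>k<?n. (if l = k then f l else 0) * V $$ (k, j))"
        using D V ij that by (simp add: scalar_prod_def D_def lessThan_atLeast0)
      also have "\<dots> = (\<Sum>k<?n. if l = k then f l * V $$ (k, j) else 0)" by (intro sum.cong) auto
      finally show ?thesis using that by simp
    qed
    have "mat_adjoint V * D * V = mat_adjoint V * (D * V)" using A D V by (rule assoc_mult_mat)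
    then have "(mat_adjoint V * D * V) $$ (i, j) = (\<Sum>l<?n. mat_adjoint V $$ (i, l) * (D * V) $$ (l, j))"
      using A D V ij by (simp add: scalar_prod_def lessThan_atLeast0)
    also have "\<dots> = (\<Sum>l<?n. cnj (V $$ (l, i)) * (f l * V $$ (l, j)))"
      using ij DV mat_adjoint_index[OF V] by (intro sum.cong) auto
    also have "\<dots> = (\<Sum>l<?n. cnj (szego_phi a (f l) i) * (f l * szego_phi a (f l) j) / of_real (christoffel a m (f l))
         / of_real (sqrt (szego_normsq a i) * sqrt (szego_normsq a j)))"
    proof (rule sum.cong[OF refl])
      fix l assume l: "l \<in> {..<?n}"
      have "complex_of_real (sqrt (christoffel a m (f l))) * of_real (sqrt (christoffel a m (f l))) = of_real (christoffel a m (f l))"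
        using christoffel_ge_1[of "f l"] by (simp flip: of_real_mult)
      then show "cnj (V $$ (l, i)) * (f l * V $$ (l, j)) = cnj (szego_phi a (f l) i) * (f l * szego_phi a (f l) j) / of_real (christoffel a m (f l))
         / of_real (sqrt (szego_normsq a i) * sqrt (szego_normsq a j))"
        using l ij by (simp add: Vij field_simps)
    qed
    also have "\<dots> = G $$ (i, j)"
      unfolding G_def GGT_index_sum[OF ij] sum_divide_distrib[symmetric]
      using sum.reindex_bij_betw[OF f, of "\<lambda>\<zeta>. cnj (szego_phi a \<zeta> i) * (\<zeta> * szego_phi a \<zeta> j) / of_real (christoffel a m \<zeta>)"] by simp
    finally show "G $$ (i, j) = (mat_adjoint V * D * V) $$ (i, j)" by simp
  qed (use G A V in auto)
  have DD: "mat_adjoint D * D = 1\<^sub>m ?n"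
  proof (rule eq_matI)
    fix i j assume "i < dim_row (1\<^sub>m ?n :: complex mat)" "j < dim_col (1\<^sub>m ?n :: complex mat)"
    then have ij: "i < ?n" "j < ?n" by auto
    have "(mat_adjoint D * D) $$ (i, j) = (\<Sum>l<?n. cnj (D $$ (l, i)) * D $$ (l, j))"
      using D DA ij by (simp add: scalar_prod_def lessThan_atLeast0 mat_adjoint_index[OF D])
    also have "\<dots> = (\<Sum>l<?n. if l = i then (if i = j then cnj (f i) * f i else 0) else 0)"
      using ij by (intro sum.cong) (auto simp: D_def)
    also have "\<dots> = (if i = j then 1 else 0)"
      using ij zerosD(1)[OF fz[OF ij(1)]] complex_norm_square[of "f i"] by (auto simp: mult.commute)
    finally show "(mat_adjoint D * D) $$ (i, j) = 1\<^sub>m ?n $$ (i, j)" using ij by simp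
  qed (use D DA in auto)
  have GA: "mat_adjoint G = mat_adjoint V * mat_adjoint D * V"
    unfolding GV mat_adjoint_mult[OF mult_carrier_mat[OF A D] V] mat_adjoint_mult[OF A D] mat_adjoint_adjoint[OF V]
    using A DA V by (simp add: assoc_mult_mat[of _ ?n ?n _ ?n _ ?n])
  have "mat_adjoint G * G = mat_adjoint V * (mat_adjoint D * ((V * mat_adjoint V) * (D * V)))"
    unfolding GA unfolding GV using A D V DA by (simp add: assoc_mult_mat[of _ ?n ?n _ ?n _ ?n])
  also have "\<dots> = mat_adjoint V * ((mat_adjoint D * D) * V)"
    unfolding u using A D V DA by (simp add: assoc_mult_mat[of _ ?n ?n _ ?n _ ?n])
  also have "\<dots> = 1\<^sub>m ?n" unfolding DD using V u by simp
  finally show "GGT ?n a \<in> unitary_mats ?n" using G by (simp add: unitary_mats_def G_def)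
  have "similar_mat G D"
    by (rule similar_matI[of _ _ "mat_adjoint V" V ?n]) (use G D V A u GV in auto)
  then have "char_poly G = char_poly D" by (rule char_poly_similar)
  also have "\<dots> = (\<Prod>x\<leftarrow>diag_mat D. [:- x, 1:])"
    by (rule char_poly_upper_triangular[OF D]) (auto simp: D_def upper_triangular_def)
  also have "diag_mat D = map f [0..<?n]" by (auto simp: diag_mat_def D_def)
  finally have cp: "char_poly G = (\<Prod>x\<leftarrow>map f [0..<?n]. [:- x, 1:])" .
  have "eigvals_mset G = mset (map f [0..<?n])"
    unfolding eigvals_mset_def cp by (rule proots_prod_linear)
  also have "\<dots> = image_mset f (mset_set {..<?n})" by (simp add: lessThan_atLeast0 del: upt_Suc)
  also have "\<dots> = mset_set (f ` {..<?n})"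
    using f by (intro image_mset_mset_set) (auto simp: bij_betw_def)
  also have "f ` {..<?n} = zeros" using f by (auto simp: bij_betw_def)
  finally show "eigvals_mset (GGT ?n a) = mset_set zeros" by (simp add: G_def)
qed

end

section \<open>Spectra of unitary matrices\<close>

lemma unitary_eigvals:
  assumes A: "A \<in> unitary_mats n"
  shows unitary_eigvals_size: "size (eigvals_mset A) = n"
    and unitary_eigvals_norm: "z \<in># eigvals_mset A \<Longrightarrow> cmod z = 1"
proof -
  have c: "A \<in> carrier_mat n n" and u: "mat_adjoint A * A = 1\<^sub>m n" using A by (auto simp: unitary_mats_def)
  show "size (eigvals_mset A) = n"
    unfolding eigvals_mset_def size_proots_complex using degree_monic_char_poly[OF c] by simp
  assume "z \<in># eigvals_mset A"
  moreover have "char_poly A \<noteq> 0" using degree_monic_char_poly[OF c] by (metis coeff_0 zero_neq_one)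
  ultimately have "poly (char_poly A) z = 0" unfolding eigvals_mset_def by simp
  then have "eigenvalue A z" using eigenvalue_root_char_poly[OF c] by simp
  then obtain v where v: "v \<in> carrier_vec n" "v \<noteq> 0\<^sub>v n" "A *\<^sub>v v = z \<cdot>\<^sub>v v"
    using c unfolding eigenvalue_def eigenvector_def by auto
  define S where "S = (\<Sum>i<n. (cmod (v $ i))\<^sup>2)"
  have Av: "(\<Sum>j<n. A $$ (i, j) * v $ j) = z * v $ i" if "i < n" for i
  proof -
    have "(A *\<^sub>v v) $ i = (\<Sum>j<n. A $$ (i, j) * v $ j)"
      using c v(1) that by (simp add: scalar_prod_def lessThan_atLeast0)
    then show ?thesis unfolding v(3) using v(1) that by simp
  qed
  have orth: "(\<Sum>i<n. cnj (A $$ (i, j)) * A $$ (i, k)) = (if j = k then 1 else 0)" if "j < n" "k < n" for j k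
  proof -
    have "(mat_adjoint A * A) $$ (j, k) = (\<Sum>i<n. cnj (A $$ (i, j)) * A $$ (i, k))"
      using c that mat_adjoint_carrier[OF c] by (simp add: scalar_prod_def lessThan_atLeast0 mat_adjoint_index[OF c])
    then show ?thesis unfolding u using that by simp
  qed
  have "(\<Sum>i<n. cnj (z * v $ i) * (z * v $ i)) = (\<Sum>i<n. cnj (\<Sum>j<n. A $$ (i, j) * v $ j) * (\<Sum>k<n. A $$ (i, k) * v $ k))"
    by (intro sum.cong refl) (simp add: Av del: cnj_sum)
  also have "\<dots> = (\<Sum>i<n. \<Sum>j<n. \<Sum>k<n. cnj (v $ j) * v $ k * (cnj (A $$ (i, j)) * A $$ (i, k)))"
    unfolding cnj_sum sum_product by (intro sum.cong refl) simp
  also have "\<dots> = (\<Sum>j<n. \<Sum>k<n. \<Sum>i<n. cnj (v $ j) * v $ k * (cnj (A $$ (i, j)) * A $$ (i, k)))"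
    by (rule trans[OF sum.swap], rule sum.cong[OF refl], rule sum.swap)
  also have "\<dots> = (\<Sum>j<n. \<Sum>k<n. cnj (v $ j) * v $ k * (if j = k then 1 else 0))"
    unfolding sum_distrib_left[symmetric] using orth by (intro sum.cong) auto
  also have "\<dots> = (\<Sum>j<n. cnj (v $ j) * v $ j)" by (simp add: if_distrib[of "(*) _"] cong: if_cong)
  finally have e: "cnj z * z * (\<Sum>i<n. cnj (v $ i) * v $ i) = (\<Sum>i<n. cnj (v $ i) * v $ i)"
    by (simp add: sum_distrib_left mult_ac)
  have S: "(\<Sum>i<n. cnj (v $ i) * v $ i) = of_real S"
    unfolding S_def of_real_sum complex_norm_square by (simp add: mult.commute)
  have "S \<noteq> 0"
  proof
    assume "S = 0"
    then have "v $ i = 0" if "i < n" for i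
      using that unfolding S_def by (subst (asm) sum_nonneg_eq_0_iff) auto
    then show False using v(1,2) by (auto intro!: eq_vecI)
  qed
  then have "cnj z * z = 1" using e unfolding S by simp
  then have "(cmod z)\<^sup>2 = 1" using complex_norm_square[of z] by (metis mult.commute of_real_1 of_real_eq_iff)
  then show "cmod z = 1" using norm_ge_zero[of z] by (simp add: power2_eq_1_iff)
qed

definition mtrace :: "complex mat \<Rightarrow> complex" where "mtrace A = (\<Sum>i<dim_row A. A $$ (i, i))"

lemma mtrace_comm:
  assumes "A \<in> carrier_mat n n" "B \<in> carrier_mat n n"
  shows "mtrace (A * B) = mtrace (B * A)"
proof -
  have "mtrace (A * B) = (\<Sum>i<n. \<Sum>k<n. A $$ (i, k) * B $$ (k, i))"
    unfolding mtrace_def using assms by (intro sum.cong) (auto simp: scalar_prod_def lessThan_atLeast0)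
  also have "\<dots> = (\<Sum>k<n. \<Sum>i<n. B $$ (k, i) * A $$ (i, k))"
    by (subst sum.swap) (simp add: mult.commute)
  also have "\<dots> = mtrace (B * A)"
    unfolding mtrace_def using assms by (intro sum.cong) (auto simp: scalar_prod_def lessThan_atLeast0)
  finally show ?thesis .
qed

lemma upper_triangular_pow:
  fixes B :: "complex mat"
  assumes B: "B \<in> carrier_mat n n" "upper_triangular B"
  shows "upper_triangular (B ^\<^sub>m k) \<and> (\<forall>i<n. (B ^\<^sub>m k) $$ (i, i) = (B $$ (i, i)) ^ k)"
proof (induction k)
  case 0
  then show ?case using B by (auto simp: upper_triangular_def)
next
  case (Suc k)
  have c: "B ^\<^sub>m k \<in> carrier_mat n n" using B by simp
  have z: "(B ^\<^sub>m k) $$ (i, l) = 0" if "l < i" "i < n" for i l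
    using Suc c that by (auto simp: upper_triangular_def)
  have zB: "B $$ (i, l) = 0" if "l < i" "i < n" for i l
    using B that by (auto simp: upper_triangular_def)
  have e: "(B ^\<^sub>m Suc k) $$ (i, j) = (\<Sum>l<n. (B ^\<^sub>m k) $$ (i, l) * B $$ (l, j))" if "i < n" "j < n" for i j
    using c B that by (simp add: scalar_prod_def lessThan_atLeast0)
  have "(B ^\<^sub>m Suc k) $$ (i, j) = 0" if "j < i" "i < n" for i j
  proof -
    have "(B ^\<^sub>m k) $$ (i, l) * B $$ (l, j) = 0" if "l < n" for l
      using z[of l i] zB[of j l] \<open>j < i\<close> \<open>i < n\<close> that by (cases "l < i") auto
    then have "(\<Sum>l<n. (B ^\<^sub>m k) $$ (i, l) * B $$ (l, j)) = 0" by (intro sum.neutral) auto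
    then show ?thesis using e[of i j] that by simp
  qed
  moreover have "(B ^\<^sub>m Suc k) $$ (i, i) = (B $$ (i, i)) ^ Suc k" if "i < n" for i
  proof -
    have "(B ^\<^sub>m k) $$ (i, l) * B $$ (l, i) = (if l = i then (B $$ (i, i)) ^ Suc k else 0)" if "l < n" for l
      using z[of l i] zB[of i l] Suc \<open>i < n\<close> that by (cases "l = i"; cases "l < i") auto
    then have "(\<Sum>l<n. (B ^\<^sub>m k) $$ (i, l) * B $$ (l, i)) = (\<Sum>l<n. if l = i then (B $$ (i, i)) ^ Suc k else 0)"
      by (intro sum.cong) auto
    then show ?thesis using e[of i i] that by simp
  qed
  ultimately show ?case using B by (auto simp: upper_triangular_def)
qed

text \<open>
  Power sums of eigenvalues are traces of powers, hence polynomial in the matrix entries. This is how functions of the spectrum,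
  such as moments of the empirical spectral distribution, are seen to be measurable.
\<close>
lemma eigvals_power_sum:
  assumes A: "A \<in> carrier_mat n n"
  shows "(\<Sum>\<zeta>\<in>#eigvals_mset A. \<zeta> ^ k) = mtrace (A ^\<^sub>m k)"
proof -
  obtain es where es: "char_poly A = (\<Prod>e\<leftarrow>es. [:- e, 1:])"
    using char_poly_factorized[OF A] by auto
  obtain B P Q where sd: "schur_decomposition A es = (B, P, Q)" by (cases "schur_decomposition A es") auto
  from schur_decomposition[OF A es sd]
  have sim: "similar_mat_wit A B P Q" and ut: "upper_triangular B" and dg: "diag_mat B = es" by auto
  note w = similar_mat_witD2[OF A sim]
  have Ak: "A ^\<^sub>m k = P * B ^\<^sub>m k * Q"
    using similar_mat_wit_pow[OF sim, of k] unfolding similar_mat_wit_def Let_def by auto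
  have "mtrace (A ^\<^sub>m k) = mtrace (Q * (P * B ^\<^sub>m k))"
    unfolding Ak using w by (intro mtrace_comm[of _ n]) auto
  also have "Q * (P * B ^\<^sub>m k) = B ^\<^sub>m k"
    using assoc_mult_mat[OF w(7) w(6), of "B ^\<^sub>m k" n] w by simp
  also have "mtrace (B ^\<^sub>m k) = (\<Sum>i<n. (B $$ (i, i)) ^ k)"
    unfolding mtrace_def using upper_triangular_pow[OF w(5) ut] w(5) by (intro sum.cong) auto
  also have "\<dots> = (\<Sum>e\<leftarrow>es. e ^ k)"
    unfolding dg[symmetric] diag_mat_def using w(5) by (simp add: sum_list_sum_nth lessThan_atLeast0)
  also have "\<dots> = (\<Sum>\<zeta>\<in>#eigvals_mset A. \<zeta> ^ k)"
    unfolding eigvals_mset_def es proots_prod_linear by (simp add: sum_mset_sum_list flip: mset_map)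
  finally show ?thesis by simp
qed

lemma space_unitary_borel [simp]: "space (unitary_borel n) = unitary_mats n"
  by (simp add: unitary_borel_def)

lemma measurable_entry:
  assumes "i < n" "j < n"
  shows "(\<lambda>A. A $$ (i, j)) \<in> borel_measurable (unitary_borel n)"
proof -
  have "(\<lambda>A. \<lambda>ij\<in>{..<n} \<times> {..<n}. A $$ ij) \<in> unitary_borel n \<rightarrow>\<^sub>M (\<Pi>\<^sub>M ij\<in>{..<n} \<times> {..<n}. borel)"
    unfolding unitary_borel_def by (rule measurable_vimage_algebra1) (auto simp: space_PiM)
  from measurable_compose[OF this measurable_component_singleton[of "(i, j)"]] assms
  show ?thesis by simp
qed

lemma measurable_into_unitary_borel:
  assumes "\<And>x. x \<in> space N \<Longrightarrow> F x \<in> unitary_mats n"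
    and "\<And>i j. i < n \<Longrightarrow> j < n \<Longrightarrow> (\<lambda>x. F x $$ (i, j)) \<in> borel_measurable N"
  shows "F \<in> N \<rightarrow>\<^sub>M unitary_borel n"
  unfolding unitary_borel_def
proof (rule measurable_vimage_algebra2)
  show "F \<in> space N \<rightarrow> unitary_mats n" using assms(1) by auto
  show "(\<lambda>x. \<lambda>ij\<in>{..<n} \<times> {..<n}. F x $$ ij) \<in> N \<rightarrow>\<^sub>M (\<Pi>\<^sub>M ij\<in>{..<n} \<times> {..<n}. borel)"
    by (rule measurable_restrict) (use assms(2) in auto)
qed

lemma measurable_mtrace_pow: "(\<lambda>A. mtrace (A ^\<^sub>m k)) \<in> borel_measurable (unitary_borel n)"
proof -
  have "(\<lambda>A. (A ^\<^sub>m k) $$ (i, j)) \<in> borel_measurable (unitary_borel n)" if "i < n" "j < n" for i j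
    using that
  proof (induction k arbitrary: i j)
    case 0
    have "(\<lambda>A. (A ^\<^sub>m 0) $$ (i, j)) \<in> borel_measurable (unitary_borel n) \<longleftrightarrow> (\<lambda>A. 1\<^sub>m n $$ (i, j) :: complex) \<in> borel_measurable (unitary_borel n)"
      by (rule measurable_cong) (auto simp: unitary_mats_def)
    then show ?case by simp
  next
    case (Suc k)
    have "(\<lambda>A. (A ^\<^sub>m Suc k) $$ (i, j)) \<in> borel_measurable (unitary_borel n) \<longleftrightarrow>
        (\<lambda>A. \<Sum>l<n. (A ^\<^sub>m k) $$ (i, l) * A $$ (l, j)) \<in> borel_measurable (unitary_borel n)"
    proof (rule measurable_cong)
      fix A assume "A \<in> space (unitary_borel n)"
      then have c: "A \<in> carrier_mat n n" by (simp add: unitary_mats_def)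
      then have "A ^\<^sub>m k \<in> carrier_mat n n" by simp
      then show "(A ^\<^sub>m Suc k) $$ (i, j) = (\<Sum>l<n. (A ^\<^sub>m k) $$ (i, l) * A $$ (l, j))"
        using c Suc.prems by (simp add: scalar_prod_def lessThan_atLeast0)
    qed
    then show ?case using Suc measurable_entry by auto
  qed
  moreover have "(\<lambda>A. mtrace (A ^\<^sub>m k)) \<in> borel_measurable (unitary_borel n) \<longleftrightarrow>
      (\<lambda>A. \<Sum>i<n. (A ^\<^sub>m k) $$ (i, i)) \<in> borel_measurable (unitary_borel n)"
  proof (rule measurable_cong)
    fix A assume "A \<in> space (unitary_borel n)"
    then have "A \<in> carrier_mat n n" by (simp add: unitary_mats_def)
    then have "A ^\<^sub>m k \<in> carrier_mat n n" by simp
    then have "dim_row (A ^\<^sub>m k) = n" by blast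
    then show "mtrace (A ^\<^sub>m k) = (\<Sum>i<n. (A ^\<^sub>m k) $$ (i, i))" by (simp add: mtrace_def)
  qed
  ultimately show ?thesis by auto
qed

section \<open>Moments and weak convergence on the circle\<close>

lemma circle_prob:
  assumes "\<mu> \<in> circle_probs"
  shows circle_prob_space: "prob_space \<mu>" and circle_prob_sets: "sets \<mu> = sets circle_borel"
    and circle_prob_carrier: "space \<mu> = sphere 0 1"
proof -
  show "prob_space \<mu>" and s: "sets \<mu> = sets circle_borel" using assms by (auto simp: space_prob_algebra)
  show "space \<mu> = sphere 0 1"
    using sets_eq_imp_space_eq[OF s] by (simp add: circle_borel_def space_restrict_space)
qed

lemma circle_measurable:
  fixes h :: "complex \<Rightarrow> 'b :: {banach, second_countable_topology}"
  assumes "\<mu> \<in> circle_probs" "continuous_on (sphere 0 1) h"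
  shows "h \<in> borel_measurable \<mu>"
  using borel_measurable_continuous_on_restrict[OF assms(2)]
  by (simp add: measurable_cong_sets[OF circle_prob_sets[OF assms(1)] refl] circle_borel_def)

lemma circle_integrable_continuous:
  fixes h :: "complex \<Rightarrow> 'b :: {banach, second_countable_topology}"
  assumes "\<mu> \<in> circle_probs" "continuous_on (sphere 0 1) h"
  shows "integrable \<mu> h"
proof -
  interpret prob_space \<mu> by (rule circle_prob_space[OF assms(1)])
  have "bounded (h ` sphere 0 1)"
    by (rule compact_imp_bounded[OF compact_continuous_image[OF assms(2) compact_sphere]])
  then obtain B where B: "\<forall>x\<in>h ` sphere 0 1. norm x \<le> B"
    unfolding bounded_iff by blast
  then have "AE z in \<mu>. norm (h z) \<le> B"
    by (intro AE_I2) (simp add: circle_prob_carrier[OF assms(1)])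
  then show ?thesis
    by (rule integrable_const_bound) (rule circle_measurable[OF assms])
qed

lemma circle_integral_bound:
  fixes h :: "complex \<Rightarrow> 'b :: {banach, second_countable_topology}"
  assumes "\<mu> \<in> circle_probs" "continuous_on (sphere 0 1) h" "\<And>z. cmod z = 1 \<Longrightarrow> norm (h z) \<le> B"
  shows "norm (integral\<^sup>L \<mu> h) \<le> B"
proof -
  interpret prob_space \<mu> by (rule circle_prob_space[OF assms(1)])
  have "norm (integral\<^sup>L \<mu> h) \<le> integral\<^sup>L \<mu> (\<lambda>z. norm (h z))" by (rule integral_norm_bound)
  also have "\<dots> \<le> integral\<^sup>L \<mu> (\<lambda>z. B)"
    using circle_integrable_continuous[OF assms(1,2)] assms(3) circle_prob_carrier[OF assms(1)]
    by (intro integral_mono) auto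
  finally show ?thesis by (simp add: prob_space)
qed

definition moment :: "complex measure \<Rightarrow> nat \<Rightarrow> complex" where
  "moment \<nu> k = integral\<^sup>L \<nu> (\<lambda>z. z ^ k)"

context
  fixes \<nu> :: "nat \<Rightarrow> complex measure" and \<mu> :: "complex measure"
  assumes \<nu>: "\<And>i. \<nu> i \<in> circle_probs" and \<mu>: "\<mu> \<in> circle_probs"
begin

text \<open>
  Convergence of integrals against \<open>h\<close> times every Laurent monomial. Unlike convergence of \<open>\<integral> h\<close> alone, it is stable under
  multiplication of \<open>h\<close> by \<open>z\<close> and by \<open>cnj z = inverse z\<close>, hence passes from \<open>1\<close> to all polynomials in \<open>Re z\<close> and \<open>Im z\<close>.
\<close>
definition laurent_conv :: "(complex \<Rightarrow> complex) \<Rightarrow> bool" where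
  "laurent_conv h \<longleftrightarrow> continuous_on (sphere 0 1) h \<and>
     (\<forall>k :: int. (\<lambda>i. integral\<^sup>L (\<nu> i) (\<lambda>z. h z * z powi k)) \<longlonglongrightarrow> integral\<^sup>L \<mu> (\<lambda>z. h z * z powi k))"

lemma laurent_conv_cong:
  assumes "\<And>z. cmod z = 1 \<Longrightarrow> h z = k z"
  shows "laurent_conv h = laurent_conv k"
proof -
  have "integral\<^sup>L N (\<lambda>z. h z * z powi j) = integral\<^sup>L N (\<lambda>z. k z * z powi j)" if "N \<in> circle_probs" for N j
    using assms circle_prob_carrier[OF that] by (intro Bochner_Integration.integral_cong) auto
  moreover have "continuous_on (sphere 0 1) h = continuous_on (sphere 0 1) k"
    using assms by (intro continuous_on_cong) auto
  ultimately show ?thesis unfolding laurent_conv_def using \<nu> \<mu> by simp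
qed

lemma laurent_conv_add:
  assumes "laurent_conv h" "laurent_conv k" shows "laurent_conv (\<lambda>z. h z + k z)"
proof -
  have c: "continuous_on (sphere 0 1) (\<lambda>z. f z * z powi j)" if "laurent_conv f" for f j
    using that unfolding laurent_conv_def by (intro continuous_intros) auto
  have "integral\<^sup>L N (\<lambda>z. (h z + k z) * z powi j) = integral\<^sup>L N (\<lambda>z. h z * z powi j) + integral\<^sup>L N (\<lambda>z. k z * z powi j)"
    if "N \<in> circle_probs" for N j
    unfolding distrib_right
    by (intro Bochner_Integration.integral_add circle_integrable_continuous[OF that] c assms)
  then show ?thesis using assms \<nu> \<mu> unfolding laurent_conv_def
    by (auto intro!: tendsto_add continuous_intros)
qed

lemma laurent_conv_shift:
  assumes "laurent_conv h" shows "laurent_conv (\<lambda>z. c * z powi j * h z)"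
proof -
  have "integral\<^sup>L N (\<lambda>z. c * z powi j * h z * z powi k) = c * integral\<^sup>L N (\<lambda>z. h z * z powi (j + k))"
    if "N \<in> circle_probs" for N k
  proof -
    have "c * integral\<^sup>L N (\<lambda>z. h z * z powi (j + k)) = integral\<^sup>L N (\<lambda>z. c * (h z * z powi (j + k)))" by simp
    also have "\<dots> = integral\<^sup>L N (\<lambda>z. c * z powi j * h z * z powi k)"
    proof (rule Bochner_Integration.integral_cong[OF refl])
      fix z assume "z \<in> space N"
      then have "z \<noteq> 0" using circle_prob_carrier[OF that] by auto
      then show "c * (h z * z powi (j + k)) = c * z powi j * h z * z powi k" by (simp add: power_int_add)
    qed
    finally show ?thesis by simp
  qed
  then show ?thesis using assms \<nu> \<mu> unfolding laurent_conv_def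
    by (auto intro!: tendsto_mult continuous_intros)
qed

lemma laurent_conv_polynomial:
  fixes g :: "complex \<Rightarrow> real"
  shows "real_polynomial_function g \<Longrightarrow> laurent_conv h \<Longrightarrow> laurent_conv (\<lambda>z. of_real (g z) * h z)"
proof (induction g arbitrary: h rule: real_polynomial_function.induct)
  case (linear f)
  define c where "c = Complex (f 1 / 2) (- f \<i> / 2)"
  have f: "complex_of_real (f z) = c * z + cnj c * cnj z" for z
  proof -
    have "f z = f (Re z *\<^sub>R 1 + Im z *\<^sub>R \<i>)"
      by (rule arg_cong[where f = f]) (simp add: complex_eq_iff)
    also have "\<dots> = Re z * f 1 + Im z * f \<i>"
      using bounded_linear.linear[OF linear.hyps] by (simp only: linear_add linear_scale real_scaleR_def)
    finally show ?thesis by (simp add: c_def complex_eq_iff algebra_simps)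
  qed
  have "laurent_conv (\<lambda>z. c * z powi 1 * h z + cnj c * z powi (-1) * h z)"
    by (rule laurent_conv_add[OF laurent_conv_shift[OF linear.prems] laurent_conv_shift[OF linear.prems]])
  moreover have "of_real (f z) * h z = c * z powi 1 * h z + cnj c * z powi (-1) * h z" if "cmod z = 1" for z
  proof -
    have "cnj z = inverse z" using that complex_norm_square[of z] by (simp add: inverse_unique)
    then show ?thesis unfolding f by (simp add: algebra_simps)
  qed
  ultimately show ?case
    using laurent_conv_cong[of "\<lambda>z. of_real (f z) * h z" "\<lambda>z. c * z powi 1 * h z + cnj c * z powi (-1) * h z"] by blast
next
  case (const c)
  then show ?case using laurent_conv_shift[of h "of_real c" 0] by simp
next
  case (add f g)
  then show ?case by (simp add: distrib_right laurent_conv_add)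
next
  case (mult f g)
  then show ?case by (simp add: mult.assoc)
qed

text \<open>
  Polynomials in \<open>Re z\<close> and \<open>Im z\<close> are uniformly dense in the continuous functions on the circle.
\<close>
lemma moments_imp_weak_conv:
  assumes mom: "\<And>k. (\<lambda>i. moment (\<nu> i) k) \<longlonglongrightarrow> moment \<mu> k"
  shows "circle_weak_conv \<nu> \<mu>"
  unfolding circle_weak_conv_def
proof safe
  fix f :: "complex \<Rightarrow> real" assume f: "continuous_on (sphere 0 1) f"
  have one: "laurent_conv (\<lambda>_. 1)"
    unfolding laurent_conv_def
  proof (intro conjI allI)
    fix k :: int
    show "(\<lambda>i. integral\<^sup>L (\<nu> i) (\<lambda>z. 1 * z powi k)) \<longlonglongrightarrow> integral\<^sup>L \<mu> (\<lambda>z. 1 * z powi k)"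
    proof (cases "k \<ge> 0")
      case True
      then show ?thesis using mom[of "nat k"] by (simp add: moment_def power_int_def)
    next
      case False
      have "integral\<^sup>L N (\<lambda>z. 1 * z powi k) = cnj (moment N (nat (- k)))" if "N \<in> circle_probs" for N
        unfolding moment_def Bochner_Integration.integral_cnj[symmetric]
      proof (rule Bochner_Integration.integral_cong[OF refl])
        fix z assume "z \<in> space N"
        then have "cmod z = 1" using circle_prob_carrier[OF that] by auto
        then have "cnj z = inverse z" using complex_norm_square[of z] by (simp add: inverse_unique)
        then show "1 * z powi k = cnj (z ^ nat (- k))" using False by (simp add: power_int_def power_inverse)
      qed
      then show ?thesis using mom[of "nat (- k)"] \<nu> \<mu> by (simp add: tendsto_cnj)
    qed
  qed auto
  have gconv: "(\<lambda>i. integral\<^sup>L (\<nu> i) g) \<longlonglongrightarrow> integral\<^sup>L \<mu> g" if "real_polynomial_function g" for g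
  proof -
    have "(\<lambda>i. integral\<^sup>L (\<nu> i) (\<lambda>z. of_real (g z) * 1 * z powi 0)) \<longlonglongrightarrow> integral\<^sup>L \<mu> (\<lambda>z. complex_of_real (g z) * 1 * z powi 0)"
      using laurent_conv_polynomial[OF that one] unfolding laurent_conv_def by blast
    then have "(\<lambda>i. complex_of_real (integral\<^sup>L (\<nu> i) g)) \<longlonglongrightarrow> of_real (integral\<^sup>L \<mu> g)" by simp
    then show ?thesis by (simp only: tendsto_of_real_iff)
  qed
  show "(\<lambda>i. integral\<^sup>L (\<nu> i) f) \<longlonglongrightarrow> integral\<^sup>L \<mu> f"
  proof (rule LIMSEQ_I)
    fix e :: real assume e: "e > 0"
    obtain g where g: "real_polynomial_function g" "\<And>z. z \<in> sphere 0 1 \<Longrightarrow> \<bar>f z - g z\<bar> < e / 4"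
      using Stone_Weierstrass_real_polynomial_function[of "sphere 0 1 :: complex set" f "e / 4"] f e by auto
    have gc: "continuous_on (sphere 0 1) g"
      using continuous_real_polymonial_function[OF g(1)] by (simp add: continuous_at_imp_continuous_on)
    obtain i0 where i0: "\<And>i. i \<ge> i0 \<Longrightarrow> norm (integral\<^sup>L (\<nu> i) g - integral\<^sup>L \<mu> g) < e / 4"
      using LIMSEQ_D[OF gconv[OF g(1)], of "e / 4"] e by auto
    have close: "\<bar>integral\<^sup>L N f - integral\<^sup>L N g\<bar> \<le> e / 4" if N: "N \<in> circle_probs" for N
    proof -
      have "norm (integral\<^sup>L N (\<lambda>z. f z - g z)) \<le> e / 4"
        by (rule circle_integral_bound[OF N]) (use f gc g(2) in \<open>auto intro!: continuous_intros less_imp_le\<close>)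
      then show ?thesis
        using circle_integrable_continuous[OF N f] circle_integrable_continuous[OF N gc] by simp
    qed
    show "\<exists>i0. \<forall>i\<ge>i0. norm (integral\<^sup>L (\<nu> i) f - integral\<^sup>L \<mu> f) < e"
    proof (intro exI allI impI)
      fix i assume "i \<ge> i0"
      from i0[OF this] close[OF \<nu>[of i]] close[OF \<mu>]
      show "norm (integral\<^sup>L (\<nu> i) f - integral\<^sup>L \<mu> f) < e" unfolding real_norm_def by linarith
    qed
  qed
qed

end

text \<open>
  A functional that is sequentially continuous for weak convergence is a continuous function of the moment sequence, regarded as a
  point of the product space \<open>nat \<Rightarrow> complex\<close>; so it suffices that the moments are measurable.
\<close>
lemma measurable_weak_functional:
  fixes J :: "complex measure \<Rightarrow> real"
  assumes J: "\<And>\<nu> \<mu>. (\<And>i. \<nu> i \<in> circle_probs) \<Longrightarrow> \<mu> \<in> circle_probs \<Longrightarrow> circle_weak_conv \<nu> \<mu> \<Longrightarrow> (\<lambda>i. J (\<nu> i)) \<longlonglongrightarrow> J \<mu>"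
    and F: "\<And>x. x \<in> space N \<Longrightarrow> F x \<in> circle_probs"
    and m: "\<And>k. (\<lambda>x. moment (F x) k) \<in> borel_measurable N"
  shows "(\<lambda>x. J (F x)) \<in> borel_measurable N"
proof -
  define S where "S = moment ` circle_probs"
  define g where "g s = J (inv_into circle_probs moment s)" for s
  have inv: "inv_into circle_probs moment s \<in> circle_probs" "moment (inv_into circle_probs moment s) = s" if "s \<in> S" for s
    using that unfolding S_def by (auto intro: inv_into_into f_inv_into_f)
  have "continuous_on S g"
  proof (rule continuous_on_sequentiallyI)
    fix u s assume u: "\<forall>i. u i \<in> S" and s: "s \<in> S" and lim: "u \<longlonglongrightarrow> s"
    have "(\<lambda>i. u i k) \<longlonglongrightarrow> s k" for k
      by (rule continuous_on_tendsto_compose[OF continuous_on_product_coordinates[of k] lim]) auto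
    then have "circle_weak_conv (\<lambda>i. inv_into circle_probs moment (u i)) (inv_into circle_probs moment s)"
      using u by (intro moments_imp_weak_conv inv(1) s) (auto simp: inv(2)[OF s] inv(2))
    then show "(\<lambda>i. g (u i)) \<longlonglongrightarrow> g s"
      unfolding g_def using u by (intro J inv(1) s) auto
  qed
  then have gm: "g \<in> borel_measurable (restrict_space borel S)"
    by (rule borel_measurable_continuous_on_restrict)
  have "(\<lambda>x. moment (F x)) \<in> borel_measurable N"
    using m by (intro measurable_coordinatewise_then_product)
  then have "(\<lambda>x. moment (F x)) \<in> N \<rightarrow>\<^sub>M restrict_space borel S"
    using F by (intro measurable_restrict_space2) (auto simp: S_def)
  from measurable_compose[OF this gm] have "(\<lambda>x. g (moment (F x))) \<in> borel_measurable N" .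
  moreover have "g (moment \<nu>) = J \<nu>" if "\<nu> \<in> circle_probs" for \<nu>
  proof -
    have "moment \<nu> \<in> S" using that by (simp add: S_def)
    note i = inv[OF this]
    have "circle_weak_conv (\<lambda>_. \<nu>) (inv_into circle_probs moment (moment \<nu>))"
      by (rule moments_imp_weak_conv[OF that i(1)]) (simp add: i(2))
    then have "(\<lambda>i :: nat. J \<nu>) \<longlonglongrightarrow> g (moment \<nu>)"
      unfolding g_def by (rule J[OF that i(1)])
    then show ?thesis by (simp add: LIMSEQ_const_iff)
  qed
  ultimately show ?thesis using F by (auto intro: measurable_cong[THEN iffD1, rotated])
qed

lemma metric_weakly_continuous:
  assumes D: "metrizes_circle_weak_conv D" and "\<And>i. \<nu> i \<in> circle_probs" "\<mu> \<in> circle_probs" "\<mu>\<^sub>0 \<in> circle_probs"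
    and w: "circle_weak_conv \<nu> \<mu>"
  shows "(\<lambda>i. D (\<nu> i) \<mu>\<^sub>0) \<longlonglongrightarrow> D \<mu> \<mu>\<^sub>0"
proof -
  interpret Metric_space circle_probs D using D by (simp add: metrizes_circle_weak_conv_def)
  have lim: "(\<lambda>i. D (\<nu> i) \<mu>) \<longlonglongrightarrow> 0"
    using D assms(2,3) w by (auto simp: metrizes_circle_weak_conv_def)
  have "(\<lambda>i. D (\<nu> i) \<mu>\<^sub>0 - D \<mu> \<mu>\<^sub>0) \<longlonglongrightarrow> 0"
  proof (rule Lim_null_comparison[OF _ lim])
    have "\<bar>D (\<nu> i) \<mu>\<^sub>0 - D \<mu> \<mu>\<^sub>0\<bar> \<le> D (\<nu> i) \<mu>" for i
      using triangle[OF assms(2)[of i] assms(3,4)] triangle[OF assms(3) assms(2)[of i] assms(4)] commute[of "\<nu> i" \<mu>]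
      by linarith
    then show "\<forall>\<^sub>F i in sequentially. norm (D (\<nu> i) \<mu>\<^sub>0 - D \<mu> \<mu>\<^sub>0) \<le> D (\<nu> i) \<mu>" by simp
  qed
  then show ?thesis by (simp add: LIM_zero_iff)
qed

lemma sum_mset_count: "(\<Sum>x\<in>#M. f x) = (\<Sum>x\<in>set_mset M. of_nat (count M x) * (f x :: 'b :: comm_semiring_1))"
proof (induction M)
  case (add x M)
  show ?case
  proof (cases "x \<in># M")
    case True
    have "(\<Sum>y\<in>set_mset M. of_nat (count (add_mset x M) y) * f y) = (\<Sum>y\<in>set_mset M. of_nat (count M y) * f y + (if y = x then f x else 0))"
      by (intro sum.cong) (auto simp: algebra_simps)
    then show ?thesis using True add by (simp add: sum.distrib insert_absorb add.commute)
  next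
    case False
    then have "(\<Sum>y\<in>set_mset M. of_nat (count (add_mset x M) y) * f y) = (\<Sum>y\<in>set_mset M. of_nat (count M y) * f y)"
      by (intro sum.cong) auto
    then show ?thesis using False add by (simp add: count_eq_zero_iff[THEN iffD2])
  qed
qed simp

lemma esd_circle_probs:
  assumes A: "A \<in> unitary_mats n" "n \<ge> 1"
  shows "esd A \<in> circle_probs"
proof -
  let ?p = "pmf_of_multiset (eigvals_mset A)"
  have ne: "eigvals_mset A \<noteq> {#}" using unitary_eigvals_size[OF A(1)] A(2) by auto
  define N where "N = distr (measure_pmf ?p) borel (\<lambda>z. z)"
  have N: "sets N = sets borel" "space N = UNIV" by (auto simp: N_def)
  have "AE z in measure_pmf ?p. z \<in> sphere 0 1"
    using unitary_eigvals_norm[OF A(1)] ne by (auto simp: AE_measure_pmf_iff set_pmf_of_multiset)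
  then have "emeasure (measure_pmf ?p) (sphere 0 1) = 1"
    by (intro measure_pmf.emeasure_eq_1_AE) auto
  then have "emeasure N (sphere 0 1) = 1" by (simp add: N_def emeasure_distr)
  then have "prob_space (restrict_space N (sphere 0 1))"
    by (intro prob_spaceI) (simp add: N space_restrict_space emeasure_restrict_space)
  moreover have "sets (restrict_space N (sphere 0 1)) = sets circle_borel"
    using N by (simp add: circle_borel_def sets_restrict_space)
  ultimately show ?thesis by (simp add: esd_def N_def space_prob_algebra)
qed

lemma integral_esd:
  fixes f :: "complex \<Rightarrow> complex"
  assumes A: "A \<in> unitary_mats n" "n \<ge> 1" and f: "continuous_on (sphere 0 1) f"
  shows "integral\<^sup>L (esd A) f = (\<Sum>\<zeta>\<in>#eigvals_mset A. f \<zeta>) / of_nat n"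
proof -
  let ?p = "pmf_of_multiset (eigvals_mset A)"
  have ne: "eigvals_mset A \<noteq> {#}" using unitary_eigvals_size[OF A(1)] A(2) by auto
  have m: "(\<lambda>z. indicat_real (sphere 0 1) z *\<^sub>R f z) \<in> borel_measurable borel"
    using f by (intro borel_measurable_continuous_on_indicator) auto
  have "integral\<^sup>L (esd A) f = (LINT z|distr (measure_pmf ?p) borel (\<lambda>z. z). indicat_real (sphere 0 1) z *\<^sub>R f z)"
    unfolding esd_def by (rule integral_restrict_space) auto
  also have "\<dots> = (LINT z|measure_pmf ?p. indicat_real (sphere 0 1) z *\<^sub>R f z)"
    by (rule integral_distr[OF _ m]) auto
  also have "\<dots> = (\<Sum>z\<in>set_mset (eigvals_mset A). pmf ?p z *\<^sub>R (indicat_real (sphere 0 1) z *\<^sub>R f z))"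
    using ne by (intro integral_measure_pmf) (auto simp: set_pmf_of_multiset)
  also have "\<dots> = (\<Sum>z\<in>set_mset (eigvals_mset A). of_nat (count (eigvals_mset A) z) * f z) / of_nat n"
    unfolding sum_divide_distrib using ne unitary_eigvals[OF A(1)]
    by (intro sum.cong) (auto simp: pmf_of_multiset scaleR_conv_of_real)
  finally show ?thesis by (simp add: sum_mset_count)
qed

lemma moment_esd:
  assumes A: "A \<in> unitary_mats n" "n \<ge> 1"
  shows "moment (esd A) k = (\<Sum>\<zeta>\<in>#eigvals_mset A. \<zeta> ^ k) / of_nat n"
  proof -
  have c: "continuous_on (sphere 0 1) (\<lambda>z::complex. z ^ k)" by (rule continuous_on_power[OF continuous_on_id])
  show ?thesis unfolding moment_def by (rule integral_esd[OF A c])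
qed

lemma measurable_esd_functional:
  fixes J :: "complex measure \<Rightarrow> real"
  assumes n: "n \<ge> 1"
    and J: "\<And>\<nu> \<mu>. (\<And>i. \<nu> i \<in> circle_probs) \<Longrightarrow> \<mu> \<in> circle_probs \<Longrightarrow> circle_weak_conv \<nu> \<mu> \<Longrightarrow> (\<lambda>i. J (\<nu> i)) \<longlonglongrightarrow> J \<mu>"
  shows "(\<lambda>A. J (esd A)) \<in> borel_measurable (unitary_borel n)"
proof (rule measurable_weak_functional[where F = esd and J = J])
  fix k
  have e: "moment (esd A) k = mtrace (A ^\<^sub>m k) / of_nat n" if "A \<in> space (unitary_borel n)" for A
  proof -
    have A: "A \<in> unitary_mats n" using that by simp
    then have c: "A \<in> carrier_mat n n" by (simp add: unitary_mats_def)
    show ?thesis by (simp only: moment_esd[OF A n] eigvals_power_sum[OF c])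
  qed
  have "(\<lambda>A. mtrace (A ^\<^sub>m k) / of_nat n) \<in> borel_measurable (unitary_borel n)"
    by (rule borel_measurable_divide[OF measurable_mtrace_pow borel_measurable_const])
  then show "(\<lambda>A. moment (esd A) k) \<in> borel_measurable (unitary_borel n)"
    using measurable_cong[of "unitary_borel n" "\<lambda>A. moment (esd A) k" "\<lambda>A. mtrace (A ^\<^sub>m k) / of_nat n", OF e] by simp
next
  fix A assume "A \<in> space (unitary_borel n)"
  then show "esd A \<in> circle_probs" using esd_circle_probs[OF _ n] by simp
next
  fix \<nu> \<mu> assume "\<And>i. \<nu> i \<in> circle_probs" "\<mu> \<in> circle_probs" "circle_weak_conv \<nu> \<mu>"
  then show "(\<lambda>i. J (\<nu> i)) \<longlonglongrightarrow> J \<mu>" by (rule J)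
qed

section \<open>The Jacobi weight and the factorization of the characteristic polynomial\<close>

text \<open>
  The factor \<open>(1 - z) powr (cnj \<delta>) * (1 - cnj z) powr \<delta>\<close> of \<open>det_delta\<close>, in a form that shows that it is a nonnegative
  real. At \<open>z = 1\<close> it is \<open>0\<close>, in accordance with \<open>0 powr \<delta> = 0\<close>.
\<close>
definition jacobi_weight :: "complex \<Rightarrow> complex \<Rightarrow> real" where
  "jacobi_weight \<delta> z = (if z = 1 then 0 else exp (2 * Re (cnj \<delta> * Ln (1 - z))))"

lemma Re_one_minus_pos: "cmod w \<le> 1 \<Longrightarrow> w \<noteq> 1 \<Longrightarrow> Re (1 - w) > 0"
proof -
  assume w: "cmod w \<le> 1" "w \<noteq> 1"
  have "Re w \<le> 1" using complex_Re_le_cmod[of w] w(1) by simp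
  moreover have "Re w \<noteq> 1"
  proof
    assume r: "Re w = 1"
    have "(cmod w)\<^sup>2 \<le> 1" using w(1) by (simp add: power_le_one)
    then have "Im w = 0" using r by (simp add: cmod_power2)
    then show False using r w(2) by (simp add: complex_eq_iff)
  qed
  ultimately show ?thesis by simp
qed

lemma cnj_Ln_pos: "Re w > 0 \<Longrightarrow> cnj (Ln w) = Ln (cnj w)"
  by (rule cnj_Ln) (auto simp: complex_nonpos_Reals_iff)

lemma jacobi_weight_eq:
  assumes "cmod z = 1"
  shows "(1 - z) powr cnj \<delta> * (1 - cnj z) powr \<delta> = of_real (jacobi_weight \<delta> z)"
proof (cases "z = 1")
  case False
  then have p: "Re (1 - z) > 0" using Re_one_minus_pos[of z] assms by simp
  have nz: "1 - z \<noteq> 0" "1 - cnj z \<noteq> 0" using False by (auto simp: complex_eq_iff)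
  have "Ln (1 - cnj z) = cnj (Ln (1 - z))" using cnj_Ln_pos[OF p] by simp
  then have "(1 - z) powr cnj \<delta> * (1 - cnj z) powr \<delta> = exp (cnj \<delta> * Ln (1 - z) + cnj (cnj \<delta> * Ln (1 - z)))"
    using nz by (simp add: powr_def exp_add)
  also have "cnj \<delta> * Ln (1 - z) + cnj (cnj \<delta> * Ln (1 - z)) = of_real (2 * Re (cnj \<delta> * Ln (1 - z)))"
    using complex_add_cnj by blast
  finally show ?thesis using False unfolding jacobi_weight_def by (simp only: exp_of_real if_False)
qed (simp add: jacobi_weight_def)

lemma det_delta_eq:
  assumes "A \<in> unitary_mats n"
  shows "det_delta \<delta> A = of_real (\<Prod>\<zeta>\<in>#eigvals_mset A. jacobi_weight \<delta> \<zeta>)"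
proof -
  have "(\<Prod>\<zeta>\<in>#M. (1 - \<zeta>) powr cnj \<delta> * (1 - cnj \<zeta>) powr \<delta>) = of_real (\<Prod>\<zeta>\<in>#M. jacobi_weight \<delta> \<zeta>)"
    if "\<And>\<zeta>. \<zeta> \<in># M \<Longrightarrow> cmod \<zeta> = 1" for M
    using that by (induction M) (auto simp: jacobi_weight_eq)
  then show ?thesis unfolding det_delta_def using unitary_eigvals_norm[OF assms] by blast
qed

lemma jacobi_weight_nonneg: "jacobi_weight \<delta> z \<ge> 0" by (simp add: jacobi_weight_def)

lemma prod_mset_exp:
  fixes f :: "'a \<Rightarrow> real"
  assumes "\<And>x. x \<in># M \<Longrightarrow> f x > 0"
  shows "(\<Prod>x\<in>#M. f x) = exp (\<Sum>x\<in>#M. ln (f x))"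
  using assms by (induction M) (auto simp: exp_add)

lemma tendsto_prod_mset:
  fixes f :: "nat \<Rightarrow> 'a \<Rightarrow> real"
  assumes "\<And>x. x \<in># M \<Longrightarrow> (\<lambda>i. f i x) \<longlonglongrightarrow> g x"
  shows "(\<lambda>i. \<Prod>x\<in>#M. f i x) \<longlonglongrightarrow> (\<Prod>x\<in>#M. g x)"
  using assms
proof (induction M)
  case (add x M)
  then have "(\<lambda>i. f i x * (\<Prod>x\<in>#M. f i x)) \<longlonglongrightarrow> g x * (\<Prod>x\<in>#M. g x)"
    by (intro tendsto_mult) auto
  then show ?case by simp
qed simp

lemma integral_esd_real:
  fixes h :: "complex \<Rightarrow> real"
  assumes A: "A \<in> unitary_mats n" "n \<ge> 1" and h: "continuous_on (sphere 0 1) h"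
  shows "integral\<^sup>L (esd A) h = (\<Sum>\<zeta>\<in>#eigvals_mset A. h \<zeta>) / n"
proof -
  have c: "continuous_on (sphere 0 1) (\<lambda>z. complex_of_real (h z))" using h by (intro continuous_on_of_real)
  have "complex_of_real (integral\<^sup>L (esd A) h) = (\<Sum>\<zeta>\<in>#eigvals_mset A. complex_of_real (h \<zeta>)) / of_nat n"
    using integral_esd[OF A c] by simp
  also have "(\<Sum>\<zeta>\<in>#M. complex_of_real (h \<zeta>)) = of_real (\<Sum>\<zeta>\<in>#M. h \<zeta>)" for M
    by (induction M) auto
  finally have "complex_of_real (integral\<^sup>L (esd A) h) = of_real ((\<Sum>\<zeta>\<in>#eigvals_mset A. h \<zeta>) / n)"
    by simp
  then show ?thesis by (simp only: of_real_eq_iff)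
qed

text \<open>
  A continuous positive approximation of \<open>jacobi_weight\<close> on the circle. The shrinking factor \<open>1 - 1 / (m + 2)\<close> keeps the
  argument of the logarithm off the branch cut; the second factor forces the limit \<open>0\<close> at \<open>z = 1\<close>, also when
  \<open>Re \<delta> = 0\<close>.
\<close>
definition smooth_weight :: "complex \<Rightarrow> nat \<Rightarrow> complex \<Rightarrow> real" where
  "smooth_weight \<delta> m z = exp (2 * Re (cnj \<delta> * Ln (1 - of_real (1 - 1 / (m + 2)) * z)))
     * max (1 / (m + 1)) (min 1 ((m + 1) * cmod (1 - z)))"

lemma shrunk_pos:
  assumes "cmod z = 1"
  shows "Re (1 - of_real (1 - 1 / (real m + 2)) * z) > 0"
proof (rule Re_one_minus_pos)
  have n: "cmod (of_real (1 - 1 / (real m + 2)) * z) = 1 - 1 / (real m + 2)"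
    using assms by (simp add: norm_mult abs_of_nonneg divide_le_eq del: of_real_diff)
  then show "cmod (of_real (1 - 1 / (real m + 2)) * z) \<le> 1" by simp
  show "of_real (1 - 1 / (real m + 2)) * z \<noteq> 1"
  proof
    assume "of_real (1 - 1 / (real m + 2)) * z = 1"
    with n have "1 - 1 / (real m + 2) = 1" by simp
    then show False by simp
  qed
qed

lemma continuous_smooth_weight: "continuous_on (sphere 0 1) (smooth_weight \<delta> m)"
proof -
  have "1 - of_real (1 - 1 / (real m + 2)) * z \<notin> \<real>\<^sub>\<le>\<^sub>0" if "z \<in> sphere 0 1" for z :: complex
    using shrunk_pos[of z m] that by (auto simp: complex_nonpos_Reals_iff simp del: minus_complex.sel)
  then show ?thesis unfolding smooth_weight_def[abs_def]
    by (intro continuous_intros) auto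
qed

lemma smooth_weight_pos: "smooth_weight \<delta> m z > 0"
  unfolding smooth_weight_def by (intro mult_pos_pos) (auto simp: less_max_iff_disj)

lemma smooth_weight_tendsto:
  assumes "cmod z = 1" "Re \<delta> \<ge> 0"
  shows "(\<lambda>m. smooth_weight \<delta> m z) \<longlonglongrightarrow> jacobi_weight \<delta> z"
proof -
  have r: "(\<lambda>m. 1 - 1 / (real m + 2)) \<longlonglongrightarrow> 1" by real_asymp
  show ?thesis
  proof (cases "z = 1")
    case True
    have up: "smooth_weight \<delta> m z \<le> 1 / (real m + 1)" for m
    proof -
      have e: "1 - of_real (1 - 1 / (real m + 2)) * z = of_real (1 / (real m + 2))" using True by simp
      have "Ln (1 - of_real (1 - 1 / (real m + 2)) * z) = of_real (ln (1 / (real m + 2)))"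
        unfolding e by (rule Ln_of_real) simp
      then have "Re (cnj \<delta> * Ln (1 - of_real (1 - 1 / (real m + 2)) * z)) = Re \<delta> * ln (1 / (real m + 2))"
        by simp
      moreover have "ln (1 / (real m + 2)) \<le> 0" by (simp add: ln_div)
      ultimately have "exp (2 * Re (cnj \<delta> * Ln (1 - of_real (1 - 1 / (real m + 2)) * z))) \<le> 1"
        using assms(2) by (simp add: mult_nonneg_nonpos)
      then show ?thesis using True by (simp add: smooth_weight_def divide_right_mono)
    qed
    have "(\<lambda>m. smooth_weight \<delta> m z) \<longlonglongrightarrow> 0"
    proof (rule tendsto_sandwich[where f = "\<lambda>_. 0" and h = "\<lambda>m. 1 / (real m + 1)"])
      show "\<forall>\<^sub>F m in sequentially. 0 \<le> smooth_weight \<delta> m z"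
        using smooth_weight_pos[of \<delta> _ z] by (simp add: less_imp_le)
      show "\<forall>\<^sub>F m in sequentially. smooth_weight \<delta> m z \<le> 1 / (real m + 1)"
        using up by simp
      show "(\<lambda>m. 1 / (real m + 1)) \<longlonglongrightarrow> 0" by real_asymp
    qed simp
    then show ?thesis using True by (simp add: jacobi_weight_def)
  next
    case False
    then have p: "Re (1 - z) > 0" using Re_one_minus_pos assms by simp
    then have "1 - z \<notin> \<real>\<^sub>\<le>\<^sub>0" by (auto simp: complex_nonpos_Reals_iff simp del: minus_complex.sel)
    moreover have "(\<lambda>m. 1 - of_real (1 - 1 / (real m + 2)) * z) \<longlonglongrightarrow> 1 - of_real 1 * z"
      by (intro tendsto_intros r)
    ultimately have "(\<lambda>m. Ln (1 - of_real (1 - 1 / (real m + 2)) * z)) \<longlonglongrightarrow> Ln (1 - z)"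
      by (intro tendsto_Ln) auto
    note L = this
    have "(\<lambda>m. exp (2 * Re (cnj \<delta> * Ln (1 - of_real (1 - 1 / (real m + 2)) * z)))) \<longlonglongrightarrow> exp (2 * Re (cnj \<delta> * Ln (1 - z)))"
      by (intro tendsto_exp tendsto_mult tendsto_const tendsto_Re L)
    moreover have "(\<lambda>m. max (1 / (real m + 1)) (min 1 ((real m + 1) * cmod (1 - z)))) \<longlonglongrightarrow> 1"
    proof (rule tendsto_eventually)
      have c: "cmod (1 - z) > 0" using False by simp
      obtain m0 where m0: "1 / cmod (1 - z) < real m0" using reals_Archimedean2 by blast
      show "\<forall>\<^sub>F m in sequentially. max (1 / (real m + 1)) (min 1 ((real m + 1) * cmod (1 - z))) = 1"
        using eventually_ge_at_top[of m0]
      proof eventually_elim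
        case (elim m)
        have "1 / cmod (1 - z) < real m + 1" using m0 elim by linarith
        then have "1 < (real m + 1) * cmod (1 - z)" using c by (simp add: divide_less_eq)
        then show ?case by simp
      qed
    qed
    ultimately have "(\<lambda>m. smooth_weight \<delta> m z) \<longlonglongrightarrow> exp (2 * Re (cnj \<delta> * Ln (1 - z))) * 1"
      unfolding smooth_weight_def by (rule tendsto_mult)
    then show ?thesis using False by (simp add: jacobi_weight_def)
  qed
qed

text \<open>
  The product over the eigenvalues of a continuous positive function is the exponential of \<open>n\<close> times a weakly continuous
  functional of the empirical spectral distribution; \<open>det_delta\<close> is a limit of such products.
\<close>
lemma measurable_det_delta:
  assumes n: "n \<ge> 1" and \<delta>: "Re \<delta> \<ge> 0"
  shows "(\<lambda>A. Re (det_delta \<delta> A)) \<in> borel_measurable (unitary_borel n)"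
proof (rule borel_measurable_LIMSEQ_real)
  define h where "h m z = ln (smooth_weight \<delta> m z)" for m z
  have c: "continuous_on (sphere 0 1) (h m)" for m
    unfolding h_def using continuous_smooth_weight smooth_weight_pos
    by (intro continuous_on_ln) (auto simp: less_imp_neq[symmetric] neq_iff)
  show "(\<lambda>A. exp (n * integral\<^sup>L (esd A) (h m))) \<in> borel_measurable (unitary_borel n)" for m
  proof -
    have "(\<lambda>A. integral\<^sup>L (esd A) (h m)) \<in> borel_measurable (unitary_borel n)"
      by (rule measurable_esd_functional[where J = "\<lambda>\<nu>. integral\<^sup>L \<nu> (h m)", OF n])
         (use c in \<open>auto simp: circle_weak_conv_def\<close>)
    then show ?thesis by measurable
  qed
  fix A assume "A \<in> space (unitary_borel n)"
  then have A: "A \<in> unitary_mats n" by simp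
  have "exp (n * integral\<^sup>L (esd A) (h m)) = (\<Prod>\<zeta>\<in>#eigvals_mset A. smooth_weight \<delta> m \<zeta>)" for m
  proof -
    define S where "S = (\<Sum>\<zeta>\<in>#eigvals_mset A. h m \<zeta>)"
    have "n * integral\<^sup>L (esd A) (h m) = S"
      unfolding integral_esd_real[OF A n c] S_def[symmetric] using n by simp
    then show ?thesis
      unfolding S_def h_def using smooth_weight_pos by (subst prod_mset_exp) auto
  qed
  moreover have "(\<lambda>m. \<Prod>\<zeta>\<in>#eigvals_mset A. smooth_weight \<delta> m \<zeta>) \<longlonglongrightarrow> (\<Prod>\<zeta>\<in>#eigvals_mset A. jacobi_weight \<delta> \<zeta>)"
    using unitary_eigvals_norm[OF A] \<delta> by (intro tendsto_prod_mset smooth_weight_tendsto)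
  ultimately show "(\<lambda>m. exp (n * integral\<^sup>L (esd A) (h m))) \<longlonglongrightarrow> Re (det_delta \<delta> A)"
    by (simp add: det_delta_eq[OF A])
qed

context verblunsky
begin

text \<open>
  The reversed polynomials satisfy \<open>\<psi>\<^sub>k\<^sub>+\<^sub>1 = \<psi>\<^sub>k * (1 - step_factor k z)\<close>.
\<close>
definition step_factor :: "nat \<Rightarrow> complex \<Rightarrow> complex" where
  "step_factor k z = a k * z * szego_phi a z k / szego_psi a z k"

lemma a_le_1: "k \<le> m \<Longrightarrow> cmod (a k) \<le> 1"
  using disc[of k] circ by (cases "k = m") auto

lemma step_factor_le_1:
  assumes "k \<le> m" "cmod z \<le> 1" shows "cmod (step_factor k z) \<le> cmod z"
proof -
  have p: "szego_psi a z k \<noteq> 0" "cmod (szego_phi a z k) \<le> cmod (szego_psi a z k)"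
    using szego_phi_le_psi[of k a z] disc assms by auto
  have "cmod (a k) * cmod z * (cmod (szego_phi a z k) / cmod (szego_psi a z k)) \<le> 1 * cmod z * 1"
    using a_le_1[OF assms(1)] p by (intro mult_mono) (auto simp: divide_le_eq_1)
  then show ?thesis by (simp add: step_factor_def norm_mult norm_divide)
qed

lemma psi_step: "k \<le> m \<Longrightarrow> cmod z \<le> 1 \<Longrightarrow> szego_psi a z (Suc k) = szego_psi a z k * (1 - step_factor k z)"
  using psi_nonzero[of z k] by (simp add: step_factor_def algebra_simps)

lemma psi_prod:
  assumes "cmod z \<le> 1" shows "szego_psi a z (Suc m) = (\<Prod>k\<le>m. 1 - step_factor k z)"
proof -
  have "j \<le> Suc m \<Longrightarrow> szego_psi a z j = (\<Prod>k<j. 1 - step_factor k z)" for j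
  proof (induction j)
    case (Suc j)
    then show ?case using psi_step[of j z] assms by (simp only: prod.lessThan_Suc)
  qed simp
  from this[of "Suc m"] show ?thesis by (simp only: lessThan_Suc_atMost order_refl)
qed

lemma psi_zeros_prod: "szego_psi a z (Suc m) = (\<Prod>\<zeta>\<in>zeros. 1 - cnj \<zeta> * z)"
proof (cases "z = 0")
  case True
  have "szego_psi a 0 j = 1" for j by (induction j) auto
  then show ?thesis using True by simp
next
  case False
  have P: "szego_poly a (Suc m) = (\<Prod>\<zeta>\<in>zeros. [:- \<zeta>, 1:])"
    using complex_poly_decompose_rsquarefree[OF szego_rsquarefree] szego_poly_monic[of a "Suc m"]
    unfolding zeros_poly by (metis smult_1_left)
  have "szego_psi a z (Suc m) = poly (reversed_poly (szego_poly a (Suc m))) z"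
    by (rule poly_szego_poly[THEN conjunct2, symmetric])
  also have "\<dots> = z ^ Suc m * cnj (poly (szego_poly a (Suc m)) (1 / cnj z))"
    using szego_poly_monic[of a "Suc m"] by (simp only: poly_reversed_poly[OF False])
  also have "\<dots> = (\<Prod>\<zeta>\<in>zeros. z) * (\<Prod>\<zeta>\<in>zeros. cnj (1 / cnj z - \<zeta>))"
    unfolding P by (simp add: poly_prod card_zeros)
  also have "\<dots> = (\<Prod>\<zeta>\<in>zeros. 1 - cnj \<zeta> * z)"
    unfolding prod.distrib[symmetric] using False by (intro prod.cong) (auto simp: algebra_simps)
  finally show ?thesis .
qed

lemma continuous_szego: "continuous_on S (\<lambda>z. szego_phi a z j) \<and> continuous_on S (\<lambda>z. szego_psi a z j)"
  by (induction j) (auto intro!: continuous_intros)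

text \<open>
  Both sides are logarithms of the reversed last polynomial, once factorized over its zeros and once along the recursion. Along the
  segment from \<open>0\<close> to \<open>z\<close> all factors have positive real part, so the difference of the two sides is
  continuous with values in \<open>2 * pi * \<i> * \<int>\<close>, and it vanishes at \<open>0\<close>.
\<close>
lemma Ln_sum_identity:
  assumes z: "cmod z \<le> 1" "\<And>\<zeta>. \<zeta> \<in> zeros \<Longrightarrow> cnj \<zeta> * z \<noteq> 1"
  shows "(\<Sum>\<zeta>\<in>zeros. Ln (1 - cnj \<zeta> * z)) = (\<Sum>k\<le>m. Ln (1 - step_factor k z))"
proof -
  define zt where "zt t = of_real t * z" for t :: real
  define D where "D t = (\<Sum>\<zeta>\<in>zeros. Ln (1 - cnj \<zeta> * zt t)) - (\<Sum>k\<le>m. Ln (1 - step_factor k (zt t)))" for t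
  have zt: "cmod (zt t) \<le> 1" if "t \<in> {0..1}" for t
    using that z(1) by (auto simp: zt_def norm_mult mult_le_one)
  have nz1: "cnj \<zeta> * zt t \<noteq> 1" if "t \<in> {0..1}" "\<zeta> \<in> zeros" for t \<zeta>
  proof
    assume e: "cnj \<zeta> * zt t = 1"
    then have "cmod (cnj \<zeta> * zt t) = 1" by simp
    then have "t * cmod z = 1" using that zerosD(1)[of \<zeta>] by (simp add: norm_mult zt_def)
    moreover have "t * cmod z \<le> t * 1" using that z(1) by (intro mult_left_mono) auto
    ultimately have "t = 1" using that by simp
    then show False using e z(2)[OF that(2)] by (simp add: zt_def)
  qed
  have pos1: "Re (1 - cnj \<zeta> * zt t) > 0" if "t \<in> {0..1}" "\<zeta> \<in> zeros" for t \<zeta>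
    using nz1[OF that] zt[OF that(1)] zerosD(1)[OF that(2)] by (intro Re_one_minus_pos) (auto simp: norm_mult)
  have nz2: "1 - step_factor k (zt t) \<noteq> 0" if "t \<in> {0..1}" "k \<le> m" for t k
  proof -
    have "(\<Prod>k\<le>m. 1 - step_factor k (zt t)) \<noteq> 0"
      unfolding psi_prod[OF zt[OF that(1)], symmetric] psi_zeros_prod
      using nz1[OF that(1)] finite_zeros by (auto simp: eq_diff_eq)
    then show ?thesis using that(2) by simp
  qed
  have pos2: "Re (1 - step_factor k (zt t)) > 0" if "t \<in> {0..1}" "k \<le> m" for t k
    using nz2[OF that] step_factor_le_1[OF that(2) zt[OF that(1)]] zt[OF that(1)]
    by (intro Re_one_minus_pos) auto
  have cs: "continuous_on {0..1} (\<lambda>t. step_factor k (zt t))" if "k \<le> m" for k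
  proof -
    have "continuous_on (zt ` {0..1}) (\<lambda>z. szego_phi a z k)" "continuous_on (zt ` {0..1}) (\<lambda>z. szego_psi a z k)"
      using continuous_szego by blast+
    moreover have "continuous_on {0..1} zt" unfolding zt_def by (intro continuous_intros)
    ultimately have "continuous_on {0..1} (\<lambda>t. szego_phi a (zt t) k)" "continuous_on {0..1} (\<lambda>t. szego_psi a (zt t) k)"
      by (auto intro: continuous_on_compose2)
    then show ?thesis unfolding step_factor_def using psi_nonzero[OF zt that]
      by (intro continuous_intros) (auto simp: zt_def intro!: continuous_intros)
  qed
  have cont: "continuous_on {0..1} D"
    unfolding D_def
  proof (intro continuous_on_diff continuous_on_sum)
    show "continuous_on {0..1} (\<lambda>t. Ln (1 - cnj \<zeta> * zt t))" if "\<zeta> \<in> zeros" for \<zeta>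
    proof (rule continuous_on_Ln')
      show "continuous_on {0..1} (\<lambda>t. 1 - cnj \<zeta> * zt t)" unfolding zt_def by (intro continuous_intros)
      show "1 - cnj \<zeta> * zt t \<notin> \<real>\<^sub>\<le>\<^sub>0" if "t \<in> {0..1}" for t
        using pos1[OF that \<open>\<zeta> \<in> zeros\<close>] unfolding complex_nonpos_Reals_iff by linarith
    qed
    show "continuous_on {0..1} (\<lambda>t. Ln (1 - step_factor k (zt t)))" if "k \<in> {..m}" for k
    proof (rule continuous_on_Ln')
      show "continuous_on {0..1} (\<lambda>t. 1 - step_factor k (zt t))" using cs that by (intro continuous_intros) auto
      show "1 - step_factor k (zt t) \<notin> \<real>\<^sub>\<le>\<^sub>0" if "t \<in> {0..1}" for t
        using pos2[OF that, of k] \<open>k \<in> {..m}\<close> unfolding complex_nonpos_Reals_iff by fastforce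
    qed
  qed
  have expD: "exp (D t) = 1" if "t \<in> {0..1}" for t
  proof -
    have "exp (D t) = (\<Prod>\<zeta>\<in>zeros. exp (Ln (1 - cnj \<zeta> * zt t))) / (\<Prod>k\<le>m. exp (Ln (1 - step_factor k (zt t))))"
      unfolding D_def using finite_zeros by (simp add: exp_diff exp_sum)
    also have "\<dots> = (\<Prod>\<zeta>\<in>zeros. 1 - cnj \<zeta> * zt t) / (\<Prod>k\<le>m. 1 - step_factor k (zt t))"
      using nz1[OF that] nz2[OF that] by (intro arg_cong2[where f = "(/)"] prod.cong) auto
    also have "\<dots> = 1"
      unfolding psi_prod[OF zt[OF that], symmetric] psi_zeros_prod using nz1[OF that] finite_zeros
      by (simp add: eq_diff_eq)
    finally show ?thesis .
  qed
  have "D constant_on {0..1}"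
  proof (rule continuous_discrete_range_constant[OF _ cont])
    show "\<exists>e>0. \<forall>y. y \<in> {0..1} \<and> D y \<noteq> D x \<longrightarrow> e \<le> cmod (D y - D x)" if "x \<in> {0..1}" for x
    proof (intro exI[of _ "2 * pi"] conjI allI impI)
      fix y assume y: "y \<in> {0..1} \<and> D y \<noteq> D x"
      have "exp (D y - D x) = 1" using expD y that by (simp add: exp_diff)
      then obtain j :: int where "Re (D y - D x) = 0" "Im (D y - D x) = of_int (2 * j) * pi"
        unfolding exp_eq_1 by blast
      then have j: "D y - D x = of_int (2 * j) * pi * \<i>" by (simp add: complex_eq_iff)
      then have "j \<noteq> 0" using y by auto
      then have "1 \<le> \<bar>real_of_int j\<bar>" by linarith
      then show "2 * pi \<le> cmod (D y - D x)"
        unfolding j by (simp add: norm_mult)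
    qed simp
  qed simp
  then have "D 1 = D 0" unfolding constant_on_def by (metis atLeastAtMost_iff order_refl zero_le_one)
  also have "D 0 = 0" by (simp add: D_def zt_def step_factor_def)
  finally show ?thesis by (simp add: D_def zt_def)
qed

end

section \<open>Reflection and rotation invariance of the coefficient laws\<close>

lemma borel_measurable_cis: "cis \<in> borel_measurable borel"
  by (intro borel_measurable_continuous_onI continuous_intros)

lemma measurable_cis_circle: "cis \<in> borel \<rightarrow>\<^sub>M circle_borel"
  unfolding circle_borel_def by (rule measurable_restrict_space2) (auto simp: borel_measurable_cis)

lemma borel_measurable_cnj [measurable]: "cnj \<in> borel_measurable borel"
  by (intro borel_measurable_continuous_onI continuous_intros)

lemma lborel_cnj: "distr lborel borel cnj = lborel"
proof -
  define c where "c j = (if j = (1 :: complex) then 1 else - 1 :: real)" for j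
  have "lborel = density (distr lborel borel (\<lambda>x. 0 + (\<Sum>j\<in>Basis. (c j * (x \<bullet> j)) *\<^sub>R j))) (\<lambda>_. (\<Prod>j\<in>(Basis :: complex set). \<bar>c j\<bar>))"
    by (rule lborel_affine_euclidean) (simp add: c_def)
  moreover have "0 + (\<Sum>j\<in>Basis. (c j * (x \<bullet> j)) *\<^sub>R j) = cnj x" for x :: complex
    by (simp add: Basis_complex_def c_def complex_eq_iff inner_complex_def)
  moreover have "(\<Prod>j\<in>(Basis :: complex set). \<bar>c j\<bar>) = 1" by (simp add: c_def Basis_complex_def)
  ultimately show ?thesis by (simp add: density_1)
qed

text \<open>
  Identification of \<open>complex\<close> with \<open>real ^ 2\<close>, where orthogonal maps are known to preserve Lebesgue measure.
\<close>
definition plane :: "complex \<Rightarrow> real ^ 2" where "plane z = (\<chi> i. if i = 1 then Re z else Im z)"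

definition unplane :: "real ^ 2 \<Rightarrow> complex" where "unplane v = Complex (v $ 1) (v $ 2)"

lemma plane_inv [simp]: "unplane (plane z) = z" "plane (unplane v) = v"
proof -
  show "unplane (plane z) = z" by (simp add: plane_def unplane_def complex_eq_iff)
  show "plane (unplane v) = v" unfolding Finite_Cartesian_Product.vec_eq_iff forall_2 by (simp add: plane_def unplane_def)
qed

lemma norm_plane: "norm (plane z) = cmod z"
  by (simp add: norm_vec_def L2_set_def plane_def sum_2 cmod_def)

lemma linear_plane: "linear plane" "linear unplane"
  by (auto intro!: linearI simp: plane_def unplane_def Finite_Cartesian_Product.vec_eq_iff complex_eq_iff)

lemma plane_box: "plane -` box l u = box (unplane l) (unplane u)"
  unfolding set_eq_iff
proof (intro allI)
  fix z
  have "z \<in> plane -` box l u \<longleftrightarrow> (\<forall>i. l $ i < plane z $ i \<and> plane z $ i < u $ i)"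
    by (simp add: mem_box_cart)
  also have "\<dots> \<longleftrightarrow> (l $ 1 < Re z \<and> Re z < u $ 1) \<and> (l $ 2 < Im z \<and> Im z < u $ 2)"
    by (simp add: forall_2 plane_def)
  also have "\<dots> \<longleftrightarrow> z \<in> box (unplane l) (unplane u)"
    by (simp add: box_def Basis_complex_def unplane_def inner_complex_def)
  finally show "z \<in> plane -` box l u \<longleftrightarrow> z \<in> box (unplane l) (unplane u)" .
qed

lemma borel_plane [measurable]: "plane \<in> borel_measurable borel" "unplane \<in> borel_measurable borel"
  using linear_plane by (auto intro!: borel_measurable_continuous_onI linear_continuous_on simp: linear_conv_bounded_linear)

lemma lborel_plane: "distr lborel borel plane = lborel"
proof (rule lborel_eqI[symmetric])
  fix l u :: "real ^ 2" assume le: "\<And>b. b \<in> Basis \<Longrightarrow> l \<bullet> b \<le> u \<bullet> b"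
  have l1: "l $ 1 \<le> u $ 1" "l $ 2 \<le> u $ 2"
    using le[of "axis 1 1"] le[of "axis 2 1"] by (auto simp: cart_eq_inner_axis)
  have B: "(Basis :: (real ^ 2) set) = {axis 1 1, axis 2 1}"
    by (auto simp: Basis_vec_def exhaust_2) (metis exhaust_2)
  have ne: "axis 1 1 \<noteq> (axis 2 1 :: real ^ 2)" by (simp add: axis_eq_axis)
  have "emeasure (distr lborel borel plane) (box l u) = emeasure lborel (box (unplane l) (unplane u))"
    by (subst emeasure_distr) (auto simp: plane_box)
  also have "\<dots> = (\<Prod>b\<in>Basis. (unplane u - unplane l) \<bullet> b)"
    using l1 by (subst emeasure_lborel_box_eq) (auto simp: Basis_complex_def unplane_def inner_complex_def)
  also have "\<dots> = (u $ 1 - l $ 1) * (u $ 2 - l $ 2)"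
    by (simp add: Basis_complex_def unplane_def inner_complex_def)
  also have "(u $ 1 - l $ 1) * (u $ 2 - l $ 2) = (\<Prod>b\<in>Basis. (u - l) \<bullet> b)"
    unfolding B using ne by (simp add: inner_axis)
  finally show "emeasure (distr lborel borel plane) (box l u) = ennreal (\<Prod>b\<in>Basis. (u - l) \<bullet> b)" .
qed simp

lemma lborel_rotation:
  assumes "cmod c = 1" shows "distr lborel borel (\<lambda>z. c * z) = (lborel :: complex measure)"
proof (rule lborel_eqI[symmetric])
  fix l u :: complex assume le: "\<And>b. b \<in> Basis \<Longrightarrow> l \<bullet> b \<le> u \<bullet> b"
  have c0: "c \<noteq> 0" using assms by auto
  define f where "f v = plane (unplane v / c)" for v
  have lin: "linear f"
    unfolding f_def
  proof (rule linearI)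
    fix v w :: "real ^ 2" and r :: real
    show "plane (unplane (v + w) / c) = plane (unplane v / c) + plane (unplane w / c)"
      by (simp only: linear_add[OF linear_plane(2)] linear_add[OF linear_plane(1)] add_divide_distrib)
    have "unplane (r *\<^sub>R v) / c = r *\<^sub>R (unplane v / c)"
      unfolding linear_scale[OF linear_plane(2)] unfolding scaleR_conv_of_real by simp
    then show "plane (unplane (r *\<^sub>R v) / c) = r *\<^sub>R plane (unplane v / c)"
      by (simp only: linear_scale[OF linear_plane(1)])
  qed
  have orth: "orthogonal_transformation f"
    unfolding orthogonal_transformation using lin assms
    by (simp add: f_def norm_plane norm_divide) (metis norm_plane plane_inv(2))
  let ?B = "box (plane l) (plane u)"
  have L: "emeasure lborel W = emeasure lborel (unplane -` W)" if "W \<in> sets borel" for W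
  proof -
    have "emeasure lborel (unplane -` W) = emeasure (distr lborel borel plane) (unplane -` W)"
      by (simp add: lborel_plane)
    also have "\<dots> = emeasure lborel (plane -` unplane -` W)"
      using that measurable_sets_borel[OF borel_plane(2) that] by (subst emeasure_distr) auto
    also have "plane -` unplane -` W = W" by auto
    finally show ?thesis by simp
  qed
  have m: "(\<lambda>z. c * z) -` box l u \<in> sets borel"
    by (intro borel_open open_vimage continuous_intros) auto
  have im: "unplane -` (\<lambda>z. c * z) -` box l u = f ` ?B"
  proof
    show "unplane -` (\<lambda>z. c * z) -` box l u \<subseteq> f ` ?B"
    proof
      fix v assume v: "v \<in> unplane -` (\<lambda>z. c * z) -` box l u"
      have e: "f (plane (c * unplane v)) = v" using c0 by (simp add: f_def)
      have "c * unplane v \<in> plane -` ?B" unfolding plane_box using v by simp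
      then have "plane (c * unplane v) \<in> ?B" by simp
      then show "v \<in> f ` ?B" using e by (metis imageI)
    qed
    show "f ` ?B \<subseteq> unplane -` (\<lambda>z. c * z) -` box l u"
    proof
      fix v assume "v \<in> f ` ?B"
      then obtain w where w: "w \<in> ?B" "v = f w" by blast
      have "plane (unplane w) \<in> ?B" using w(1) by simp
      then have "unplane w \<in> plane -` ?B" by (rule vimageI2)
      then have "unplane w \<in> box l u" unfolding plane_box by simp
      then show "v \<in> unplane -` (\<lambda>z. c * z) -` box l u" using w c0 by (simp add: f_def)
    qed
  qed
  have pb: "unplane -` box l u = ?B"
  proof (rule Set.set_eqI)
    fix v
    have "v \<in> ?B \<longleftrightarrow> unplane v \<in> plane -` ?B" by simp
    also have "\<dots> \<longleftrightarrow> v \<in> unplane -` box l u" unfolding plane_box by simp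
    finally show "v \<in> unplane -` box l u \<longleftrightarrow> v \<in> ?B" by blast
  qed
  have B: "?B \<in> lmeasurable" by simp
  have fB: "f ` ?B \<in> lmeasurable" "measure lebesgue (f ` ?B) = measure lebesgue ?B"
    using measurable_orthogonal_image[OF orth B] measure_orthogonal_image[OF orth B] by auto
  have open_fB: "f ` ?B \<in> sets borel" unfolding im[symmetric]
    using measurable_sets_borel[OF borel_plane(2) m] by simp
  have "emeasure (distr lborel borel (\<lambda>z. c * z)) (box l u) = emeasure lborel ((\<lambda>z. c * z) -` box l u)"
    by (subst emeasure_distr) auto
  also have "\<dots> = emeasure lborel (f ` ?B)" unfolding L[OF m] im ..
  also have "\<dots> = emeasure lebesgue (f ` ?B)" using open_fB by simp
  also have "\<dots> = measure lebesgue (f ` ?B)" by (rule emeasure_eq_measure2[OF fB(1)])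
  also have "\<dots> = emeasure lebesgue ?B" unfolding fB(2) by (rule emeasure_eq_measure2[OF B, symmetric])
  also have "\<dots> = emeasure lborel ?B" by simp
  also have "\<dots> = emeasure lborel (box l u)"
    using L[of "box l u"] unfolding pb by simp
  also have "\<dots> = (\<Prod>b\<in>Basis. (u - l) \<bullet> b)"
    using le by (subst emeasure_lborel_box_eq) (auto simp: Basis_complex_def)
  finally show "emeasure (distr lborel borel (\<lambda>z. c * z)) (box l u) = ennreal (\<Prod>b\<in>Basis. (u - l) \<bullet> b)" .
qed simp

lemma nn_integral_reflect_rotate:
  assumes "cmod c = 1" and [measurable]: "f \<in> borel_measurable borel"
  shows "(\<integral>\<^sup>+z. f (cnj z * c) \<partial>lborel) = (\<integral>\<^sup>+z. f z \<partial>lborel)"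
proof -
  have "(\<integral>\<^sup>+z. f z \<partial>lborel) = (\<integral>\<^sup>+z. f z \<partial>distr lborel borel (\<lambda>z. c * z))"
    by (simp add: lborel_rotation assms)
  also have "\<dots> = (\<integral>\<^sup>+z. f (c * z) \<partial>lborel)"
    by (subst nn_integral_distr) auto
  also have "\<dots> = (\<integral>\<^sup>+z. f (c * z) \<partial>distr lborel borel cnj)"
    by (simp add: lborel_cnj)
  also have "\<dots> = (\<integral>\<^sup>+z. f (c * cnj z) \<partial>lborel)"
    by (subst nn_integral_distr) auto
  finally show ?thesis by (simp add: mult.commute)
qed

lemma nn_integral_haar:
  assumes "f \<in> borel_measurable circle_borel"
  shows "(\<integral>\<^sup>+z. f z \<partial>circle_haar) = (\<integral>\<^sup>+t\<in>{0..<2*pi}. f (cis t) \<partial>lborel) / ennreal (2 * pi)"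
proof -
  have cm'': "cis \<in> uniform_measure lborel {0..<2*pi} \<rightarrow>\<^sub>M circle_borel"
    by (simp add: measurable_cis_circle cong: measurable_cong_sets)
  have m: "(\<lambda>t. f (cis t)) \<in> borel_measurable lborel"
    using measurable_compose[OF measurable_cis_circle assms] by simp
  show ?thesis
    unfolding circle_haar_def using assms m
    by (subst nn_integral_distr[OF cm'']) (simp_all add: nn_integral_uniform_measure)
qed

lemma nn_integral_periodic_shift:
  fixes f :: "real \<Rightarrow> ennreal"
  assumes [measurable]: "f \<in> borel_measurable borel" and per: "\<And>t. f (t + 2 * pi) = f t" and c: "0 \<le> c" "c < 2 * pi"
  shows "(\<integral>\<^sup>+t\<in>{0..<2*pi}. f (t + c) \<partial>lborel) = (\<integral>\<^sup>+t\<in>{0..<2*pi}. f t \<partial>lborel)"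
proof -
  have tr: "(\<integral>\<^sup>+t. g (t + a) \<partial>lborel) = (\<integral>\<^sup>+t. g t \<partial>lborel)" if [measurable]: "g \<in> borel_measurable borel" for g :: "real \<Rightarrow> ennreal" and a
  proof -
    have "(\<integral>\<^sup>+t. g (a + t) \<partial>lborel) = (\<integral>\<^sup>+t. g t \<partial>lborel)"
      using nn_integral_distr[of "(+) a" lborel borel g] lborel_distr_plus[of a] by simp
    then show ?thesis by (simp add: add.commute)
  qed
  have "(\<integral>\<^sup>+t\<in>{0..<2*pi}. f (t + c) \<partial>lborel) = (\<integral>\<^sup>+t\<in>{c..<2*pi+c}. f t \<partial>lborel)"
    by (subst tr[of "\<lambda>t. f t * indicator {c..<2*pi+c} t" c, symmetric]) (auto intro!: nn_integral_cong simp: indicator_def)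
  also have "\<dots> = (\<integral>\<^sup>+t. f t * indicator {c..<2*pi} t + f t * indicator {2*pi..<2*pi+c} t \<partial>lborel)"
    using c by (intro nn_integral_cong) (auto simp: indicator_def)
  also have "\<dots> = (\<integral>\<^sup>+t\<in>{c..<2*pi}. f t \<partial>lborel) + (\<integral>\<^sup>+t\<in>{2*pi..<2*pi+c}. f t \<partial>lborel)"
    by (rule nn_integral_add) auto
  also have "(\<integral>\<^sup>+t\<in>{2*pi..<2*pi+c}. f t \<partial>lborel) = (\<integral>\<^sup>+t\<in>{0..<c}. f t \<partial>lborel)"
    by (subst tr[of "\<lambda>t. f t * indicator {2*pi..<2*pi+c} t" "2 * pi", symmetric]) (auto intro!: nn_integral_cong simp: indicator_def per)
  also have "(\<integral>\<^sup>+t\<in>{c..<2*pi}. f t \<partial>lborel) + (\<integral>\<^sup>+t\<in>{0..<c}. f t \<partial>lborel)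
      = (\<integral>\<^sup>+t. f t * indicator {c..<2*pi} t + f t * indicator {0..<c} t \<partial>lborel)"
    by (rule nn_integral_add[symmetric]) auto
  also have "\<dots> = (\<integral>\<^sup>+t\<in>{0..<2*pi}. f t \<partial>lborel)"
    using c by (intro nn_integral_cong) (auto simp: indicator_def)
  finally show ?thesis .
qed

lemma nn_integral_periodic_reflect:
  fixes f :: "real \<Rightarrow> ennreal"
  assumes [measurable]: "f \<in> borel_measurable borel" and per: "\<And>t. f (t + 2 * pi) = f t"
  shows "(\<integral>\<^sup>+t\<in>{0..<2*pi}. f (- t) \<partial>lborel) = (\<integral>\<^sup>+t\<in>{0..<2*pi}. f t \<partial>lborel)"
proof -
  have "(\<integral>\<^sup>+t\<in>{0..<2*pi}. f (- t) \<partial>lborel) = (\<integral>\<^sup>+t. (\<lambda>t. f t * indicator {0<..2*pi} t) (2 * pi + (- 1) * t) \<partial>lborel)"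
  proof (intro nn_integral_cong)
    fix t
    show "f (- t) * indicator {0..<2 * pi} t = f (2 * pi + - 1 * t) * indicator {0<..2 * pi} (2 * pi + - 1 * t)"
      using per[of "- t"] by (auto simp: indicator_def add.commute)
  qed
  also have "\<dots> = (\<integral>\<^sup>+t. f t * indicator {0<..2*pi} t \<partial>lborel)"
    using nn_integral_real_affine[of "\<lambda>t. f t * indicator {0<..2*pi} t" "- 1" "2 * pi"] by simp
  also have "\<dots> = (\<integral>\<^sup>+t\<in>{0..<2*pi}. f t \<partial>lborel)"
  proof (rule nn_integral_cong_AE)
    have "AE t in lborel. t \<noteq> 0" "AE t in lborel. t \<noteq> (2 * pi)" by (rule AE_lborel_singleton)+
    then show "AE t in lborel. f t * indicator {0<..2*pi} t = f t * indicator {0..<2*pi} t"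
      by eventually_elim (auto simp: indicator_def)
  qed
  finally show ?thesis .
qed

lemma sets_disc_law: "sets (disc_law s) = sets (restrict_space borel (if s = 1 then sphere 0 1 else ball 0 1))"
  by (simp add: disc_law_def circle_haar_def circle_borel_def sets_restrict_space)

lemma space_disc_law: "space (disc_law s) = (if s = 1 then sphere 0 1 else ball 0 1)"
  by (simp add: disc_law_def circle_haar_def space_restrict_space circle_borel_def)

lemma measurable_disc_law_id: "(\<lambda>z. z) \<in> disc_law s \<rightarrow>\<^sub>M borel"
  unfolding measurable_cong_sets[OF sets_disc_law refl]
  by (rule measurable_restrict_space1) simp

lemma measurable_into_disc_law:
  assumes "f \<in> N \<rightarrow>\<^sub>M borel" "\<And>x. x \<in> space N \<Longrightarrow> f x \<in> space (disc_law s)"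
  shows "f \<in> N \<rightarrow>\<^sub>M disc_law s"
  unfolding measurable_cong_sets[OF refl sets_disc_law]
  using assms by (intro measurable_restrict_space2) (auto simp: space_disc_law)

lemma nn_integral_disc:
  assumes "s \<noteq> 1" "f \<in> borel_measurable (disc_law s)"
  shows "(\<integral>\<^sup>+z. f z \<partial>disc_law s) = (\<integral>\<^sup>+z. ennreal ((s - 1) / (2 * pi) * (1 - (cmod z)\<^sup>2) powr ((s - 3) / 2)) * f z * indicator (ball 0 1) z \<partial>lborel)"
proof -
  have f: "f \<in> borel_measurable (restrict_space lborel (ball 0 1))"
    using assms(2) unfolding measurable_cong_sets[OF sets_disc_law refl] using assms(1)
    by (simp add: measurable_cong_sets[OF sets_restrict_space_cong[OF sets_lborel] refl])
  have w: "(\<lambda>z. ennreal ((s - 1) / (2 * pi) * (1 - (cmod z)\<^sup>2) powr ((s - 3) / 2))) \<in> borel_measurable (restrict_space lborel (ball 0 1))"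
    by (rule measurable_restrict_space1) simp
  have e: "disc_law s = density (restrict_space lborel (ball 0 1))
       (\<lambda>z. ennreal ((s - 1) / (2 * pi) * (1 - (cmod z)\<^sup>2) powr ((s - 3) / 2)))"
    using assms(1) by (simp add: disc_law_def)
  show ?thesis
    unfolding e nn_integral_density[OF w f] by (rule nn_integral_restrict_space) simp
qed

text \<open>
  Both the normalized length on the circle and the radial densities on the disc are invariant under rotations and under
  conjugation.
\<close>
lemma disc_law_invariant:
  assumes c: "cmod c = 1" and f: "f \<in> borel_measurable (disc_law s)"
  shows "(\<integral>\<^sup>+z. f (cnj z * c) \<partial>disc_law s) = (\<integral>\<^sup>+z. f z \<partial>disc_law s)"
proof -
  have rm: "(\<lambda>z. cnj z * c) \<in> disc_law s \<rightarrow>\<^sub>M disc_law s"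
  proof (rule measurable_into_disc_law)
    have "(\<lambda>z. cnj z * c) \<in> borel \<rightarrow>\<^sub>M borel" by (intro borel_measurable_continuous_onI continuous_intros)
    from measurable_compose[OF measurable_disc_law_id this] show "(\<lambda>z. cnj z * c) \<in> disc_law s \<rightarrow>\<^sub>M borel" .
  qed (auto simp: space_disc_law norm_mult c split: if_splits)
  note fr = measurable_compose[OF rm f]
  show ?thesis
  proof (cases "s = 1")
    case True
    have f': "f \<in> borel_measurable circle_borel" "(\<lambda>z. f (cnj z * c)) \<in> borel_measurable circle_borel"
      using f fr True by (simp_all add: measurable_cong_sets[OF sets_disc_law refl] circle_borel_def)
    obtain p where p: "0 \<le> p" "p < 2 * pi" "c = cis p"
      using Arg2pi[of c] c that[of "Arg2pi c"] unfolding is_Arg_def cis_conv_exp by simp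
    have m [measurable]: "(\<lambda>t. f (cis t)) \<in> borel_measurable borel" by (rule measurable_compose[OF measurable_cis_circle f'(1)])
    have per: "f (cis (t + 2 * pi)) = f (cis t)" for t by (simp add: cis_mult[symmetric])
    have "(\<integral>\<^sup>+t\<in>{0..<2*pi}. f (cnj (cis t) * c) \<partial>lborel) = (\<integral>\<^sup>+t\<in>{0..<2*pi}. (\<lambda>t. f (cis (t + p))) (- t) \<partial>lborel)"
      by (simp add: p(3) cis_cnj cis_mult)
    also have "\<dots> = (\<integral>\<^sup>+t\<in>{0..<2*pi}. f (cis (t + p)) \<partial>lborel)"
      using per[of "_ + p"] by (intro nn_integral_periodic_reflect) (auto simp: add_ac)
    also have "\<dots> = (\<integral>\<^sup>+t\<in>{0..<2*pi}. f (cis t) \<partial>lborel)"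
      by (rule nn_integral_periodic_shift[OF m per p(1,2)])
    finally show ?thesis using True nn_integral_haar[OF f'(1)] nn_integral_haar[OF f'(2)] by (simp add: disc_law_def)
  next
    case False
    define F where "F z = ennreal ((s - 1) / (2 * pi) * (1 - (cmod z)\<^sup>2) powr ((s - 3) / 2)) * f z * indicator (ball 0 1) z" for z
    have "f \<in> borel_measurable (restrict_space borel (ball 0 1))"
      using f False by (simp add: measurable_cong_sets[OF sets_disc_law refl])
    then have "(\<lambda>z. f z * indicator (ball 0 1) z) \<in> borel_measurable borel"
      by (subst (asm) borel_measurable_restrict_space_iff_ennreal) auto
    note fi = this
    have "(\<lambda>z. ennreal ((s - 1) / (2 * pi) * (1 - (cmod z)\<^sup>2) powr ((s - 3) / 2))) \<in> borel_measurable (borel :: complex measure)"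
      by measurable
    from borel_measurable_times_ennreal[OF this fi] have "F \<in> borel_measurable borel" unfolding F_def by (simp add: mult.assoc)
    from nn_integral_reflect_rotate[OF c this] show ?thesis
      unfolding nn_integral_disc[OF False f] nn_integral_disc[OF False fr] F_def
      by (simp add: norm_mult c indicator_def)
  qed
qed

lemma sigma_finite_disc_law: "sigma_finite_measure (disc_law s)"
proof (cases "s = 1")
  case True
  have "prob_space (uniform_measure lborel {0..<2 * pi})"
    by (rule prob_space_uniform_measure) auto
  moreover have "cis \<in> uniform_measure lborel {0..<2*pi} \<rightarrow>\<^sub>M circle_borel"
    by (simp add: measurable_cis_circle cong: measurable_cong_sets)
  ultimately have "prob_space circle_haar" unfolding circle_haar_def by (rule prob_space.prob_space_distr)
  then interpret prob_space "disc_law s" using True by (simp add: disc_law_def)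
  show ?thesis by unfold_locales
next
  case False
  interpret R: sigma_finite_measure "restrict_space lborel (ball 0 1 :: complex set)"
    by (rule sigma_finite_measure_restrict_space) (auto intro: sigma_finite_lborel)
  have "(\<lambda>z. ennreal ((s - 1) / (2 * pi) * (1 - (cmod z)\<^sup>2) powr ((s - 3) / 2))) \<in> borel_measurable (restrict_space lborel (ball 0 1))"
    by (rule measurable_restrict_space1) simp
  from R.sigma_finite_iff_density_finite[OF this]
  have "sigma_finite_measure (density (restrict_space lborel (ball 0 1))
      (\<lambda>z. ennreal ((s - 1) / (2 * pi) * (1 - (cmod z)\<^sup>2) powr ((s - 3) / 2))))" by simp
  then show ?thesis unfolding disc_law_def if_not_P[OF False] .
qed

section \<open>Independence of the deformed coefficients\<close>

text \<open>
  The deformed Verblunsky coefficients: \<open>a k\<close> reflected and rotated by the phase of the previous polynomial at \<open>1\<close>.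
\<close>
definition deformed :: "(nat \<Rightarrow> complex) \<Rightarrow> nat \<Rightarrow> complex" where
  "deformed a k = cnj (a k) * (cnj (szego_phi a 1 k) / szego_phi a 1 k)"

lemma psi_at_1: "szego_psi a 1 j = cnj (szego_phi a 1 j)"
  by (induction j) auto

lemma szego_cong:
  assumes "\<And>l. l < j \<Longrightarrow> a l = b l"
  shows "szego_phi a z j = szego_phi b z j \<and> szego_psi a z j = szego_psi b z j"
  using assms by (induction j) auto

lemma deformed_cong: "(\<And>l. l \<le> k \<Longrightarrow> a l = b l) \<Longrightarrow> deformed a k = deformed b k"
  using szego_cong[of k a b 1] by (simp add: deformed_def)

context verblunsky
begin

lemma phi_1_nonzero: "j \<le> m \<Longrightarrow> szego_phi a 1 j \<noteq> 0"
  using psi_nonzero[of 1 j] psi_at_1[of a j] by auto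

lemma norm_deformed: "j \<le> m \<Longrightarrow> cmod (deformed a j) = cmod (a j)"
  using phi_1_nonzero[of j] by (simp add: deformed_def norm_mult norm_divide)

lemma step_factor_1: "step_factor k 1 = cnj (deformed a k)"
  by (simp add: step_factor_def deformed_def psi_at_1)

text \<open>
  At \<open>z = 1\<close> the \<open>k\<close>-th factor of the recursion is \<open>1 - cnj (deformed a k)\<close>, so the logarithmic identity becomes, after conjugation,
  \<open>\<Sum> Ln (1 - \<zeta>) = \<Sum> Ln (1 - deformed a k)\<close>. If \<open>1\<close> is an eigenvalue, some deformed coefficient is \<open>1\<close> and both products
  vanish.
\<close>
lemma jacobi_weight_product:
  "(\<Prod>\<zeta>\<in>zeros. jacobi_weight \<delta> \<zeta>) = (\<Prod>k\<le>m. jacobi_weight \<delta> (deformed a k))"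
proof (cases "1 \<in> zeros")
  case True
  have "(\<Prod>k\<le>m. 1 - step_factor k 1) = (\<Prod>\<zeta>\<in>zeros. 1 - cnj \<zeta> * 1)"
    using psi_prod[of 1] psi_zeros_prod[of 1] by simp
  also have "\<dots> = 0" using True finite_zeros by (auto intro!: bexI[of _ 1])
  finally obtain k where "k \<le> m" "step_factor k 1 = 1" by auto
  then have "k \<le> m" "deformed a k = 1" unfolding step_factor_1 using complex_cnj_cancel_iff[of "deformed a k" 1] by auto
  then have "(\<Prod>k\<le>m. jacobi_weight \<delta> (deformed a k)) = 0" by (auto simp: jacobi_weight_def intro!: bexI[of _ k])
  moreover have "(\<Prod>\<zeta>\<in>zeros. jacobi_weight \<delta> \<zeta>) = 0"
    using True finite_zeros by (auto simp: jacobi_weight_def intro!: bexI[of _ 1])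
  ultimately show ?thesis by simp
next
  case False
  then have ne: "cnj \<zeta> * 1 \<noteq> 1" if "\<zeta> \<in> zeros" for \<zeta>
    using that complex_cnj_cancel_iff[of \<zeta> 1] by auto
  have "(\<Prod>k\<le>m. 1 - step_factor k 1) = (\<Prod>\<zeta>\<in>zeros. 1 - cnj \<zeta> * 1)"
    using psi_prod[of 1] psi_zeros_prod[of 1] by simp
  then have "(\<Prod>k\<le>m. 1 - step_factor k 1) \<noteq> 0" using ne finite_zeros by auto
  then have nk: "deformed a k \<noteq> 1" if "k \<le> m" for k using that unfolding step_factor_1 by auto
  have L1: "Ln (1 - cnj \<zeta> * 1) = cnj (Ln (1 - \<zeta>))" if "\<zeta> \<in> zeros" for \<zeta>
  proof -
    have "Re (1 - \<zeta>) > 0" using zerosD(1)[OF that] that False by (intro Re_one_minus_pos) auto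
    from cnj_Ln_pos[OF this] show ?thesis by simp
  qed
  have L2: "Ln (1 - step_factor k 1) = cnj (Ln (1 - deformed a k))" if "k \<le> m" for k
  proof -
    have "Re (1 - deformed a k) > 0" using nk[OF that] norm_deformed[OF that] a_le_1[OF that] by (intro Re_one_minus_pos) auto
    from cnj_Ln_pos[OF this] show ?thesis by (simp add: step_factor_1)
  qed
  have "cnj (\<Sum>\<zeta>\<in>zeros. Ln (1 - \<zeta>)) = (\<Sum>\<zeta>\<in>zeros. Ln (1 - cnj \<zeta> * 1))"
    unfolding cnj_sum using L1 by (intro sum.cong) auto
  also have "\<dots> = (\<Sum>k\<le>m. Ln (1 - step_factor k 1))"
    using ne by (intro Ln_sum_identity) auto
  also have "\<dots> = cnj (\<Sum>k\<le>m. Ln (1 - deformed a k))"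
    unfolding cnj_sum using L2 by (intro sum.cong) auto
  finally have S: "(\<Sum>\<zeta>\<in>zeros. Ln (1 - \<zeta>)) = (\<Sum>k\<le>m. Ln (1 - deformed a k))"
    using complex_cnj_cancel_iff by blast
  have "(\<Prod>\<zeta>\<in>zeros. jacobi_weight \<delta> \<zeta>) = (\<Prod>\<zeta>\<in>zeros. exp (2 * Re (cnj \<delta> * Ln (1 - \<zeta>))))"
    using False by (intro prod.cong) (auto simp: jacobi_weight_def)
  also have "\<dots> = exp (2 * Re (cnj \<delta> * (\<Sum>\<zeta>\<in>zeros. Ln (1 - \<zeta>))))"
    using finite_zeros by (simp only: exp_sum[symmetric] sum_distrib_left Re_sum)
  also have "\<dots> = (\<Prod>k\<le>m. exp (2 * Re (cnj \<delta> * Ln (1 - deformed a k))))"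
    unfolding S by (simp only: exp_sum[symmetric] sum_distrib_left Re_sum finite_atMost)
  also have "\<dots> = (\<Prod>k\<le>m. jacobi_weight \<delta> (deformed a k))"
    using nk by (intro prod.cong) (auto simp: jacobi_weight_def)
  finally show ?thesis .
qed

end

locale verblunsky_law =
  fixes m :: nat and \<beta> :: real
  assumes beta_pos: "\<beta> > 0"
begin

text \<open>
  The law of the \<open>k\<close>-th coefficient of the ensemble of size \<open>m + 1\<close> with \<open>\<delta> = 0\<close>.
\<close>
definition coeff_law :: "nat \<Rightarrow> complex measure" where
  "coeff_law k = disc_law (\<beta> * (real (Suc m) - real k - 1) + 1)"

lemma space_coeff_law: "k < m \<Longrightarrow> space (coeff_law k) = ball 0 1" "space (coeff_law m) = sphere 0 1"
  using beta_pos by (auto simp: coeff_law_def space_disc_law)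

lemma verblunsky_space:
  assumes "a \<in> space (Pi\<^sub>M {..<Suc m} coeff_law)" shows "verblunsky m a"
proof
  have "a k \<in> space (coeff_law k)" if "k < Suc m" for k
    using assms that by (auto simp: space_PiM PiE_def Pi_def)
  then show "k < m \<Longrightarrow> cmod (a k) < 1" "cmod (a m) = 1" for k
    using space_coeff_law by (fastforce simp: less_Suc_eq)+
qed

sublocale L: product_sigma_finite coeff_law
  unfolding product_sigma_finite_def coeff_law_def by (intro allI sigma_finite_disc_law)

lemma measurable_coord:
  assumes "k \<in> I" shows "(\<lambda>a. a k) \<in> borel_measurable (Pi\<^sub>M I coeff_law)"
proof -
  have i: "(\<lambda>z. z) \<in> coeff_law k \<rightarrow>\<^sub>M borel" unfolding coeff_law_def by (rule measurable_disc_law_id)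
  show ?thesis
    by (rule measurable_compose[of "\<lambda>a. a k" "Pi\<^sub>M I coeff_law" "coeff_law k" "\<lambda>z. z" borel, OF measurable_component_singleton[OF assms] i])
qed

lemma measurable_szego:
  assumes "\<And>l. l < j \<Longrightarrow> l \<in> I"
  shows "(\<lambda>a. szego_phi a z j) \<in> borel_measurable (Pi\<^sub>M I coeff_law) \<and> (\<lambda>a. szego_psi a z j) \<in> borel_measurable (Pi\<^sub>M I coeff_law)"
  using assms
proof (induction j)
  case (Suc j)
  then have [measurable]: "(\<lambda>a. szego_phi a z j) \<in> borel_measurable (Pi\<^sub>M I coeff_law)"
      "(\<lambda>a. szego_psi a z j) \<in> borel_measurable (Pi\<^sub>M I coeff_law)" by auto
  have [measurable]: "(\<lambda>a. a j) \<in> borel_measurable (Pi\<^sub>M I coeff_law)" using Suc.prems measurable_coord by blast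
  show ?case by simp
qed simp

lemma measurable_deformed:
  assumes "{..k} \<subseteq> I"
  shows "(\<lambda>a. deformed a k) \<in> borel_measurable (Pi\<^sub>M I coeff_law)"
proof -
  have [measurable]: "(\<lambda>a. szego_phi a 1 k) \<in> borel_measurable (Pi\<^sub>M I coeff_law)" using assms by (intro measurable_szego[THEN conjunct1]) auto
  have [measurable]: "(\<lambda>a. a k) \<in> borel_measurable (Pi\<^sub>M I coeff_law)" using assms measurable_coord by blast
  show ?thesis unfolding deformed_def by simp
qed

lemma deformed_space:
  assumes "j \<le> Suc m" "a \<in> space (Pi\<^sub>M {..<j} coeff_law)" "k < j"
  shows "deformed a k \<in> space (coeff_law k)" and "szego_phi a 1 k \<noteq> 0"
proof -
  have ak: "a l \<in> space (coeff_law l)" if "l < j" for l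
    using assms(2) that by (auto simp: space_PiM PiE_def Pi_def)
  have "cmod (a l) < 1" if "l < k" for l
    using ak[of l] that assms space_coeff_law(1)[of l] by auto
  then have "szego_psi a 1 k \<noteq> 0" using szego_phi_le_psi[of k a 1] by simp
  then show nz: "szego_phi a 1 k \<noteq> 0" by (simp add: psi_at_1)
  then have "cmod (deformed a k) = cmod (a k)" by (simp add: deformed_def norm_mult norm_divide)
  then show "deformed a k \<in> space (coeff_law k)"
    using ak[OF assms(3)] by (auto simp: coeff_law_def space_disc_law split: if_splits)
qed

lemma measurable_deformed_PiM:
  assumes "j \<le> Suc m"
  shows "(\<lambda>a. \<lambda>k\<in>{..<j}. deformed a k) \<in> Pi\<^sub>M {..<j} coeff_law \<rightarrow>\<^sub>M Pi\<^sub>M {..<j} coeff_law"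
proof (rule measurable_restrict)
  fix k assume k: "k \<in> {..<j}"
  show "(\<lambda>a. deformed a k) \<in> Pi\<^sub>M {..<j} coeff_law \<rightarrow>\<^sub>M coeff_law k"
    unfolding coeff_law_def[of k]
  proof (rule measurable_into_disc_law)
    have "{..k} \<subseteq> {..<j}" using k by auto
    then show "(\<lambda>a. deformed a k) \<in> borel_measurable (Pi\<^sub>M {..<j} coeff_law)" by (rule measurable_deformed)
    show "deformed a k \<in> space (disc_law (\<beta> * (real (Suc m) - real k - 1) + 1))" if "a \<in> space (Pi\<^sub>M {..<j} coeff_law)" for a
      using deformed_space(1)[OF assms that] k by (simp add: coeff_law_def)
  qed
qed

text \<open>
  The map from coefficients to deformed coefficients is triangular: with \<open>a 0, \<dots>, a (j - 1)\<close> fixed, \<open>deformed a j\<close> is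
  \<open>cnj (a j)\<close> times a unimodular constant. Integrating out one coordinate after the other, starting with the last, shows that it preserves
  the product measure.
\<close>
lemma nn_integral_deformed:
  assumes "j \<le> Suc m" "H \<in> borel_measurable (Pi\<^sub>M {..<j} coeff_law)"
  shows "(\<integral>\<^sup>+a. H (\<lambda>k\<in>{..<j}. deformed a k) \<partial>Pi\<^sub>M {..<j} coeff_law) = (\<integral>\<^sup>+a. H a \<partial>Pi\<^sub>M {..<j} coeff_law)"
  using assms
proof (induction j arbitrary: H)
  case 0
  then show ?case by (simp add: PiM_empty nn_integral_count_space_finite restrict_def)
next
  case (Suc j)
  have I: "{..<Suc j} = insert j {..<j}" by auto
  note HM = Suc.prems(2)
  have m1: "(\<lambda>a. H (\<lambda>k\<in>{..<Suc j}. deformed a k)) \<in> borel_measurable (Pi\<^sub>M {..<Suc j} coeff_law)"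
    using measurable_compose[OF measurable_deformed_PiM[OF Suc.prems(1)] HM] .
  have upd: "(\<lambda>p. (fst p)(j := snd p)) \<in> Pi\<^sub>M {..<j} coeff_law \<Otimes>\<^sub>M coeff_law j \<rightarrow>\<^sub>M Pi\<^sub>M {..<Suc j} coeff_law"
    unfolding I by measurable
  have HP: "(\<lambda>p. H ((fst p)(j := snd p))) \<in> borel_measurable (Pi\<^sub>M {..<j} coeff_law \<Otimes>\<^sub>M coeff_law j)"
    by (rule measurable_compose[OF upd HM])
  define K where "K x = (\<integral>\<^sup>+y. H (x(j := y)) \<partial>coeff_law j)" for x
  have KM: "K \<in> borel_measurable (Pi\<^sub>M {..<j} coeff_law)"
    unfolding K_def using L.sigma_finite_measures[of j] HP
    by (intro sigma_finite_measure.borel_measurable_nn_integral) (auto simp: case_prod_unfold)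
  have "(\<integral>\<^sup>+a. H (\<lambda>k\<in>{..<Suc j}. deformed a k) \<partial>Pi\<^sub>M {..<Suc j} coeff_law)
      = (\<integral>\<^sup>+x. (\<integral>\<^sup>+y. H (\<lambda>k\<in>{..<Suc j}. deformed (x(j := y)) k) \<partial>coeff_law j) \<partial>Pi\<^sub>M {..<j} coeff_law)"
    using m1 unfolding I by (intro L.product_nn_integral_insert) auto
  also have "\<dots> = (\<integral>\<^sup>+x. K (\<lambda>k\<in>{..<j}. deformed x k) \<partial>Pi\<^sub>M {..<j} coeff_law)"
  proof (rule nn_integral_cong)
    fix x assume x: "x \<in> space (Pi\<^sub>M {..<j} coeff_law)"
    define g where "g = (\<lambda>k\<in>{..<j}. deformed x k)"
    define u where "u = cnj (szego_phi x 1 j) / szego_phi x 1 j"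
    have "cmod (x l) < 1" if "l < j" for l
    proof -
      have "x l \<in> space (coeff_law l)" using x that by (auto simp: space_PiM PiE_def Pi_def)
      then show ?thesis using that Suc.prems(1) space_coeff_law(1)[of l] by auto
    qed
    then have "szego_psi x 1 j \<noteq> 0" using szego_phi_le_psi[of j x 1] by simp
    then have u: "cmod u = 1" by (simp add: u_def norm_divide psi_at_1)
    have g: "g \<in> space (Pi\<^sub>M {..<j} coeff_law)"
      using measurable_space[OF measurable_deformed_PiM x] Suc.prems(1) by (simp add: g_def)
    have e: "(\<lambda>k\<in>{..<Suc j}. deformed (x(j := y)) k) = g(j := cnj y * u)" for y
    proof
      fix k
      show "(\<lambda>k\<in>{..<Suc j}. deformed (x(j := y)) k) k = (g(j := cnj y * u)) k"
      proof (cases "k < j")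
        case True
        then show ?thesis using deformed_cong[of k "x(j := y)" x] by (simp add: g_def)
      next
        case False
        then show ?thesis using szego_cong[of j "x(j := y)" x 1]
          by (cases "k = j") (auto simp: g_def u_def deformed_def)
      qed
    qed
    have gm: "(\<lambda>y. H (g(j := y))) \<in> borel_measurable (disc_law (\<beta> * (real (Suc m) - real j - 1) + 1))"
      using measurable_compose[OF measurable_Pair1'[OF g] HP] by (simp add: coeff_law_def)
    show "(\<integral>\<^sup>+y. H (\<lambda>k\<in>{..<Suc j}. deformed (x(j := y)) k) \<partial>coeff_law j) = K (\<lambda>k\<in>{..<j}. deformed x k)"
      unfolding e K_def g_def[symmetric] coeff_law_def by (rule disc_law_invariant[OF u gm])
  qed
  also have "\<dots> = (\<integral>\<^sup>+x. K x \<partial>Pi\<^sub>M {..<j} coeff_law)"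
    using Suc.prems(1) KM by (intro Suc.IH) auto
  also have "\<dots> = (\<integral>\<^sup>+a. H a \<partial>Pi\<^sub>M {..<Suc j} coeff_law)"
    unfolding K_def using HM unfolding I by (intro L.product_nn_integral_insert[symmetric]) auto
  finally show ?case .
qed

lemma measurable_GGT: "GGT (Suc m) \<in> Pi\<^sub>M {..<Suc m} coeff_law \<rightarrow>\<^sub>M unitary_borel (Suc m)"
proof (rule measurable_into_unitary_borel)
  fix a assume "a \<in> space (Pi\<^sub>M {..<Suc m} coeff_law)"
  then interpret verblunsky m a by (rule verblunsky_space)
  show "GGT (Suc m) a \<in> unitary_mats (Suc m)" by (rule GGT_unitary)
next
  fix i j assume ij: "i < Suc m" "j < Suc m"
  let ?M = "Pi\<^sub>M {..<Suc m} coeff_law"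
  have co [measurable]: "l < Suc m \<Longrightarrow> (\<lambda>a. a l) \<in> borel_measurable ?M" for l using measurable_coord[of l] by simp
  have [measurable]: "l < Suc m \<Longrightarrow> (\<lambda>a. szego_normsq a l) \<in> borel_measurable ?M" for l
    unfolding szego_normsq_def by (intro borel_measurable_prod borel_measurable_diff borel_measurable_power borel_measurable_norm) auto
  have [measurable]: "(\<lambda>a. psi_coeff a i l) \<in> borel_measurable ?M" if "l < Suc m" for l
    using that
  proof (induction l)
    case (Suc l)
    then have [measurable]: "(\<lambda>a. psi_coeff a i l) \<in> borel_measurable ?M" "(\<lambda>a. a l) \<in> borel_measurable ?M" by auto
    show ?case by simp
  qed simp
  have "(\<lambda>a. of_real (sqrt (szego_normsq a i) / sqrt (szego_normsq a j)) * ((if i = Suc j then 1 else 0) + cnj (a j) * psi_coeff a i j)) \<in> borel_measurable ?M"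
    using ij by measurable
  then show "(\<lambda>a. GGT (Suc m) a $$ (i, j)) \<in> borel_measurable ?M"
    using measurable_cong[of ?M "\<lambda>a. GGT (Suc m) a $$ (i, j)" "\<lambda>a. of_real (sqrt (szego_normsq a i) / sqrt (szego_normsq a j)) * ((if i = Suc j then 1 else 0) + cnj (a j) * psi_coeff a i j)"]
      verblunsky.GGT_index[OF verblunsky_space] ij by simp
qed

lemma CJ0_eq: "CJ0 (Suc m) \<beta> = distr (Pi\<^sub>M {..<Suc m} coeff_law) (unitary_borel (Suc m)) (GGT (Suc m))"
  by (simp add: CJ0_def coeff_law_def[abs_def])

lemma measurable_jacobi_weight: "(\<lambda>z. ennreal (jacobi_weight \<delta> z)) \<in> borel_measurable (coeff_law k)"
proof -
  define S where "S = {z. Re (1 - z) > 0}"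
  have "open S" unfolding S_def by (intro open_Collect_less continuous_intros)
  moreover have "continuous_on S (\<lambda>z. exp (2 * Re (cnj \<delta> * Ln (1 - z))))"
    by (intro continuous_intros) (auto simp: S_def complex_nonpos_Reals_iff)
  ultimately have h: "(\<lambda>z. indicator S z *\<^sub>R exp (2 * Re (cnj \<delta> * Ln (1 - z)))) \<in> borel_measurable borel"
    by (intro borel_measurable_continuous_on_indicator) auto
  have i: "(\<lambda>z. z) \<in> coeff_law k \<rightarrow>\<^sub>M borel" unfolding coeff_law_def by (rule measurable_disc_law_id)
  have "(\<lambda>z. indicator S z *\<^sub>R exp (2 * Re (cnj \<delta> * Ln (1 - z)))) \<in> borel_measurable (coeff_law k)"
    by (rule measurable_compose[OF i h])
  moreover have "indicator S z *\<^sub>R exp (2 * Re (cnj \<delta> * Ln (1 - z))) = jacobi_weight \<delta> z" if "z \<in> space (coeff_law k)" for z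
  proof -
    have "cmod z \<le> 1" using that by (auto simp: coeff_law_def space_disc_law split: if_splits)
    then show ?thesis using Re_one_minus_pos[of z] by (auto simp: jacobi_weight_def S_def indicator_def)
  qed
  ultimately have "jacobi_weight \<delta> \<in> borel_measurable (coeff_law k)"
    using measurable_cong[of "coeff_law k" "\<lambda>z. indicator S z *\<^sub>R exp (2 * Re (cnj \<delta> * Ln (1 - z)))" "jacobi_weight \<delta>" borel] by blast
  then show ?thesis by measurable
qed

lemma det_delta_GGT:
  assumes "a \<in> space (Pi\<^sub>M {..<Suc m} coeff_law)"
  shows "Re (det_delta \<delta> (GGT (Suc m) a)) = (\<Prod>k\<in>{..<Suc m}. jacobi_weight \<delta> (deformed a k))"
proof -
  interpret verblunsky m a by (rule verblunsky_space[OF assms])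
  show ?thesis
    unfolding det_delta_eq[OF GGT_unitary] eigvals_GGT
    using jacobi_weight_product[of \<delta>] by (simp add: lessThan_Suc_atMost prod_unfold_prod_mset)
qed

text \<open>
  The only access to the Jacobi ensemble that the sequel needs. In terms of the deformed coefficients the ensemble is a product of
  tilted laws, so the expectation of a sum of distances \<open>cmod (deformed a j - g j)\<close> involves one coordinate at a
  time; Markov's inequality bounds the probability of an event on which the sum is at least \<open>\<eta>\<close>. Stating the
  marginal hypothesis without normalization avoids any integrability side condition on the weight.
\<close>
lemma CJ_markov_bound:
  assumes \<delta>: "Re \<delta> \<ge> 0" and prob: "prob_space (CJ (Suc m) \<delta> \<beta>)"
    and bad: "bad \<in> sets (unitary_borel (Suc m))"
    and J: "J \<subseteq> {..<Suc m}" and c: "c0 \<ge> 0" "\<And>j. j \<in> J \<Longrightarrow> c j \<ge> 0" "\<And>j. j \<in> J \<Longrightarrow> E j \<ge> 0" and \<eta>: "\<eta> > 0"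
    and Y: "\<And>a. verblunsky m a \<Longrightarrow> GGT (Suc m) a \<in> bad \<Longrightarrow> \<eta> \<le> c0 + (\<Sum>j\<in>J. c j * cmod (deformed a j - g j))"
    and marg: "\<And>j. j \<in> J \<Longrightarrow> (\<integral>\<^sup>+z. ennreal (cmod (z - g j)) * ennreal (jacobi_weight \<delta> z) \<partial>coeff_law j)
         \<le> ennreal (E j) * (\<integral>\<^sup>+z. ennreal (jacobi_weight \<delta> z) \<partial>coeff_law j)"
  shows "measure (CJ (Suc m) \<delta> \<beta>) bad \<le> (c0 + (\<Sum>j\<in>J. c j * E j)) / \<eta>"
proof -
  let ?n = "Suc m"
  let ?P = "Pi\<^sub>M {..<?n} coeff_law"
  let ?f = "\<lambda>A. ennreal (Re (det_delta \<delta> A))"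
  define Z where "Z = (\<integral>\<^sup>+A. ?f A \<partial>CJ0 ?n \<beta>)"
  define w where "w = (\<lambda>z. ennreal (jacobi_weight \<delta> z))"
  have finJ: "finite J" using J finite_subset by blast
  have wm: "w \<in> borel_measurable (coeff_law k)" for k unfolding w_def by (rule measurable_jacobi_weight)
  have setsCJ0: "sets (CJ0 ?n \<beta>) = sets (unitary_borel ?n)" by (simp add: CJ0_def)
  have fm': "?f \<in> borel_measurable (unitary_borel ?n)" using measurable_det_delta[OF _ \<delta>, of ?n] by simp
  then have fm: "?f \<in> borel_measurable (CJ0 ?n \<beta>)" by (simp add: measurable_cong_sets[OF setsCJ0 refl])
  have CJ: "CJ ?n \<delta> \<beta> = density (CJ0 ?n \<beta>) (\<lambda>A. ?f A / Z)" by (simp add: CJ_def Z_def)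
  have dm: "(\<lambda>A. ?f A / Z) \<in> borel_measurable (CJ0 ?n \<beta>)" using fm by measurable
  have em: "emeasure (CJ ?n \<delta> \<beta>) X = (\<integral>\<^sup>+A. ?f A * indicator X A \<partial>CJ0 ?n \<beta>) / Z" if "X \<in> sets (unitary_borel ?n)" for X
  proof -
    have "emeasure (CJ ?n \<delta> \<beta>) X = (\<integral>\<^sup>+A. (?f A / Z) * indicator X A \<partial>CJ0 ?n \<beta>)"
      unfolding CJ using that setsCJ0 by (intro emeasure_density[OF dm]) simp
    also have "\<dots> = (\<integral>\<^sup>+A. (?f A * indicator X A) / Z \<partial>CJ0 ?n \<beta>)"
      by (intro nn_integral_cong) (simp add: divide_ennreal_def mult_ac)
    also have "\<dots> = (\<integral>\<^sup>+A. ?f A * indicator X A \<partial>CJ0 ?n \<beta>) / Z"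
      using fm that setsCJ0 by (intro nn_integral_divide) simp
    finally show ?thesis .
  qed
  have one: "emeasure (CJ ?n \<delta> \<beta>) (unitary_mats ?n) = 1"
    using prob_space.emeasure_space_1[OF prob] by (simp add: CJ CJ0_def)
  have top: "unitary_mats ?n \<in> sets (unitary_borel ?n)" using sets.top[of "unitary_borel ?n"] by simp
  have "(\<integral>\<^sup>+A. ?f A * indicator (unitary_mats ?n) A \<partial>CJ0 ?n \<beta>) = Z"
    unfolding Z_def by (intro nn_integral_cong) (simp add: CJ0_def indicator_def)
  then have "Z / Z = 1" using em[OF top] one by simp
  \<comment> \<open>The normalizing constant is positive and finite because otherwise the density would not have total mass 1.\<close>
  then have Z: "Z \<noteq> 0" "Z \<noteq> \<infinity>" by auto
  have prodf: "?f (GGT ?n a) = (\<Prod>k\<in>{..<?n}. w (deformed a k))" if "a \<in> space ?P" for a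
    unfolding det_delta_GGT[OF that] w_def by (rule prod_ennreal[symmetric]) (rule jacobi_weight_nonneg)
  \<comment> \<open>From here on all integrals are carried from the matrices to the deformed coefficients, where the weight is a product.\<close>
  define W where "W x = (\<Prod>k\<in>{..<?n}. w (x k))" for x
  have Wm: "W \<in> borel_measurable ?P"
    unfolding W_def
  proof (rule borel_measurable_prod_ennreal)
    fix k assume "k \<in> {..<?n}"
    from measurable_compose[of "\<lambda>x. x k" ?P "coeff_law k" w borel, OF measurable_component_singleton[OF this] wm[of k]]
    show "(\<lambda>x. w (x k)) \<in> borel_measurable ?P" .
  qed
  have W: "?f (GGT ?n a) = W (\<lambda>k\<in>{..<?n}. deformed a k)" if "a \<in> space ?P" for a
    unfolding prodf[OF that] W_def by (intro prod.cong) auto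
  have Zint: "Z = (\<integral>\<^sup>+x. W x \<partial>?P)"
  proof -
    have "Z = (\<integral>\<^sup>+a. ?f (GGT ?n a) \<partial>?P)"
      unfolding Z_def CJ0_eq by (rule nn_integral_distr[OF measurable_GGT]) (use fm' in simp)
    also have "\<dots> = (\<integral>\<^sup>+a. W (\<lambda>k\<in>{..<?n}. deformed a k) \<partial>?P)" using W by (intro nn_integral_cong) auto
    also have "\<dots> = (\<integral>\<^sup>+x. W x \<partial>?P)" by (rule nn_integral_deformed[OF order_refl Wm])
    finally show ?thesis .
  qed
  have "Z = (\<Prod>k\<in>{..<?n}. \<integral>\<^sup>+z. w z \<partial>coeff_law k)"
    unfolding Zint W_def by (rule L.product_nn_integral_prod) (use wm in auto)
  then have Zp: "Z = (\<integral>\<^sup>+z. w z \<partial>coeff_law j) * (\<Prod>k\<in>{..<?n} - {j}. \<integral>\<^sup>+z. w z \<partial>coeff_law k)" if "j \<in> J" for j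
    using that J by (subst (asm) prod.remove[of _ j]) auto
  define Yf where "Yf x = ennreal c0 + (\<Sum>j\<in>J. ennreal (c j) * ennreal (cmod (x j - g j)))" for x
  have dm': "(\<lambda>x. ennreal (cmod (x j - g j))) \<in> borel_measurable ?P" if "j \<in> J" for j
  proof -
    have [measurable]: "(\<lambda>x. x j) \<in> borel_measurable ?P" using measurable_coord[of j "{..<?n}"] that J by blast
    show ?thesis by measurable
  qed
  have Ym: "Yf \<in> borel_measurable ?P"
    unfolding Yf_def using dm' by (intro borel_measurable_add borel_measurable_sum borel_measurable_times_ennreal) auto
  have Jint: "(\<integral>\<^sup>+x. W x * ennreal (cmod (x j - g j)) \<partial>?P) \<le> ennreal (E j) * Z" if j: "j \<in> J" for j
  proof -
    have "(\<integral>\<^sup>+x. W x * ennreal (cmod (x j - g j)) \<partial>?P)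
        = (\<integral>\<^sup>+x. (\<Prod>k\<in>{..<?n}. (if k = j then (\<lambda>z. ennreal (cmod (z - g j)) * w z) else w) (x k)) \<partial>?P)"
    proof (rule nn_integral_cong)
      fix x
      have "(\<Prod>k\<in>{..<?n}. (if k = j then (\<lambda>z. ennreal (cmod (z - g j)) * w z) else w) (x k))
        = (ennreal (cmod (x j - g j)) * w (x j)) * (\<Prod>k\<in>{..<?n} - {j}. (if k = j then (\<lambda>z. ennreal (cmod (z - g j)) * w z) else w) (x k))"
        using j J by (subst prod.remove[of _ j]) auto
      also have "(\<Prod>k\<in>{..<?n} - {j}. (if k = j then (\<lambda>z. ennreal (cmod (z - g j)) * w z) else w) (x k)) = (\<Prod>k\<in>{..<?n} - {j}. w (x k))"
        by (intro prod.cong) auto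
      also have "(ennreal (cmod (x j - g j)) * w (x j)) * (\<Prod>k\<in>{..<?n} - {j}. w (x k)) = W x * ennreal (cmod (x j - g j))"
      proof -
        have "W x = w (x j) * (\<Prod>k\<in>{..<?n} - {j}. w (x k))"
          unfolding W_def by (rule prod.remove) (use j J in auto)
        then show ?thesis by (simp only: mult_ac)
      qed
      finally show "W x * ennreal (cmod (x j - g j)) = (\<Prod>k\<in>{..<?n}. (if k = j then (\<lambda>z. ennreal (cmod (z - g j)) * w z) else w) (x k))" ..
    qed
    also have "\<dots> = (\<Prod>k\<in>{..<?n}. \<integral>\<^sup>+z. (if k = j then (\<lambda>z. ennreal (cmod (z - g j)) * w z) else w) z \<partial>coeff_law k)"
    proof (rule L.product_nn_integral_prod)
      fix k
      have "(\<lambda>z. ennreal (cmod (z - g j))) \<in> borel_measurable (coeff_law j)"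
      proof -
        have [measurable]: "(\<lambda>z. z) \<in> coeff_law j \<rightarrow>\<^sub>M borel" unfolding coeff_law_def by (rule measurable_disc_law_id)
        show ?thesis by measurable
      qed
      then show "(if k = j then (\<lambda>z. ennreal (cmod (z - g j)) * w z) else w) \<in> borel_measurable (coeff_law k)"
        using wm by (cases "k = j") (auto intro!: borel_measurable_times_ennreal)
    qed simp
    also have "\<dots> = (\<integral>\<^sup>+z. ennreal (cmod (z - g j)) * w z \<partial>coeff_law j) *
        (\<Prod>k\<in>{..<?n} - {j}. \<integral>\<^sup>+z. (if k = j then (\<lambda>z. ennreal (cmod (z - g j)) * w z) else w) z \<partial>coeff_law k)"
      using j J by (subst prod.remove[of _ j]) auto
    also have "(\<Prod>k\<in>{..<?n} - {j}. \<integral>\<^sup>+z. (if k = j then (\<lambda>z. ennreal (cmod (z - g j)) * w z) else w) z \<partial>coeff_law k)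
        = (\<Prod>k\<in>{..<?n} - {j}. \<integral>\<^sup>+z. w z \<partial>coeff_law k)"
      by (intro prod.cong) auto
    also have "(\<integral>\<^sup>+z. ennreal (cmod (z - g j)) * w z \<partial>coeff_law j) * (\<Prod>k\<in>{..<?n} - {j}. \<integral>\<^sup>+z. w z \<partial>coeff_law k)
       \<le> (ennreal (E j) * (\<integral>\<^sup>+z. w z \<partial>coeff_law j)) * (\<Prod>k\<in>{..<?n} - {j}. \<integral>\<^sup>+z. w z \<partial>coeff_law k)"
      using marg[OF j] unfolding w_def by (intro mult_right_mono) auto
    also have "\<dots> = ennreal (E j) * Z" unfolding Zp[OF j] by (simp add: mult.assoc)
    finally show ?thesis .
  qed
  have Yint: "(\<integral>\<^sup>+x. W x * Yf x \<partial>?P) \<le> ennreal (c0 + (\<Sum>j\<in>J. c j * E j)) * Z"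
  proof -
    have "(\<integral>\<^sup>+x. W x * Yf x \<partial>?P) = (\<integral>\<^sup>+x. ennreal c0 * W x + (\<Sum>j\<in>J. ennreal (c j) * (W x * ennreal (cmod (x j - g j)))) \<partial>?P)"
      unfolding Yf_def by (intro nn_integral_cong) (simp add: distrib_left sum_distrib_left mult_ac)
    also have "\<dots> = (\<integral>\<^sup>+x. ennreal c0 * W x \<partial>?P) + (\<integral>\<^sup>+x. (\<Sum>j\<in>J. ennreal (c j) * (W x * ennreal (cmod (x j - g j)))) \<partial>?P)"
      using Wm dm' by (intro nn_integral_add borel_measurable_times_ennreal borel_measurable_sum) auto
    also have "\<dots> = ennreal c0 * Z + (\<Sum>j\<in>J. ennreal (c j) * (\<integral>\<^sup>+x. W x * ennreal (cmod (x j - g j)) \<partial>?P))"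
    proof -
      have wd: "(\<lambda>x. W x * ennreal (cmod (x j - g j))) \<in> borel_measurable ?P" if "j \<in> J" for j
        using Wm dm'[OF that] by (rule borel_measurable_times_ennreal)
      show ?thesis
        unfolding Zint nn_integral_cmult[OF Wm]
        using wd by (subst nn_integral_sum)
          (simp_all only: nn_integral_cmult borel_measurable_times_ennreal borel_measurable_const cong: sum.cong)
    qed
    also have "\<dots> \<le> ennreal c0 * Z + (\<Sum>j\<in>J. ennreal (c j) * (ennreal (E j) * Z))"
      using Jint by (intro add_left_mono sum_mono mult_left_mono) auto
    also have "\<dots> = ennreal (c0 + (\<Sum>j\<in>J. c j * E j)) * Z"
    proof -
      have "ennreal (c0 + (\<Sum>j\<in>J. c j * E j)) = ennreal c0 + ennreal (\<Sum>j\<in>J. c j * E j)"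
        using c by (intro ennreal_plus sum_nonneg) auto
      also have "ennreal (\<Sum>j\<in>J. c j * E j) = (\<Sum>j\<in>J. ennreal (c j) * ennreal (E j))"
        using c by (subst sum_ennreal[symmetric]) (auto simp: ennreal_mult)
      finally show ?thesis by (simp add: distrib_right sum_distrib_right mult.assoc)
    qed
    finally show ?thesis .
  qed
  have indb: "(indicator bad (GGT ?n a) :: ennreal) \<le> Yf (\<lambda>k\<in>{..<?n}. deformed a k) / ennreal \<eta>" if a: "a \<in> space ?P" for a
  proof (cases "GGT ?n a \<in> bad")
    case True
    have "ennreal \<eta> \<le> ennreal (c0 + (\<Sum>j\<in>J. c j * cmod (deformed a j - g j)))"
      by (intro ennreal_leI Y verblunsky_space a True)
    also have "\<dots> = ennreal c0 + ennreal (\<Sum>j\<in>J. c j * cmod (deformed a j - g j))"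
      using c by (intro ennreal_plus sum_nonneg) auto
    also have "ennreal (\<Sum>j\<in>J. c j * cmod (deformed a j - g j)) = (\<Sum>j\<in>J. ennreal (c j) * ennreal (cmod (deformed a j - g j)))"
      using c by (subst sum_ennreal[symmetric]) (auto simp: ennreal_mult)
    also have "ennreal c0 + \<dots> = Yf (\<lambda>k\<in>{..<?n}. deformed a k)"
      unfolding Yf_def using J by (intro arg_cong2[where f = "(+)"] sum.cong) auto
    finally have "ennreal \<eta> / ennreal \<eta> \<le> Yf (\<lambda>k\<in>{..<?n}. deformed a k) / ennreal \<eta>"
      by (rule divide_right_mono_ennreal)
    moreover have "ennreal \<eta> / ennreal \<eta> = 1" using \<eta> by (simp add: divide_ennreal)
    ultimately show ?thesis using True by simp
  qed simp
  have "(\<integral>\<^sup>+A. ?f A * indicator bad A \<partial>CJ0 ?n \<beta>) = (\<integral>\<^sup>+a. ?f (GGT ?n a) * indicator bad (GGT ?n a) \<partial>?P)"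
    unfolding CJ0_eq
    by (rule nn_integral_distr[OF measurable_GGT]) (use fm' bad in \<open>simp add: borel_measurable_times_ennreal\<close>)
  also have "\<dots> \<le> (\<integral>\<^sup>+a. (\<lambda>x. W x * Yf x / ennreal \<eta>) (\<lambda>k\<in>{..<?n}. deformed a k) \<partial>?P)"
  proof (rule nn_integral_mono)
    fix a assume a: "a \<in> space ?P"
    have "W (\<lambda>k\<in>{..<?n}. deformed a k) * indicator bad (GGT ?n a) \<le> W (\<lambda>k\<in>{..<?n}. deformed a k) * (Yf (\<lambda>k\<in>{..<?n}. deformed a k) / ennreal \<eta>)"
      using indb[OF a] by (intro mult_left_mono) auto
    then show "?f (GGT ?n a) * indicator bad (GGT ?n a) \<le> (\<lambda>x. W x * Yf x / ennreal \<eta>) (\<lambda>k\<in>{..<?n}. deformed a k)"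
      unfolding W[OF a] by (simp add: ennreal_times_divide)
  qed
  also have "\<dots> = (\<integral>\<^sup>+x. W x * Yf x / ennreal \<eta> \<partial>?P)"
    by (rule nn_integral_deformed[OF order_refl]) (use Wm Ym in \<open>auto intro!: borel_measurable_divide_ennreal borel_measurable_times_ennreal\<close>)
  also have "\<dots> = (\<integral>\<^sup>+x. W x * Yf x \<partial>?P) / ennreal \<eta>"
    using Wm Ym by (intro nn_integral_divide borel_measurable_times_ennreal)
  also have "\<dots> \<le> ennreal (c0 + (\<Sum>j\<in>J. c j * E j)) * Z / ennreal \<eta>"
    by (rule divide_right_mono_ennreal[OF Yint])
  finally have "emeasure (CJ ?n \<delta> \<beta>) bad \<le> ennreal (c0 + (\<Sum>j\<in>J. c j * E j)) * Z / ennreal \<eta> / Z"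
    unfolding em[OF bad] by (rule divide_right_mono_ennreal)
  also have "\<dots> = ennreal (c0 + (\<Sum>j\<in>J. c j * E j)) / ennreal \<eta> * (Z / Z)"
    by (simp add: divide_ennreal_def mult_ac)
  also have "\<dots> = ennreal ((c0 + (\<Sum>j\<in>J. c j * E j)) / \<eta>)"
    unfolding \<open>Z / Z = 1\<close> mult_1_right using \<eta> c by (intro divide_ennreal add_nonneg_nonneg sum_nonneg) auto
  finally show ?thesis
    using \<eta> c by (simp add: measure_def enn2real_leI sum_nonneg)
qed

end

section \<open>Concentration of a single coefficient\<close>

text \<open>
  Translation invariance: difference quotients of \<open>F\<close> integrate to \<open>0\<close>, and they are dominated because the derivative is
  bounded and \<open>F\<close> has bounded support.
\<close>
lemma integral_directional_derivative_zero:
  fixes F F' :: "complex \<Rightarrow> real" and h :: complex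
  assumes Fm [measurable]: "F \<in> borel_measurable borel"
    and der: "\<And>z. ((\<lambda>t. F (z + of_real t * h)) has_real_derivative F' z) (at 0)"
    and bound: "\<And>z. \<bar>F' z\<bar> \<le> B" and supp: "\<And>z. cmod z \<ge> 1 \<Longrightarrow> F z = 0" and h: "cmod h = 1"
  shows "integrable lborel F'" and "integral\<^sup>L lborel F' = 0"
proof -
  have der': "((\<lambda>t. F (z + of_real t * h)) has_real_derivative F' (z + of_real t * h)) (at t)" for z t
  proof -
    have "((\<lambda>u. F ((z + of_real t * h) + of_real u * h)) has_real_derivative F' (z + of_real t * h)) (at 0)"
      by (rule der)
    then have "((\<lambda>u. (\<lambda>t. F (z + of_real t * h)) (u + t)) has_real_derivative F' (z + of_real t * h)) (at 0)"
      by (simp add: algebra_simps)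
    then show ?thesis using DERIV_at_within_shift[of "\<lambda>t. F (z + of_real t * h)" _ t 0 UNIV] by (simp add: add.commute)
  qed
  have mvt: "\<bar>F (z + of_real e * h) - F z\<bar> \<le> B * e" if "e \<ge> 0" for z e
  proof (cases "e = 0")
    case False
    then have "0 < e" using that by simp
    from MVT2[OF this, of "\<lambda>t. F (z + of_real t * h)" "\<lambda>t. F' (z + of_real t * h)"] der'
    obtain t where "F (z + of_real e * h) - F (z + of_real 0 * h) = (e - 0) * F' (z + of_real t * h)" by blast
    then have "\<bar>F (z + of_real e * h) - F z\<bar> = e * \<bar>F' (z + of_real t * h)\<bar>" using that by (simp add: abs_mult)
    also have "\<dots> \<le> e * B" using bound that by (intro mult_left_mono) auto
    finally show ?thesis by (simp add: mult.commute)
  qed simp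
  \<comment> \<open>Difference quotients with step \<open>1 / (k + 1) \<le> 1\<close>, so that all of them are supported in the disc of radius 2.\<close>
  define D where "D k z = (F (z + of_real (1 / (real k + 1)) * h) - F z) * (real k + 1)" for k z
  have Dm: "D k \<in> borel_measurable lborel" for k
    unfolding D_def[abs_def] by measurable
  have lim: "(\<lambda>k. D k z) \<longlonglongrightarrow> F' z" for z
  proof -
    have "((\<lambda>t. (F (z + of_real t * h) - F (z + of_real 0 * h)) / (t - 0)) \<longlongrightarrow> F' z) (at 0)"
      using der[of z] unfolding has_field_derivative_iff by simp
    then have "((\<lambda>t. (F (z + of_real t * h) - F z) / t) \<longlongrightarrow> F' z) (at 0)" by simp
    moreover have "filterlim (\<lambda>k. 1 / (real k + 1)) (at 0) sequentially"
      unfolding filterlim_at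
    proof (intro conjI)
      show "(\<lambda>k. 1 / (real k + 1)) \<longlonglongrightarrow> 0" by real_asymp
      have "1 / (real k + 1) \<noteq> 0" for k by simp
      then show "\<forall>\<^sub>F k in sequentially. 1 / (real k + 1) \<in> UNIV \<and> 1 / (real k + 1) \<noteq> 0" by simp
    qed
    ultimately have "(\<lambda>k. (F (z + of_real (1 / (real k + 1)) * h) - F z) / (1 / (real k + 1))) \<longlonglongrightarrow> F' z"
      by (rule filterlim_compose)
    then show ?thesis unfolding D_def by simp
  qed
  have B0: "B \<ge> 0" using bound[of 0] by linarith
  have Db: "norm (D k z) \<le> B * indicator (cball 0 2) z" for k z
  proof (cases "cmod z \<le> 2")
    case True
    have "\<bar>F (z + of_real (1 / (real k + 1)) * h) - F z\<bar> * (real k + 1) \<le> B * (1 / (real k + 1)) * (real k + 1)"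
      by (intro mult_right_mono mvt) auto
    then show ?thesis using True unfolding D_def by (simp add: abs_mult)
  next
    case False
    have "cmod (of_real (1 / (real k + 1)) * h) \<le> 1" using h by (simp add: norm_mult norm_divide del: of_real_divide)
    then have "cmod (z + of_real (1 / (real k + 1)) * h) \<ge> 1"
      using norm_triangle_ineq2[of z "- (of_real (1 / (real k + 1)) * h)"] False by simp
    then show ?thesis using supp[of z] supp[of "z + of_real (1 / (real k + 1)) * h"] False by (simp add: D_def)
  qed
  have w: "integrable lborel (\<lambda>z :: complex. B * indicator (cball 0 2) z)"
    by (intro integrable_mult_right integrable_real_indicator) (simp_all only: emeasure_bounded_finite bounded_cball sets_lborel borel_closed closed_cball)
  have F'm: "F' \<in> borel_measurable lborel" by (rule borel_measurable_LIMSEQ_real[OF lim Dm])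
  show "integrable lborel F'"
    by (rule integrable_dominated_convergence[where s = D, OF F'm Dm w]) (simp_all only: lim Db AE_I2)
  have conv: "(\<lambda>k. integral\<^sup>L lborel (D k)) \<longlonglongrightarrow> integral\<^sup>L lborel F'"
    by (rule integral_dominated_convergence[where s = D, OF F'm Dm w]) (simp_all only: lim Db AE_I2)
  have Fb: "norm (F z) \<le> (B * 2) * indicator (cball 0 2) z" for z
  proof (cases "cmod z < 1")
    case True
    have "cmod (of_real 2 * h) = 2" using h by (simp add: norm_mult)
    then have "cmod (z + of_real 2 * h) \<ge> 1" using norm_triangle_ineq2[of "of_real 2 * h" "- z"] True by (simp add: add.commute)
    then show ?thesis using mvt[of 2 z] supp[of "z + of_real 2 * h"] True by simp
  qed (use supp B0 in auto)
  have w2: "integrable lborel (\<lambda>z :: complex. (B * 2) * indicator (cball 0 2) z)"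
    by (intro integrable_mult_right integrable_real_indicator) (simp_all only: emeasure_bounded_finite bounded_cball sets_lborel borel_closed closed_cball)
  have Fi: "integrable lborel F"
    by (rule Bochner_Integration.integrable_bound[OF w2]) (use Fb B0 in auto)
  have tr: "integrable lborel (\<lambda>z. F (z + c))" "integral\<^sup>L lborel (\<lambda>z. F (z + c)) = integral\<^sup>L lborel F" for c
  proof -
    have "integrable (distr lborel borel ((+) c)) F" using Fi by (simp add: lborel_distr_plus)
    then show "integrable lborel (\<lambda>z. F (z + c))" by (subst (asm) integrable_distr_eq) (auto simp: add.commute)
    have "integral\<^sup>L lborel F = integral\<^sup>L (distr lborel borel ((+) c)) F" by (simp add: lborel_distr_plus)
    also have "\<dots> = integral\<^sup>L lborel (\<lambda>z. F (z + c))" by (subst integral_distr) (auto simp: add.commute)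
    finally show "integral\<^sup>L lborel (\<lambda>z. F (z + c)) = integral\<^sup>L lborel F" by simp
  qed
  have "integral\<^sup>L lborel (D k) = 0" for k
    unfolding D_def[abs_def] using tr[of "of_real (1 / (real k + 1)) * h"] Fi by simp
  then show "integral\<^sup>L lborel F' = 0" using conv by (simp add: LIMSEQ_const_iff)
qed

lemma exp_twice_derivative:
  fixes f :: "real \<Rightarrow> real"
  assumes "(f has_real_derivative D) (at x)"
  shows "((\<lambda>t. exp (2 * f t)) has_real_derivative exp (2 * f x) * (2 * D)) (at x)"
  using assms by (auto intro!: derivative_eq_intros)

lemma Re_of_real_mult: "Re (of_real r * w) = r * Re w"
  by simp

text \<open>
  The tilted law \<open>q powr (N - 1) * J\<close> on the disc with \<open>q = 1 - (cmod z)\<^sup>2\<close>, in which both exponents are proportional to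
  \<open>N\<close>. The bound \<open>N \<ge> 2\<close> makes \<open>q powr N\<close> vanish to second order at the unit circle, so that functions
  extended by \<open>0\<close> stay differentiable.
\<close>
locale jacobi_disc =
  fixes N :: real and d :: complex
  assumes N: "N \<ge> 2" and d: "Re d \<ge> 0"
begin

definition J :: "complex \<Rightarrow> real" where "J z = exp (2 * Re (cnj (of_real N * d) * Ln (1 - z)))"

definition q :: "complex \<Rightarrow> real" where "q z = 1 - (cmod z)\<^sup>2"

definition p :: "complex \<Rightarrow> real" where "p z = q z powr (N - 1) * J z"

text \<open>
  The gradient of \<open>- ln (q powr N * J)\<close> is \<open>2 * N * X / q\<close>, see \<open>weight_derivative\<close>. So the only zero of \<open>X\<close> is the mode, and
  \<open>X\<close> measures the distance to it.
\<close>
definition X :: "complex \<Rightarrow> complex" where "X z = z + d * of_real (q z) / (1 - cnj z)"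

lemma Re_pos: "cmod z < 1 \<Longrightarrow> Re (1 - z) > 0"
  using complex_Re_le_cmod[of z] by simp

lemma q_pos: "cmod z < 1 \<Longrightarrow> 0 < q z" "q z \<le> 1"
  by (auto simp: q_def abs_square_less_1)

lemma q_le: "cmod z < 1 \<Longrightarrow> q z \<le> 2 * cmod (1 - z)"
proof -
  assume z: "cmod z < 1"
  have "q z = (1 - cmod z) * (1 + cmod z)" by (simp add: q_def power2_eq_square algebra_simps)
  also have "\<dots> \<le> (1 - cmod z) * 2" using z by (intro mult_left_mono) auto
  also have "1 - cmod z \<le> cmod (1 - z)" using norm_triangle_ineq2[of 1 z] by simp
  finally show ?thesis by simp
qed

lemma J_bounded: obtains K where "K > 0" "\<And>z. cmod z < 1 \<Longrightarrow> J z \<le> K"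
proof
  let ?D = "of_real N * d"
  show "exp (2 * (Re ?D * ln 2 + \<bar>Im ?D\<bar> * pi)) > 0" by simp
  fix z assume z: "cmod z < 1"
  have nz: "1 - z \<noteq> 0" using Re_pos[OF z] by auto
  have "cmod (1 - z) \<le> 2" using norm_triangle_ineq4[of 1 z] z by simp
  then have "ln (cmod (1 - z)) \<le> ln 2" using nz by simp
  moreover have "Re ?D \<ge> 0" using N d by simp
  ultimately have "Re ?D * ln (cmod (1 - z)) \<le> Re ?D * ln 2" by (rule mult_left_mono)
  moreover have "Im ?D * Im (Ln (1 - z)) \<le> \<bar>Im ?D\<bar> * pi"
  proof -
    have "\<bar>Im (Ln (1 - z))\<bar> \<le> pi" using mpi_less_Im_Ln[OF nz] Im_Ln_le_pi[OF nz] by auto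
    then have "\<bar>Im ?D\<bar> * \<bar>Im (Ln (1 - z))\<bar> \<le> \<bar>Im ?D\<bar> * pi" by (intro mult_left_mono) auto
    then show ?thesis unfolding abs_mult[symmetric] by linarith
  qed
  moreover have "Re (cnj ?D * Ln (1 - z)) = Re ?D * ln (cmod (1 - z)) + Im ?D * Im (Ln (1 - z))"
    using nz by (simp add: algebra_simps)
  ultimately have "Re (cnj ?D * Ln (1 - z)) \<le> Re ?D * ln 2 + \<bar>Im ?D\<bar> * pi" by linarith
  then show "J z \<le> exp (2 * (Re ?D * ln 2 + \<bar>Im ?D\<bar> * pi))" unfolding J_def by simp
qed

lemma norm_frac: "cmod z < 1 \<Longrightarrow> cmod (of_real (q z) / (1 - cnj z)) \<le> 2"
proof -
  assume z: "cmod z < 1"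
  have n: "cmod (1 - cnj z) = cmod (1 - z)" by (metis complex_cnj_diff complex_cnj_one complex_mod_cnj)
  have "cmod (1 - z) > 0" using Re_pos[OF z] by auto
  then show ?thesis using q_le[OF z] q_pos(1)[OF z] by (simp add: norm_divide n divide_le_eq)
qed

lemma X_bound: "cmod z < 1 \<Longrightarrow> cmod (X z) \<le> 1 + 2 * cmod d"
proof -
  assume z: "cmod z < 1"
  have "X z = z + d * (of_real (q z) / (1 - cnj z))" by (simp add: X_def)
  then have "cmod (X z) \<le> cmod z + cmod d * cmod (of_real (q z) / (1 - cnj z))"
    by (metis norm_mult norm_triangle_ineq)
  also have "\<dots> \<le> 1 + cmod d * 2" using z norm_frac[OF z] by (intro add_mono mult_left_mono) auto
  finally show ?thesis by simp
qed

text \<open>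
  One power of \<open>q\<close> more than the density \<open>p\<close>: the boundary terms of the integration by parts vanish and derivatives
  produce exactly the factor \<open>p\<close>.
\<close>
definition weight :: "complex \<Rightarrow> real" where "weight z = q z powr N * J z"

lemma weight_eq: "cmod z < 1 \<Longrightarrow> weight z = q z * p z"
  using q_pos(1)[of z] powr_add[of "q z" 1 "N - 1"] by (simp add: weight_def p_def)

lemma p_nonneg: "p z \<ge> 0" by (simp add: p_def J_def)

lemma p_le_J: "cmod z < 1 \<Longrightarrow> p z \<le> J z"
  using q_pos[of z] N by (simp add: p_def J_def powr_le1)

text \<open>
  The derivative of \<open>X\<close> in the direction \<open>h\<close>.
\<close>
definition dX :: "complex \<Rightarrow> complex \<Rightarrow> complex" where
  "dX h z = h + d * (of_real (- 2 * Re (z * cnj h)) / (1 - cnj z) + of_real (q z) * cnj h / (1 - cnj z)\<^sup>2)"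

definition flux :: "complex \<Rightarrow> complex \<Rightarrow> real" where
  "flux h z = (if cmod z < 1 then Re (X z * cnj h) * weight z else 0)"

definition dflux :: "complex \<Rightarrow> complex \<Rightarrow> real" where
  "dflux h z = (if cmod z < 1 then Re (dX h z * cnj h) * weight z - 2 * N * (Re (X z * cnj h))\<^sup>2 * p z else 0)"

lemma q_derivative: "((\<lambda>t. q (z + of_real t * h)) has_real_derivative (- 2 * Re (z * cnj h))) (at 0)"
proof -
  have e: "q (z + of_real t * h) = 1 - ((Re z + t * Re h)\<^sup>2 + (Im z + t * Im h)\<^sup>2)" for t
    by (simp add: q_def cmod_power2)
  show ?thesis unfolding e by (auto intro!: derivative_eq_intros simp: algebra_simps)
qed

lemma X_derivative:
  assumes z: "cmod z < 1"
  shows "((\<lambda>t. X (z + of_real t * h)) has_vector_derivative dX h z) (at 0)"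
proof -
  have nz: "1 - cnj z \<noteq> 0" using Re_pos[OF z] by (auto simp: complex_eq_iff)
  have q': "((\<lambda>t. complex_of_real (q (z + of_real t * h))) has_vector_derivative of_real (- 2 * Re (z * cnj h))) (at 0)"
    using q_derivative[of z h] by (intro has_vector_derivative_of_real) (simp add: has_real_derivative_iff_has_vector_derivative)
  have l: "((\<lambda>t. 1 - cnj (z + of_real t * h)) has_vector_derivative (- cnj h)) (at 0)"
    by (auto intro!: derivative_eq_intros)
  have i: "((\<lambda>t. inverse (1 - cnj (z + of_real t * h))) has_vector_derivative (- cnj h * - (inverse (1 - cnj z) ^ 2))) (at 0)"
  proof -
    have "(inverse has_field_derivative - (inverse (1 - cnj (z + of_real 0 * h)) ^ 2)) (at (1 - cnj (z + of_real 0 * h)))"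
      using nz DERIV_inverse[of "1 - cnj z"] by (simp add: numeral_2_eq_2)
    from field_vector_diff_chain_at[OF l this] show ?thesis by (simp add: comp_def)
  qed
  have l2: "((\<lambda>t. z + of_real t * h) has_vector_derivative h) (at 0)"
    by (auto intro!: derivative_eq_intros)
  from has_vector_derivative_add[OF l2 has_vector_derivative_mult_right[OF has_vector_derivative_mult[OF q' i], of d]]
  show ?thesis unfolding X_def[abs_def] dX_def by (simp add: divide_inverse power_inverse algebra_simps)
qed

lemma J_derivative:
  assumes z: "cmod z < 1"
  shows "((\<lambda>t. J (z + of_real t * h)) has_real_derivative J z * (2 * Re (cnj (of_real N * d) * (- h / (1 - z))))) (at 0)"
proof -
  have nr: "1 - z \<notin> \<real>\<^sub>\<le>\<^sub>0" using Re_pos[OF z] by (auto simp: complex_nonpos_Reals_iff)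
  have l: "((\<lambda>t. 1 - (z + of_real t * h)) has_vector_derivative (- h)) (at 0)"
    by (auto intro!: derivative_eq_intros)
  have "((\<lambda>w. cnj (of_real N * d) * Ln w) has_field_derivative cnj (of_real N * d) * inverse (1 - z)) (at (1 - (z + of_real 0 * h)))"
    using nr by (auto intro!: derivative_eq_intros simp: divide_inverse)
  from field_vector_diff_chain_at[OF l this]
  have "((\<lambda>t. cnj (of_real N * d) * Ln (1 - (z + of_real t * h))) has_vector_derivative (- h * (cnj (of_real N * d) * inverse (1 - z)))) (at 0)"
    by (simp add: comp_def)
  from bounded_linear.has_vector_derivative[OF bounded_linear_Re this]
  have "((\<lambda>t. Re (cnj (of_real N * d) * Ln (1 - (z + of_real t * h)))) has_real_derivative Re (- h * (cnj (of_real N * d) * inverse (1 - z)))) (at 0)"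
    by (simp add: has_real_derivative_iff_has_vector_derivative)
  then have "((\<lambda>t. J (z + of_real t * h)) has_real_derivative J (z + of_real 0 * h) * (2 * Re (- h * (cnj (of_real N * d) * inverse (1 - z))))) (at 0)"
    unfolding J_def by (rule exp_twice_derivative)
  then show ?thesis by (simp add: divide_inverse algebra_simps)
qed

lemma weight_derivative:
  assumes z: "cmod z < 1"
  shows "((\<lambda>t. weight (z + of_real t * h)) has_real_derivative (- 2 * N * p z * Re (X z * cnj h))) (at 0)"
proof -
  have qp: "q (z + of_real 0 * h) > 0" using q_pos(1)[OF z] by simp
  have "((\<lambda>t. q (z + of_real t * h) powr N) has_real_derivative (N * q (z + of_real 0 * h) powr (N - of_nat 1) * (- 2 * Re (z * cnj h)))) (at 0)"
    by (rule DERIV_fun_powr[OF q_derivative qp])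
  from DERIV_mult[OF this J_derivative[OF z, of h]]
  have D: "((\<lambda>t. weight (z + of_real t * h)) has_real_derivative
     (N * q z powr (N - 1) * (- 2 * Re (z * cnj h)) * J z + J z * (2 * Re (cnj (of_real N * d) * (- h / (1 - z)))) * q z powr N)) (at 0)"
    unfolding weight_def by (simp add: mult.commute)
  have qN: "q z powr N = q z * q z powr (N - 1)" using q_pos(1)[OF z] powr_add[of "q z" 1 "N - 1"] by simp
  have c: "Re (cnj d * (h / (1 - z))) = Re (d / (1 - cnj z) * cnj h)"
    using complex_cnj[of "Re (cnj d * (h / (1 - z)))"] by (metis (no_types, lifting) cnj.sel(1) complex_cnj_cnj complex_cnj_diff complex_cnj_divide complex_cnj_mult complex_cnj_one times_divide_eq_left times_divide_eq_right mult.commute)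
  have "Re (X z * cnj h) = Re (z * cnj h) + q z * Re (d / (1 - cnj z) * cnj h)"
  proof -
    have "X z * cnj h = z * cnj h + of_real (q z) * (d / (1 - cnj z) * cnj h)"
      by (simp add: X_def algebra_simps)
    then show ?thesis by (simp only: plus_complex.sel Re_of_real_mult)
  qed
  moreover have "Re (cnj (of_real N * d) * (- h / (1 - z))) = - N * Re (d / (1 - cnj z) * cnj h)"
  proof -
    have "cnj (of_real N * d) * (- h / (1 - z)) = of_real (- N) * (cnj d * (h / (1 - z)))" by simp
    then show ?thesis using c by (simp only: Re_of_real_mult)
  qed
  ultimately have "N * q z powr (N - 1) * (- 2 * Re (z * cnj h)) * J z + J z * (2 * Re (cnj (of_real N * d) * (- h / (1 - z)))) * q z powr N
     = - 2 * N * p z * Re (X z * cnj h)"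
    unfolding qN p_def by (simp add: algebra_simps)
  then show ?thesis using D by simp
qed

end

lemma quadratic_imp_derivative_zero:
  fixes f :: "real \<Rightarrow> real"
  assumes "\<delta> > 0" "\<And>t. \<bar>t\<bar> \<le> \<delta> \<Longrightarrow> \<bar>f t\<bar> \<le> K * t\<^sup>2"
  shows "(f has_real_derivative 0) (at 0)"
proof -
  have f0: "f 0 = 0" using assms(2)[of 0] assms(1) by simp
  have "((\<lambda>t. (f t - f 0) / (t - 0)) \<longlongrightarrow> 0) (at 0)"
  proof (rule Lim_null_comparison)
    show "((\<lambda>t. K * \<bar>t\<bar>) \<longlongrightarrow> 0) (at (0::real))" by (auto intro!: tendsto_eq_intros)
    have "norm ((f t - f 0) / (t - 0)) \<le> K * \<bar>t\<bar>" if "t \<noteq> 0" "\<bar>t\<bar> < \<delta>" for t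
      using assms(2)[of t] that by (simp add: f0 abs_divide divide_le_eq power2_eq_square mult.assoc abs_mult_self_eq)
    then show "\<forall>\<^sub>F t in at 0. norm ((f t - f 0) / (t - 0)) \<le> K * \<bar>t\<bar>"
      unfolding eventually_at using assms(1) by (intro exI[of _ \<delta>]) auto
  qed
  then show ?thesis unfolding has_field_derivative_iff .
qed

lemma divergence_algebra:
  fixes A B C D r x W q p N :: real
  assumes "A + B = 2 - 2 * r" "C + D = x" "W = q * p"
  shows "(A * W - 2 * N * C * p) + (B * W - 2 * N * D * p) = 2 * (1 - r) * q * p - 2 * N * x * p"
proof -
  have "(A * W - 2 * N * C * p) + (B * W - 2 * N * D * p) = (A + B) * W - 2 * N * (C + D) * p"
    by (simp add: algebra_simps)
  then show ?thesis unfolding assms by (simp add: algebra_simps)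
qed

lemma moment_algebra:
  fixes S x I :: real
  assumes "S > 0"
  shows "(1 + 2 * x) * S * ((1 + 2 * x) / (S * S) * I) + (1 + 2 * x) / S * I = 2 * (1 + 2 * x) * (1 + x) / S * I"
  using assms by (simp add: field_simps)

context jacobi_disc
begin

lemma flux_bound:
  assumes K: "\<And>z. cmod z < 1 \<Longrightarrow> J z \<le> K" and h: "cmod h = 1" and z: "cmod z < 1"
  shows "\<bar>flux h z\<bar> \<le> (1 + 2 * cmod d) * K * q z powr N"
proof -
  have "\<bar>Re (X z * cnj h)\<bar> \<le> 1 + 2 * cmod d"
    using abs_Re_le_cmod[of "X z * cnj h"] X_bound[OF z] h by (simp add: norm_mult)
  moreover have "\<bar>weight z\<bar> \<le> K * q z powr N"
  proof -
    have "q z powr N * J z \<le> q z powr N * K" using K[OF z] by (intro mult_left_mono) auto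
    moreover have "J z \<ge> 0" by (simp add: J_def)
    ultimately show ?thesis unfolding weight_def by (simp add: abs_mult mult.commute)
  qed
  ultimately have "\<bar>Re (X z * cnj h)\<bar> * \<bar>weight z\<bar> \<le> (1 + 2 * cmod d) * (K * q z powr N)"
    by (intro mult_mono) auto
  then show ?thesis using z by (simp add: flux_def abs_mult mult.assoc)
qed

text \<open>
  Inside the disc this is the product rule. On the unit circle the flux is bounded by a multiple of \<open>q powr N \<le> q\<^sup>2\<close>,
  which is quadratic in the displacement.
\<close>
lemma flux_derivative:
  assumes h: "cmod h = 1"
  shows "((\<lambda>t. flux h (z + of_real t * h)) has_real_derivative dflux h z) (at 0)"
proof (cases "cmod z < 1")
  case z: True
  have "((\<lambda>t. X (z + of_real t * h) * cnj h) has_vector_derivative dX h z * cnj h) (at 0)"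
    by (rule has_vector_derivative_mult_left[OF X_derivative[OF z]])
  from bounded_linear.has_vector_derivative[OF bounded_linear_Re this]
  have R: "((\<lambda>t. Re (X (z + of_real t * h) * cnj h)) has_real_derivative Re (dX h z * cnj h)) (at 0)"
    by (simp only: has_real_derivative_iff_has_vector_derivative)
  have D: "((\<lambda>t. Re (X (z + of_real t * h) * cnj h) * weight (z + of_real t * h)) has_real_derivative dflux h z) (at 0)"
    using DERIV_mult[OF R weight_derivative[OF z, of h]] z
    by (simp add: dflux_def power2_eq_square algebra_simps)
  have "\<forall>\<^sub>F t in nhds 0. cmod (z + of_real t * h) < 1"
    unfolding eventually_nhds_metric
  proof (intro exI[of _ "1 - cmod z"] conjI allI impI)
    show "0 < 1 - cmod z" using z by simp
    fix t :: real assume "dist t 0 < 1 - cmod z"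
    then have "cmod z + cmod (of_real t * h) < 1" using h by (simp add: norm_mult)
    then show "cmod (z + of_real t * h) < 1" using norm_triangle_ineq[of z "of_real t * h"] by linarith
  qed
  then have ev: "\<forall>\<^sub>F t in nhds 0. Re (X (z + of_real t * h) * cnj h) * weight (z + of_real t * h) = flux h (z + of_real t * h)"
    by eventually_elim (simp add: flux_def)
  show ?thesis using D DERIV_cong_ev[OF refl ev refl] by simp
next
  case z: False
  obtain K where K: "K > 0" "\<And>z. cmod z < 1 \<Longrightarrow> J z \<le> K" using J_bounded by blast
  have "\<bar>flux h (z + of_real t * h)\<bar> \<le> ((1 + 2 * cmod d) * K * 4) * t\<^sup>2" if t: "\<bar>t\<bar> \<le> 1 / 2" for t
  proof (cases "cmod (z + of_real t * h) < 1")
    case True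
    let ?w = "z + of_real t * h"
    have "cmod (of_real t * h) = \<bar>t\<bar>" using h by (simp add: norm_mult)
    then have "cmod ?w \<ge> 1 - \<bar>t\<bar>" using norm_triangle_ineq2[of z "- (of_real t * h)"] z by simp
    then have "(1 - \<bar>t\<bar>)\<^sup>2 \<le> (cmod ?w)\<^sup>2" using t by (intro power_mono) auto
    moreover have "1 - 2 * \<bar>t\<bar> \<le> (1 - \<bar>t\<bar>)\<^sup>2" by (simp add: power2_eq_square algebra_simps)
    ultimately have "q ?w \<le> 2 * \<bar>t\<bar>" unfolding q_def by linarith
    have qq: "0 < q ?w" "q ?w \<le> 1" using q_pos(1)[OF True] q_pos(2) by auto
    have "q ?w powr N \<le> q ?w powr 2" using qq N by (intro powr_mono') auto
    also have "\<dots> = (q ?w)\<^sup>2" using qq by simp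
    also have "\<dots> \<le> (2 * \<bar>t\<bar>)\<^sup>2" using qq \<open>q ?w \<le> 2 * \<bar>t\<bar>\<close> by (intro power_mono) auto
    also have "\<dots> = 4 * t\<^sup>2" by (simp add: power_mult_distrib)
    finally have "(1 + 2 * cmod d) * K * q ?w powr N \<le> (1 + 2 * cmod d) * K * (4 * t\<^sup>2)"
      using K(1) by (intro mult_left_mono) auto
    then show ?thesis using flux_bound[OF K(2) h True] by (simp add: mult.assoc)
  next
    case False
    then show ?thesis using K(1) by (simp add: flux_def)
  qed
  from quadratic_imp_derivative_zero[of "1/2", OF _ this]
  show ?thesis using z by (simp add: dflux_def)
qed

lemma continuous_on_disc:
  "continuous_on (ball 0 1) q" "continuous_on (ball 0 1) J" "continuous_on (ball 0 1) p" "continuous_on (ball 0 1) X"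
  "continuous_on (ball 0 1) weight"
proof -
  show q: "continuous_on (ball 0 1) q" unfolding q_def[abs_def] by (intro continuous_intros)
  have nr: "1 - z \<notin> \<real>\<^sub>\<le>\<^sub>0" if "z \<in> ball 0 1" for z :: complex
    using Re_pos[of z] that by (auto simp: complex_nonpos_Reals_iff)
  show J: "continuous_on (ball 0 1) J" unfolding J_def[abs_def] using nr by (intro continuous_intros) auto
  have q0: "q z \<noteq> 0" if "z \<in> ball 0 1" for z using q_pos(1)[of z] that by auto
  show "continuous_on (ball 0 1) p" "continuous_on (ball 0 1) weight"
    unfolding p_def[abs_def] weight_def[abs_def] using q J q0 by (auto intro!: continuous_intros)
  have "1 - cnj z \<noteq> 0" if "z \<in> ball 0 1" for z using Re_pos[of z] that by (auto simp: complex_eq_iff)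
  then show "continuous_on (ball 0 1) X" unfolding X_def[abs_def] using q by (intro continuous_intros) auto
qed

lemma measurable_flux: "flux h \<in> borel_measurable borel"
proof -
  have "continuous_on (ball 0 1) (\<lambda>z. Re (X z * cnj h) * weight z)"
    using continuous_on_disc by (intro continuous_intros)
  then have "(\<lambda>z. indicator (ball 0 1) z *\<^sub>R (Re (X z * cnj h) * weight z)) \<in> borel_measurable borel"
    by (intro borel_measurable_continuous_on_indicator) auto
  moreover have "flux h = (\<lambda>z. indicator (ball 0 1) z *\<^sub>R (Re (X z * cnj h) * weight z))"
    by (auto simp: flux_def indicator_def fun_eq_iff)
  ultimately show ?thesis by simp
qed

lemma dflux_bound:
  assumes h: "cmod h = 1"
  obtains B where "\<And>z. \<bar>dflux h z\<bar> \<le> B"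
proof -
  obtain K where K: "K > 0" "\<And>z. cmod z < 1 \<Longrightarrow> J z \<le> K" using J_bounded by blast
  have "\<bar>dflux h z\<bar> \<le> (1 + 8 * cmod d) * K + 2 * N * (1 + 2 * cmod d)\<^sup>2 * K" for z
  proof (cases "cmod z < 1")
    case z: True
    define r where "r = of_real (q z) / (1 - cnj z)"
    have r: "cmod r \<le> 2" unfolding r_def by (rule norm_frac[OF z])
    have pK: "0 \<le> p z" "p z \<le> K" using p_nonneg p_le_J[OF z] K(2)[OF z] by auto
    have nz: "1 - cnj z \<noteq> 0" using Re_pos[OF z] by (auto simp: complex_eq_iff)
    have "of_real (q z) * dX h z = of_real (q z) * h + d * (of_real (- 2 * Re (z * cnj h)) * r + r\<^sup>2 * cnj h)"
      unfolding dX_def r_def using nz by (simp add: field_simps power2_eq_square)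
    then have "cmod (of_real (q z) * dX h z) \<le> cmod (of_real (q z) * h) + cmod (d * (of_real (- 2 * Re (z * cnj h)) * r + r\<^sup>2 * cnj h))"
      by (metis norm_triangle_ineq)
    also have "\<dots> \<le> 1 + cmod d * (2 * 2 + 2\<^sup>2)"
    proof (rule add_mono)
      show "cmod (of_real (q z) * h) \<le> 1" using q_pos(1)[OF z] q_pos(2)[of z] h by (simp add: norm_mult)
      have "\<bar>Re (z * cnj h)\<bar> \<le> 1" using abs_Re_le_cmod[of "z * cnj h"] z h by (simp add: norm_mult)
      then have "cmod (of_real (- 2 * Re (z * cnj h))) \<le> 2" unfolding norm_of_real abs_mult by simp
      then have "cmod (of_real (- 2 * Re (z * cnj h)) * r) \<le> 2 * 2" unfolding norm_mult using r by (intro mult_mono) auto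
      moreover have "cmod (r\<^sup>2 * cnj h) \<le> 2\<^sup>2" using power_mono[OF r, of 2] h by (simp add: norm_mult norm_power)
      ultimately have "cmod (of_real (- 2 * Re (z * cnj h)) * r + r\<^sup>2 * cnj h) \<le> 2 * 2 + 2\<^sup>2"
        by (intro norm_triangle_le) simp
      then show "cmod (d * (of_real (- 2 * Re (z * cnj h)) * r + r\<^sup>2 * cnj h)) \<le> cmod d * (2 * 2 + 2\<^sup>2)"
        unfolding norm_mult by (intro mult_left_mono) auto
    qed
    finally have b: "q z * cmod (dX h z) \<le> 1 + 8 * cmod d" using q_pos(1)[OF z] by (simp add: norm_mult)
    have "\<bar>Re (dX h z * cnj h) * weight z\<bar> = \<bar>Re (dX h z * cnj h)\<bar> * (q z * p z)"
      using weight_eq[OF z] q_pos(1)[OF z] pK by (simp add: abs_mult)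
    also have "\<dots> \<le> cmod (dX h z) * (q z * p z)"
      using abs_Re_le_cmod[of "dX h z * cnj h"] h q_pos(1)[OF z] pK by (intro mult_right_mono) (auto simp: norm_mult)
    also have "\<dots> = (q z * cmod (dX h z)) * p z" by simp
    also have "\<dots> \<le> (1 + 8 * cmod d) * K" using b pK by (intro mult_mono) auto
    finally have 1: "\<bar>Re (dX h z * cnj h) * weight z\<bar> \<le> (1 + 8 * cmod d) * K" .
    have "\<bar>Re (X z * cnj h)\<bar> \<le> 1 + 2 * cmod d"
      using abs_Re_le_cmod[of "X z * cnj h"] X_bound[OF z] h by (simp add: norm_mult)
    then have "(Re (X z * cnj h))\<^sup>2 \<le> (1 + 2 * cmod d)\<^sup>2" using power_mono[of "\<bar>Re (X z * cnj h)\<bar>" _ 2] by simp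
    then have "2 * N * (Re (X z * cnj h))\<^sup>2 * p z \<le> 2 * N * (1 + 2 * cmod d)\<^sup>2 * K"
      using N pK by (intro mult_mono) auto
    moreover have "0 \<le> 2 * N * (Re (X z * cnj h))\<^sup>2 * p z" using N pK by simp
    ultimately have "\<bar>Re (dX h z * cnj h) * weight z - 2 * N * (Re (X z * cnj h))\<^sup>2 * p z\<bar>
        \<le> (1 + 8 * cmod d) * K + 2 * N * (1 + 2 * cmod d)\<^sup>2 * K" using 1 by linarith
    then show ?thesis using z unfolding dflux_def by simp
  next
    case False
    have "0 \<le> (1 + 8 * cmod d) * K" "0 \<le> 2 * N * (1 + 2 * cmod d)\<^sup>2 * K"
      using K(1) N by (auto intro!: mult_nonneg_nonneg)
    then show ?thesis using False by (simp add: dflux_def)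
  qed
  then show ?thesis using that by blast
qed

lemma flux_integral:
  assumes "cmod h = 1"
  shows "integrable lborel (dflux h)" "integral\<^sup>L lborel (dflux h) = 0"
proof -
  obtain B where B: "\<And>z. \<bar>dflux h z\<bar> \<le> B" using dflux_bound[OF assms] by blast
  show "integrable lborel (dflux h)" "integral\<^sup>L lborel (dflux h) = 0"
    using integral_directional_derivative_zero[OF measurable_flux flux_derivative[OF assms] B _ assms]
    by (auto simp: flux_def)
qed

text \<open>
  The two directional derivatives add up to the divergence of \<open>X * weight\<close>; the second term comes from the
  gradient of the weight, which is proportional to \<open>X\<close> itself.
\<close>
lemma dflux_sum:
  assumes z: "cmod z < 1"
  shows "dflux 1 z + dflux \<i> z = 2 * (1 - Re (d * cnj z / (1 - cnj z))) * q z * p z - 2 * N * (cmod (X z))\<^sup>2 * p z"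
proof -
  have "dX 1 z * cnj 1 + dX \<i> z * cnj \<i> = 2 - 2 * (d * cnj z / (1 - cnj z))"
  proof -
    have "complex_of_real (Re z) - \<i> * of_real (Im z) = cnj z" by (simp add: complex_eq_iff)
    then show ?thesis
      by (simp add: dX_def divide_inverse algebra_simps)
  qed
  then have "Re (dX 1 z * cnj 1) + Re (dX \<i> z * cnj \<i>) = 2 - 2 * Re (d * cnj z / (1 - cnj z))"
    by (metis (no_types, lifting) Re_complex_of_real minus_complex.sel(1) mult_2 of_real_numeral plus_complex.sel(1) Re_divide_numeral)
  moreover have "(Re (X z * cnj 1))\<^sup>2 + (Re (X z * cnj \<i>))\<^sup>2 = (cmod (X z))\<^sup>2"
    by (simp add: cmod_power2)
  ultimately show ?thesis
    unfolding dflux_def if_P[OF z] using weight_eq[OF z] by (rule divergence_algebra)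
qed

lemma p_integrable:
  assumes c: "continuous_on (ball 0 1) f" and b: "\<And>z. cmod z < 1 \<Longrightarrow> \<bar>f z\<bar> \<le> C"
  shows "integrable lborel (\<lambda>z. indicator (ball 0 1) z *\<^sub>R (f z * p z))"
proof -
  obtain K where K: "K > 0" "\<And>z. cmod z < 1 \<Longrightarrow> J z \<le> K" using J_bounded by blast
  have w: "integrable lborel (\<lambda>z :: complex. (C * K) * indicator (ball 0 1) z)"
    by (intro integrable_mult_right integrable_real_indicator) (simp_all only: emeasure_bounded_finite bounded_ball sets_lborel borel_open open_ball)
  show ?thesis
  proof (rule Bochner_Integration.integrable_bound[OF w])
    have "continuous_on (ball 0 1) (\<lambda>z. f z * p z)" using c continuous_on_disc by (intro continuous_intros)
    then show "(\<lambda>z. indicator (ball 0 1) z *\<^sub>R (f z * p z)) \<in> borel_measurable lborel"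
      using borel_measurable_continuous_on_indicator[of "ball 0 1" "\<lambda>z. f z * p z"] by simp
    have "\<bar>f z * p z\<bar> \<le> C * K" if z: "cmod z < 1" for z
    proof -
      have "\<bar>p z\<bar> \<le> K" using p_nonneg[of z] p_le_J[OF z] K(2)[OF z] by simp
      moreover have "0 \<le> C" using b[OF z] by linarith
      ultimately show ?thesis unfolding abs_mult using b[OF z] by (intro mult_mono) auto
    qed
    then have "norm (indicator (ball 0 1) z *\<^sub>R (f z * p z)) \<le> norm ((C * K) * indicator (ball 0 1) z)" for z
      by (cases "cmod z < 1") (force simp: indicator_def)+
    then show "AE z in lborel. norm (indicator (ball 0 1) z *\<^sub>R (f z * p z)) \<le> norm ((C * K) * indicator (ball 0 1) z)"
      by simp
  qed
qed

text \<open>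
  The divergence of \<open>X * weight\<close> has integral \<open>0\<close>, and \<open>q * div X\<close> is bounded independently of \<open>N\<close>.
\<close>
lemma X_second_moment:
  "(LINT z|lborel. indicator (ball 0 1) z *\<^sub>R ((cmod (X z))\<^sup>2 * p z))
     \<le> (1 + 2 * cmod d) / N * (LINT z|lborel. indicator (ball 0 1) z *\<^sub>R (1 * p z))"
proof -
  let ?c = "1 + 2 * cmod d"
  have iX: "integrable lborel (\<lambda>z. indicator (ball 0 1) z *\<^sub>R ((cmod (X z))\<^sup>2 * p z))"
  proof (rule p_integrable[where C = "?c\<^sup>2"])
    show "continuous_on (ball 0 1) (\<lambda>z. (cmod (X z))\<^sup>2)" using continuous_on_disc by (intro continuous_intros)
    show "\<bar>(cmod (X z))\<^sup>2\<bar> \<le> ?c\<^sup>2" if "cmod z < 1" for z using power_mono[OF X_bound[OF that], of 2] by simp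
  qed
  have i1: "integrable lborel (\<lambda>z. indicator (ball 0 1) z *\<^sub>R (1 * p z))"
    by (rule p_integrable[where C = 1]) auto
  have "0 = integral\<^sup>L lborel (\<lambda>z. dflux 1 z + dflux \<i> z)"
    using flux_integral[of 1] flux_integral[of \<i>] by simp
  also have "\<dots> \<le> integral\<^sup>L lborel (\<lambda>z. 2 * ?c * (indicator (ball 0 1) z *\<^sub>R (1 * p z)) - 2 * N * (indicator (ball 0 1) z *\<^sub>R ((cmod (X z))\<^sup>2 * p z)))"
  proof (rule integral_mono)
    show "integrable lborel (\<lambda>z. dflux 1 z + dflux \<i> z)"
      using flux_integral[of 1] flux_integral[of \<i>] by (intro Bochner_Integration.integrable_add) auto
    show "integrable lborel (\<lambda>z. 2 * ?c * (indicator (ball 0 1) z *\<^sub>R (1 * p z)) - 2 * N * (indicator (ball 0 1) z *\<^sub>R ((cmod (X z))\<^sup>2 * p z)))"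
      by (intro Bochner_Integration.integrable_diff integrable_mult_right i1 iX)
    fix z
    show "dflux 1 z + dflux \<i> z \<le> 2 * ?c * (indicator (ball 0 1) z *\<^sub>R (1 * p z)) - 2 * N * (indicator (ball 0 1) z *\<^sub>R ((cmod (X z))\<^sup>2 * p z))"
    proof (cases "cmod z < 1")
      case z: True
      let ?r = "d * cnj z / (1 - cnj z)"
      have "(1 - Re ?r) * q z \<le> ?c"
      proof -
        have "cmod (of_real (q z) * ?r) = cmod d * cmod z * cmod (of_real (q z) / (1 - cnj z))"
          by (simp add: norm_mult norm_divide)
        also have "\<dots> \<le> cmod d * 1 * 2" using norm_frac[OF z] z by (intro mult_mono) auto
        finally have "\<bar>Re (of_real (q z) * ?r)\<bar> \<le> 2 * cmod d" using abs_Re_le_cmod[of "of_real (q z) * ?r"] by linarith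
        then have "\<bar>q z * Re ?r\<bar> \<le> 2 * cmod d" unfolding Re_of_real_mult .
        then have "q z - q z * Re ?r \<le> ?c" using q_pos(2)[of z] by linarith
        then show ?thesis by (simp add: algebra_simps)
      qed
      then have "2 * ((1 - Re ?r) * q z) * p z \<le> 2 * ?c * p z" using p_nonneg[of z] by (intro mult_right_mono mult_left_mono) auto
      then have f: "2 * (1 - Re ?r) * q z * p z \<le> 2 * ?c * p z" by (simp only: mult.assoc)
      have i: "indicator (ball 0 1) z = (1 :: real)" using z by simp
      show ?thesis
        unfolding dflux_sum[OF z] i scaleR_one mult_1_left using diff_right_mono[OF f] by (simp only: mult.assoc)
    qed (simp add: dflux_def)
  qed
  also have "\<dots> = 2 * ?c * (LINT z|lborel. indicator (ball 0 1) z *\<^sub>R (1 * p z)) - 2 * N * (LINT z|lborel. indicator (ball 0 1) z *\<^sub>R ((cmod (X z))\<^sup>2 * p z))"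
    using i1 iX by (simp only: Bochner_Integration.integral_diff integrable_mult_right integral_mult_right_zero)
  finally show ?thesis using N by (simp add: field_simps)
qed

text \<open>
  The zero of \<open>X\<close>, i.e. the maximum of \<open>q powr N * J\<close>.
\<close>
definition mode :: complex where "mode = - d / (1 + cnj d)"

text \<open>
  In the half-plane variable \<open>w = (1 + z) / (1 - z)\<close> the field \<open>X\<close> becomes real-affine,
  \<open>X * (w + 1) = (w - 1) + 2 * d * Re w\<close>, so it controls \<open>w - w\<^sub>*\<close> linearly, where \<open>w\<^sub>*\<close> corresponds to the mode.
\<close>
lemma norm_mode_diff:
  assumes z: "cmod z < 1" shows "cmod (z - mode) \<le> 2 * (1 + 2 * cmod d) * cmod (X z)"
proof -
  define w where "w = (1 + z) / (1 - z)"
  define ws where "ws = (1 + mode) / (1 - mode)"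
  have nz: "1 - z \<noteq> 0" "1 - cnj z \<noteq> 0" using Re_pos[OF z] by (auto simp: complex_eq_iff)
  have nd: "1 + cnj d \<noteq> 0" "1 + d \<noteq> 0" using d by (auto simp: complex_eq_iff)
  have a2: "1 + d + cnj d = of_real (1 + 2 * Re d)" by (simp add: complex_eq_iff)
  have a2p: "1 + 2 * Re d > 0" using d by simp
  have nzd: "1 + d + cnj d \<noteq> 0" unfolding a2 using a2p by (simp only: of_real_eq_0_iff)
  have w1: "w + 1 = 2 / (1 - z)" using nz by (simp add: w_def field_simps)
  have zw: "z = (w - 1) / (w + 1)" unfolding w1 using nz by (simp add: w_def field_simps)
  have qzz: "of_real (q z) = 1 - z * cnj z" by (simp only: q_def of_real_diff of_real_1 complex_norm_square)
  have Rew: "of_real (Re w) = of_real (q z) / ((1 - z) * (1 - cnj z))"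
  proof -
    have "2 * complex_of_real (Re w) = w + cnj w" by (simp add: complex_add_cnj)
    also have "\<dots> = 2 * (of_real (q z) / ((1 - z) * (1 - cnj z)))"
      unfolding w_def qzz using nz by (simp add: field_simps)
    finally show ?thesis by (subst (asm) mult_left_cancel) auto
  qed
  have Xw: "X z * (w + 1) = (w - 1) + 2 * d * of_real (Re w)"
  proof -
    have "X z * (w + 1) = z * (w + 1) + 2 * d * (of_real (q z) / ((1 - z) * (1 - cnj z)))"
    proof -
      have "d * of_real (q z) / (1 - cnj z) * (w + 1) = 2 * d * (of_real (q z) / ((1 - z) * (1 - cnj z)))"
        unfolding w1 by (simp add: mult_ac)
      then show ?thesis unfolding X_def distrib_right[of z] by simp
    qed
    also have "z * (w + 1) = w - 1" unfolding w1 using nz by (simp add: w_def field_simps)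
    finally show ?thesis unfolding Rew .
  qed
  have nm: "1 - mode = (1 + d + cnj d) / (1 + cnj d)" unfolding mode_def using nd by (simp add: field_simps)
  have pm: "1 + mode = (1 + cnj d - d) / (1 + cnj d)" unfolding mode_def using nd by (simp add: field_simps)
  have ws: "ws = (1 + cnj d - d) / (1 + d + cnj d)"
    unfolding ws_def pm nm using nd by simp
  have Rews: "Re ws = 1 / (1 + 2 * Re d)"
  proof -
    have "1 + cnj d - d = Complex 1 (- 2 * Im d)" by (simp add: complex_eq_iff)
    then show ?thesis unfolding ws a2 by (simp only: Re_divide_of_real complex.sel)
  qed
  have nm0: "1 - mode \<noteq> 0" unfolding nm using nzd nd by simp
  have ws1: "ws + 1 = 2 / (1 - mode)" using nm0 by (simp add: ws_def field_simps)
  have mw: "mode = (ws - 1) / (ws + 1)" unfolding ws1 using nm0 by (simp add: ws_def field_simps)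
  have eqs: "(ws - 1) + 2 * d * of_real (Re ws) = 0"
    unfolding Rews unfolding ws of_real_divide a2[symmetric] of_real_1 using nzd by (simp add: field_simps)
  define v where "v = w - ws"
  have Lv: "X z * (w + 1) = v + 2 * d * of_real (Re v)"
  proof -
    have "X z * (w + 1) = ((w - 1) + 2 * d * of_real (Re w)) - ((ws - 1) + 2 * d * of_real (Re ws))"
      unfolding Xw eqs by simp
    then show ?thesis by (simp add: v_def algebra_simps)
  qed
  have "\<bar>Re v\<bar> \<le> cmod (X z * (w + 1))"
  proof -
    have "Re (X z * (w + 1)) = (1 + 2 * Re d) * Re v" unfolding Lv by (simp add: algebra_simps)
    then have "\<bar>Re (X z * (w + 1))\<bar> = (1 + 2 * Re d) * \<bar>Re v\<bar>" using a2p by (simp only: abs_mult abs_of_pos)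
    moreover have "1 * \<bar>Re v\<bar> \<le> (1 + 2 * Re d) * \<bar>Re v\<bar>" using d by (intro mult_right_mono) auto
    ultimately show ?thesis using abs_Re_le_cmod[of "X z * (w + 1)"] by linarith
  qed
  note Rv = this
  have "v = X z * (w + 1) - 2 * d * of_real (Re v)" unfolding Lv by simp
  then have "cmod v \<le> cmod (X z * (w + 1)) + cmod (2 * d * of_real (Re v))" by (metis norm_triangle_ineq4)
  moreover have "cmod (2 * d * of_real (Re v)) = 2 * cmod d * \<bar>Re v\<bar>" by (simp add: norm_mult)
  moreover have "2 * cmod d * \<bar>Re v\<bar> \<le> 2 * cmod d * cmod (X z * (w + 1))" using Rv by (intro mult_left_mono) auto
  ultimately have "cmod v \<le> cmod (X z * (w + 1)) + 2 * cmod d * cmod (X z * (w + 1))" by linarith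
  then have vb: "cmod v \<le> (1 + 2 * cmod d) * (cmod (X z) * cmod (w + 1))"
    unfolding norm_mult by (simp only: distrib_right mult_1_left)
  have wn: "w + 1 \<noteq> 0" "ws + 1 \<noteq> 0" using w1 ws1 nz nm0 by auto
  have "z - mode = 2 * v / ((w + 1) * (ws + 1))"
  proof -
    have "(w - 1) / (w + 1) - (ws - 1) / (ws + 1) = 2 * v / ((w + 1) * (ws + 1))"
      using wn by (simp add: field_simps v_def)
    then show ?thesis using zw mw by metis
  qed
  then have zm: "cmod (z - mode) = 2 * cmod v / (cmod (w + 1) * cmod (ws + 1))" by (simp add: norm_mult norm_divide)
  have ge1: "cmod (ws + 1) \<ge> 1" 
  proof -
    have "0 \<le> Re ws" unfolding Rews using a2p by simp
    then show ?thesis using complex_Re_le_cmod[of "ws + 1"] by simp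
  qed
  have w0: "cmod (w + 1) > 0" "cmod (ws + 1) > 0" using wn by simp_all
  have "2 * cmod v / (cmod (w + 1) * cmod (ws + 1)) \<le> 2 * cmod v / (cmod (w + 1) * 1)"
    using ge1 w0 by (intro divide_left_mono mult_left_mono mult_pos_pos) auto
  also have "\<dots> \<le> 2 * ((1 + 2 * cmod d) * (cmod (X z) * cmod (w + 1))) / (cmod (w + 1) * 1)"
    using vb w0 by (intro divide_right_mono mult_left_mono) auto
  also have "\<dots> = 2 * (1 + 2 * cmod d) * cmod (X z)" using w0 by simp
  finally show ?thesis unfolding zm .
qed

lemma first_moment_bound:
  "(LINT z|lborel. indicator (ball 0 1) z *\<^sub>R (cmod (z - mode) * p z))
     \<le> 2 * (1 + 2 * cmod d) * (1 + cmod d) / sqrt N * (LINT z|lborel. indicator (ball 0 1) z *\<^sub>R (1 * p z))"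
proof -
  let ?c = "1 + 2 * cmod d"
  have sN: "sqrt N > 0" "sqrt N * sqrt N = N" using N by auto
  have iX: "integrable lborel (\<lambda>z. indicator (ball 0 1) z *\<^sub>R ((cmod (X z))\<^sup>2 * p z))"
  proof (rule p_integrable[where C = "?c\<^sup>2"])
    show "continuous_on (ball 0 1) (\<lambda>z. (cmod (X z))\<^sup>2)" using continuous_on_disc by (intro continuous_intros)
    show "\<bar>(cmod (X z))\<^sup>2\<bar> \<le> ?c\<^sup>2" if "cmod z < 1" for z using power_mono[OF X_bound[OF that], of 2] by simp
  qed
  have i1: "integrable lborel (\<lambda>z. indicator (ball 0 1) z *\<^sub>R (1 * p z))"
    by (rule p_integrable[where C = 1]) auto
  have im: "integrable lborel (\<lambda>z. indicator (ball 0 1) z *\<^sub>R (cmod (z - mode) * p z))"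
  proof (rule p_integrable[where C = "1 + cmod mode"])
    show "\<bar>cmod (z - mode)\<bar> \<le> 1 + cmod mode" if "cmod z < 1" for z
      using norm_triangle_ineq4[of z mode] that by simp
  qed (intro continuous_intros)
  have "(LINT z|lborel. indicator (ball 0 1) z *\<^sub>R (cmod (z - mode) * p z))
     \<le> (LINT z|lborel. ?c * sqrt N * (indicator (ball 0 1) z *\<^sub>R ((cmod (X z))\<^sup>2 * p z)) + ?c / sqrt N * (indicator (ball 0 1) z *\<^sub>R (1 * p z)))"
  proof (rule integral_mono[OF im])
    show "integrable lborel (\<lambda>z. ?c * sqrt N * (indicator (ball 0 1) z *\<^sub>R ((cmod (X z))\<^sup>2 * p z)) + ?c / sqrt N * (indicator (ball 0 1) z *\<^sub>R (1 * p z)))"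
      by (intro Bochner_Integration.integrable_add integrable_mult_right i1 iX)
    fix z
    show "indicator (ball 0 1) z *\<^sub>R (cmod (z - mode) * p z) \<le> ?c * sqrt N * (indicator (ball 0 1) z *\<^sub>R ((cmod (X z))\<^sup>2 * p z)) + ?c / sqrt N * (indicator (ball 0 1) z *\<^sub>R (1 * p z))"
    proof (cases "cmod z < 1")
      case z: True
      \<comment> \<open>The optimal form of \<open>2 * x \<le> c * x\<^sup>2 + 1 / c\<close> for second moments of order \<open>1 / N\<close>.\<close>
      have "0 \<le> (sqrt N * cmod (X z) - 1)\<^sup>2" by simp
      then have "2 * (sqrt N * cmod (X z)) \<le> (sqrt N * cmod (X z))\<^sup>2 + 1" by (simp add: power2_eq_square algebra_simps)
      then have "(2 * (sqrt N * cmod (X z))) / sqrt N \<le> ((sqrt N * cmod (X z))\<^sup>2 + 1) / sqrt N"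
        using sN by (intro divide_right_mono) auto
      then have "2 * cmod (X z) \<le> sqrt N * (cmod (X z))\<^sup>2 + 1 / sqrt N"
        using sN by (simp add: power2_eq_square add_divide_distrib mult_ac)
      then have "?c * (2 * cmod (X z)) \<le> ?c * (sqrt N * (cmod (X z))\<^sup>2 + 1 / sqrt N)" by (intro mult_left_mono) auto
      moreover have "cmod (z - mode) \<le> ?c * (2 * cmod (X z))" using norm_mode_diff[OF z] by (simp only: mult_ac)
      ultimately have "cmod (z - mode) * p z \<le> (?c * (sqrt N * (cmod (X z))\<^sup>2 + 1 / sqrt N)) * p z"
        using p_nonneg[of z] by (intro mult_right_mono) auto
      then show ?thesis using z by (simp add: distrib_left distrib_right add_divide_distrib mult_ac)
    qed simp
  qed
  also have "\<dots> = ?c * sqrt N * (LINT z|lborel. indicator (ball 0 1) z *\<^sub>R ((cmod (X z))\<^sup>2 * p z)) + ?c / sqrt N * (LINT z|lborel. indicator (ball 0 1) z *\<^sub>R (1 * p z))"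
    using i1 iX by (simp only: Bochner_Integration.integral_add integrable_mult_right integral_mult_right_zero)
  also have "\<dots> \<le> ?c * sqrt N * (?c / N * (LINT z|lborel. indicator (ball 0 1) z *\<^sub>R (1 * p z))) + ?c / sqrt N * (LINT z|lborel. indicator (ball 0 1) z *\<^sub>R (1 * p z))"
    using X_second_moment sN by (intro add_right_mono mult_left_mono) auto
  also have "?c * sqrt N * (?c / N * I) + ?c / sqrt N * I = 2 * ?c * (1 + cmod d) / sqrt N * I" for I
    using moment_algebra[OF sN(1), of "cmod d" I] unfolding sN(2) .
  finally show ?thesis .
qed

lemma nn_integral_jacobi:
  assumes c: "continuous_on UNIV f" and nn: "\<And>z. 0 \<le> f z" and b: "\<And>z. cmod z < 1 \<Longrightarrow> \<bar>f z\<bar> \<le> C"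
  shows "(\<integral>\<^sup>+z. ennreal (f z) * ennreal (jacobi_weight (of_real N * d) z) \<partial>disc_law (2 * N + 1))
     = ennreal (N / pi * (LINT z|lborel. indicator (ball 0 1) z *\<^sub>R (f z * p z)))"
proof -
  have s: "2 * N + 1 \<noteq> 1" using N by simp
  interpret V: verblunsky_law 1 "2 * N" by standard (use N in simp)
  have jm: "(\<lambda>z. ennreal (jacobi_weight (of_real N * d) z)) \<in> borel_measurable (disc_law (2 * N + 1))"
  proof -
    have "V.coeff_law 0 = disc_law (2 * N + 1)" unfolding V.coeff_law_def by simp
    then show ?thesis using V.measurable_jacobi_weight[of "of_real N * d" 0] by metis
  qed
  have "f \<in> borel_measurable borel" using c by (rule borel_measurable_continuous_onI)
  from measurable_compose[OF measurable_disc_law_id this] have "f \<in> borel_measurable (disc_law (2 * N + 1))" .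
  then have m: "(\<lambda>z. ennreal (f z) * ennreal (jacobi_weight (of_real N * d) z)) \<in> borel_measurable (disc_law (2 * N + 1))"
    using jm by measurable
  have int: "integrable lborel (\<lambda>z. indicator (ball 0 1) z *\<^sub>R (f z * p z))"
    by (rule p_integrable[OF continuous_on_subset[OF c] b]) auto
  have "(\<integral>\<^sup>+z. ennreal (f z) * ennreal (jacobi_weight (of_real N * d) z) \<partial>disc_law (2 * N + 1))
     = (\<integral>\<^sup>+z. ennreal (N / pi * (indicator (ball 0 1) z *\<^sub>R (f z * p z))) \<partial>lborel)"
    unfolding nn_integral_disc[OF s m]
  proof (rule nn_integral_cong)
    fix z
    show "ennreal ((2 * N + 1 - 1) / (2 * pi) * (1 - (cmod z)\<^sup>2) powr ((2 * N + 1 - 3) / 2)) * (ennreal (f z) * ennreal (jacobi_weight (of_real N * d) z)) * indicator (ball 0 1) z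
       = ennreal (N / pi * (indicator (ball 0 1) z *\<^sub>R (f z * p z)))"
    proof (cases "cmod z < 1")
      case z: True
      have z1: "z \<noteq> 1" using z by auto
      have e: "(2 * N + 1 - 1) / (2 * pi) = N / pi" "(2 * N + 1 - 3) / 2 = N - 1" by (simp_all add: field_simps)
      have jw: "jacobi_weight (of_real N * d) z = J z" using z1 by (simp add: jacobi_weight_def J_def)
      have i: "indicator (ball 0 1) z = (1 :: ennreal)" "indicator (ball 0 1) z = (1 :: real)" using z by simp_all
      have "ennreal (N / pi * q z powr (N - 1)) * (ennreal (f z) * ennreal (J z)) = ennreal (N / pi * q z powr (N - 1) * (f z * J z))"
      proof -
        have J0: "J z \<ge> 0" by (simp add: J_def)
        have "0 \<le> f z * J z" "0 \<le> N / pi * q z powr (N - 1)" using nn[of z] J0 N by simp_all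
        then show ?thesis unfolding ennreal_mult[OF nn J0, symmetric] by (rule ennreal_mult[symmetric, rotated])
      qed
      also have "N / pi * q z powr (N - 1) * (f z * J z) = N / pi * (f z * p z)" by (simp add: p_def mult_ac)
      finally show ?thesis unfolding e jw i q_def[symmetric] by simp
    qed simp
  qed
  also have "\<dots> = ennreal (LINT z|lborel. N / pi * (indicator (ball 0 1) z *\<^sub>R (f z * p z)))"
    using int nn p_nonneg N by (intro nn_integral_eq_integral integrable_mult_right) (auto simp: indicator_def)
  finally show ?thesis by (simp only: integral_mult_right_zero)
qed

text \<open>
  Second moments of \<open>X\<close> of order \<open>1 / N\<close> give first moments of order \<open>1 / sqrt N\<close>, and \<open>X\<close> dominates the distance to the mode.
\<close>
theorem disc_law_concentration:
  "(\<integral>\<^sup>+z. ennreal (cmod (z - mode)) * ennreal (jacobi_weight (of_real N * d) z) \<partial>disc_law (2 * N + 1))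
     \<le> ennreal (2 * (1 + 2 * cmod d) * (1 + cmod d) / sqrt N) * (\<integral>\<^sup>+z. ennreal (jacobi_weight (of_real N * d) z) \<partial>disc_law (2 * N + 1))"
proof -
  define I where "I = (LINT z|lborel. indicator (ball 0 1) z *\<^sub>R (1 * p z))"
  have c: "continuous_on UNIV (\<lambda>z. cmod (z - mode))" by (intro continuous_intros)
  have b: "\<bar>cmod (z - mode)\<bar> \<le> 1 + cmod mode" if "cmod z < 1" for z
    using norm_triangle_ineq4[of z mode] that by simp
  have c1: "continuous_on UNIV (\<lambda>z :: complex. 1 :: real)" by (intro continuous_intros)
  have A: "(\<integral>\<^sup>+z. ennreal (cmod (z - mode)) * ennreal (jacobi_weight (of_real N * d) z) \<partial>disc_law (2 * N + 1))
     = ennreal (N / pi * (LINT z|lborel. indicator (ball 0 1) z *\<^sub>R (cmod (z - mode) * p z)))"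
    by (rule nn_integral_jacobi[OF c _ b]) auto
  have B: "(\<integral>\<^sup>+z. ennreal (jacobi_weight (of_real N * d) z) \<partial>disc_law (2 * N + 1)) = ennreal (N / pi * I)"
    using nn_integral_jacobi[OF c1, of 1] unfolding I_def by simp
  let ?K = "2 * (1 + 2 * cmod d) * (1 + cmod d) / sqrt N"
  have "N / pi * (LINT z|lborel. indicator (ball 0 1) z *\<^sub>R (cmod (z - mode) * p z)) \<le> N / pi * (?K * I)"
    unfolding I_def using first_moment_bound N by (intro mult_left_mono) auto
  also have "\<dots> = ?K * (N / pi * I)" by (simp only: mult_ac)
  finally have "ennreal (N / pi * (LINT z|lborel. indicator (ball 0 1) z *\<^sub>R (cmod (z - mode) * p z))) \<le> ennreal (?K * (N / pi * I))"
    by (rule ennreal_leI)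
  also have "\<dots> = ennreal ?K * ennreal (N / pi * I)" using N by (intro ennreal_mult') auto
  finally show ?thesis unfolding A B .
qed

end

section \<open>The limiting recursion and its fixed point\<close>

text \<open>
  The half-plane variable, in which the limiting objects are square roots of quadratic polynomials.
\<close>
definition cayley :: "complex \<Rightarrow> complex" where "cayley z = (1 + z) / (1 - z)"

lemma cayley_pos: "cmod z < 1 \<Longrightarrow> Re (cayley z) > 0"
proof -
  assume z: "cmod z < 1"
  then have nz: "1 - z \<noteq> 0" by auto
  have "(cmod z)\<^sup>2 < 1" using z by (simp add: abs_square_less_1)
  then have "1 - (Re z)\<^sup>2 - (Im z)\<^sup>2 > 0" by (simp add: cmod_power2)
  moreover have "(1 - Re z)\<^sup>2 + (Im z)\<^sup>2 > 0" using nz by (simp add: complex_eq_iff sum_power2_gt_zero_iff)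
  moreover have "Re (cayley z) = (1 - (Re z)\<^sup>2 - (Im z)\<^sup>2) / ((1 - Re z)\<^sup>2 + (Im z)\<^sup>2)"
    by (simp add: cayley_def Re_divide power2_eq_square algebra_simps)
  ultimately show ?thesis by simp
qed

text \<open>
  For a level \<open>s > 0\<close>, \<open>herglotz s\<close> below is \<open>s\<close> times the Herglotz function of the limit with parameter \<open>d / s\<close>. Keeping \<open>s\<close> as a
  scale, instead of dividing by it, makes all quantities polynomial in \<open>s\<close> and \<open>d\<close>.
\<close>
locale hua_pickrell =
  fixes d :: complex
  assumes d: "Re d \<ge> 0"
begin

definition A :: "complex \<Rightarrow> complex" where "A k = of_real (Re d) * k + \<i> * of_real (Im d)"

definition B :: "complex \<Rightarrow> complex" where "B k = of_real (Re d) + \<i> * of_real (Im d) * k"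

definition Disc :: "real \<Rightarrow> complex \<Rightarrow> complex" where
  "Disc s k = (of_real s)\<^sup>2 + 2 * of_real s * B k + (A k)\<^sup>2"

definition Root :: "real \<Rightarrow> complex \<Rightarrow> complex" where "Root s k = csqrt (Disc s k)"

lemma Root_sq: "(Root s k)\<^sup>2 = Disc s k" by (simp add: Root_def)

lemma Re_Disc: "Re (Disc s k) = (Re d)\<^sup>2 * (Re k)\<^sup>2 - (Re d)\<^sup>2 * (Im k)\<^sup>2 - 2 * Im d * (s + Re d) * Im k + s\<^sup>2 + 2 * Re d * s - (Im d)\<^sup>2"
  and Im_Disc: "Im (Disc s k) = 2 * Re k * ((Re d)\<^sup>2 * Im k + Im d * (s + Re d))"
  by (simp_all add: Disc_def A_def B_def power2_eq_square algebra_simps)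

text \<open>
  The constant term left in \<open>Disc s\<close> after completing the square in the imaginary part of \<open>k\<close>.
\<close>
lemma disc_const:
  assumes "s > 0" "Re d > 0"
  shows "s\<^sup>2 + 2 * Re d * s - (Im d)\<^sup>2 + (Im d * (s + Re d))\<^sup>2 / (Re d)\<^sup>2 > 0"
proof -
  have "(Re d)\<^sup>2 \<le> (s + Re d)\<^sup>2" using assms by (intro power_mono) auto
  then have "(Im d)\<^sup>2 * (Re d)\<^sup>2 \<le> (Im d)\<^sup>2 * (s + Re d)\<^sup>2" by (intro mult_left_mono) auto
  then have "(Im d)\<^sup>2 \<le> (Im d * (s + Re d))\<^sup>2 / (Re d)\<^sup>2"
    using assms by (simp add: le_divide_eq power_mult_distrib)
  moreover have "s\<^sup>2 + 2 * Re d * s > 0" using assms by (simp add: add_pos_pos)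
  ultimately show ?thesis by linarith
qed

text \<open>
  On the half-plane the discriminant is real only where its linear imaginary part vanishes, and there completing the square
  shows that it is positive. So the principal square root is holomorphic in \<open>k\<close>.
\<close>
lemma Disc_slit:
  assumes s: "s > 0" and k: "Re k > 0" shows "Disc s k \<notin> \<real>\<^sub>\<le>\<^sub>0"
proof
  assume "Disc s k \<in> \<real>\<^sub>\<le>\<^sub>0"
  then have re: "Re (Disc s k) \<le> 0" and im: "Im (Disc s k) = 0" by (auto simp: complex_nonpos_Reals_iff)
  have e: "(Re d)\<^sup>2 * Im k = - (Im d * (s + Re d))" using im k unfolding Im_Disc by simp
  show False
  proof (cases "Re d = 0")
    case True
    then have "Im d = 0" using e s by simp
    then show False using re True s unfolding Re_Disc by simp
  next
    case False
    then have a: "Re d > 0" using d by simp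
    have e2: "(Im d * (s + Re d))\<^sup>2 / (Re d)\<^sup>2 = (Re d)\<^sup>2 * (Im k)\<^sup>2"
    proof -
      have "(Im d * (s + Re d))\<^sup>2 = ((Re d)\<^sup>2 * Im k)\<^sup>2" using e by (simp add: power2_eq_square)
      then show ?thesis using a by (simp add: power_mult_distrib power2_eq_square)
    qed
    have "- (2 * Im d * (s + Re d) * Im k) = 2 * ((Re d)\<^sup>2 * Im k) * Im k" unfolding e by (simp add: algebra_simps)
    also have "\<dots> = 2 * ((Re d)\<^sup>2 * (Im k)\<^sup>2)" by (simp add: power2_eq_square)
    finally have "Re (Disc s k) = (Re d)\<^sup>2 * (Re k)\<^sup>2 + ((Re d)\<^sup>2 * (Im k)\<^sup>2) + s\<^sup>2 + 2 * Re d * s - (Im d)\<^sup>2"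
      unfolding Re_Disc by linarith
    moreover have "0 \<le> (Re d)\<^sup>2 * (Re k)\<^sup>2" by simp
    ultimately show False using re disc_const[OF s a] e2 by linarith
  qed
qed

lemma Root_pos: "s > 0 \<Longrightarrow> Re k > 0 \<Longrightarrow> Re (Root s k) > 0"
proof -
  assume a: "s > 0" "Re k > 0"
  have "Re (Root s k) \<ge> 0" using csqrt_principal[of "Disc s k"] unfolding Root_def by auto
  moreover have "Re (Root s k) \<noteq> 0"
  proof
    assume z: "Re (Root s k) = 0"
    have "Disc s k = (Root s k)\<^sup>2" by (simp add: Root_sq)
    also have "\<dots> = of_real (- (Im (Root s k))\<^sup>2)" using z by (simp add: complex_eq_iff power2_eq_square)
    finally have "Disc s k \<in> \<real>\<^sub>\<le>\<^sub>0" by (simp add: complex_nonpos_Reals_iff)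
    then show False using Disc_slit[OF a] by simp
  qed
  ultimately show ?thesis by simp
qed

lemma Root_nonzero: "s > 0 \<Longrightarrow> Re k > 0 \<Longrightarrow> Root s k \<noteq> 0"
  using Root_pos[of s k] by auto

definition herglotz :: "real \<Rightarrow> complex \<Rightarrow> complex" where "herglotz s k = Root s k - A k"

definition V :: "real \<Rightarrow> complex \<Rightarrow> complex" where "V s k = Root s k + A k"

text \<open>
  Compare \<open>Root = u + \<i> * v\<close> with \<open>A = x + \<i> * y\<close>: if \<open>u \<le> x\<close>, the equation for the imaginary part of \<open>Root\<^sup>2\<close>
  forces \<open>v\<close> to be so large that the equation for the real part fails.
\<close>
lemma Re_herglotz_pos:
  assumes s: "s > 0" and k: "Re k > 0" shows "Re (herglotz s k) > 0"
proof (cases "Re d = 0")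
  case True
  then show ?thesis using Root_pos[OF assms] by (simp add: herglotz_def A_def)
next
  case False
  then have a: "Re d > 0" using d by simp
  define u v where "u = Re (Root s k)" and "v = Im (Root s k)"
  have u: "u > 0" using Root_pos[OF assms] by (simp add: u_def)
  have re: "u\<^sup>2 - v\<^sup>2 = Re (Disc s k)" and im: "2 * u * v = Im (Disc s k)"
    using arg_cong[OF Root_sq[of s k], of Re] arg_cong[OF Root_sq[of s k], of Im]
    by (simp_all add: u_def v_def power2_eq_square algebra_simps)
  define e where "e = (Re d)\<^sup>2 * Im k + Im d * (s + Re d)"
  have uv: "u * v = Re k * e" using im unfolding Im_Disc e_def by simp
  have "u > Re d * Re k"
  proof (rule ccontr)
    assume "\<not> u > Re d * Re k"
    then have ul: "u \<le> Re d * Re k" by simp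
    then have u2: "u\<^sup>2 \<le> (Re d)\<^sup>2 * (Re k)\<^sup>2" using u by (metis less_imp_le power_mono power_mult_distrib)
    have "(Re k * e)\<^sup>2 = u\<^sup>2 * v\<^sup>2" using uv by (metis power_mult_distrib)
    also have "\<dots> \<le> ((Re d)\<^sup>2 * (Re k)\<^sup>2) * v\<^sup>2" using u2 by (intro mult_right_mono) auto
    finally have "(Re k)\<^sup>2 * e\<^sup>2 \<le> (Re k)\<^sup>2 * ((Re d)\<^sup>2 * v\<^sup>2)" by (simp add: power_mult_distrib mult_ac)
    then have "e\<^sup>2 \<le> (Re d)\<^sup>2 * v\<^sup>2" using k by simp
    then have v2: "e\<^sup>2 / (Re d)\<^sup>2 \<le> v\<^sup>2" using a by (simp add: divide_le_eq mult.commute)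
    have "e\<^sup>2 / (Re d)\<^sup>2 = (Re d)\<^sup>2 * (Im k)\<^sup>2 + 2 * Im d * (s + Re d) * Im k + (Im d * (s + Re d))\<^sup>2 / (Re d)\<^sup>2"
      unfolding e_def using a by (simp add: field_simps power2_eq_square)
    then show False using u2 v2 re disc_const[OF s a] unfolding Re_Disc by linarith
  qed
  then show ?thesis by (simp add: herglotz_def A_def u_def)
qed

lemma Re_V_pos: "s > 0 \<Longrightarrow> Re k > 0 \<Longrightarrow> Re (V s k) > 0"
  using Root_pos[of s k] d by (simp add: V_def A_def add_pos_nonneg)

lemma V_eq: "(V s k)\<^sup>2 = 2 * V s k * A k + (of_real s)\<^sup>2 + 2 * of_real s * B k"
proof -
  have "(V s k - A k)\<^sup>2 = Disc s k" using Root_sq by (simp add: V_def)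
  then show ?thesis unfolding Disc_def by (simp add: power2_eq_square algebra_simps)
qed

text \<open>
  A fixed point of the limiting Moebius map, see \<open>moebius_step_fixpt\<close>. This form shows that it lies in the closed unit
  disc.
\<close>
definition fixpt :: "real \<Rightarrow> complex \<Rightarrow> complex" where
  "fixpt s z = (V s (cayley z) - of_real s) / (V s (cayley z) + of_real s)"

lemma V_plus_nonzero: "s > 0 \<Longrightarrow> Re k > 0 \<Longrightarrow> V s k + of_real s \<noteq> 0"
  using Re_V_pos[of s k] by (auto simp: complex_eq_iff)

lemma norm_fixpt: "s > 0 \<Longrightarrow> cmod z < 1 \<Longrightarrow> cmod (fixpt s z) \<le> 1"
proof -
  assume s: "s > 0" and z: "cmod z < 1"
  let ?V = "V s (cayley z)"
  have p: "Re ?V > 0" using Re_V_pos[OF s cayley_pos[OF z]] .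
  have "(cmod (?V - of_real s))\<^sup>2 \<le> (cmod (?V + of_real s))\<^sup>2"
    unfolding cmod_power2 using p s by (simp add: power2_eq_square algebra_simps)
  then have "cmod (?V - of_real s) \<le> cmod (?V + of_real s)" by (rule power2_le_imp_le) simp
  then show ?thesis by (simp add: fixpt_def norm_divide divide_le_eq_1)
qed

lemma cayley_z: "cmod z < 1 \<Longrightarrow> z * (cayley z + 1) = cayley z - 1" "cmod z < 1 \<Longrightarrow> (1 - z) * (cayley z + 1) = 2"
proof -
  assume "cmod z < 1"
  then have "1 - z \<noteq> 0" by auto
  then show "z * (cayley z + 1) = cayley z - 1" "(1 - z) * (cayley z + 1) = 2"
    by (simp_all add: cayley_def field_simps)
qed

lemma d_eq: "d = of_real (Re d) + \<i> * of_real (Im d)" "cnj d = of_real (Re d) - \<i> * of_real (Im d)"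
  by (simp_all add: complex_eq_iff)

lemma AB_rel: "cnj d * (k - 1) = A k - B k" "d * (k + 1) = A k + B k"
  by (simp_all add: A_def B_def complex_eq_iff algebra_simps)

text \<open>
  A formula for the fixed point without division by \<open>V + s\<close>, obtained by clearing denominators with the help of \<open>V_eq\<close>.
\<close>
lemma fixpt_linear:
  assumes s: "s > 0" and z: "cmod z < 1"
  shows "2 * cnj d * z * fixpt s z = - (of_real s + d) + (of_real s + cnj d) * z + (1 - z) * Root s (cayley z)"
proof -
  define k where "k = cayley z"
  define v where "v = V s k"
  define S where "S = complex_of_real s"
  have k: "Re k > 0" using cayley_pos[OF z] by (simp add: k_def)
  have nz: "v + S \<noteq> 0" "k + 1 \<noteq> 0" using V_plus_nonzero[OF s k] k by (auto simp: v_def S_def complex_eq_iff)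
  note zk = cayley_z[OF z, folded k_def]
  have fp: "fixpt s z * (v + S) = v - S" using nz by (simp add: fixpt_def v_def S_def k_def)
  have R: "Root s k = v - A k" by (simp add: v_def V_def)
  have veq: "v * v = 2 * v * A k + S * S + 2 * S * B k" using V_eq[of s k] by (simp add: v_def S_def power2_eq_square)
  have "(2 * cnj d * z * fixpt s z) * ((k + 1) * (v + S)) = 2 * (cnj d * (z * (k + 1))) * (fixpt s z * (v + S))" by (simp add: mult_ac)
  also have "\<dots> = 2 * (A k - B k) * (v - S)" unfolding zk fp AB_rel by simp
  also have "\<dots> = (2 * v - 2 * A k - 2 * B k - 2 * S) * (v + S)"
  proof -
    have "(2 * v - 2 * A k - 2 * B k - 2 * S) * (v + S) - 2 * (A k - B k) * (v - S) = 2 * (v * v - (2 * v * A k + S * S + 2 * S * B k))"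
      by (simp add: algebra_simps)
    then show ?thesis using veq by simp
  qed
  also have "2 * v - 2 * A k - 2 * B k - 2 * S = - (S * (k + 1) + d * (k + 1)) + (S * (k - 1) + cnj d * (k - 1)) + 2 * (v - A k)"
    unfolding AB_rel by (simp add: algebra_simps)
  also have "\<dots> = - (S * (k + 1) + d * (k + 1)) + (S * (z * (k + 1)) + cnj d * (z * (k + 1))) + ((1 - z) * (k + 1)) * (v - A k)"
    unfolding zk ..
  also have "\<dots> * (v + S) = (- (S + d) + (S + cnj d) * z + (1 - z) * (v - A k)) * ((k + 1) * (v + S))"
    by (simp add: algebra_simps)
  finally have "(2 * cnj d * z * fixpt s z) * ((k + 1) * (v + S)) = (- (S + d) + (S + cnj d) * z + (1 - z) * (v - A k)) * ((k + 1) * (v + S))" .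
  then have "2 * cnj d * z * fixpt s z = - (S + d) + (S + cnj d) * z + (1 - z) * (v - A k)" using nz by simp
  then show ?thesis unfolding R[symmetric] unfolding k_def S_def .
qed

lemma fixpt_quadratic:
  assumes s: "s > 0" and z: "cmod z < 1"
  shows "cnj d * z * (fixpt s z)\<^sup>2 + (of_real s + d - (of_real s + cnj d) * z) * fixpt s z - d = 0"
proof -
  define k where "k = cayley z"
  define v where "v = V s k"
  define S where "S = complex_of_real s"
  define f where "f = fixpt s z"
  have k: "Re k > 0" using cayley_pos[OF z] by (simp add: k_def)
  have nz: "v + S \<noteq> 0" "k + 1 \<noteq> 0" using V_plus_nonzero[OF s k] k by (auto simp: v_def S_def complex_eq_iff)
  note zk = cayley_z[OF z, folded k_def]
  have fp: "f * (v + S) = v - S" using nz by (simp add: f_def fixpt_def v_def S_def k_def)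
  have veq: "v * v = 2 * v * A k + S * S + 2 * S * B k" using V_eq[of s k] by (simp add: v_def S_def power2_eq_square)
  have "(cnj d * z * f\<^sup>2 + (S + d - (S + cnj d) * z) * f - d) * ((k + 1) * (v + S)\<^sup>2)
     = cnj d * (z * (k + 1)) * (f * (v + S))\<^sup>2 + (S * (k + 1) + d * (k + 1) - (S * (z * (k + 1)) + cnj d * (z * (k + 1)))) * (f * (v + S)) * (v + S)
       - d * (k + 1) * (v + S)\<^sup>2"
    by (simp add: algebra_simps power2_eq_square)
  also have "\<dots> = (A k - B k) * (v - S)\<^sup>2 + (2 * S + 2 * B k) * (v - S) * (v + S) - (A k + B k) * (v + S)\<^sup>2"
    unfolding zk fp AB_rel by (simp add: algebra_simps)
  also have "\<dots> = 2 * S * (v * v - (2 * v * A k + S * S + 2 * S * B k))"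
    by (simp add: power2_eq_square algebra_simps)
  also have "\<dots> = 0" using veq by simp
  finally show ?thesis using nz by (simp add: f_def S_def)
qed

text \<open>
  The mode of the deformed coefficient at level \<open>s\<close>.
\<close>
definition limit_coeff :: "real \<Rightarrow> complex" where "limit_coeff s = - d / (of_real s + cnj d)"

lemma s_plus_d_nonzero: "s > 0 \<Longrightarrow> of_real s + d \<noteq> 0" "s > 0 \<Longrightarrow> of_real s + cnj d \<noteq> 0"
  using d by (auto simp: complex_eq_iff)

lemma norm_limit_coeff: "s > 0 \<Longrightarrow> cmod (limit_coeff s) < 1"
proof -
  assume s: "s > 0"
  have "(cmod d)\<^sup>2 < (cmod (of_real s + cnj d))\<^sup>2"
    unfolding cmod_power2 using d s by (simp add: power2_eq_square algebra_simps add_pos_nonneg)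
  then have "cmod d < cmod (of_real s + cnj d)" using power2_less_imp_less by (metis norm_ge_zero)
  then show ?thesis by (simp add: limit_coeff_def norm_divide divide_less_eq)
qed

text \<open>
  The limit of the factors \<open>1 - step_factor k z\<close>, see \<open>limit_factor_eq\<close>.
\<close>
definition limit_factor :: "real \<Rightarrow> complex \<Rightarrow> complex" where
  "limit_factor s z = (of_real s + d + (of_real s + cnj d) * z + (1 - z) * Root s (cayley z)) / (2 * (of_real s + d))"

lemma limit_factor_eq:
  assumes s: "s > 0" and z: "cmod z < 1"
  shows "limit_factor s z = 1 - cnj (limit_coeff s) * z * fixpt s z"
proof -
  note nz = s_plus_d_nonzero[OF s]
  have "2 * (of_real s + d) * (1 - cnj (limit_coeff s) * z * fixpt s z) = 2 * (of_real s + d) + 2 * cnj d * z * fixpt s z"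
    using nz by (simp add: limit_coeff_def field_simps)
  also have "\<dots> = of_real s + d + (of_real s + cnj d) * z + (1 - z) * Root s (cayley z)"
    unfolding fixpt_linear[OF assms] by (simp add: algebra_simps)
  finally have e: "2 * (of_real s + d) * (1 - cnj (limit_coeff s) * z * fixpt s z) = of_real s + d + (of_real s + cnj d) * z + (1 - z) * Root s (cayley z)" .
  have n2: "2 * (of_real s + d) \<noteq> 0" using nz(1) by (simp only: mult_eq_0_iff) simp
  show ?thesis unfolding limit_factor_def e[symmetric] by (rule nonzero_mult_div_cancel_left[OF n2])
qed

text \<open>
  The recursion of the ratios \<open>(\<phi> z / \<psi> z) * (\<psi> 1 / \<phi> 1)\<close>, see \<open>ratio_Suc\<close> below.
\<close>
definition moebius_step :: "complex \<Rightarrow> complex \<Rightarrow> complex \<Rightarrow> complex" where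
  "moebius_step g z x = (1 - cnj g) / (1 - g) * ((z * x - g) / (1 - cnj g * z * x))"

lemma moebius_step_fixpt:
  assumes s: "s > 0" and z: "cmod z < 1"
  shows "moebius_step (limit_coeff s) z (fixpt s z) = fixpt s z"
proof -
  define f where "f = fixpt s z"
  define p pb where "p = of_real s + d" and "pb = of_real s + cnj d"
  have nz: "p \<noteq> 0" "pb \<noteq> 0" using s_plus_d_nonzero[OF s] by (auto simp: p_def pb_def)
  have t: "of_real s + d + cnj d \<noteq> 0" using s d by (auto simp: complex_eq_iff)
  have g: "limit_coeff s = - d / pb" "cnj (limit_coeff s) = - cnj d / p" by (simp_all add: limit_coeff_def p_def pb_def)
  have g1: "1 - limit_coeff s = (of_real s + d + cnj d) / pb" "1 - cnj (limit_coeff s) = (of_real s + d + cnj d) / p"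
    unfolding g(2) unfolding g(1) using nz by (simp_all add: field_simps) (simp_all add: p_def pb_def)
  have c: "(1 - cnj (limit_coeff s)) / (1 - limit_coeff s) = pb / p" unfolding g1 using nz t by simp
  have den: "1 - cnj (limit_coeff s) * z * f = (p + cnj d * z * f) / p" unfolding g(2) using nz by (simp add: field_simps)
  have num: "z * f - limit_coeff s = (pb * z * f + d) / pb" unfolding g(1) using nz by (simp add: field_simps)
  have "cmod (cnj (limit_coeff s) * z * f) < 1"
  proof -
    have "cmod (limit_coeff s) * (cmod z * cmod f) \<le> cmod (limit_coeff s) * 1"
      using z norm_fixpt[OF assms] by (intro mult_left_mono mult_le_one) (auto simp: f_def)
    then show ?thesis using norm_limit_coeff[OF s] by (simp add: norm_mult mult.assoc)
  qed
  then have "1 - cnj (limit_coeff s) * z * f \<noteq> 0" by auto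
  then have dn: "p + cnj d * z * f \<noteq> 0" unfolding den by auto
  have quad: "pb * z * f + d = f * (p + cnj d * z * f)"
    using fixpt_quadratic[OF assms] unfolding f_def[symmetric] p_def[symmetric] pb_def[symmetric]
    by (simp add: power2_eq_square algebra_simps)
  have "moebius_step (limit_coeff s) z f = pb / p * (((pb * z * f + d) / pb) / ((p + cnj d * z * f) / p))"
    unfolding moebius_step_def c den num ..
  also have "\<dots> = f" unfolding quad using nz dn by simp
  finally show ?thesis by (simp add: f_def)
qed

lemma holomorphic_cayley: "cayley holomorphic_on ball 0 1"
  unfolding cayley_def[abs_def] by (intro holomorphic_intros) auto

lemma cayley_derivative: "cmod z < 1 \<Longrightarrow> (cayley has_field_derivative 2 / (1 - z)\<^sup>2) (at z)"
proof -
  assume z: "cmod z < 1"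
  then have nz: "1 - z \<noteq> 0" by auto
  have "((\<lambda>z. (1 + z) / (1 - z)) has_field_derivative ((0 + 1) * (1 - z) - (1 + z) * (0 - 1)) / ((1 - z) * (1 - z))) (at z)"
    using nz by (intro DERIV_divide derivative_intros)
  moreover have "((0 + 1) * (1 - z) - (1 + z) * (0 - 1)) / ((1 - z) * (1 - z)) = 2 / (1 - z)\<^sup>2"
    by (simp add: power2_eq_square algebra_simps)
  ultimately show ?thesis unfolding cayley_def[abs_def] by simp
qed

lemma Root_derivative_k:
  assumes s: "s > 0" and k: "Re k > 0"
  shows "(Root s has_field_derivative (\<i> * of_real s * of_real (Im d) + of_real (Re d) * A k) / Root s k) (at k)"
proof -
  have D: "(Disc s has_field_derivative 2 * (\<i> * of_real s * of_real (Im d) + of_real (Re d) * A k)) (at k)"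
    unfolding Disc_def[abs_def] A_def[abs_def] B_def[abs_def]
    by (auto intro!: derivative_eq_intros simp: algebra_simps power2_eq_square)
  have "(csqrt has_field_derivative inverse (2 * csqrt (Disc s k))) (at (Disc s k))"
    using has_field_derivative_csqrt[OF Disc_slit[OF assms]] by simp
  note c = DERIV_chain2[OF this D]
  have e: "inverse (2 * y) * (2 * x) = x / y" for x y :: complex by (simp add: field_simps)
  show ?thesis using c unfolding Root_def[abs_def] e .
qed

lemma Root_derivative_s:
  assumes s: "s > 0" and k: "Re k > 0"
  shows "((\<lambda>s. Root s k) has_vector_derivative (of_real s + B k) / Root s k) (at s)"
proof -
  have o: "(complex_of_real has_vector_derivative 1) (at s)" by (auto intro!: derivative_eq_intros)
  have "((\<lambda>w. w\<^sup>2 + 2 * w * B k + (A k)\<^sup>2) has_field_derivative (2 * (of_real s + B k))) (at (of_real s))"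
    by (auto intro!: derivative_eq_intros simp: algebra_simps)
  from field_vector_diff_chain_at[OF o this]
  have D: "((\<lambda>s. Disc s k) has_vector_derivative (2 * (of_real s + B k))) (at s)"
    unfolding Disc_def comp_def by simp
  have "(csqrt has_field_derivative inverse (2 * csqrt (Disc s k))) (at (Disc s k))"
    using has_field_derivative_csqrt[OF Disc_slit[OF assms]] by simp
  note c = field_vector_diff_chain_at[OF D this]
  have e: "2 * x * inverse (2 * y) = x / y" for x y :: complex by (simp add: field_simps)
  show ?thesis using c unfolding Root_def comp_def e .
qed

text \<open>
  The derivative with respect to \<open>s\<close> of \<open>(s - herglotz s) / 2\<close>.
\<close>
definition log_slope :: "real \<Rightarrow> complex \<Rightarrow> complex" where
  "log_slope s z = (1 - (of_real s + B (cayley z)) / Root s (cayley z)) / 2"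

lemma limit_factor_nonzero:
  assumes s: "s > 0" and z: "cmod z < 1" shows "limit_factor s z \<noteq> 0"
proof -
  have "cmod (limit_coeff s) * (cmod z * cmod (fixpt s z)) \<le> cmod (limit_coeff s) * 1"
    using z norm_fixpt[OF assms] by (intro mult_left_mono mult_le_one) auto
  then have "cmod (cnj (limit_coeff s) * z * fixpt s z) < 1" using norm_limit_coeff[OF s] by (simp add: norm_mult mult.assoc)
  then show ?thesis unfolding limit_factor_eq[OF assms] by auto
qed

text \<open>
  The key identity: \<open>z\<close> times the logarithmic derivative of the limiting factor in \<open>z\<close> is a derivative in \<open>s\<close>, namely
  \<open>log_slope\<close>. After clearing denominators it is a polynomial identity modulo \<open>Root\<^sup>2 = Disc\<close>.
\<close>
lemma limit_factor_derivative:
  assumes s: "s > 0" and z: "cmod z < 1"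
  obtains E' where "(limit_factor s has_field_derivative E') (at z)" "z * E' = log_slope s z * limit_factor s z"
proof
  define k where "k = cayley z"
  define R where "R = Root s k"
  define S where "S = complex_of_real s"
  define a where "a = complex_of_real (Re d)"
  define b where "b = \<i> * complex_of_real (Im d)"
  define p where "p = S + d"
  have k: "Re k > 0" using cayley_pos[OF z] by (simp add: k_def)
  have R0: "R \<noteq> 0" using Root_nonzero[OF s k] by (simp add: R_def)
  have p0: "p \<noteq> 0" using s_plus_d_nonzero[OF s] by (simp add: p_def S_def)
  have z1: "1 - z \<noteq> 0" using z by auto
  have k1: "k + 1 \<noteq> 0" using k by (auto simp: complex_eq_iff)
  have kz: "2 / (1 - z)\<^sup>2 = (k + 1) / (1 - z)"
  proof -
    have "2 / (1 - z)\<^sup>2 = ((1 - z) * (k + 1)) / ((1 - z) * (1 - z))"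
      using cayley_z(2)[OF z] unfolding k_def[symmetric] power2_eq_square by (simp only:)
    then show ?thesis using z1 by simp
  qed
  define R' where "R' = (S * b + a * A k) / R * ((k + 1) / (1 - z))"
  define E' where "E' = ((S + cnj d) + ((1 - z) * R' - R)) / (2 * p)"
  have DR: "((\<lambda>z. Root s (cayley z)) has_field_derivative R') (at z)"
    using DERIV_chain2[OF Root_derivative_k[OF s cayley_pos[OF z]] cayley_derivative[OF z]]
    unfolding k_def[symmetric] kz by (simp add: R'_def R_def S_def a_def b_def mult_ac)
  have D2: "((\<lambda>z. S + d + (S + cnj d) * z + (1 - z) * Root s (cayley z)) has_field_derivative ((S + cnj d) + ((1 - z) * R' - R))) (at z)"
    using DR by (auto intro!: derivative_eq_intros simp: R_def k_def)
  have "((\<lambda>z. (S + d + (S + cnj d) * z + (1 - z) * Root s (cayley z)) / (2 * p)) has_field_derivative E') (at z)"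
    unfolding E'_def by (rule DERIV_cdivide[OF D2])
  then show "(limit_factor s has_field_derivative E') (at z)" unfolding limit_factor_def[abs_def] S_def[symmetric] p_def[symmetric] .
  have Akab: "A k = a * k + b" "B k = a + b * k" by (simp_all add: A_def B_def a_def b_def)
  have dd: "d = a + b" "cnj d = a - b" using d_eq by (simp_all add: a_def b_def)
  have RR: "R * R = S * S + 2 * S * B k + A k * A k"
    using Root_sq[of s k] by (simp add: R_def S_def Disc_def power2_eq_square)
  note zk = cayley_z[OF z, folded k_def]
  have "(k + 1) * R * (2 * p * (z * E')) = (z * (k + 1)) * ((S + cnj d) * R + (k + 1) * (S * b + a * A k) - R * R)"
    unfolding E'_def R'_def using p0 R0 z1 by (simp add: field_simps)
  also have "\<dots> = (k - 1) * ((S + a - b) * R + (k + 1) * (S * b + a * (a * k + b)) - R * R)"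
    unfolding zk Akab(1) unfolding dd(2) by (simp add: algebra_simps)
  also have "\<dots> = (R - (S + a + b * k)) * ((S + a) * k + b + R)"
  proof -
    have "k * (R * R) = (k * k - 1) * (b * (S + a) + a * a * k) + (S + a + b * k) * ((S + a) * k + b)"
      unfolding RR Akab by (simp add: algebra_simps)
    then show ?thesis by (simp add: algebra_simps)
  qed
  also have "(S + a) * k + b + R = ((S + d) * (k + 1) + (S + cnj d) * (z * (k + 1)) + ((1 - z) * (k + 1)) * R) / 2"
    unfolding zk unfolding dd(2) by (subst dd(1)) (simp add: algebra_simps)
  also have "\<dots> = (k + 1) * (p * limit_factor s z)"
    unfolding limit_factor_def k_def[symmetric] R_def[symmetric] S_def[symmetric] p_def[symmetric] using p0
    by (simp add: field_simps)
  also have "(R - (S + a + b * k)) * ((k + 1) * (p * limit_factor s z)) = (k + 1) * R * (2 * p * (log_slope s z * limit_factor s z))"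
    unfolding log_slope_def k_def[symmetric] R_def[symmetric] S_def[symmetric] Akab using R0 by (simp add: field_simps)
  finally show "z * E' = log_slope s z * limit_factor s z" using k1 R0 p0 by simp
qed

end

section \<open>Stability of the recursion\<close>

lemma norm_one_minus_ge: "cmod w \<le> r \<Longrightarrow> 1 - r \<le> cmod (1 - w)"
  using norm_triangle_ineq2[of 1 w] by simp

lemma Ln_one_minus_lipschitz:
  assumes "cmod w \<le> 1/4" "cmod v \<le> 1/4"
  shows "cmod (Ln (1 - w) - Ln (1 - v)) \<le> 4/3 * cmod (w - v)"
proof (rule field_differentiable_bound[where f = "\<lambda>w. Ln (1 - w)" and S = "cball 0 (1/4)" and f' = "\<lambda>w. - inverse (1 - w)"])
  fix x :: complex assume "x \<in> cball 0 (1/4)"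
  then have x: "cmod x \<le> 1/4" by simp
  then have "Re x \<le> 1/4" using abs_Re_le_cmod[of x] by linarith
  then have nr: "1 - x \<notin> \<real>\<^sub>\<le>\<^sub>0" by (auto simp: complex_nonpos_Reals_iff)
  have "((\<lambda>w. 1 - w) has_field_derivative (0 - 1)) (at x)" by (intro derivative_intros)
  from DERIV_chain2[OF has_field_derivative_Ln[OF nr] this]
  have "((\<lambda>w. Ln (1 - w)) has_field_derivative - inverse (1 - x)) (at x)" by simp
  then show "((\<lambda>w. Ln (1 - w)) has_field_derivative - inverse (1 - x)) (at x within cball 0 (1/4))"
    by (rule has_field_derivative_at_within)
  have "3/4 \<le> cmod (1 - x)" using norm_one_minus_ge[OF x] by simp
  then have "inverse (cmod (1 - x)) \<le> inverse (3/4)" by (intro le_imp_inverse_le) auto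
  then show "cmod (- inverse (1 - x)) \<le> 4/3" by (simp add: norm_inverse)
qed (use assms in auto)

lemma Ln_one_minus_bound: "cmod w \<le> 1/4 \<Longrightarrow> cmod (Ln (1 - w)) \<le> 1/3"
  using Ln_one_minus_lipschitz[of w 0] by simp

text \<open>
  The Moebius part of the recursion maps the closed disc to itself.
\<close>
lemma disc_automorphism_le_1:
  assumes "cmod g < 1" "cmod u \<le> 1" shows "cmod (u - g) \<le> cmod (1 - cnj g * u)"
proof -
  have "(cmod (1 - cnj g * u))\<^sup>2 - (cmod (u - g))\<^sup>2 = (1 - (cmod g)\<^sup>2) * (1 - (cmod u)\<^sup>2)"
    unfolding cmod_power2 by (simp add: power2_eq_square algebra_simps)
  moreover have "0 \<le> 1 - (cmod g)\<^sup>2" "0 \<le> 1 - (cmod u)\<^sup>2"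
    using assms by (simp_all add: power_le_one)
  ultimately have "(cmod (u - g))\<^sup>2 \<le> (cmod (1 - cnj g * u))\<^sup>2" using mult_nonneg_nonneg by (metis diff_ge_0_iff_ge)
  then show ?thesis by (rule power2_le_imp_le) simp
qed

lemma unimodular_quotient:
  assumes "w \<noteq> 0" shows "cmod (cnj w / w) = 1"
  using assms by (simp add: norm_divide)

lemma unimodular_quotient_lipschitz:
  assumes "w \<noteq> 0" "v \<noteq> 0" shows "cmod (cnj w / w - cnj v / v) \<le> 2 / cmod v * cmod (w - v)"
proof -
  have "cnj w / w - cnj v / v = (cnj w * (v - w) + (cnj w - cnj v) * w) / (w * v)"
    using assms by (simp add: field_simps)
  also have "cmod \<dots> \<le> (cmod (cnj w * (v - w)) + cmod ((cnj w - cnj v) * w)) / cmod (w * v)"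
    unfolding norm_divide by (intro divide_right_mono norm_triangle_ineq) simp
  also have "\<dots> = 2 / cmod v * cmod (w - v)"
  proof -
    have "cmod (cnj w * (v - w)) = cmod w * cmod (w - v)" by (simp add: norm_mult norm_minus_commute)
    moreover have "cmod ((cnj w - cnj v) * w) = cmod w * cmod (w - v)"
      by (metis complex_cnj_diff complex_mod_cnj mult.commute norm_mult)
    ultimately show ?thesis using assms by (simp add: norm_mult)
  qed
  finally show ?thesis .
qed

context hua_pickrell
begin

text \<open>
  The derivative of the map in its argument is at most \<open>cmod z / (1 - cmod z)\<^sup>2\<close> in modulus, which is \<open>4/9\<close> for
  \<open>cmod z = 1/4\<close>.
\<close>
lemma moebius_step_contraction:
  assumes g: "cmod g < 1" and z: "cmod z \<le> 1/4" and x: "cmod x \<le> 1" "cmod y \<le> 1"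
  shows "cmod (moebius_step g z x - moebius_step g z y) \<le> 4/9 * cmod (x - y)"
proof -
  have b: "3/4 \<le> cmod (1 - cnj g * z * u)" if "cmod u \<le> 1" for u
  proof -
    have "cmod g * cmod z * cmod u \<le> 1 * (1/4) * 1" using g z that by (intro mult_mono) auto
    then have "cmod (cnj g * z * u) \<le> 1/4" by (simp add: norm_mult)
    from norm_one_minus_ge[OF this] show ?thesis by simp
  qed
  have nz: "1 - cnj g * z * x \<noteq> 0" "1 - cnj g * z * y \<noteq> 0" using b[OF x(1)] b[OF x(2)] by auto
  have g1: "1 - g \<noteq> 0" using g by auto
  have c: "cmod ((1 - cnj g) / (1 - g)) = 1" using unimodular_quotient[OF g1] by simp
  have "moebius_step g z x - moebius_step g z y = (1 - cnj g) / (1 - g) * ((z * x - g) / (1 - cnj g * z * x) - (z * y - g) / (1 - cnj g * z * y))"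
    by (simp add: moebius_step_def right_diff_distrib)
  also have "(z * x - g) / (1 - cnj g * z * x) - (z * y - g) / (1 - cnj g * z * y)
      = (1 - g * cnj g) * z * (x - y) / ((1 - cnj g * z * x) * (1 - cnj g * z * y))"
    using nz by (simp add: diff_frac_eq) (simp add: algebra_simps)
  finally have "cmod (moebius_step g z x - moebius_step g z y) = cmod (1 - g * cnj g) * cmod z * cmod (x - y) / (cmod (1 - cnj g * z * x) * cmod (1 - cnj g * z * y))"
    using c by (simp only: norm_mult norm_divide mult_1)
  also have "\<dots> \<le> 1 * (1/4) * cmod (x - y) / ((3/4) * (3/4))"
  proof (intro frac_le mult_mono b x)
    have "1 - g * cnj g = of_real (1 - (cmod g)\<^sup>2)" by (simp only: of_real_diff of_real_1 complex_norm_square[symmetric])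
    then have "cmod (1 - g * cnj g) = \<bar>1 - (cmod g)\<^sup>2\<bar>" by (simp only: norm_of_real)
    then show "cmod (1 - g * cnj g) \<le> 1" using g by (simp add: abs_square_less_1 power_le_one)
  qed (use z in auto)
  finally show ?thesis by simp
qed

text \<open>
  The dependence on the coefficient is not uniform: the unimodular prefactor \<open>(1 - cnj g) / (1 - g)\<close> oscillates near
  \<open>g = 1\<close>. Only one of the two coefficients has to stay away from \<open>1\<close>, and it can be taken to be the deterministic one.
\<close>
lemma moebius_step_lipschitz:
  assumes g: "cmod g < 1" "cmod g' < 1" and z: "cmod z \<le> 1/4" and x: "cmod x \<le> 1"
  shows "cmod (moebius_step g z x - moebius_step g' z x) \<le> (2 / cmod (1 - g') + 4) * cmod (g - g')"
proof -
  define u where "u = z * x"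
  have "cmod z * cmod x \<le> 1/4 * 1" using z x by (intro mult_mono) auto
  then have u: "cmod u \<le> 1/4" by (simp add: u_def norm_mult)
  have b: "3/4 \<le> cmod (1 - cnj h * u)" if "cmod h < 1" for h
  proof -
    have "cmod h * cmod u \<le> 1 * (1/4)" using that u by (intro mult_mono) auto
    then have "cmod (cnj h * u) \<le> 1/4" by (simp add: norm_mult)
    from norm_one_minus_ge[OF this] show ?thesis by simp
  qed
  have nz: "1 - cnj g * u \<noteq> 0" "1 - cnj g' * u \<noteq> 0" "1 - g \<noteq> 0" "1 - g' \<noteq> 0" using b[OF g(1)] b[OF g(2)] g by auto
  define c where "c h = (1 - cnj h) / (1 - h)" for h :: complex
  define M where "M h = (u - h) / (1 - cnj h * u)" for h
  have s: "moebius_step h z x = c h * M h" for h by (simp add: moebius_step_def c_def M_def u_def mult.assoc)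
  have "cmod (u - g) / cmod (1 - cnj g * u) \<le> 1"
    using disc_automorphism_le_1[of g u] g u by (simp add: divide_le_eq_1)
  then have M1: "cmod (M g) \<le> 1" by (simp add: M_def norm_divide)
  have c1: "cmod (c g') = 1" using unimodular_quotient[OF nz(4)] by (simp add: c_def)
  have cc: "cmod (c g - c g') \<le> 2 / cmod (1 - g') * cmod (g - g')"
    using unimodular_quotient_lipschitz[OF nz(3,4)] by (simp add: c_def norm_minus_commute)
  have MM: "cmod (M g - M g') \<le> 4 * cmod (g - g')"
  proof -
    have "M g - M g' = ((g' - g) + u * u * (cnj g - cnj g') + u * ((g - g') * cnj g' - g' * (cnj g - cnj g'))) / ((1 - cnj g * u) * (1 - cnj g' * u))"
      unfolding M_def using nz by (simp add: diff_frac_eq) (simp add: algebra_simps)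
    also have "cmod \<dots> \<le> (25/16 * cmod (g - g')) / (3/4 * (3/4))"
      unfolding norm_divide
    proof (intro frac_le)
      have t: "cmod (cnj g - cnj g') = cmod (g - g')" by (metis complex_cnj_diff complex_mod_cnj)
      have "cmod ((g' - g) + u * u * (cnj g - cnj g') + u * ((g - g') * cnj g' - g' * (cnj g - cnj g')))
         \<le> cmod (g' - g) + cmod (u * u * (cnj g - cnj g')) + cmod (u * ((g - g') * cnj g' - g' * (cnj g - cnj g')))"
        by (intro norm_triangle_le add_right_mono norm_triangle_ineq) 
      moreover have "cmod (u * u * (cnj g - cnj g')) \<le> (1/4) * (1/4) * cmod (g - g')"
        unfolding norm_mult t using u by (intro mult_mono) auto
      moreover have "cmod (u * ((g - g') * cnj g' - g' * (cnj g - cnj g'))) \<le> (1/4) * (2 * cmod (g - g'))"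
        unfolding norm_mult
      proof (intro mult_mono u)
        have "cmod ((g - g') * cnj g' - g' * (cnj g - cnj g')) \<le> cmod ((g - g') * cnj g') + cmod (g' * (cnj g - cnj g'))"
          by (rule norm_triangle_ineq4)
        also have "\<dots> = cmod g' * cmod (g - g') + cmod g' * cmod (g - g')" unfolding norm_mult t by simp
        also have "\<dots> \<le> 1 * cmod (g - g') + 1 * cmod (g - g')" using g by (intro add_mono mult_right_mono) auto
        finally show "cmod ((g - g') * cnj g' - g' * (cnj g - cnj g')) \<le> 2 * cmod (g - g')" by simp
      qed auto
      ultimately show "cmod ((g' - g) + u * u * (cnj g - cnj g') + u * ((g - g') * cnj g' - g' * (cnj g - cnj g'))) \<le> 25/16 * cmod (g - g')"
        by (simp add: norm_minus_commute)
      show "3/4 * (3/4) \<le> cmod ((1 - cnj g * u) * (1 - cnj g' * u))"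
        unfolding norm_mult using b[OF g(1)] b[OF g(2)] by (intro mult_mono) auto
    qed auto
    also have "\<dots> \<le> 4 * cmod (g - g')" by simp
    finally show ?thesis .
  qed
  have "moebius_step g z x - moebius_step g' z x = (c g - c g') * M g + c g' * (M g - M g')" unfolding s by (simp add: algebra_simps)
  also have "cmod \<dots> \<le> cmod (c g - c g') * cmod (M g) + cmod (c g') * cmod (M g - M g')"
    using norm_triangle_ineq[of "(c g - c g') * M g" "c g' * (M g - M g')"] by (simp only: norm_mult)
  also have "\<dots> \<le> cmod (c g - c g') * 1 + 1 * (4 * cmod (g - g'))"
    using M1 c1 MM by (intro add_mono mult_mono) auto
  also have "\<dots> \<le> (2 / cmod (1 - g') + 4) * cmod (g - g')" using cc by (simp add: algebra_simps)
  finally show ?thesis .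
qed

definition lipschitz_const :: "real \<Rightarrow> real" where "lipschitz_const \<eta> = 4 + 2 * (1 + cmod d / \<eta>)"

lemma s_plus_d_ge: "s > 0 \<Longrightarrow> s \<le> cmod (of_real s + d)" "s > 0 \<Longrightarrow> s \<le> cmod (of_real s + cnj d)"
  using complex_Re_le_cmod[of "of_real s + d"] complex_Re_le_cmod[of "of_real s + cnj d"] d by auto

text \<open>
  The modes can approach \<open>1\<close> only as \<open>s\<close> tends to \<open>0\<close>; this is where levels below \<open>\<eta>\<close> are given up.
\<close>
lemma one_minus_limit_coeff_ge:
  assumes "\<eta> > 0" "s \<ge> \<eta>" shows "2 / cmod (1 - limit_coeff s) + 4 \<le> lipschitz_const \<eta>"
proof -
  have s: "s > 0" using assms by simp
  note nz = s_plus_d_nonzero[OF s]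
  have "1 - limit_coeff s = of_real (s + 2 * Re d) / (of_real s + cnj d)"
    using nz by (simp add: limit_coeff_def field_simps) (simp add: complex_eq_iff)
  then have "1 / cmod (1 - limit_coeff s) = cmod (of_real s + cnj d) / (s + 2 * Re d)"
    using s d by (simp add: norm_divide del: of_real_add)
  also have "\<dots> \<le> (s + cmod d) / s"
    using s d norm_triangle_ineq[of "of_real s" "cnj d"] by (intro frac_le) auto
  also have "\<dots> = 1 + cmod d / s" using s by (simp add: field_simps)
  also have "\<dots> \<le> 1 + cmod d / \<eta>" using assms s by (intro add_left_mono divide_left_mono mult_pos_pos) auto
  finally have "1 / cmod (1 - limit_coeff s) \<le> 1 + cmod d / \<eta>" .
  then show ?thesis by (simp add: lipschitz_const_def)
qed

lemma limit_coeff_lipschitz: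
  assumes "\<eta> > 0" "s \<ge> \<eta>" "t \<ge> \<eta>" shows "cmod (limit_coeff s - limit_coeff t) \<le> cmod d / \<eta>\<^sup>2 * \<bar>s - t\<bar>"
proof -
  have s: "s > 0" "t > 0" using assms by auto
  have "limit_coeff s - limit_coeff t = d * of_real (s - t) / ((of_real s + cnj d) * (of_real t + cnj d))"
    using s_plus_d_nonzero[OF s(1)] s_plus_d_nonzero[OF s(2)] by (simp add: limit_coeff_def field_simps)
  then have "cmod (limit_coeff s - limit_coeff t) = cmod d * \<bar>s - t\<bar> / (cmod (of_real s + cnj d) * cmod (of_real t + cnj d))"
    by (simp only: norm_divide norm_mult norm_of_real)
  also have "\<dots> \<le> cmod d * \<bar>s - t\<bar> / (\<eta> * \<eta>)"
  proof (intro divide_left_mono mult_mono mult_pos_pos)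
    have "\<eta> \<le> cmod (of_real s + cnj d)" "\<eta> \<le> cmod (of_real t + cnj d)"
      using assms s_plus_d_ge(2)[OF s(1)] s_plus_d_ge(2)[OF s(2)] by linarith+
    then show "\<eta> \<le> cmod (of_real s + cnj d)" "\<eta> \<le> cmod (of_real t + cnj d)" by -
    show "0 < cmod (of_real s + cnj d)" "0 < cmod (of_real t + cnj d)"
      using s_plus_d_nonzero(2)[OF s(1)] s_plus_d_nonzero(2)[OF s(2)] by simp_all
  qed (use assms in auto)
  finally show ?thesis by (simp add: power2_eq_square)
qed

text \<open>
  Fixed points of uniform contractions inherit the Lipschitz dependence of the maps, with the factor \<open>9/5 = 1 / (1 - 4/9)\<close>.
\<close>
lemma fixpt_lipschitz:
  assumes "\<eta> > 0" "s \<ge> \<eta>" "t \<ge> \<eta>" "cmod z \<le> 1/4"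
  shows "cmod (fixpt s z - fixpt t z) \<le> 9/5 * lipschitz_const \<eta> * (cmod d / \<eta>\<^sup>2 * \<bar>s - t\<bar>)"
proof -
  have st: "s > 0" "t > 0" and z: "cmod z < 1" using assms by auto
  have "cmod (fixpt s z - fixpt t z) = cmod ((moebius_step (limit_coeff s) z (fixpt s z) - moebius_step (limit_coeff s) z (fixpt t z)) + (moebius_step (limit_coeff s) z (fixpt t z) - moebius_step (limit_coeff t) z (fixpt t z)))"
    by (simp add: moebius_step_fixpt st z)
  also have "\<dots> \<le> 4/9 * cmod (fixpt s z - fixpt t z) + lipschitz_const \<eta> * (cmod d / \<eta>\<^sup>2 * \<bar>s - t\<bar>)"
  proof (rule norm_triangle_mono)
    show "cmod (moebius_step (limit_coeff s) z (fixpt s z) - moebius_step (limit_coeff s) z (fixpt t z)) \<le> 4/9 * cmod (fixpt s z - fixpt t z)"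
      by (rule moebius_step_contraction[OF norm_limit_coeff[OF st(1)] assms(4) norm_fixpt[OF st(1) z] norm_fixpt[OF st(2) z]])
    have "cmod (moebius_step (limit_coeff s) z (fixpt t z) - moebius_step (limit_coeff t) z (fixpt t z)) \<le> (2 / cmod (1 - limit_coeff t) + 4) * cmod (limit_coeff s - limit_coeff t)"
      by (rule moebius_step_lipschitz[OF norm_limit_coeff[OF st(1)] norm_limit_coeff[OF st(2)] assms(4) norm_fixpt[OF st(2) z]])
    also have "\<dots> \<le> lipschitz_const \<eta> * (cmod d / \<eta>\<^sup>2 * \<bar>s - t\<bar>)"
      by (rule mult_mono[OF one_minus_limit_coeff_ge limit_coeff_lipschitz]) (use assms in \<open>auto simp: lipschitz_const_def\<close>)
    finally show "cmod (moebius_step (limit_coeff s) z (fixpt t z) - moebius_step (limit_coeff t) z (fixpt t z)) \<le> lipschitz_const \<eta> * (cmod d / \<eta>\<^sup>2 * \<bar>s - t\<bar>)" .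
  qed
  finally show ?thesis by simp
qed

end

locale jacobi_chain = hua_pickrell d + verblunsky m a for d m a
begin

text \<open>
  The normalization by the values at \<open>1\<close> makes the recursion depend on the deformed coefficients alone.
\<close>
definition ratio :: "nat \<Rightarrow> complex \<Rightarrow> complex" where
  "ratio k z = szego_phi a z k / szego_psi a z k * (szego_psi a 1 k / szego_phi a 1 k)"

lemma norm_ratio: "k \<le> m \<Longrightarrow> cmod z \<le> 1 \<Longrightarrow> cmod (ratio k z) \<le> 1"
proof -
  assume k: "k \<le> m" and z: "cmod z \<le> 1"
  have p: "szego_psi a z k \<noteq> 0" "cmod (szego_phi a z k) \<le> cmod (szego_psi a z k)"
    using szego_phi_le_psi[of k a z] disc k z by auto
  have "cmod (szego_psi a 1 k / szego_phi a 1 k) = 1"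
    using unimodular_quotient[OF phi_1_nonzero[OF k]] by (simp add: psi_at_1)
  then have "cmod (ratio k z) = cmod (szego_phi a z k) / cmod (szego_psi a z k)"
    by (simp only: ratio_def norm_mult norm_divide mult_1_right)
  then show ?thesis using p by (simp add: divide_le_eq_1)
qed

lemma step_factor_ratio: "k \<le> m \<Longrightarrow> step_factor k z = cnj (deformed a k) * z * ratio k z"
  using phi_1_nonzero[of k] by (simp add: step_factor_def deformed_def ratio_def psi_at_1)

lemma ratio_Suc:
  assumes k: "k < m" and z: "cmod z \<le> 1"
  shows "ratio (Suc k) z = moebius_step (deformed a k) z (ratio k z)"
proof -
  define p q p1 q1 g where "p = szego_phi a z k" and "q = szego_psi a z k" and "p1 = szego_phi a 1 k" and "q1 = szego_psi a 1 k" and "g = deformed a k"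
  have nz: "q \<noteq> 0" "p1 \<noteq> 0" "q1 \<noteq> 0"
    using psi_nonzero[of z k] phi_1_nonzero[of k] k z by (auto simp: q_def p1_def q1_def psi_at_1)
  have q1: "q1 = cnj p1" by (simp add: p1_def q1_def psi_at_1)
  have ga: "cnj (a k) * q1 = g * p1" "a k * p1 = cnj g * q1" "cnj (a k) = g * (p1 / q1)" "a k = cnj g * (q1 / p1)"
    using nz unfolding q1 by (auto simp: g_def deformed_def p1_def)
  define r where "r = ratio k z"
  have r: "r = p / q * (q1 / p1)" by (simp add: r_def ratio_def p_def q_def p1_def q1_def)
  have pr: "p = r * q * (p1 / q1)" using nz by (simp add: r)
  have s1: "szego_phi a z (Suc k) = q * (p1 / q1) * (z * r - g)"
  proof -
    have "szego_phi a z (Suc k) = z * p - cnj (a k) * q" by (simp add: p_def q_def)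
    also have "\<dots> = z * (r * q * (p1 / q1)) - (g * (p1 / q1)) * q" using pr ga(3) by metis
    also have "\<dots> = q * (p1 / q1) * (z * r - g)" by (simp only: right_diff_distrib mult_ac)
    finally show ?thesis .
  qed
  have s2: "szego_psi a z (Suc k) = q * (1 - cnj g * z * r)"
  proof -
    have "szego_psi a z (Suc k) = q - a k * z * p" by (simp add: p_def q_def)
    also have "\<dots> = q - (cnj g * (q1 / p1)) * z * (r * q * (p1 / q1))" using pr ga(4) by metis
    finally show ?thesis using nz by (simp add: algebra_simps)
  qed
  have s3: "szego_phi a 1 (Suc k) = p1 * (1 - g)"
    using ga(1) by (simp add: p1_def[symmetric] q1_def[symmetric] algebra_simps)
  have s4: "szego_psi a 1 (Suc k) = q1 * (1 - cnj g)"
    using ga(2) by (simp add: p1_def[symmetric] q1_def[symmetric] algebra_simps)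
  show ?thesis
    unfolding ratio_def[of "Suc k"] s1 s2 s3 s4 moebius_step_def r_def[symmetric] g_def[symmetric] using nz by (simp add: mult_ac)
qed

definition scale :: "nat \<Rightarrow> real" where "scale k = (real m - real k) / real (Suc m)"

text \<open>
  Each error contributes a geometric series to the later ones, so the errors of the chain add up to a multiple of the total
  perturbation.
\<close>
lemma contraction_sum:
  fixes e c :: "nat \<Rightarrow> real"
  assumes "\<And>k. k < K \<Longrightarrow> e (Suc k) \<le> 4/9 * e k + c k"
  shows "j \<le> K \<Longrightarrow> (\<Sum>k<j. e k) + 9/5 * e j \<le> 9/5 * (e 0 + (\<Sum>k<j. c k))"
proof (induction j)
  case (Suc j)
  then show ?case using assms[of j] by (simp add: algebra_simps)
qed simp

text \<open>
  The first \<open>K\<close> levels are at least \<open>\<eta>\<close>; there the ratio follows the moving fixed point, and the errors are summed by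
  \<open>contraction_sum\<close>. The remaining levels cost at most \<open>1\<close> each, and so does the last, unimodular coefficient.
\<close>
lemma chain_bound:
  assumes \<eta>: "\<eta> > 0" and K: "K < m" and K\<eta>: "\<eta> * real (Suc m) \<le> real m - real K" and z: "cmod z \<le> 1/4"
  shows "cmod ((\<Sum>\<zeta>\<in>zeros. Ln (1 - cnj \<zeta> * z)) - (\<Sum>k<m. Ln (limit_factor (scale k) z)))
    \<le> 2 + 2 * lipschitz_const \<eta> * lipschitz_const \<eta> * (cmod d / \<eta>\<^sup>2) + (\<Sum>k<K. 2 * lipschitz_const \<eta> * cmod (deformed a k - limit_coeff (scale k))) + (real (Suc m) - real K)"
proof -
  define s where "s = scale"
  define e where "e k = cmod (ratio k z - fixpt (s k) z)" for k
  define \<delta> where "\<delta> k = cmod (deformed a k - limit_coeff (s k))" for k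
  define L where "L = lipschitz_const \<eta>"
  \<comment> \<open>The displacement of the fixed point from one level to the next.\<close>
  define C where "C = 9/5 * L * (cmod d / \<eta>\<^sup>2 * (1 / real (Suc m)))"
  have L: "L \<ge> 4" using \<eta> by (simp add: L_def lipschitz_const_def)
  have z1: "cmod z < 1" "cmod z \<le> 1" using z by auto
  have s\<eta>: "s k \<ge> \<eta>" if "k \<le> K" for k
  proof -
    have "\<eta> * real (Suc m) \<le> real m - real k" using K\<eta> that by linarith
    then show ?thesis unfolding s_def scale_def by (simp add: le_divide_eq del: of_nat_Suc)
  qed
  have s0: "s k > 0" if "k < m" for k using that by (simp add: s_def scale_def)
  have \<gamma>1: "cmod (deformed a k) < 1" if "k < m" for k using norm_deformed[of k] disc[of k] that by simp
  have fe: "cmod (fixpt (s k) z) \<le> 1" if "k < m" for k using norm_fixpt[OF s0[OF that] z1(1)] .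
  have rec: "e (Suc k) \<le> 4/9 * e k + (L * \<delta> k + C)" if k: "k < K" for k
  proof -
    have km: "k < m" "Suc k < m" using k K by auto
    have r: "cmod (ratio k z) \<le> 1" using norm_ratio[of k z] km z1 by simp
    note g = norm_limit_coeff[OF s0[OF km(1)]]
    \<comment> \<open>Three sources of error: the fluctuation of the coefficient, the old error, and the motion of the fixed point.\<close>
    have "ratio (Suc k) z - fixpt (s (Suc k)) z
        = (moebius_step (deformed a k) z (ratio k z) - moebius_step (limit_coeff (s k)) z (ratio k z)) + (moebius_step (limit_coeff (s k)) z (ratio k z) - moebius_step (limit_coeff (s k)) z (fixpt (s k) z))
          + (fixpt (s k) z - fixpt (s (Suc k)) z)"
      by (simp add: ratio_Suc[OF km(1) z1(2)] moebius_step_fixpt[OF s0[OF km(1)] z1(1)])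
    also have "cmod \<dots> \<le> L * \<delta> k + 4/9 * e k + C"
    proof (intro norm_triangle_mono)
      have "cmod (moebius_step (deformed a k) z (ratio k z) - moebius_step (limit_coeff (s k)) z (ratio k z)) \<le> (2 / cmod (1 - limit_coeff (s k)) + 4) * cmod (deformed a k - limit_coeff (s k))"
        by (rule moebius_step_lipschitz[OF \<gamma>1[OF km(1)] g z r])
      also have "\<dots> \<le> L * \<delta> k" unfolding L_def \<delta>_def
        using one_minus_limit_coeff_ge[OF \<eta> s\<eta>[of k]] k by (intro mult_right_mono) auto
      finally show "cmod (moebius_step (deformed a k) z (ratio k z) - moebius_step (limit_coeff (s k)) z (ratio k z)) \<le> L * \<delta> k" .
      show "cmod (moebius_step (limit_coeff (s k)) z (ratio k z) - moebius_step (limit_coeff (s k)) z (fixpt (s k) z)) \<le> 4/9 * e k"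
        unfolding e_def by (rule moebius_step_contraction[OF g z r fe[OF km(1)]])
      have "s k - s (Suc k) = 1 / real (Suc m)"
        unfolding s_def scale_def diff_divide_distrib[symmetric] by simp
      then have ab: "\<bar>s k - s (Suc k)\<bar> = 1 / real (Suc m)" by simp
      have "cmod (fixpt (s k) z - fixpt (s (Suc k)) z) \<le> 9/5 * lipschitz_const \<eta> * (cmod d / \<eta>\<^sup>2 * \<bar>s k - s (Suc k)\<bar>)"
        using k by (intro fixpt_lipschitz \<eta> s\<eta> z) auto
      then show "cmod (fixpt (s k) z - fixpt (s (Suc k)) z) \<le> C" unfolding ab C_def L_def .
    qed
    finally show ?thesis unfolding e_def by simp
  qed
  have C0: "C \<ge> 0" using L by (simp add: C_def)
  have "real K * C \<le> real (Suc m) * C" using C0 K by (intro mult_right_mono) auto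
  also have "\<dots> = 9/5 * L * (cmod d / \<eta>\<^sup>2)" by (simp add: C_def)
  finally have KC: "real K * C \<le> 9/5 * L * (cmod d / \<eta>\<^sup>2)" .
  have "(\<Sum>k<K. e k) \<le> 9/5 * (e 0 + (\<Sum>k<K. L * \<delta> k + C))"
  proof -
    have "(\<Sum>k<K. e k) + 9/5 * e K \<le> 9/5 * (e 0 + (\<Sum>k<K. L * \<delta> k + C))"
      using rec by (rule contraction_sum) auto
    moreover have "0 \<le> 9/5 * e K" by (simp add: e_def)
    ultimately show ?thesis by linarith
  qed
  also have "\<dots> \<le> 9/5 * (2 + (L * (\<Sum>k<K. \<delta> k) + 9/5 * L * (cmod d / \<eta>\<^sup>2)))"
  proof (intro mult_left_mono add_mono)
    show "e 0 \<le> 2"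
    using norm_triangle_ineq4[of "ratio 0 z" "fixpt (s 0) z"] norm_ratio[of 0 z] fe[of 0] K z1 by (simp add: e_def)
    have "(\<Sum>k<K. L * \<delta> k + C) = L * (\<Sum>k<K. \<delta> k) + real K * C" by (simp add: sum.distrib sum_distrib_left)
    then show "(\<Sum>k<K. L * \<delta> k + C) \<le> L * (\<Sum>k<K. \<delta> k) + 9/5 * L * (cmod d / \<eta>\<^sup>2)"
      using KC by simp
  qed auto
  finally have E: "(\<Sum>k<K. e k) \<le> 9/5 * (2 + (L * (\<Sum>k<K. \<delta> k) + 9/5 * L * (cmod d / \<eta>\<^sup>2)))" .
  have sf: "cmod (step_factor k z) \<le> 1/4" if "k \<le> m" for k using step_factor_le_1[OF that z1(2)] z by simp
  have gf: "cmod (cnj (limit_coeff (s k)) * z * fixpt (s k) z) \<le> 1/4" if "k < m" for k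
  proof -
    have "cmod (limit_coeff (s k)) * cmod z * cmod (fixpt (s k) z) \<le> 1 * (1/4) * 1"
      using norm_limit_coeff[OF s0[OF that]] z fe[OF that] by (intro mult_mono) auto
    then show ?thesis by (simp add: norm_mult)
  qed
  have limit_factor: "limit_factor (s k) z = 1 - cnj (limit_coeff (s k)) * z * fixpt (s k) z" if "k < m" for k by (rule limit_factor_eq[OF s0[OF that] z1(1)])
  have t1: "cmod (Ln (1 - step_factor k z) - Ln (limit_factor (s k) z)) \<le> 1/3 * (\<delta> k + e k)" if "k < m" for k
  proof -
    have "cmod (Ln (1 - step_factor k z) - Ln (limit_factor (s k) z)) \<le> 4/3 * cmod (step_factor k z - cnj (limit_coeff (s k)) * z * fixpt (s k) z)"
      unfolding limit_factor[OF that] using that by (intro Ln_one_minus_lipschitz sf gf) auto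
    also have "step_factor k z - cnj (limit_coeff (s k)) * z * fixpt (s k) z
      = z * (cnj (deformed a k - limit_coeff (s k)) * ratio k z + cnj (limit_coeff (s k)) * (ratio k z - fixpt (s k) z))"
      using that by (simp add: step_factor_ratio algebra_simps)
    also have "cmod \<dots> \<le> 1/4 * (\<delta> k * 1 + 1 * e k)"
      unfolding norm_mult[of z]
    proof (intro mult_mono norm_triangle_mono z)
      show "cmod (cnj (deformed a k - limit_coeff (s k)) * ratio k z) \<le> \<delta> k * 1"
        unfolding norm_mult complex_mod_cnj \<delta>_def using norm_ratio[of k z] that z1 by (intro mult_mono) auto
      show "cmod (cnj (limit_coeff (s k)) * (ratio k z - fixpt (s k) z)) \<le> 1 * e k"
        unfolding norm_mult complex_mod_cnj e_def using norm_limit_coeff[OF s0[OF that]] by (intro mult_mono) auto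
    qed auto
    finally show ?thesis by simp
  qed
  have t2: "cmod (Ln (1 - step_factor k z) - Ln (limit_factor (s k) z)) \<le> 1" if "k < m" for k
    using norm_triangle_ineq4[of "Ln (1 - step_factor k z)" "Ln (limit_factor (s k) z)"] Ln_one_minus_bound[OF sf, of k]
      Ln_one_minus_bound[OF gf[OF that]] that unfolding limit_factor[OF that] by simp
  have "(\<Sum>\<zeta>\<in>zeros. Ln (1 - cnj \<zeta> * z)) = (\<Sum>k\<le>m. Ln (1 - step_factor k z))"
  proof (rule Ln_sum_identity[OF z1(2)])
    fix \<zeta> assume "\<zeta> \<in> zeros"
    then have "cmod (cnj \<zeta> * z) < 1" using zerosD(1)[of \<zeta>] z by (simp add: norm_mult)
    then show "cnj \<zeta> * z \<noteq> 1" by auto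
  qed
  also have "\<dots> = (\<Sum>k<m. Ln (1 - step_factor k z)) + Ln (1 - step_factor m z)"
    unfolding lessThan_Suc_atMost[symmetric] by simp
  finally have id: "(\<Sum>\<zeta>\<in>zeros. Ln (1 - cnj \<zeta> * z)) - (\<Sum>k<m. Ln (limit_factor (s k) z))
     = (\<Sum>k<m. Ln (1 - step_factor k z) - Ln (limit_factor (s k) z)) + Ln (1 - step_factor m z)"
    by (simp add: sum_subtractf)
  also have "cmod \<dots> \<le> (\<Sum>k<m. cmod (Ln (1 - step_factor k z) - Ln (limit_factor (s k) z))) + 1"
    using Ln_one_minus_bound[OF sf[of m]] by (intro norm_triangle_mono norm_sum) auto
  also have "(\<Sum>k<m. cmod (Ln (1 - step_factor k z) - Ln (limit_factor (s k) z)))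
      = (\<Sum>k<K. cmod (Ln (1 - step_factor k z) - Ln (limit_factor (s k) z))) + (\<Sum>k\<in>{K..<m}. cmod (Ln (1 - step_factor k z) - Ln (limit_factor (s k) z)))"
    using K by (subst sum.union_disjoint[symmetric]) (auto intro!: sum.cong)
  also have "\<dots> \<le> (\<Sum>k<K. 1/3 * (\<delta> k + e k)) + (\<Sum>k\<in>{K..<m}. 1)"
    using t1 t2 K by (intro add_mono sum_mono) auto
  also have "\<dots> = 1/3 * ((\<Sum>k<K. \<delta> k) + (\<Sum>k<K. e k)) + (real m - real K)"
    unfolding sum_distrib_left[symmetric] sum.distrib using K by (simp add: of_nat_diff)
  also have "\<dots> \<le> 1/3 * ((\<Sum>k<K. \<delta> k) + 9/5 * (2 + (L * (\<Sum>k<K. \<delta> k) + 9/5 * L * (cmod d / \<eta>\<^sup>2)))) + (real m - real K)"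
    using E by simp
  also have "\<dots> \<le> 2 + 2 * L * L * (cmod d / \<eta>\<^sup>2) + 2 * L * (\<Sum>k<K. \<delta> k) + (real m - real K)"
  proof -
    have S: "(\<Sum>k<K. \<delta> k) \<ge> 0" by (intro sum_nonneg) (simp add: \<delta>_def)
    have q: "cmod d / \<eta>\<^sup>2 \<ge> 0" by simp
    have "1 * (\<Sum>k<K. \<delta> k) \<le> L * (\<Sum>k<K. \<delta> k)" using L S by (intro mult_right_mono) auto
    moreover have "1 * L * (cmod d / \<eta>\<^sup>2) \<le> L * L * (cmod d / \<eta>\<^sup>2)" using L q by (intro mult_right_mono) auto
    moreover have "0 \<le> L * L * (cmod d / \<eta>\<^sup>2)" "0 \<le> L * (\<Sum>k<K. \<delta> k)" using L q S by auto
    ultimately show ?thesis by (simp add: algebra_simps)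
  qed
  finally have "cmod ((\<Sum>\<zeta>\<in>zeros. Ln (1 - cnj \<zeta> * z)) - (\<Sum>k<m. Ln (limit_factor (s k) z)))
     \<le> 2 + 2 * L * L * (cmod d / \<eta>\<^sup>2) + 2 * L * (\<Sum>k<K. \<delta> k) + (real m - real K) + 1" by simp
  then show ?thesis by (simp add: s_def L_def \<delta>_def sum_distrib_left)
qed

end

section \<open>Riemann sums and the limiting Herglotz function\<close>

text \<open>
  Cauchy's inequality for the Taylor coefficients.
\<close>
lemma coefficient_bound:
  assumes hol: "f holomorphic_on ball 0 1" and r: "0 < r" "r < 1"
    and s: "\<And>z. cmod z < 1 \<Longrightarrow> (\<lambda>k. c k * z ^ k) sums f z"
    and B: "\<And>z. cmod z \<le> r \<Longrightarrow> cmod (f z) \<le> B"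
  shows "cmod (c k) \<le> B / r ^ k"
proof -
  have "f has_fps_expansion Abs_fps c"
  proof (rule has_fps_expansionI)
    have "eventually (\<lambda>u. u \<in> ball (0::complex) 1) (nhds 0)" by (rule eventually_nhds_in_open) auto
    then show "eventually (\<lambda>u. (\<lambda>n. fps_nth (Abs_fps c) n * u ^ n) sums f u) (nhds 0)"
      by (rule eventually_mono) (use s in auto)
  qed
  from fps_nth_fps_expansion[OF this, of k] have c: "c k = (deriv ^^ k) f 0 / fact k" by simp
  have "cball 0 r \<subseteq> ball (0::complex) 1" "ball 0 r \<subseteq> ball (0::complex) 1" using r by auto
  then have "f holomorphic_on ball 0 r" "continuous_on (cball 0 r) f"
    using hol holomorphic_on_subset holomorphic_on_imp_continuous_on by blast+
  from Cauchy_inequality[OF this r(1), of B k] B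
  have "cmod ((deriv ^^ k) f 0) \<le> fact k * B / r ^ k" by simp
  then show ?thesis by (simp add: c norm_divide divide_le_eq field_simps)
qed

lemma deriv_bound:
  assumes hol: "f holomorphic_on ball 0 1" and B: "\<And>z. cmod z \<le> 1/4 \<Longrightarrow> cmod (f z) \<le> B" and z: "cmod z \<le> 1/8"
  shows "cmod (deriv f z) \<le> 8 * B"
proof -
  have sub: "cmod x \<le> 1/4" if "dist z x \<le> 1/8" for x
    using norm_triangle_ineq2[of x z] that z by (simp add: dist_norm norm_minus_commute)
  then have "cball z (1/8) \<subseteq> ball 0 1" by force
  moreover from this have "ball z (1/8) \<subseteq> ball 0 1" using ball_subset_cball by blast
  ultimately have "f holomorphic_on ball z (1/8)" "continuous_on (cball z (1/8)) f"
    using hol holomorphic_on_subset holomorphic_on_imp_continuous_on by blast+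
  from Cauchy_inequality[OF this, of B 1] B sub show ?thesis by (simp add: dist_norm)
qed

context hua_pickrell
begin

lemma holomorphic_herglotz: assumes s: "s > 0" shows "(\<lambda>z. herglotz s (cayley z)) holomorphic_on ball 0 1"
proof -
  have "Disc s (cayley z) \<notin> \<real>\<^sub>\<le>\<^sub>0" if "z \<in> ball 0 1" for z
    using Disc_slit[OF s cayley_pos] that by simp
  then show ?thesis
    unfolding herglotz_def Root_def
    by (intro holomorphic_intros) (auto simp: Disc_def A_def B_def intro!: holomorphic_intros holomorphic_cayley)
qed

lemma herglotz_at_1: assumes s: "s > 0" shows "herglotz s 1 = of_real s"
proof -
  have "Disc s 1 = (of_real s + d)\<^sup>2"
    by (simp add: complex_eq_iff Disc_def A_def B_def power2_eq_square algebra_simps)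
  moreover have "csqrt ((of_real s + d)\<^sup>2) = of_real s + d"
    by (rule csqrt_square) (use s d in auto)
  ultimately have "Root s 1 = of_real s + d" unfolding Root_def by (simp only:)
  then show ?thesis by (simp add: herglotz_def A_def complex_eq_iff)
qed

text \<open>
  The Schwarz lemma for \<open>(F - s) / (F + s)\<close> with \<open>F = herglotz s (cayley z)\<close>: \<open>F\<close> has positive real part and equals \<open>s\<close> at
  \<open>z = 0\<close>. The bound is linear in \<open>s\<close>, so small levels do not contribute to the telescoping sum.
\<close>
lemma norm_herglotz_le:
  assumes s: "s > 0" and z: "cmod z \<le> 1/8" shows "cmod (herglotz s (cayley z)) \<le> 2 * s"
proof -
  define g where "g z = (herglotz s (cayley z) - of_real s) / (herglotz s (cayley z) + of_real s)" for z
  have p: "Re (herglotz s (cayley z)) > 0" if "cmod z < 1" for z using Re_herglotz_pos[OF s cayley_pos[OF that]] .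
  have nz: "herglotz s (cayley z) + of_real s \<noteq> 0" if "cmod z < 1" for z using p[OF that] s by (auto simp: complex_eq_iff)
  have "cmod (g z) \<le> cmod z"
  proof (rule Schwarz_Lemma(1))
    show "g holomorphic_on ball 0 1"
      unfolding g_def using nz by (intro holomorphic_intros holomorphic_herglotz s) auto
    show "g 0 = 0" using herglotz_at_1[OF s] by (simp add: g_def cayley_def)
    show "cmod (g z) < 1" if "cmod z < 1" for z
    proof -
      let ?F = "herglotz s (cayley z)"
      have "(cmod (?F - of_real s))\<^sup>2 < (cmod (?F + of_real s))\<^sup>2"
        unfolding cmod_power2 using p[OF that] s by (simp add: power2_eq_square algebra_simps)
      then have "cmod (?F - of_real s) < cmod (?F + of_real s)" by (rule power2_less_imp_less) simp
      then show ?thesis by (simp add: g_def norm_divide divide_less_eq)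
    qed
    show "cmod z < 1" using z by simp
  qed
  then have g: "cmod (g z) \<le> 1/8" using z by simp
  have z1: "cmod z < 1" using z by simp
  let ?F = "herglotz s (cayley z)"
  have "g z * (?F + of_real s) = ?F - of_real s" using nz[OF z1] by (simp add: g_def)
  then have "?F = of_real s + g z * (?F + of_real s)" by simp
  then have "cmod ?F \<le> cmod (of_real s) + cmod (g z * (?F + of_real s))" using norm_triangle_ineq by metis
  also have "\<dots> \<le> s + 1/8 * (cmod ?F + s)"
    unfolding norm_mult using g s norm_triangle_ineq[of ?F "of_real s"] by (intro add_mono mult_mono) auto
  finally have "cmod ?F \<le> s + 1/8 * (cmod ?F + s)" .
  moreover have "x \<le> s + 1/8 * (x + s) \<Longrightarrow> x \<le> 2 * s" for x using s by argo
  ultimately show ?thesis by blast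
qed

lemma herglotz_derivative_s:
  assumes "s > 0" "cmod z < 1"
  shows "((\<lambda>s. (of_real s - herglotz s (cayley z)) / 2) has_vector_derivative log_slope s z) (at s)"
proof -
  have o: "(complex_of_real has_vector_derivative 1) (at s)" by (auto intro!: derivative_eq_intros)
  have "((\<lambda>s. of_real s - (Root s (cayley z) - A (cayley z))) has_vector_derivative (1 - ((of_real s + B (cayley z)) / Root s (cayley z) - 0))) (at s)"
    by (intro has_vector_derivative_diff o Root_derivative_s assms cayley_pos has_vector_derivative_const)
  from has_vector_derivative_mult_left[OF this, of "1/2"] show ?thesis
    by (simp add: herglotz_def log_slope_def)
qed

lemma log_limit_factor_derivative:
  assumes s: "s > 0" and z: "cmod z < 1"
  obtains l where "((\<lambda>z. Ln (limit_factor s z)) has_field_derivative l) (at z)" "z * l = log_slope s z"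
proof -
  obtain E' where E': "(limit_factor s has_field_derivative E') (at z)" "z * E' = log_slope s z * limit_factor s z"
    using limit_factor_derivative[OF assms] by blast
  have "cmod (limit_coeff s) * (cmod z * cmod (fixpt s z)) \<le> cmod (limit_coeff s) * 1"
    using z norm_fixpt[OF assms] by (intro mult_left_mono mult_le_one) auto
  then have "cmod (cnj (limit_coeff s) * z * fixpt s z) < 1" using norm_limit_coeff[OF s] by (simp add: norm_mult mult.assoc)
  then have "Re (cnj (limit_coeff s) * z * fixpt s z) < 1" using complex_Re_le_cmod order.strict_trans1 by blast
  then have nr: "limit_factor s z \<notin> \<real>\<^sub>\<le>\<^sub>0" unfolding limit_factor_eq[OF assms] complex_nonpos_Reals_iff by simp
  show ?thesis
  proof
    show "((\<lambda>z. Ln (limit_factor s z)) has_field_derivative inverse (limit_factor s z) * E') (at z)"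
      by (rule DERIV_chain2[OF has_field_derivative_Ln[OF nr] E'(1)])
    show "z * (inverse (limit_factor s z) * E') = log_slope s z"
      using E'(2) limit_factor_nonzero[OF assms] by (simp add: field_simps)
  qed
qed

lemma holomorphic_log_limit_factor: assumes s: "s > 0" shows "(\<lambda>z. Ln (limit_factor s z)) holomorphic_on ball 0 1"
proof -
  have "\<exists>l. ((\<lambda>z. Ln (limit_factor s z)) has_field_derivative l) (at z)" if z: "z \<in> ball 0 1" for z
  proof -
    have z1: "cmod z < 1" using z by simp
    show ?thesis by (rule log_limit_factor_derivative[OF s z1]) blast
  qed
  then show ?thesis
    by (simp add: holomorphic_on_open)
qed

lemma norm_log_limit_factor_le: assumes s: "s > 0" and z: "cmod z \<le> 1/4" shows "cmod (Ln (limit_factor s z)) \<le> 1"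
proof -
  have z1: "cmod z < 1" using z by simp
  have "cmod (limit_coeff s) * cmod z * cmod (fixpt s z) \<le> 1 * (1/4) * 1"
    using norm_limit_coeff[OF s] z norm_fixpt[OF s z1] by (intro mult_mono) auto
  then have w: "cmod (cnj (limit_coeff s) * z * fixpt s z) \<le> 1/4" by (simp add: norm_mult)
  then have "cmod (Ln (1 + - (cnj (limit_coeff s) * z * fixpt s z))) \<le> 2 * cmod (- (cnj (limit_coeff s) * z * fixpt s z))"
    by (intro norm_Ln_le) auto
  then show ?thesis using w unfolding limit_factor_eq[OF s z1] by simp
qed

text \<open>
  Cauchy's inequality for \<open>Ln (limit_factor s z)\<close> gives a bound that is uniform in the level, although the formula for
  \<open>log_slope\<close> may degenerate as \<open>s\<close> tends to \<open>0\<close>.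
\<close>
lemma norm_log_slope_le: assumes s: "s > 0" and z: "cmod z \<le> 1/8" shows "cmod (log_slope s z) \<le> 1"
proof -
  have z1: "cmod z < 1" using z by simp
  obtain l where l: "((\<lambda>z. Ln (limit_factor s z)) has_field_derivative l) (at z)" "z * l = log_slope s z"
    using log_limit_factor_derivative[OF s z1] .
  have "cmod (deriv (\<lambda>z. Ln (limit_factor s z)) z) \<le> 8 * 1"
    by (rule deriv_bound[OF holomorphic_log_limit_factor[OF s] norm_log_limit_factor_le[OF s] z])
  then have "cmod l \<le> 8" using DERIV_imp_deriv[OF l(1)] by simp
  then have "cmod z * cmod l \<le> 1/8 * 8" using z by (intro mult_mono) auto
  then show ?thesis unfolding l(2)[symmetric] norm_mult by simp
qed

lemma log_slope_uniformly_continuous: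
  assumes \<eta>: "\<eta> > 0" and \<epsilon>: "\<epsilon> > 0"
  obtains \<delta> where "\<delta> > 0" "\<And>s t z. s \<in> {\<eta>..1} \<Longrightarrow> t \<in> {\<eta>..1} \<Longrightarrow> cmod z \<le> 1/8 \<Longrightarrow> \<bar>s - t\<bar> < \<delta> \<Longrightarrow> cmod (log_slope s z - log_slope t z) \<le> \<epsilon>"
proof -
  define S where "S = {\<eta>..1} \<times> cball (0::complex) (1/8)"
  have c: "continuous_on S (\<lambda>p. cayley (snd p))"
    unfolding cayley_def S_def by (intro continuous_intros) auto
  have pos: "fst p > 0" "cmod (snd p) < 1" if "p \<in> S" for p using that \<eta> by (auto simp: S_def)
  have D: "continuous_on S (\<lambda>p. Disc (fst p) (cayley (snd p)))"
    unfolding Disc_def A_def B_def by (intro continuous_intros c)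
  have R: "continuous_on S (\<lambda>p. Root (fst p) (cayley (snd p)))"
    unfolding Root_def
  proof (rule continuous_on_compose2[OF continuous_on_csqrt D])
    show "(\<lambda>p. Disc (fst p) (cayley (snd p))) ` S \<subseteq> - \<real>\<^sub>\<le>\<^sub>0"
      using Disc_slit[OF pos(1) cayley_pos[OF pos(2)]] by auto
  qed
  have "continuous_on S (\<lambda>p. log_slope (fst p) (snd p))"
    unfolding log_slope_def B_def using Root_nonzero[OF pos(1) cayley_pos[OF pos(2)]]
    by (intro continuous_intros c R) auto
  moreover have "compact S" unfolding S_def by (intro compact_Times) auto
  ultimately have uc: "uniformly_continuous_on S (\<lambda>p. log_slope (fst p) (snd p))" by (rule compact_uniformly_continuous)
  show ?thesis
  proof (rule uniformly_continuous_onE[OF uc \<epsilon>])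
    fix \<delta> assume \<delta>: "\<delta> > 0" "\<And>p q. p \<in> S \<Longrightarrow> q \<in> S \<Longrightarrow> dist q p < \<delta> \<Longrightarrow> dist (log_slope (fst q) (snd q)) (log_slope (fst p) (snd p)) < \<epsilon>"
    show ?thesis
    proof (rule that[OF \<delta>(1)])
      fix s t z assume st: "s \<in> {\<eta>..1}" "t \<in> {\<eta>..1}" "cmod z \<le> 1/8" "\<bar>s - t\<bar> < \<delta>"
      have "dist (s, z) (t, z) < \<delta>" using st by (simp add: dist_Pair_Pair dist_real_def)
      from \<delta>(2)[OF _ _ this] st have "dist (log_slope s z) (log_slope t z) < \<epsilon>" by (simp add: S_def)
      then show "cmod (log_slope s z - log_slope t z) \<le> \<epsilon>" by (simp add: dist_norm)
    qed
  qed
qed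

definition riemann_sum :: "nat \<Rightarrow> complex \<Rightarrow> complex" where
  "riemann_sum m z = (\<Sum>k<m. log_slope ((real m - real k) / real (Suc m)) z) / of_nat (Suc m)"

text \<open>
  \<open>log_slope\<close> is a derivative in the level, so the Riemann sum telescopes up to its modulus of continuity on the levels above \<open>\<eta>\<close>; the other
  levels contribute \<open>O \<eta>\<close> by the uniform bounds.
\<close>
lemma riemann_sum_limit:
  assumes \<epsilon>: "\<epsilon> > 0"
  obtains N where "\<And>m z. m \<ge> N \<Longrightarrow> cmod z \<le> 1/8 \<Longrightarrow> cmod (riemann_sum m z - (1 - herglotz 1 (cayley z)) / 2) \<le> \<epsilon>"
proof -
  define \<eta> where "\<eta> = min 1 (\<epsilon> / 12)"
  have \<eta>: "\<eta> > 0" "\<eta> \<le> 1" "3 * \<eta> \<le> \<epsilon> / 4" using \<epsilon> by (auto simp: \<eta>_def)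
  obtain \<delta> where \<delta>: "\<delta> > 0" "\<And>s t z. s \<in> {\<eta>..1} \<Longrightarrow> t \<in> {\<eta>..1} \<Longrightarrow> cmod z \<le> 1/8 \<Longrightarrow> \<bar>s - t\<bar> < \<delta> \<Longrightarrow> cmod (log_slope s z - log_slope t z) \<le> \<epsilon> / 4"
    using log_slope_uniformly_continuous[OF \<eta>(1), of "\<epsilon> / 4"] \<epsilon> by auto
  obtain N where N: "real N > max (1 / \<delta>) (16 / \<epsilon>)" using reals_Archimedean2 by blast
  show ?thesis
  proof (rule that)
    fix m z assume m: "m \<ge> N" and z: "cmod z \<le> 1/8"
    define n where "n = Suc m"
    have n: "real n > 0" "real n > 1 / \<delta>" "real n > 16 / \<epsilon>" using N m by (auto simp: n_def)
    have n\<delta>: "1 / real n < \<delta>" "4 / real n \<le> \<epsilon> / 4" using n \<delta>(1) \<epsilon> by (simp_all add: field_simps)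
    define \<sigma> where "\<sigma> j = real j / real n" for j
    define H where "H s = (of_real s - herglotz s (cayley z)) / 2" for s
    \<comment> \<open>The number of levels that are treated by the uniform bounds only.\<close>
    define J where "J = nat \<lceil>\<eta> * real n\<rceil>"
    have J: "real J \<ge> \<eta> * real n" "real J \<le> \<eta> * real n + 1" "J > 0" "J \<le> n"
    proof -
      have c: "0 < \<eta> * real n" "\<eta> * real n \<le> 1 * real n" using \<eta> n by (simp, intro mult_right_mono) auto
      then show "real J \<ge> \<eta> * real n" "real J \<le> \<eta> * real n + 1" "J > 0" unfolding J_def by linarith+
      have "J \<le> nat \<lceil>real n\<rceil>" unfolding J_def using c by (intro nat_mono ceiling_mono) simp
      then show "J \<le> n" by simp
    qed
    have \<sigma>J: "\<sigma> J \<ge> \<eta>" "\<sigma> J > 0" "\<sigma> n = 1" using J n by (simp_all add: \<sigma>_def le_divide_eq)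
    have z1: "cmod z < 1" using z by simp
    have "(\<Sum>k<m. log_slope ((real m - real k) / real n) z) = (\<Sum>k<m. log_slope (\<sigma> (Suc (m - Suc k))) z)"
      by (intro sum.cong) (auto simp: \<sigma>_def Suc_diff_Suc of_nat_diff)
    also have "\<dots> = (\<Sum>i<m. log_slope (\<sigma> (Suc i)) z)" by (rule sum.nat_diff_reindex[where g = "\<lambda>i. log_slope (\<sigma> (Suc i)) z"])
    \<comment> \<open>The level 1 is missing from the sum; it is added so that the telescoping sum ends exactly at level 1.\<close>
    also have "\<dots> = (\<Sum>i<n. log_slope (\<sigma> (Suc i)) z) - log_slope 1 z" using \<sigma>J(3) by (simp add: n_def)
    also have "(\<Sum>i<n. log_slope (\<sigma> (Suc i)) z) = (\<Sum>i<J. log_slope (\<sigma> (Suc i)) z) + (\<Sum>i=J..<n. log_slope (\<sigma> (Suc i)) z)"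
      using J(4) sum.atLeastLessThan_concat[of 0 J n "\<lambda>i. log_slope (\<sigma> (Suc i)) z"] by (simp add: atLeast0LessThan)
    finally have S: "riemann_sum m z = (\<Sum>i<J. log_slope (\<sigma> (Suc i)) z) / n + (\<Sum>i=J..<n. log_slope (\<sigma> (Suc i)) z) / n - log_slope 1 z / n"
      by (simp add: riemann_sum_def n_def[symmetric] add_divide_distrib diff_divide_distrib)
    have tel: "(\<Sum>i=J..<n. H (\<sigma> (Suc i)) - H (\<sigma> i)) = (1 - herglotz 1 (cayley z)) / 2 - H (\<sigma> J)"
      using sum_Suc_diff'[OF J(4), of "\<lambda>i. H (\<sigma> i)"] \<sigma>J(3) by (simp add: H_def)
    have one: "cmod (log_slope (\<sigma> (Suc i)) z / n - (H (\<sigma> (Suc i)) - H (\<sigma> i))) \<le> \<epsilon> / 4 / n" if i: "i \<in> {J..<n}" for i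
    proof -
      have d1: "\<sigma> (Suc i) - \<sigma> i = 1 / n" by (simp add: \<sigma>_def diff_divide_distrib[symmetric])
      have "real J / real n \<le> real i / real n" using i by (intro divide_right_mono) auto
      then have i1: "\<eta> \<le> \<sigma> i" using \<sigma>J(1) by (simp add: \<sigma>_def)
      have i2: "\<sigma> (Suc i) \<le> 1" using i n by (simp add: \<sigma>_def)
      have "0 \<le> 1 / real n" by simp
      then have le: "\<sigma> i \<le> \<sigma> (Suc i)" using d1 by linarith
      have "cmod (H (\<sigma> (Suc i)) - H (\<sigma> i) - (\<sigma> (Suc i) - \<sigma> i) *\<^sub>R log_slope (\<sigma> (Suc i)) z) \<le> norm (\<sigma> (Suc i) - \<sigma> i) * (\<epsilon> / 4)"
      proof (rule vector_differentiable_bound_linearization[where S = "{\<sigma> i..\<sigma> (Suc i)}" and f' = "\<lambda>s. log_slope s z"])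
        show "(H has_vector_derivative log_slope s z) (at s within {\<sigma> i..\<sigma> (Suc i)})" if "s \<in> {\<sigma> i..\<sigma> (Suc i)}" for s
          unfolding H_def by (rule has_vector_derivative_at_within[OF herglotz_derivative_s[OF _ z1]]) (use that i1 \<eta> in auto)
        show "closed_segment (\<sigma> i) (\<sigma> (Suc i)) \<subseteq> {\<sigma> i..\<sigma> (Suc i)}" using le by (simp add: closed_segment_eq_real_ivl)
        show "cmod (log_slope s z - log_slope (\<sigma> (Suc i)) z) \<le> \<epsilon> / 4" if "s \<in> {\<sigma> i..\<sigma> (Suc i)}" for s
        proof (rule \<delta>(2)[OF _ _ z])
          show "s \<in> {\<eta>..1}" "\<sigma> (Suc i) \<in> {\<eta>..1}" using that i1 i2 le by auto
          show "\<bar>s - \<sigma> (Suc i)\<bar> < \<delta>" using that d1 n\<delta>(1) by auto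
        qed
        show "\<sigma> (Suc i) \<in> {\<sigma> i..\<sigma> (Suc i)}" using le by simp
      qed
      then show ?thesis unfolding d1 by (simp add: norm_minus_commute scaleR_conv_of_real)
    qed
    have "cmod (\<Sum>i=J..<n. log_slope (\<sigma> (Suc i)) z / n - (H (\<sigma> (Suc i)) - H (\<sigma> i))) \<le> (\<Sum>i=J..<n. \<epsilon> / 4 / n)"
      by (rule order.trans[OF norm_sum sum_mono]) (rule one)
    also have "\<dots> \<le> \<epsilon> / 4" 
    proof -
      have "real (n - J) * \<epsilon> \<le> real n * \<epsilon>" using \<epsilon> by (intro mult_right_mono) auto
      then show ?thesis using n by (simp add: field_simps)
    qed
    finally have fin: "cmod (\<Sum>i=J..<n. log_slope (\<sigma> (Suc i)) z / n - (H (\<sigma> (Suc i)) - H (\<sigma> i))) \<le> \<epsilon> / 4" .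
    have "(\<Sum>i=J..<n. log_slope (\<sigma> (Suc i)) z / n - (H (\<sigma> (Suc i)) - H (\<sigma> i)))
        = (\<Sum>i=J..<n. log_slope (\<sigma> (Suc i)) z) / n - (\<Sum>i=J..<n. H (\<sigma> (Suc i)) - H (\<sigma> i))"
      by (simp only: sum_subtractf sum_divide_distrib)
    then have main: "cmod ((\<Sum>i=J..<n. log_slope (\<sigma> (Suc i)) z) / n - ((1 - herglotz 1 (cayley z)) / 2 - H (\<sigma> J))) \<le> \<epsilon> / 4"
      using fin unfolding tel by (simp only:)
    have small: "cmod ((\<Sum>i<J. log_slope (\<sigma> (Suc i)) z) / n) \<le> real J / n"
    proof -
      have "cmod (\<Sum>i<J. log_slope (\<sigma> (Suc i)) z) \<le> (\<Sum>i<J. 1)"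
        using n by (intro order.trans[OF norm_sum sum_mono] norm_log_slope_le z) (simp add: \<sigma>_def)
      then show ?thesis using n by (simp add: norm_divide divide_right_mono)
    qed
    have HJ: "cmod (H (\<sigma> J)) \<le> 2 * (real J / n)"
    proof -
      have "cmod (of_real (\<sigma> J) - herglotz (\<sigma> J) (cayley z)) \<le> cmod (of_real (\<sigma> J)) + cmod (herglotz (\<sigma> J) (cayley z))" by (rule norm_triangle_ineq4)
      also have "\<dots> \<le> \<sigma> J + 2 * \<sigma> J" using norm_herglotz_le[OF \<sigma>J(2) z] \<sigma>J(2) by (intro add_mono) auto
      finally show ?thesis using \<sigma>J(2) by (simp add: H_def norm_divide \<sigma>_def[symmetric])
    qed
    have h1: "cmod (log_slope 1 z / n) \<le> 1 / n" using norm_log_slope_le[of 1 z] z n by (simp add: norm_divide divide_right_mono)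
    have Jn: "real J / n \<le> \<eta> + 1 / n" using J(2) n by (simp add: field_simps)
    have "riemann_sum m z - (1 - herglotz 1 (cayley z)) / 2
       = (\<Sum>i<J. log_slope (\<sigma> (Suc i)) z) / n + ((\<Sum>i=J..<n. log_slope (\<sigma> (Suc i)) z) / n - ((1 - herglotz 1 (cayley z)) / 2 - H (\<sigma> J))) + (- H (\<sigma> J)) + (- (log_slope 1 z / n))"
      unfolding S by simp
    also have "cmod \<dots> \<le> real J / n + \<epsilon> / 4 + 2 * (real J / n) + 1 / n"
      by (intro norm_triangle_mono small main) (simp_all only: norm_minus_cancel HJ h1)
    also have "\<dots> \<le> \<epsilon>" using Jn n\<delta>(2) \<eta>(3) \<epsilon> by simp
    finally show "cmod (riemann_sum m z - (1 - herglotz 1 (cayley z)) / 2) \<le> \<epsilon>" .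
  qed
qed

definition herglotz_coeff :: "nat \<Rightarrow> complex" where
  "herglotz_coeff k = (deriv ^^ k) (\<lambda>z. herglotz 1 (cayley z)) 0 / fact k"

lemma herglotz_sums: "cmod z < 1 \<Longrightarrow> (\<lambda>k. herglotz_coeff k * z ^ k) sums herglotz 1 (cayley z)"
  using holomorphic_power_series[OF holomorphic_herglotz[of 1], of z] by (simp add: herglotz_coeff_def)

text \<open>
  Closeness of the logarithmic sums on \<open>cmod z \<le> 1/4\<close> gives closeness of the derivatives on \<open>cmod z \<le> 1/8\<close>. There
  \<open>z\<close> times the derivative of \<open>\<Sum> Ln (1 - cnj \<zeta> * z)\<close> is the generating function of the conjugate power sums, up to sign, whose Taylor
  coefficients are compared with those of the limit.
\<close>
lemma power_sum_bound:
  assumes S: "finite S" "S \<subseteq> sphere 0 1" "card S = Suc m"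
    and log: "\<And>z. cmod z \<le> 1/4 \<Longrightarrow> cmod ((\<Sum>\<zeta>\<in>S. Ln (1 - cnj \<zeta> * z)) - (\<Sum>k<m. Ln (limit_factor ((real m - real k) / real (Suc m)) z))) \<le> real (Suc m) * R"
    and rs: "\<And>z. cmod z \<le> 1/8 \<Longrightarrow> cmod (riemann_sum m z - (1 - herglotz 1 (cayley z)) / 2) \<le> \<rho>"
    and k: "k \<ge> 1"
  shows "cmod ((\<Sum>\<zeta>\<in>S. \<zeta> ^ k) / of_nat (Suc m) - cnj (herglotz_coeff k) / 2) \<le> 8 ^ k * (R + \<rho>)"
proof -
  define n where "n = Suc m"
  have n: "n > 0" by (simp add: n_def)
  define s where "s k = (real m - real k) / real n" for k
  have s: "s k > 0" if "k < m" for k using that by (simp add: s_def n_def)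
  have nz: "cmod (cnj \<zeta> * z) < 1" if "\<zeta> \<in> S" "cmod z < 1" for \<zeta> z using that S(2) by (auto simp: norm_mult)
  have nz': "1 - cnj \<zeta> * z \<noteq> 0" if "\<zeta> \<in> S" "cmod z < 1" for \<zeta> z using nz[OF that] by auto
  define g where "g z = (\<Sum>\<zeta>\<in>S. Ln (1 - cnj \<zeta> * z)) - (\<Sum>k<m. Ln (limit_factor (s k) z))" for z
  define G where "G z = (\<Sum>\<zeta>\<in>S. 1 - 1 / (1 - cnj \<zeta> * z)) / n - (1 - herglotz 1 (cayley z)) / 2" for z
  have Ld: "((\<lambda>z. Ln (1 - cnj \<zeta> * z)) has_field_derivative - cnj \<zeta> / (1 - cnj \<zeta> * z)) (at z)" if "\<zeta> \<in> S" "cmod z < 1" for \<zeta> z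
  proof -
    have "Re (cnj \<zeta> * z) < 1" using nz[OF that] complex_Re_le_cmod order.strict_trans1 by blast
    then have nr: "1 - cnj \<zeta> * z \<notin> \<real>\<^sub>\<le>\<^sub>0" unfolding complex_nonpos_Reals_iff by simp
    have "((\<lambda>z. 1 - cnj \<zeta> * z) has_field_derivative (0 - cnj \<zeta> * 1)) (at z)"
      by (intro derivative_intros DERIV_cmult)
    from DERIV_chain2[OF has_field_derivative_Ln[OF nr] this] show ?thesis by (simp add: field_simps)
  qed
  have zg: "z * deriv g z = of_nat n * (\<Sum>\<zeta>\<in>S. 1 - 1 / (1 - cnj \<zeta> * z)) / n - of_nat n * riemann_sum m z" 
    and gd: "\<exists>l. (g has_field_derivative l) (at z)" if z: "cmod z < 1" for z
  proof -
    have "\<forall>k. k < m \<longrightarrow> (\<exists>l. ((\<lambda>z. Ln (limit_factor (s k) z)) has_field_derivative l) (at z) \<and> z * l = log_slope (s k) z)"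
    proof (intro allI impI)
      fix k assume "k < m"
      show "\<exists>l. ((\<lambda>z. Ln (limit_factor (s k) z)) has_field_derivative l) (at z) \<and> z * l = log_slope (s k) z"
        by (rule log_limit_factor_derivative[OF s[OF \<open>k < m\<close>] z]) blast
    qed
    then obtain l where l: "\<And>k. k < m \<Longrightarrow> ((\<lambda>z. Ln (limit_factor (s k) z)) has_field_derivative l k) (at z)" "\<And>k. k < m \<Longrightarrow> z * l k = log_slope (s k) z"
      by metis
    have D: "(g has_field_derivative ((\<Sum>\<zeta>\<in>S. - cnj \<zeta> / (1 - cnj \<zeta> * z)) - (\<Sum>k<m. l k))) (at z)"
      unfolding g_def by (intro DERIV_diff DERIV_sum Ld l z) auto
    then show "\<exists>l. (g has_field_derivative l) (at z)" by blast
    have e: "z * (- cnj \<zeta> / (1 - cnj \<zeta> * z)) = 1 - 1 / (1 - cnj \<zeta> * z)" if "\<zeta> \<in> S" for \<zeta>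
      using nz'[OF that z] by (simp add: field_simps)
    have r: "of_nat n * riemann_sum m z = (\<Sum>k<m. log_slope (s k) z)" by (simp add: riemann_sum_def n_def s_def del: of_nat_Suc)
    have "z * deriv g z = (\<Sum>\<zeta>\<in>S. z * (- cnj \<zeta> / (1 - cnj \<zeta> * z))) - (\<Sum>k<m. z * l k)"
      unfolding DERIV_imp_deriv[OF D] right_diff_distrib sum_distrib_left ..
    also have "\<dots> = (\<Sum>\<zeta>\<in>S. 1 - 1 / (1 - cnj \<zeta> * z)) - (\<Sum>k<m. log_slope (s k) z)"
      by (intro arg_cong2[where f = "(-)"] sum.cong refl e l) auto
    finally show "z * deriv g z = of_nat n * (\<Sum>\<zeta>\<in>S. 1 - 1 / (1 - cnj \<zeta> * z)) / n - of_nat n * riemann_sum m z"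
      unfolding r using n by simp
  qed
  have hg: "g holomorphic_on ball 0 1" using gd by (simp add: holomorphic_on_open)
  have GB: "cmod (G z) \<le> R + \<rho>" if z: "cmod z \<le> 1/8" for z
  proof -
    have z1: "cmod z < 1" using z by simp
    have "cmod (deriv g z) \<le> 8 * (real n * R)"
      by (rule deriv_bound[OF hg _ z]) (use log in \<open>simp add: g_def s_def n_def del: of_nat_Suc\<close>)
    then have "cmod z * cmod (deriv g z) \<le> 1/8 * (8 * (real n * R))" using z by (intro mult_mono) auto
    then have b: "cmod (z * deriv g z) \<le> real n * R" by (simp add: norm_mult)
    have "G z = z * deriv g z / n + (riemann_sum m z - (1 - herglotz 1 (cayley z)) / 2)"
      unfolding zg[OF z1] using n by (simp add: G_def diff_divide_distrib)
    also have "cmod \<dots> \<le> real n * R / n + \<rho>"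
      using b rs[OF z] n by (intro norm_triangle_mono) (auto simp: norm_divide divide_right_mono divide_le_eq mult.commute)
    finally show ?thesis using n by simp
  qed
  define c where "c k = (\<Sum>\<zeta>\<in>S. (if k = 0 then 1 else 0) - cnj \<zeta> ^ k) / n - ((if k = 0 then 1 else 0) - herglotz_coeff k) / 2" for k
  have one: "(\<lambda>k. (if k = 0 then 1 else 0) * z ^ k) sums 1" for z :: complex
    using sums_If_finite_set[of "{0}" "\<lambda>k. z ^ k"] by (simp add: if_distrib[of "\<lambda>x. x * _"] cong: if_cong)
  have cs: "(\<lambda>k. c k * z ^ k) sums G z" if z: "cmod z < 1" for z
  proof -
    have "(\<lambda>k. (if k = 0 then 1 else 0) * z ^ k - cnj \<zeta> ^ k * z ^ k) sums (1 - 1 / (1 - cnj \<zeta> * z))" if "\<zeta> \<in> S" for \<zeta>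
      using sums_diff[OF one geometric_sums[OF nz[OF that z]]] by (simp add: power_mult_distrib)
    then have "(\<lambda>k. (\<Sum>\<zeta>\<in>S. (if k = 0 then 1 else 0) * z ^ k - cnj \<zeta> ^ k * z ^ k)) sums (\<Sum>\<zeta>\<in>S. 1 - 1 / (1 - cnj \<zeta> * z))"
      by (rule sums_sum)
    from sums_diff[OF sums_divide[OF this, of "of_nat n"] sums_divide[OF sums_diff[OF one[of z] herglotz_sums[OF z]], where c = 2]]
    show ?thesis
      unfolding G_def c_def by (simp only: left_diff_distrib sum_distrib_right times_divide_eq_left)
  qed
  have "G holomorphic_on ball 0 1"
    unfolding G_def using nz' by (intro holomorphic_intros holomorphic_herglotz) auto
  from coefficient_bound[OF this _ _ cs GB, of "1/8" k]
  have "cmod (c k) \<le> 8 ^ k * (R + \<rho>)" by (simp add: power_one_over field_simps)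
  moreover have "cnj (c k) = - ((\<Sum>\<zeta>\<in>S. \<zeta> ^ k) / of_nat n - cnj (herglotz_coeff k) / 2)"
    using k by (simp add: c_def sum_negf)
  ultimately show ?thesis by (metis complex_mod_cnj norm_minus_cancel n_def)
qed

end

section \<open>Boundary values and the limiting measure\<close>

text \<open>
  Cauchy's formula for the Taylor coefficients, and Cauchy's theorem for the negative frequencies.
\<close>
lemma circle_fourier:
  assumes hol: "F holomorphic_on ball 0 1" and r: "0 < r" "r < 1"
  shows "((\<lambda>t. F (of_real r * cis t) / cis t ^ k) has_integral 2 * of_real pi * (of_real r ^ k * ((deriv ^^ k) F 0 / fact k))) {0..2 * pi}"
    and "k \<ge> 1 \<Longrightarrow> ((\<lambda>t. F (of_real r * cis t) * cis t ^ k) has_integral 0) {0..2 * pi}"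
proof -
  have sub: "cball 0 r \<subseteq> ball (0::complex) 1" "ball 0 r \<subseteq> ball (0::complex) 1" using r by auto
  have c: "continuous_on (cball 0 r) F" "F holomorphic_on ball 0 r"
    using hol sub holomorphic_on_subset holomorphic_on_imp_continuous_on by blast+
  have "((\<lambda>u. F u / (u - 0) ^ Suc k) has_contour_integral 2 * pi * \<i> / fact k * (deriv ^^ k) F 0) (part_circlepath 0 r 0 (2 * pi))"
    using Cauchy_has_contour_integral_higher_derivative_circlepath[OF c, of 0 k] r unfolding circlepath_def by simp
  then have I: "((\<lambda>t. F (0 + r * cis t) / (0 + r * cis t - 0) ^ Suc k * r * \<i> * cis t) has_integral 2 * pi * \<i> / fact k * (deriv ^^ k) F 0) {0..2 * pi}"
    by (subst (asm) has_contour_integral_part_circlepath_iff) simp_all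
  have e: "F (r * cis t) / cis t ^ k = (of_real r ^ k / \<i>) * (F (0 + r * cis t) / (0 + r * cis t - 0) ^ Suc k * r * \<i> * cis t)" for t
    using r by (simp add: power_mult_distrib field_simps)
  show "((\<lambda>t. F (of_real r * cis t) / cis t ^ k) has_integral 2 * of_real pi * (of_real r ^ k * ((deriv ^^ k) F 0 / fact k))) {0..2 * pi}"
    unfolding e using has_integral_mult_right[OF I, of "of_real r ^ k / \<i>"] by (simp add: mult_ac)
  assume k: "k \<ge> 1"
  have "((\<lambda>u. F u * u ^ (k - 1)) has_contour_integral 0) (circlepath 0 r)"
  proof (rule Cauchy_theorem_disc_simple[where a = 0 and e = 1])
    show "(\<lambda>u. F u * u ^ (k - 1)) holomorphic_on ball 0 1" by (intro holomorphic_intros hol)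
  qed (use r in \<open>auto simp: path_image_circlepath\<close>)
  then have I2: "((\<lambda>t. F (0 + r * cis t) * (0 + r * cis t) ^ (k - 1) * r * \<i> * cis t) has_integral 0) {0..2 * pi}"
    unfolding circlepath_def by (subst (asm) has_contour_integral_part_circlepath_iff) simp_all
  have e2: "F (r * cis t) * cis t ^ k = (1 / (\<i> * of_real r ^ k)) * (F (0 + r * cis t) * (0 + r * cis t) ^ (k - 1) * r * \<i> * cis t)" for t
  proof -
    have "of_real r ^ k * cis t ^ k = (of_real r * cis t) ^ (k - 1) * (of_real r * cis t)"
      using k by (metis power_mult_distrib power_minus_mult less_eq_Suc_le One_nat_def)
    then show ?thesis using r by (simp add: field_simps)
  qed
  show "((\<lambda>t. F (of_real r * cis t) * cis t ^ k) has_integral 0) {0..2 * pi}"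
    unfolding e2 using has_integral_mult_right[OF I2, of "1 / (\<i> * of_real r ^ k)"] by simp
qed

text \<open>
  \<open>Re F = (F + cnj F) / 2\<close>, where \<open>F\<close> has frequencies \<open>\<ge> 0\<close> and \<open>cnj F\<close> frequencies \<open>\<le> 0\<close>; they meet only at
  \<open>k = 0\<close>.
\<close>
lemma circle_fourier_Re:
  assumes hol: "F holomorphic_on ball 0 1" and r: "0 < r" "r < 1"
  shows "((\<lambda>t. of_real (Re (F (of_real r * cis t))) * cis t ^ k) has_integral
     (if k = 0 then 2 * of_real pi * of_real (Re (F 0)) else of_real pi * (of_real r ^ k * cnj ((deriv ^^ k) F 0 / fact k)))) {0..2 * pi}"
proof -
  define c where "c = (deriv ^^ k) F 0 / fact k"
  have cc: "cnj (x / cis t ^ k) = cnj x * cis t ^ k" for x t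
  proof -
    have "cnj (cis t ^ k) = inverse (cis t ^ k)" by (simp only: complex_cnj_power cis_cnj cis_inverse[symmetric] power_inverse)
    then show ?thesis by (simp add: divide_inverse)
  qed
  have "((\<lambda>t. cnj (F (of_real r * cis t) / cis t ^ k)) has_integral cnj (2 * of_real pi * (of_real r ^ k * c))) {0..2 * pi}"
    using has_integral_linear[OF circle_fourier(1)[OF assms, of k] bounded_linear_cnj] unfolding o_def c_def .
  then have I1: "((\<lambda>t. cnj (F (of_real r * cis t)) * cis t ^ k) has_integral 2 * of_real pi * (of_real r ^ k * cnj c)) {0..2 * pi}"
    unfolding cc by simp
  have e: "of_real (Re w) * v = (w * v + cnj w * v) / 2" for w v :: complex
    by (simp add: complex_eq_iff algebra_simps)
  have I2: "((\<lambda>t. F (of_real r * cis t) * cis t ^ k) has_integral (if k = 0 then 2 * of_real pi * F 0 else 0)) {0..2 * pi}"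
  proof (cases "k = 0")
    case True
    then show ?thesis using circle_fourier(1)[OF assms, of 0] by simp
  next
    case False
    then show ?thesis using circle_fourier(2)[OF assms, of k] by simp
  qed
  have "((\<lambda>t. (F (of_real r * cis t) * cis t ^ k + cnj (F (of_real r * cis t)) * cis t ^ k) / 2) has_integral
     ((if k = 0 then 2 * of_real pi * F 0 else 0) + 2 * of_real pi * (of_real r ^ k * cnj c)) / 2) {0..2 * pi}"
    by (intro has_integral_divide has_integral_add I1 I2)
  moreover have "((if k = 0 then 2 * of_real pi * F 0 else 0) + 2 * of_real pi * (of_real r ^ k * cnj c)) / 2
     = (if k = 0 then 2 * of_real pi * of_real (Re (F 0)) else of_real pi * (of_real r ^ k * cnj c))"
  proof (cases "k = 0")
    case True
    then show ?thesis by (simp add: c_def complex_eq_iff)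
  qed simp
  ultimately show ?thesis unfolding e c_def by (simp only:)
qed

lemma cayley_cis:
  assumes t: "t \<in> {0<..<2 * pi}" shows "cis t \<noteq> 1" "cayley (cis t) = \<i> * of_real (cos (t / 2) / sin (t / 2))"
proof -
  define v where "v = cis (t / 2)"
  have s: "sin (t / 2) > 0" using t by (intro sin_gt_zero) auto
  have v: "cis t = v * v" "v * cnj v = 1" by (simp_all add: v_def cis_mult cis_cnj)
  have v0: "v \<noteq> 0" by (simp add: v_def)
  have cs: "v + cnj v = 2 * of_real (cos (t / 2))" "cnj v - v = - 2 * \<i> * of_real (sin (t / 2))"
    by (simp_all add: v_def complex_eq_iff)
  have n: "1 + cis t = v * (2 * of_real (cos (t / 2)))" "1 - cis t = v * (- 2 * \<i> * of_real (sin (t / 2)))"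
    unfolding cs[symmetric] v(1) v(2)[symmetric] by (simp_all add: algebra_simps)
  show "cis t \<noteq> 1" using n(2) s v0 by auto
  show "cayley (cis t) = \<i> * of_real (cos (t / 2) / sin (t / 2))"
    unfolding cayley_def n using v0 s by (simp add: field_simps)
qed

lemma one_minus_circle_ge:
  assumes "1/2 \<le> r" "r < 1" shows "\<bar>sin (t / 2)\<bar> \<le> cmod (1 - of_real r * cis t)"
proof -
  have "(cmod (1 - of_real r * cis t))\<^sup>2 = (1 - r * cos t)\<^sup>2 + (r * sin t)\<^sup>2"
    unfolding cmod_power2 by simp
  also have "\<dots> = 1 - 2 * r * cos t + r\<^sup>2 * ((cos t)\<^sup>2 + (sin t)\<^sup>2)"
    unfolding power2_eq_square by (simp only: algebra_simps mult_1_left mult_1_right mult_2)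
  also have "(cos t)\<^sup>2 + (sin t)\<^sup>2 = 1" by (rule sin_cos_squared_add2)
  also have "cos t = 1 - 2 * (sin (t / 2))\<^sup>2" using cos_double_sin[of "t / 2"] by simp
  also have "1 - 2 * r * (1 - 2 * (sin (t / 2))\<^sup>2) + r\<^sup>2 * 1 = (1 - r)\<^sup>2 + (4 * r) * (sin (t / 2))\<^sup>2"
    by (simp add: power2_eq_square algebra_simps)
  finally have e: "(cmod (1 - of_real r * cis t))\<^sup>2 = (1 - r)\<^sup>2 + (4 * r) * (sin (t / 2))\<^sup>2" .
  have "1 * (sin (t / 2))\<^sup>2 \<le> (4 * r) * (sin (t / 2))\<^sup>2" using assms by (intro mult_right_mono) auto
  then have "(sin (t / 2))\<^sup>2 \<le> (cmod (1 - of_real r * cis t))\<^sup>2" unfolding e by (simp add: add_increasing)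
  then show ?thesis by (metis abs_le_square_iff abs_norm_cancel)
qed

text \<open>
  An integrable majorant of \<open>1 / sqrt (sin (t / 2))\<close> with an explicit primitive: up to a constant it is the derivative of
  \<open>sqrt (sin (t / 4)) - sqrt (cos (t / 4))\<close>.
\<close>
definition endpoint_bound :: "real \<Rightarrow> real" where
  "endpoint_bound t = cos (t / 4) / sqrt (sin (t / 4)) + sin (t / 4) / sqrt (cos (t / 4))"

lemma quarter_pos: "t \<in> {0<..<2 * pi} \<Longrightarrow> sin (t / 4) > 0" "t \<in> {0<..<2 * pi} \<Longrightarrow> cos (t / 4) > 0"
  by (auto intro!: sin_gt_zero2 cos_gt_zero)

lemma endpoint_bound_ge:
  assumes t: "t \<in> {0<..<2 * pi}"
  shows "1 / sqrt (sin (t / 2)) \<le> endpoint_bound t" "1 \<le> endpoint_bound t"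
proof -
  define p q where "p = sin (t / 4)" and "q = cos (t / 4)"
  have pq: "p > 0" "q > 0" "p \<le> 1" "q \<le> 1" using quarter_pos[OF t] by (auto simp: p_def q_def)
  have sq: "p = sqrt p * sqrt p" "q = sqrt q * sqrt q" using pq by auto
  have s1: "sqrt p \<le> 1" "sqrt q \<le> 1" "sqrt p > 0" "sqrt q > 0" using pq by auto
  have "p * p \<le> p * sqrt p" "q * q \<le> q * sqrt q"
  proof -
    have "x \<le> sqrt x" if "0 < x" "x \<le> 1" for x :: real
      using that mult_left_le[of "sqrt x" "sqrt x"] by simp
    then show "p * p \<le> p * sqrt p" "q * q \<le> q * sqrt q" using pq by (intro mult_left_mono; simp)+
  qed
  moreover have "p * p + q * q = 1" unfolding p_def q_def using sin_cos_squared_add[of "t / 4"] by (simp add: power2_eq_square)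
  ultimately have one: "1 \<le> p * sqrt p + q * sqrt q" by linarith
  have e: "endpoint_bound t = (p * sqrt p + q * sqrt q) / sqrt (p * q)"
    unfolding endpoint_bound_def p_def[symmetric] q_def[symmetric] real_sqrt_mult using s1 by (simp add: field_simps)
  have b: "1 / sqrt (p * q) \<le> endpoint_bound t" unfolding e using one pq by (intro divide_right_mono) auto
  have "sin (t / 2) = 2 * (p * q)" using sin_double[of "t / 4"] by (simp add: p_def q_def mult.assoc)
  then have "sqrt (p * q) \<le> sqrt (sin (t / 2))" using pq by simp
  then have "1 / sqrt (sin (t / 2)) \<le> 1 / sqrt (p * q)" using pq by (intro frac_le) auto
  then show "1 / sqrt (sin (t / 2)) \<le> endpoint_bound t" using b by linarith
  have "p * q \<le> 1" using pq by (intro mult_le_one) auto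
  then have "sqrt (p * q) \<le> 1" by simp
  then have "1 / 1 \<le> 1 / sqrt (p * q)" using pq by (intro divide_left_mono) auto
  then show "1 \<le> endpoint_bound t" using b by linarith
qed

lemma endpoint_bound_integrable: "endpoint_bound integrable_on {0..2 * pi}"
proof -
  define \<Phi> where "\<Phi> t = 8 * (sqrt (sin (t / 4)) - sqrt (cos (t / 4)))" for t :: real
  have "(endpoint_bound has_integral \<Phi> (2 * pi) - \<Phi> 0) {0..2 * pi}"
  proof (rule fundamental_theorem_of_calculus_interior)
    show "continuous_on {0..2 * pi} \<Phi>" unfolding \<Phi>_def by (intro continuous_intros) auto
    fix t assume t: "t \<in> {0<..<2 * pi}"
    note pq = quarter_pos[OF t]
    have "(\<Phi> has_real_derivative endpoint_bound t) (at t)"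
      unfolding \<Phi>_def endpoint_bound_def using pq
      by (auto intro!: derivative_eq_intros simp: field_simps)
    then show "(\<Phi> has_vector_derivative endpoint_bound t) (at t)"
      by (simp add: has_real_derivative_iff_has_vector_derivative)
  qed simp
  then show ?thesis by blast
qed

lemma circle_law_moment:
  assumes w: "w \<in> borel_measurable borel" "\<And>t. w t \<ge> 0"
    and I: "\<And>k. ((\<lambda>t. of_real (w t) * cis t ^ k) has_integral c k) UNIV" and c0: "c 0 = 1"
  shows "distr (density lborel (\<lambda>t. ennreal (w t))) circle_borel cis \<in> circle_probs"
    and "moment (distr (density lborel (\<lambda>t. ennreal (w t))) circle_borel cis) k = c k"
proof -
  let ?D = "density lborel (\<lambda>t. ennreal (w t))"
  have cm: "cis \<in> ?D \<rightarrow>\<^sub>M circle_borel" using measurable_cis_circle by simp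
  have "((\<lambda>t. Re (of_real (w t) * cis t ^ 0)) has_integral Re (c 0)) UNIV"
    using has_integral_linear[OF I[of 0] bounded_linear_Re] by (simp add: o_def)
  then have "(w has_integral 1) UNIV" by (simp add: c0)
  then have N: "(\<integral>\<^sup>+t. ennreal (w t) \<partial>lborel) = 1" using nn_integral_has_integral_lborel[OF w] by simp
  have iw: "integrable lborel w" using N w by (intro integrableI_nonneg) auto
  have "prob_space ?D" by (rule prob_spaceI) (use N w in \<open>simp add: emeasure_density\<close>)
  then have "prob_space (distr ?D circle_borel cis)" by (rule prob_space.prob_space_distr[OF _ cm])
  then show "distr ?D circle_borel cis \<in> circle_probs" by (simp add: space_prob_algebra)
  have ik: "integrable lborel (\<lambda>t. of_real (w t) * cis t ^ k)"
    by (rule Bochner_Integration.integrable_bound[OF iw]) (use w borel_measurable_cis in \<open>auto simp: norm_mult norm_power\<close>)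
  have "moment (distr ?D circle_borel cis) k = integral\<^sup>L ?D (\<lambda>t. cis t ^ k)"
    unfolding moment_def by (rule integral_distr[OF cm]) (simp add: circle_borel_def measurable_restrict_space1)
  also have "\<dots> = integral\<^sup>L lborel (\<lambda>t. w t *\<^sub>R cis t ^ k)"
    by (rule integral_density) (use w borel_measurable_cis in auto)
  also have "\<dots> = c k"
    using has_integral_integral_lborel[OF ik] I[of k] has_integral_unique by (auto simp: scaleR_conv_of_real)
  finally show "moment (distr ?D circle_borel cis) k = c k" .
qed

context hua_pickrell
begin

text \<open>
  A majorant for passing to the boundary. If \<open>Re d > 0\<close>, the comparison of \<open>Root\<close> with \<open>A\<close> shows that the real part is even
  bounded. If \<open>Re d = 0\<close>, it has at most a singularity at \<open>z = 1\<close> of the order of \<open>sqrt (1 / cmod (1 - z))\<close>.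
\<close>
lemma Re_herglotz_bound:
  "\<exists>K\<ge>0. \<forall>r t. 1/2 \<le> r \<longrightarrow> r < 1 \<longrightarrow> t \<in> {0<..<2 * pi} \<longrightarrow> \<bar>Re (herglotz 1 (cayley (of_real r * cis t)))\<bar> \<le> K * endpoint_bound t"
proof (cases "Re d = 0")
  case False
  then have a: "Re d > 0" using d by simp
  define M where "M = 1\<^sup>2 + 2 * Re d * 1 - (Im d)\<^sup>2 + (Im d * (1 + Re d))\<^sup>2 / (Re d)\<^sup>2"
  have M: "M > 0" using disc_const[of 1] a by (simp add: M_def)
  have "\<bar>Re (herglotz 1 k)\<bar> \<le> sqrt M" if k: "Re k > 0" for k
  proof -
    define u v x y q where "u = Re (Root 1 k)" and "v = Im (Root 1 k)" and "x = Re d * Re k" and "y = Im k" and "q = Re d * Im k + Im d * (1 + Re d) / Re d"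
    have pos: "Re (herglotz 1 k) > 0" using Re_herglotz_pos[OF _ k] by simp
    have H: "Re (herglotz 1 k) = u - x" by (simp add: herglotz_def A_def u_def x_def)
    have x: "x > 0" using a k by (simp add: x_def)
    have u: "u > x" using pos H by simp
    have "u\<^sup>2 - v\<^sup>2 = Re (Disc 1 k)" using Root_sq[of 1 k] unfolding u_def v_def by (metis Re_power2)
    also have "\<dots> = x\<^sup>2 - q\<^sup>2 + M"
      unfolding Re_Disc x_def q_def M_def using a by (simp add: power2_eq_square field_simps)
    finally have e1: "u\<^sup>2 - v\<^sup>2 = x\<^sup>2 - q\<^sup>2 + M" .
    have "2 * u * v = Im (Disc 1 k)" using Root_sq[of 1 k] unfolding u_def v_def by (metis Im_power2)
    also have "\<dots> = 2 * x * q" unfolding Im_Disc x_def q_def using a by (simp add: power2_eq_square field_simps)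
    finally have uv: "u * v = x * q" by simp
    have "(u * v)\<^sup>2 \<le> (u * q)\<^sup>2" unfolding uv power_mult_distrib using u x by (intro mult_right_mono power_mono) auto
    then have "u\<^sup>2 * v\<^sup>2 \<le> u\<^sup>2 * q\<^sup>2" by (simp add: power_mult_distrib)
    then have "v\<^sup>2 \<le> q\<^sup>2" using u x by simp
    then have "u\<^sup>2 \<le> x\<^sup>2 + M" using e1 by linarith
    also have "\<dots> \<le> x\<^sup>2 + 2 * x * sqrt M + (sqrt M)\<^sup>2" using x M by simp
    also have "\<dots> = (x + sqrt M)\<^sup>2" by (simp add: power2_sum)
    finally have "u \<le> x + sqrt M" using x M by (intro power2_le_imp_le[of u]) auto
    then show ?thesis using pos H by simp
  qed
  moreover have "Re (cayley (of_real r * cis t)) > 0" if "1/2 \<le> r" "r < 1" for r t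
    using that by (intro cayley_pos) (simp add: norm_mult)
  ultimately have b: "\<bar>Re (herglotz 1 (cayley (of_real r * cis t)))\<bar> \<le> sqrt M" if "1/2 \<le> r" "r < 1" for r t using that by blast
  show ?thesis
  proof (intro exI[of _ "sqrt M"] conjI allI impI)
    show "sqrt M \<ge> 0" using M by simp
    fix r t :: real assume "1/2 \<le> r" "r < 1" and t: "t \<in> {0<..<2 * pi}"
    from b[OF this(1,2), of t] have "\<bar>Re (herglotz 1 (cayley (of_real r * cis t)))\<bar> \<le> sqrt M * 1" by simp
    also have "\<dots> \<le> sqrt M * endpoint_bound t" using endpoint_bound_ge(2)[OF t] M by (intro mult_left_mono) auto
    finally show "\<bar>Re (herglotz 1 (cayley (of_real r * cis t)))\<bar> \<le> sqrt M * endpoint_bound t" .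
  qed
next
  case True
  define C where "C = 1 + 4 * \<bar>Im d\<bar> + (Im d)\<^sup>2"
  have C: "C \<ge> 0" by (simp add: C_def)
  show ?thesis
  proof (intro exI[of _ "sqrt C"] conjI allI impI)
    show "sqrt C \<ge> 0" using C by simp
    fix r t :: real assume r: "1/2 \<le> r" "r < 1" and t: "t \<in> {0<..<2 * pi}"
    define z where "z = of_real r * cis t"
    define S where "S = sin (t / 2)"
    have S: "S > 0" "S \<le> 1" using t by (auto simp: S_def intro!: sin_gt_zero)
    have z: "cmod z < 1" using r by (simp add: z_def norm_mult)
    have sz: "S \<le> cmod (1 - z)" using one_minus_circle_ge[OF r, of t] by (simp add: z_def S_def)
    have kn: "cmod (cayley z) \<le> 2 / S"
    proof -
      have "cmod (1 + z) \<le> 2" using norm_triangle_ineq[of 1 z] z by simp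
      then show ?thesis unfolding cayley_def norm_divide using sz S by (intro frac_le) auto
    qed
    have "cmod (Disc 1 (cayley z)) \<le> C / S"
    proof -
      have "Disc 1 (cayley z) = 1 + 2 * (\<i> * of_real (Im d) * cayley z) - of_real ((Im d)\<^sup>2)"
        using True by (simp add: Disc_def A_def B_def power2_eq_square algebra_simps)
      also have "cmod \<dots> \<le> 1 + 2 * (\<bar>Im d\<bar> * cmod (cayley z)) + (Im d)\<^sup>2"
        by (intro norm_triangle_le_diff norm_triangle_le add_mono) (simp_all add: norm_mult norm_power)
      also have "\<dots> \<le> 1 / S + 2 * (\<bar>Im d\<bar> * (2 / S)) + (Im d)\<^sup>2 / S"
        using kn S by (intro add_mono mult_left_mono) (auto simp: le_divide_eq mult_left_le)
      also have "\<dots> = C / S" by (simp add: C_def add_divide_distrib)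
      finally show ?thesis .
    qed
    then have "sqrt (cmod (Disc 1 (cayley z))) \<le> sqrt (C / S)" by simp
    moreover have "cmod (Root 1 (cayley z)) = sqrt (cmod (Disc 1 (cayley z)))"
      by (simp add: Root_def norm_csqrt)
    moreover have "herglotz 1 (cayley z) = Root 1 (cayley z) - \<i> * of_real (Im d)" using True by (simp add: herglotz_def A_def)
    then have "\<bar>Re (herglotz 1 (cayley z))\<bar> \<le> cmod (Root 1 (cayley z))" using abs_Re_le_cmod by simp
    ultimately have "\<bar>Re (herglotz 1 (cayley z))\<bar> \<le> sqrt C * (1 / sqrt S)" by (simp add: real_sqrt_divide)
    also have "\<dots> \<le> sqrt C * endpoint_bound t"
      using endpoint_bound_ge(1)[OF t] C by (intro mult_left_mono) (auto simp: S_def)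
    finally show "\<bar>Re (herglotz 1 (cayley (of_real r * cis t)))\<bar> \<le> sqrt C * endpoint_bound t" by (simp add: z_def)
  qed
qed

lemma half_angle: "cos (\<xi>\<^sub>d d / 2) = (1 + Re d) / cmod (1 + d)" "sin (\<xi>\<^sub>d d / 2) = Im d / cmod (1 + d)"
proof -
  note \<xi> = \<xi>\<^sub>d_props[OF d] and \<theta> = \<theta>\<^sub>d_props[OF d]
  note nz = one_plus_nonzero[OF d]
  define v where "v = (1 + d) / of_real (cmod (1 + d))"
  have "cis (\<xi>\<^sub>d d / 2) * cis (\<xi>\<^sub>d d / 2) = (1 + d) / (1 + cnj d)" using \<xi>(3) by (simp add: cis_mult)
  also have "\<dots> = ((1 + d) * (1 + d)) / ((1 + d) * cnj (1 + d))" using nz by simp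
  also have "(1 + d) * cnj (1 + d) = of_real (cmod (1 + d)) * of_real (cmod (1 + d))"
    by (simp only: complex_norm_square[symmetric] power2_eq_square of_real_mult)
  also have "((1 + d) * (1 + d)) / (of_real (cmod (1 + d)) * of_real (cmod (1 + d))) = v * v" by (simp add: v_def)
  finally have "(cis (\<xi>\<^sub>d d / 2) - v) * (cis (\<xi>\<^sub>d d / 2) + v) = 0" by (simp add: algebra_simps)
  moreover have "Re (cis (\<xi>\<^sub>d d / 2) + v) > 0"
  proof -
    have "cos (\<xi>\<^sub>d d / 2) > 0" using \<xi> \<theta> by (intro cos_gt_zero_pi) auto
    moreover have "Re v > 0" using d nz by (simp add: v_def)
    ultimately show ?thesis by simp
  qed
  then have "cis (\<xi>\<^sub>d d / 2) + v \<noteq> 0" by (metis less_irrefl zero_complex.sel(1))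
  ultimately have "cis (\<xi>\<^sub>d d / 2) = v" by simp
  then have "Re (cis (\<xi>\<^sub>d d / 2)) = Re v" "Im (cis (\<xi>\<^sub>d d / 2)) = Im v" by simp_all
  then show "cos (\<xi>\<^sub>d d / 2) = (1 + Re d) / cmod (1 + d)" "sin (\<xi>\<^sub>d d / 2) = Im d / cmod (1 + d)"
    by (simp_all add: v_def)
qed

text \<open>
  The discriminant at the boundary point \<open>cis t\<close>, where it is real.
\<close>
definition boundary_disc :: "real \<Rightarrow> real" where
  "boundary_disc t = Re (Disc 1 (\<i> * of_real (cos (t / 2) / sin (t / 2))))"

text \<open>
  With \<open>\<xi>\<^sub>d d / 2\<close> the argument of \<open>1 + d\<close>, the radicand of \<open>w\<^sub>d\<close> is the boundary discriminant times
  \<open>(sin (t / 2) / cmod (1 + d))\<^sup>2\<close>, and the arc is exactly where it is positive.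
\<close>
lemma boundary_weight_eq:
  assumes t: "t \<in> {0<..<2 * pi}" shows "w\<^sub>d d t = sqrt (max 0 (boundary_disc t))"
proof -
  note \<xi> = \<xi>\<^sub>d_props[OF d] and \<theta> = \<theta>\<^sub>d_props[OF d] and nz = one_plus_nonzero[OF d]
  define c s R where "c = cos (t / 2)" and "s = sin (t / 2)" and "R = cmod (1 + d)"
  have s: "s > 0" using t by (auto simp: s_def intro!: sin_gt_zero)
  have R: "R > 0" using nz by (simp add: R_def)
  define P where "P = (1 + Re d) * s - Im d * c"
  have cs: "c\<^sup>2 = 1 - s\<^sup>2" by (simp add: c_def s_def cos_squared_eq)
  have bd: "boundary_disc t * s\<^sup>2 = P\<^sup>2 - (cmod d)\<^sup>2"
  proof -
    have "boundary_disc t * s\<^sup>2 = - (Re d)\<^sup>2 * c\<^sup>2 - 2 * Im d * (1 + Re d) * c * s + (1 + 2 * Re d - (Im d)\<^sup>2) * s\<^sup>2"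
      unfolding boundary_disc_def Re_Disc c_def[symmetric] s_def[symmetric] using s
      by (simp add: power2_eq_square field_simps)
    also have "\<dots> = P\<^sup>2 - (cmod d)\<^sup>2"
    proof -
      have "P\<^sup>2 = (1 + Re d)\<^sup>2 * s\<^sup>2 - 2 * Im d * (1 + Re d) * c * s + (Im d)\<^sup>2 * c\<^sup>2"
        by (simp add: P_def power2_eq_square algebra_simps)
      then show ?thesis unfolding cmod_power2 cs by (simp add: power2_eq_square algebra_simps)
    qed
    finally show ?thesis .
  qed
  have sP: "sin ((t - \<xi>\<^sub>d d) / 2) = P / R"
    unfolding diff_divide_distrib sin_diff half_angle P_def R_def c_def s_def by (simp add: field_simps)
  have sT: "sin (\<theta>\<^sub>d d / 2) = cmod d / R" using \<theta>(3) by (simp add: R_def norm_divide)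
  have al: "cmod (1 + \<alpha>\<^sub>d d) = 1 / R"
  proof -
    have "1 + \<alpha>\<^sub>d d = 1 / (1 + cnj d)" using nz by (simp add: \<alpha>\<^sub>d_def field_simps)
    moreover have "cmod (1 + cnj d) = R" unfolding R_def by (metis complex_cnj_add complex_cnj_one complex_mod_cnj)
    ultimately show ?thesis by (simp add: norm_divide)
  qed
  have sq: "boundary_disc t = (R / s)\<^sup>2 * ((sin ((t - \<xi>\<^sub>d d) / 2))\<^sup>2 - (sin (\<theta>\<^sub>d d / 2))\<^sup>2)"
  proof -
    have "(R / s)\<^sup>2 * ((P / R)\<^sup>2 - (cmod d / R)\<^sup>2) = (P\<^sup>2 - (cmod d)\<^sup>2) / s\<^sup>2"
      using R by (simp add: power_divide diff_divide_distrib[symmetric])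
    also have "\<dots> = boundary_disc t" unfolding bd[symmetric] using s by simp
    finally show ?thesis unfolding sP sT ..
  qed
  show ?thesis
  proof (cases "t \<in> {\<theta>\<^sub>d d + \<xi>\<^sub>d d <..< 2 * pi - \<theta>\<^sub>d d + \<xi>\<^sub>d d}")
    case True
    have "\<bar>sin (\<theta>\<^sub>d d / 2)\<bar> \<le> sin ((t - \<xi>\<^sub>d d) / 2)"
    proof -
      have "sin (\<theta>\<^sub>d d / 2) \<le> sin ((t - \<xi>\<^sub>d d) / 2)"
      proof (cases "(t - \<xi>\<^sub>d d) / 2 \<le> pi / 2")
        case le: True
        then show ?thesis using True \<theta> by (intro sin_monotone_2pi_le) auto
      next
        case False
        have "sin (\<theta>\<^sub>d d / 2) \<le> sin (pi - (t - \<xi>\<^sub>d d) / 2)"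
          using False True \<theta> by (intro sin_monotone_2pi_le) (auto simp: field_simps)
        then show ?thesis by (simp add: sin_diff)
      qed
      moreover have "0 \<le> sin (\<theta>\<^sub>d d / 2)" unfolding sT using R by simp
      ultimately show ?thesis by simp
    qed
    then have nn: "(sin (\<theta>\<^sub>d d / 2))\<^sup>2 \<le> (sin ((t - \<xi>\<^sub>d d) / 2))\<^sup>2" by (metis abs_le_square_iff abs_ge_self order_trans)
    then have "max 0 (boundary_disc t) = boundary_disc t" unfolding sq by simp
    then have "sqrt (max 0 (boundary_disc t)) = R / s * sqrt ((sin ((t - \<xi>\<^sub>d d) / 2))\<^sup>2 - (sin (\<theta>\<^sub>d d / 2))\<^sup>2)"
      using \<open>max 0 (boundary_disc t) = boundary_disc t\<close> R s unfolding sq by (simp add: real_sqrt_mult)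
    then show ?thesis using True R unfolding w\<^sub>d_def al s_def by simp
  next
    case False
    have "\<bar>sin ((t - \<xi>\<^sub>d d) / 2)\<bar> \<le> sin (\<theta>\<^sub>d d / 2)"
    proof (cases "t \<le> \<theta>\<^sub>d d + \<xi>\<^sub>d d")
      case True
      have b: "- (\<theta>\<^sub>d d / 2) \<le> (t - \<xi>\<^sub>d d) / 2" "(t - \<xi>\<^sub>d d) / 2 \<le> \<theta>\<^sub>d d / 2" using True t \<xi> by auto
      have "sin ((t - \<xi>\<^sub>d d) / 2) \<le> sin (\<theta>\<^sub>d d / 2)" "sin (- (\<theta>\<^sub>d d / 2)) \<le> sin ((t - \<xi>\<^sub>d d) / 2)"
        using b \<theta> by (intro sin_monotone_2pi_le; linarith)+
      then show ?thesis by simp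
    next
      case gt: False
      then have ge: "t \<ge> 2 * pi - \<theta>\<^sub>d d + \<xi>\<^sub>d d" using False by auto
      have b: "- (\<theta>\<^sub>d d / 2) \<le> pi - (t - \<xi>\<^sub>d d) / 2" "pi - (t - \<xi>\<^sub>d d) / 2 \<le> \<theta>\<^sub>d d / 2"
        using ge t \<xi> by (auto simp: field_simps)
      have "sin (pi - (t - \<xi>\<^sub>d d) / 2) \<le> sin (\<theta>\<^sub>d d / 2)" "sin (- (\<theta>\<^sub>d d / 2)) \<le> sin (pi - (t - \<xi>\<^sub>d d) / 2)"
        using b \<theta> by (intro sin_monotone_2pi_le; linarith)+
      then show ?thesis by (simp add: sin_diff)
    qed
    then have "(sin ((t - \<xi>\<^sub>d d) / 2))\<^sup>2 \<le> (sin (\<theta>\<^sub>d d / 2))\<^sup>2" by (metis abs_le_square_iff abs_ge_self order_trans)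
    then have "boundary_disc t \<le> 0" unfolding sq by (intro mult_nonneg_nonpos) auto
    then have "sqrt (max 0 (boundary_disc t)) = 0" by simp
    then show ?thesis unfolding w\<^sub>d_def using False by (simp only: if_False)
  qed
qed

lemma weight_outside: "t \<notin> {0<..<2 * pi} \<Longrightarrow> w\<^sub>d d t = 0"
  using \<xi>\<^sub>d_props[OF d] by (auto simp: w\<^sub>d_def)

lemma weight_nonneg: "w\<^sub>d d t \<ge> 0"
  using boundary_weight_eq[of t] weight_outside[of t] by (cases "t \<in> {0<..<2 * pi}") auto

lemma weight_measurable: "w\<^sub>d d \<in> borel_measurable borel"
  unfolding w\<^sub>d_def[abs_def] by measurable

text \<open>
  \<open>A\<close> is imaginary at the boundary. The principal square root jumps across the negative axis, but its real part
  \<open>sqrt ((cmod w + Re w) / 2)\<close> is continuous; at a real \<open>w\<close> it is \<open>sqrt (max 0 w)\<close>.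
\<close>
lemma herglotz_boundary:
  assumes t: "t \<in> {0<..<2 * pi}" and r: "r \<longlonglongrightarrow> 1"
  shows "(\<lambda>j. Re (herglotz 1 (cayley (of_real (r j) * cis t)))) \<longlonglongrightarrow> w\<^sub>d d t"
proof -
  define y where "y = cos (t / 2) / sin (t / 2)"
  have "(\<lambda>j. cayley (of_real (r j) * cis t)) \<longlonglongrightarrow> cayley (of_real 1 * cis t)"
    unfolding cayley_def using cayley_cis(1)[OF t] by (intro tendsto_intros r) auto
  then have k: "(\<lambda>j. cayley (of_real (r j) * cis t)) \<longlonglongrightarrow> \<i> * of_real y"
    using cayley_cis(2)[OF t] by (simp add: y_def)
  then have D: "(\<lambda>j. Disc 1 (cayley (of_real (r j) * cis t))) \<longlonglongrightarrow> Disc 1 (\<i> * of_real y)"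
    unfolding Disc_def A_def B_def by (intro tendsto_intros)
  have "(\<lambda>j. sqrt ((cmod (Disc 1 (cayley (of_real (r j) * cis t))) + Re (Disc 1 (cayley (of_real (r j) * cis t)))) / 2)
        - Re (A (cayley (of_real (r j) * cis t))))
     \<longlonglongrightarrow> sqrt ((cmod (Disc 1 (\<i> * of_real y)) + Re (Disc 1 (\<i> * of_real y))) / 2) - Re (A (\<i> * of_real y))"
    unfolding A_def by (intro tendsto_intros D k) simp
  moreover have "sqrt ((cmod (Disc 1 (\<i> * of_real y)) + Re (Disc 1 (\<i> * of_real y))) / 2) - Re (A (\<i> * of_real y)) = w\<^sub>d d t"
  proof -
    have im: "Im (Disc 1 (\<i> * of_real y)) = 0" unfolding Im_Disc by simp
    have b: "Re (Disc 1 (\<i> * of_real y)) = boundary_disc t" by (simp add: boundary_disc_def y_def)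
    have "cmod (Disc 1 (\<i> * of_real y)) = \<bar>boundary_disc t\<bar>" using im b by (simp add: cmod_def)
    then have "(cmod (Disc 1 (\<i> * of_real y)) + Re (Disc 1 (\<i> * of_real y))) / 2 = max 0 (boundary_disc t)"
      using b by simp
    moreover have "Re (A (\<i> * of_real y)) = 0" by (simp add: A_def)
    ultimately show ?thesis by (simp only: boundary_weight_eq[OF t] diff_0_right)
  qed
  moreover have "Re (herglotz 1 k) = sqrt ((cmod (Disc 1 k) + Re (Disc 1 k)) / 2) - Re (A k)" for k
    by (simp add: herglotz_def Root_def)
  ultimately show ?thesis by simp
qed

text \<open>
  The Fourier coefficients of \<open>Re F\<close> on circles of radius \<open>r < 1\<close> are known; let \<open>r\<close> tend to \<open>1\<close> by dominated convergence.
\<close>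
lemma weight_fourier:
  "((\<lambda>t. of_real (w\<^sub>d d t) * cis t ^ k) has_integral (if k = 0 then 2 * of_real pi else of_real pi * cnj (herglotz_coeff k))) UNIV"
proof -
  obtain K where K: "K \<ge> 0" "\<And>r t. 1/2 \<le> r \<Longrightarrow> r < 1 \<Longrightarrow> t \<in> {0<..<2 * pi} \<Longrightarrow> \<bar>Re (herglotz 1 (cayley (of_real r * cis t)))\<bar> \<le> K * endpoint_bound t"
    using Re_herglotz_bound by blast
  \<comment> \<open>The offset 2 keeps all radii at least 1/2, where the majorant holds.\<close>
  define r where "r j = 1 - 1 / (real j + 2)" for j :: nat
  have r: "1/2 \<le> r j" "r j < 1" "0 < r j" for j by (auto simp: r_def field_simps)
  have r1: "r \<longlonglongrightarrow> 1" unfolding r_def by real_asymp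
  define c where "c \<rho> = (if k = 0 then 2 * of_real pi else of_real pi * (of_real \<rho> ^ k * cnj (herglotz_coeff k)))" for \<rho> :: real
  define f where "f j t = of_real (Re (herglotz 1 (cayley (of_real (r j) * cis t)))) * cis t ^ k" for j t
  let ?S = "{0<..<2 * pi}"
  have oc: "(g has_integral y) ?S \<longleftrightarrow> (g has_integral y) {0..2 * pi}" for g :: "real \<Rightarrow> complex" and y
    using has_integral_open_interval[of g y 0 "2 * pi"] by (simp add: box_real)
  have "(f j has_integral c (r j)) {0..2 * pi}" for j
  proof -
    have h1: "(\<lambda>z. herglotz 1 (cayley z)) holomorphic_on ball 0 1" by (rule holomorphic_herglotz) simp
    have "herglotz 1 (cayley 0) = 1" using herglotz_at_1[of 1] by (simp add: cayley_def)
    then have "c (r j) = (if k = 0 then 2 * of_real pi * of_real (Re (herglotz 1 (cayley 0))) else of_real pi * (of_real (r j) ^ k * cnj ((deriv ^^ k) (\<lambda>z. herglotz 1 (cayley z)) 0 / fact k)))"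
      by (simp add: c_def herglotz_coeff_def)
    then show ?thesis
      using circle_fourier_Re[OF h1 r(3)[of j] r(2)[of j], of k] unfolding f_def by (simp only:)
  qed
  then have fI: "(f j has_integral c (r j)) ?S" for j unfolding oc .
  have dom: "(\<lambda>t. K * endpoint_bound t) integrable_on ?S"
    using integrable_on_cmult_left[OF endpoint_bound_integrable, of K] integrable_on_open_interval[of "\<lambda>t. K * endpoint_bound t" 0 "2 * pi"]
    by (simp add: box_real)
  have lim: "(\<lambda>j. f j t) \<longlonglongrightarrow> of_real (w\<^sub>d d t) * cis t ^ k" if "t \<in> ?S" for t
    unfolding f_def by (intro tendsto_intros herglotz_boundary that r1)
  have bd: "norm (f j t) \<le> K * endpoint_bound t" if "t \<in> ?S" for j t
    using K(2)[OF r(1,2) that, of j] by (simp add: f_def norm_mult norm_power)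
  have fi: "f j integrable_on ?S" for j using fI by blast
  note dc = dominated_convergence[OF fi dom bd lim]
  have "(\<lambda>j. integral ?S (f j)) \<longlonglongrightarrow> c 1"
  proof -
    have "(\<lambda>j. c (r j)) \<longlonglongrightarrow> c 1" 
    proof (cases "k = 0")
      case False
      have "(\<lambda>j. of_real pi * (of_real (r j) ^ k * cnj (herglotz_coeff k))) \<longlonglongrightarrow> of_real pi * (of_real 1 ^ k * cnj (herglotz_coeff k))"
        by (intro tendsto_intros r1)
      then show ?thesis using False by (simp add: c_def)
    qed (simp add: c_def)
    moreover have "integral ?S (f j) = c (r j)" for j using fI by (rule integral_unique)
    ultimately show ?thesis by simp
  qed
  then have "integral ?S (\<lambda>t. of_real (w\<^sub>d d t) * cis t ^ k) = c 1" using dc(2) LIMSEQ_unique by blast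
  then have "((\<lambda>t. of_real (w\<^sub>d d t) * cis t ^ k) has_integral c 1) ?S" using dc(1) by (simp add: has_integral_integral)
  then have "((\<lambda>t. if t \<in> ?S then of_real (w\<^sub>d d t) * cis t ^ k else 0) has_integral c 1) UNIV"
    by (simp only: has_integral_restrict_UNIV)
  moreover have "(\<lambda>t. if t \<in> ?S then of_real (w\<^sub>d d t) * cis t ^ k else 0) = (\<lambda>t. of_real (w\<^sub>d d t) * cis t ^ k)"
    using weight_outside by auto
  ultimately show ?thesis by (simp add: c_def cong: if_cong)
qed

text \<open>
  For \<open>d = 0\<close> the formula for the density gives \<open>1\<close> on \<open>(0, 2 * pi)\<close>, so the normalized Haar measure is no exception.
\<close>
lemma mu_d_eq: "\<mu>\<^sub>d d = distr (density lborel (\<lambda>t. ennreal (w\<^sub>d d t / (2 * pi)))) circle_borel cis"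
proof (cases "d = 0")
  case True
  have "density lborel (\<lambda>t. indicator {0..<2 * pi} t / ennreal (2 * pi)) = density lborel (\<lambda>t. ennreal (w\<^sub>d d t / (2 * pi)))"
  proof (rule density_cong)
    have one: "w\<^sub>d d t = 1" if "t \<in> {0<..<2 * pi}" for t
      unfolding boundary_weight_eq[OF that] boundary_disc_def Disc_def A_def B_def by (simp add: True)
    have "AE t in lborel. t \<noteq> (0::real)" by (rule AE_lborel_singleton)
    then show "AE t in lborel. indicator {0..<2 * pi} t / ennreal (2 * pi) = ennreal (w\<^sub>d d t / (2 * pi))"
    proof (rule AE_mp, intro AE_I2 impI)
      fix t :: real assume "t \<noteq> 0"
      then have "w\<^sub>d d t = indicator {0..<2 * pi} t" using one[of t] weight_outside[of t] by (auto simp: indicator_def)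
      then show "indicator {0..<2 * pi} t / ennreal (2 * pi) = ennreal (w\<^sub>d d t / (2 * pi))"
        by (simp add: divide_ennreal[symmetric] ennreal_indicator)
    qed
  qed (use weight_measurable in auto)
  then show ?thesis using True by (simp add: \<mu>\<^sub>d_def circle_haar_def uniform_measure_def)
qed (simp add: \<mu>\<^sub>d_def)

lemma mu_d_circle_probs: "\<mu>\<^sub>d d \<in> circle_probs"
  and moment_mu_d: "k \<ge> 1 \<Longrightarrow> moment (\<mu>\<^sub>d d) k = cnj (herglotz_coeff k) / 2"
proof -
  define c where "c k = (if k = 0 then 1 else cnj (herglotz_coeff k) / 2)" for k :: nat
  have I: "((\<lambda>t. of_real (w\<^sub>d d t / (2 * pi)) * cis t ^ k) has_integral c k) UNIV" for k
    using has_integral_divide[OF weight_fourier[of k], of "2 * of_real pi"]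
    by (cases "k = 0") (simp_all add: c_def)
  have m: "(\<lambda>t. w\<^sub>d d t / (2 * pi)) \<in> borel_measurable borel" using weight_measurable by simp
  have n: "w\<^sub>d d t / (2 * pi) \<ge> 0" for t using weight_nonneg by simp
  note C = circle_law_moment[OF m n I, folded mu_d_eq]
  show "\<mu>\<^sub>d d \<in> circle_probs" using C(1) by (simp add: c_def)
  show "moment (\<mu>\<^sub>d d) k = cnj (herglotz_coeff k) / 2" if "k \<ge> 1" using C(2)[of k] that by (simp add: c_def)
qed

end

section \<open>Convergence of the empirical spectral distribution\<close>

text \<open>
  Otherwise there would be measures whose first \<open>i\<close> moments are \<open>1 / (i + 1)\<close>-close to those of \<open>\<mu>\<close> but which keep a distance from
  \<open>\<mu>\<close>; such measures converge weakly to \<open>\<mu>\<close>.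
\<close>
lemma metric_controlled_by_moments:
  assumes D: "metrizes_circle_weak_conv D" and \<mu>: "\<mu> \<in> circle_probs" and \<epsilon>: "\<epsilon> > 0"
  shows "\<exists>K. \<exists>\<eta>>0. \<forall>\<nu>\<in>circle_probs. (\<forall>k. 1 \<le> k \<and> k \<le> K \<longrightarrow> cmod (moment \<nu> k - moment \<mu> k) \<le> \<eta>) \<longrightarrow> D \<nu> \<mu> \<le> \<epsilon>"
proof (rule ccontr)
  assume neg: "\<not> ?thesis"
  have "\<forall>i::nat. \<exists>\<nu>. \<nu> \<in> circle_probs \<and> (\<forall>k. 1 \<le> k \<and> k \<le> i \<longrightarrow> cmod (moment \<nu> k - moment \<mu> k) \<le> 1 / (real i + 1)) \<and> D \<nu> \<mu> > \<epsilon>"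
  proof
    fix i :: nat
    have "1 / (real i + 1) > 0" by simp
    with neg show "\<exists>\<nu>. \<nu> \<in> circle_probs \<and> (\<forall>k. 1 \<le> k \<and> k \<le> i \<longrightarrow> cmod (moment \<nu> k - moment \<mu> k) \<le> 1 / (real i + 1)) \<and> D \<nu> \<mu> > \<epsilon>"
      by (meson not_le)
  qed
  then obtain \<nu> where \<nu>: "\<And>i. \<nu> i \<in> circle_probs" "\<And>i k. 1 \<le> k \<Longrightarrow> k \<le> i \<Longrightarrow> cmod (moment (\<nu> i) k - moment \<mu> k) \<le> 1 / (real i + 1)"
      "\<And>i. D (\<nu> i) \<mu> > \<epsilon>"
    by metis
  have "(\<lambda>i. moment (\<nu> i) k) \<longlonglongrightarrow> moment \<mu> k" for k
  proof (cases "k = 0")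
    case True
    have "moment \<nu>' 0 = 1" if "\<nu>' \<in> circle_probs" for \<nu>'
      using prob_space.prob_space[OF circle_prob_space[OF that]] by (simp add: moment_def)
    then show ?thesis using True \<nu>(1) \<mu> by simp
  next
    case False
    have "(\<lambda>i. moment (\<nu> i) k - moment \<mu> k) \<longlonglongrightarrow> 0"
    proof (rule Lim_null_comparison)
      show "eventually (\<lambda>i. norm (moment (\<nu> i) k - moment \<mu> k) \<le> 1 / (real i + 1)) sequentially"
        using eventually_ge_at_top[of k] by eventually_elim (use False \<nu>(2) in auto)
      show "(\<lambda>i. 1 / (real i + 1)) \<longlonglongrightarrow> 0" by real_asymp
    qed
    then show ?thesis using Lim_null by blast
  qed
  then have "circle_weak_conv \<nu> \<mu>" by (rule moments_imp_weak_conv[OF \<nu>(1) \<mu>])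
  then have "(\<lambda>i. D (\<nu> i) \<mu>) \<longlonglongrightarrow> 0"
    using D \<nu>(1) \<mu> unfolding metrizes_circle_weak_conv_def by blast
  then have "eventually (\<lambda>i. D (\<nu> i) \<mu> < \<epsilon>) sequentially" using \<epsilon> by (rule order_tendstoD)
  then obtain i where "D (\<nu> i) \<mu> < \<epsilon>" using eventually_happens by force
  then show False using \<nu>(3)[of i] by simp
qed

context jacobi_chain
begin

lemma moment_GGT: "moment (esd (GGT (Suc m) a)) k = (\<Sum>\<zeta>\<in>zeros. \<zeta> ^ k) / of_nat (Suc m)"
  using moment_esd[OF GGT_unitary, of k] finite_zeros by (simp add: eigvals_GGT sum_unfold_sum_mset)

lemma moment_distance:
  assumes \<eta>: "\<eta> > 0" and K: "K < m" and K\<eta>: "\<eta> * real (Suc m) \<le> real m - real K"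
    and rs: "\<And>z. cmod z \<le> 1/8 \<Longrightarrow> cmod (riemann_sum m z - (1 - herglotz 1 (cayley z)) / 2) \<le> \<rho>" and k: "k \<ge> 1"
  shows "cmod (moment (esd (GGT (Suc m) a)) k - moment (\<mu>\<^sub>d d) k)
    \<le> 8 ^ k * ((2 + 2 * lipschitz_const \<eta> * lipschitz_const \<eta> * (cmod d / \<eta>\<^sup>2) + (\<Sum>j<K. 2 * lipschitz_const \<eta> * cmod (deformed a j - limit_coeff (scale j))) + (real (Suc m) - real K)) / real (Suc m) + \<rho>)"
  unfolding moment_GGT moment_mu_d[OF k]
proof (rule power_sum_bound[OF finite_zeros _ card_zeros _ rs k])
  show "zeros \<subseteq> sphere 0 1" using zerosD by auto
  fix z :: complex assume "cmod z \<le> 1/4"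
  from chain_bound[OF \<eta> K K\<eta> this]
  show "cmod ((\<Sum>\<zeta>\<in>zeros. Ln (1 - cnj \<zeta> * z)) - (\<Sum>k<m. Ln (limit_factor ((real m - real k) / real (Suc m)) z)))
    \<le> real (Suc m) * ((2 + 2 * lipschitz_const \<eta> * lipschitz_const \<eta> * (cmod d / \<eta>\<^sup>2) + (\<Sum>j<K. 2 * lipschitz_const \<eta> * cmod (deformed a j - limit_coeff (scale j))) + (real (Suc m) - real K)) / real (Suc m))"
    by (simp add: scale_def)
qed

end

context hua_pickrell
begin

text \<open>
  With \<open>N = \<beta> / 2 * (m - j)\<close> the exponent \<open>\<delta>\<close> equals \<open>N * (d / s)\<close>, so \<open>disc_law_concentration\<close> applies with \<open>d / s\<close> in place of
  \<open>d\<close>; its mode is \<open>limit_coeff s\<close>.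
\<close>
lemma coefficient_concentration:
  assumes \<beta>: "\<beta> > 0" and j: "j < m" and s: "s = (real m - real j) / real (Suc m)" "s \<ge> \<eta>" and \<eta>: "\<eta> > 0"
    and N: "\<beta> / 2 * \<eta> * real (Suc m) \<ge> 2"
  shows "(\<integral>\<^sup>+z. ennreal (cmod (z - limit_coeff s)) * ennreal (jacobi_weight (of_real (\<beta> / 2 * real (Suc m)) * d) z) \<partial>verblunsky_law.coeff_law m \<beta> j)
    \<le> ennreal (2 * (1 + 2 * cmod d / \<eta>) * (1 + cmod d / \<eta>) / sqrt (\<beta> / 2 * \<eta> * real (Suc m)))
      * (\<integral>\<^sup>+z. ennreal (jacobi_weight (of_real (\<beta> / 2 * real (Suc m)) * d) z) \<partial>verblunsky_law.coeff_law m \<beta> j)"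
proof -
  interpret L: verblunsky_law m \<beta> by unfold_locales (rule \<beta>)
  define N where "N = \<beta> / 2 * (real m - real j)"
  define d' where "d' = d / of_real s"
  have s0: "s > 0" using s(2) \<eta> by simp
  have "s * real (Suc m) = real m - real j" unfolding s(1) by (simp del: of_nat_Suc)
  then have Ns: "N = \<beta> / 2 * s * real (Suc m)" by (simp only: N_def mult.assoc)
  have "\<beta> / 2 * \<eta> * real (Suc m) \<le> N" unfolding Ns using s(2) \<beta> by (intro mult_right_mono mult_left_mono) auto
  then have N2: "N \<ge> 2" "\<beta> / 2 * \<eta> * real (Suc m) \<le> N" using N by auto
  interpret J: jacobi_disc N d'
    by unfold_locales (use N2 d s0 in \<open>auto simp: d'_def Re_divide_of_real\<close>)
  have \<delta>: "of_real N * d' = of_real (\<beta> / 2 * real (Suc m)) * d"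
    using s0 by (simp add: Ns d'_def field_simps)
  have mode: "J.mode = limit_coeff s"
    unfolding J.mode_def unfolding d'_def limit_coeff_def using s0 s_plus_d_nonzero[OF s0] by (simp add: field_simps)
  have law: "L.coeff_law j = disc_law (2 * N + 1)" by (simp add: L.coeff_law_def N_def)
  have d'n: "cmod d' \<le> cmod d / \<eta>" using s(2) \<eta> s0 by (simp add: d'_def norm_divide) (intro divide_left_mono mult_pos_pos; simp)
  have "2 * (1 + 2 * cmod d') * (1 + cmod d') / sqrt N \<le> 2 * (1 + 2 * cmod d / \<eta>) * (1 + cmod d / \<eta>) / sqrt (\<beta> / 2 * \<eta> * real (Suc m))"
  proof (intro frac_le mult_mono)
    show "sqrt (\<beta> / 2 * \<eta> * real (Suc m)) \<le> sqrt N" using N2(2) by (rule real_sqrt_le_mono)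
    show "0 < sqrt (\<beta> / 2 * \<eta> * real (Suc m))" using \<beta> \<eta> by simp
  qed (use d'n \<eta> in \<open>auto simp: add_nonneg_nonneg\<close>)
  then have E: "ennreal (2 * (1 + 2 * cmod d') * (1 + cmod d') / sqrt N) \<le> ennreal (2 * (1 + 2 * cmod d / \<eta>) * (1 + cmod d / \<eta>) / sqrt (\<beta> / 2 * \<eta> * real (Suc m)))"
    by (rule ennreal_leI)
  show ?thesis
    using order.trans[OF J.disc_law_concentration mult_right_mono[OF E zero_le]]
    unfolding \<delta> mode law .
qed

lemma measurable_esd_distance:
  assumes "n \<ge> 1" "metrizes_circle_weak_conv D"
  shows "(\<lambda>A. D (esd A) (\<mu>\<^sub>d d)) \<in> borel_measurable (unitary_borel n)"
  by (rule measurable_esd_functional[OF assms(1)]) (rule metric_weakly_continuous[OF assms(2) _ _ mu_d_circle_probs])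

text \<open>
  The levels below \<open>\<eta>\<close> contribute a term of order \<open>\<eta>\<close>; for fixed \<open>\<eta>\<close> all other errors tend to \<open>0\<close> with \<open>n\<close>. The
  constant \<open>\<kappa>\<close> does not depend on \<open>\<eta>\<close>, so that \<open>\<eta>\<close> can be chosen afterwards.
\<close>
lemma jacobi_ensemble_bound:
  assumes \<beta>: "\<beta> > 0" and D: "metrizes_circle_weak_conv D" and \<epsilon>: "\<epsilon> > 0"
  shows "\<exists>\<kappa>>0. \<forall>\<eta>. 0 < \<eta> \<and> \<eta> \<le> 1/2 \<longrightarrow> (\<exists>N C C'. \<forall>n\<ge>N.
    prob_space (CJ n (of_real (\<beta> / 2 * real n) * d) \<beta>) \<longrightarrow>
    measure (CJ n (of_real (\<beta> / 2 * real n) * d) \<beta>) {A \<in> unitary_mats n. D (esd A) (\<mu>\<^sub>d d) > \<epsilon>} \<le> (\<eta> + C / real n + C' / sqrt (real n)) / \<kappa>)"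
proof -
  obtain K \<eta>0 where K: "\<eta>0 > 0" "\<And>\<nu>. \<nu> \<in> circle_probs \<Longrightarrow> (\<And>k. 1 \<le> k \<Longrightarrow> k \<le> K \<Longrightarrow> cmod (moment \<nu> k - moment (\<mu>\<^sub>d d) k) \<le> \<eta>0) \<Longrightarrow> D \<nu> (\<mu>\<^sub>d d) \<le> \<epsilon>"
    using metric_controlled_by_moments[OF D mu_d_circle_probs \<epsilon>] by blast
  \<comment> \<open>Half of the error budget of the moments goes to the Riemann sum, half to the fluctuations; \<open>8 ^ K\<close> is the loss in Cauchy's inequality.\<close>
  define \<kappa> where "\<kappa> = \<eta>0 / (2 * 8 ^ K)"
  have \<kappa>: "\<kappa> > 0" using K(1) by (simp add: \<kappa>_def)
  obtain N0 where N0: "\<And>m z. m \<ge> N0 \<Longrightarrow> cmod z \<le> 1/8 \<Longrightarrow> cmod (riemann_sum m z - (1 - herglotz 1 (cayley z)) / 2) \<le> \<kappa>"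
    using riemann_sum_limit[OF \<kappa>] by metis
  show ?thesis
  proof (intro exI[of _ \<kappa>] conjI \<kappa> allI impI)
    fix \<eta> :: real assume \<eta>': "0 < \<eta> \<and> \<eta> \<le> 1/2"
    then have \<eta>: "\<eta> > 0" "\<eta> \<le> 1/2" by auto
    define L where "L = lipschitz_const \<eta>"
    have L: "L \<ge> 4" using \<eta> by (simp add: L_def lipschitz_const_def)
    define C where "C = 4 + 2 * L * L * (cmod d / \<eta>\<^sup>2)"
    define Q where "Q = 2 * (1 + 2 * cmod d / \<eta>) * (1 + cmod d / \<eta>) / sqrt (\<beta> / 2 * \<eta>)"
    have Q: "Q \<ge> 0" using \<eta> \<beta> by (auto simp: Q_def intro!: divide_nonneg_nonneg mult_nonneg_nonneg add_nonneg_nonneg)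
    obtain N1 where N1: "real N1 \<ge> 4 / (\<beta> * \<eta>)" using real_arch_simple by blast
    define N where "N = N0 + N1 + 4"
    show "\<exists>N C C'. \<forall>n\<ge>N. prob_space (CJ n (of_real (\<beta> / 2 * real n) * d) \<beta>) \<longrightarrow>
      measure (CJ n (of_real (\<beta> / 2 * real n) * d) \<beta>) {A \<in> unitary_mats n. D (esd A) (\<mu>\<^sub>d d) > \<epsilon>} \<le> (\<eta> + C / real n + C' / sqrt (real n)) / \<kappa>"
    proof (rule exI[of _ N], rule exI[of _ C], rule exI[of _ "2 * L * Q"], intro allI impI)
      fix n assume n: "n \<ge> N" and prob: "prob_space (CJ n (of_real (\<beta> / 2 * real n) * d) \<beta>)"
      obtain m where m: "n = Suc m" using n by (cases n) (auto simp: N_def)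
      have m0: "m \<ge> N0" "n \<ge> 4" "real n \<ge> 4 / (\<beta> * \<eta>)" using n N1 m by (auto simp: N_def)
      interpret VL: verblunsky_law m \<beta> by unfold_locales (rule \<beta>)
      \<comment> \<open>The number of levels below \<open>\<eta>\<close>, rounded up; the first \<open>J\<close> coefficients have levels at least \<open>\<eta>\<close>.\<close>
      define r where "r = nat \<lceil>\<eta> * real n\<rceil>"
      define J where "J = m - r"
      have "\<eta> * real n > 0" using \<eta> m by simp
      then have r: "\<eta> * real n \<le> real r" "real r \<le> \<eta> * real n + 1" "r > 0" unfolding r_def by linarith+
      have "\<eta> * real n \<le> 1/2 * real n" using \<eta> by (intro mult_right_mono) auto
      then have rm: "r \<le> m" using r(2) m0(2) m by linarith
      then have J: "J < m" "real m - real J = real r" using r(3) by (auto simp: J_def of_nat_diff)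
      define s where "s j = (real m - real j) / real (Suc m)" for j
      have s\<eta>: "s j \<ge> \<eta>" if "j < J" for j
      proof -
        have "\<eta> * real (Suc m) \<le> real m - real j" using r(1) J that m by simp
        then show ?thesis unfolding s_def by (simp add: le_divide_eq del: of_nat_Suc)
      qed
      define bad where "bad = {A \<in> unitary_mats n. D (esd A) (\<mu>\<^sub>d d) > \<epsilon>}"
      have badm: "bad \<in> sets (unitary_borel (Suc m))"
        using measurable_sets[OF measurable_esd_distance[OF _ D, of n], of "{\<epsilon><..}"] m
        unfolding bad_def by (simp add: vimage_def Int_def conj_commute)
      define c0 where "c0 = (2 + 2 * L * L * (cmod d / \<eta>\<^sup>2) + (real n - real J)) / real n"
      define E where "E = 2 * (1 + 2 * cmod d / \<eta>) * (1 + cmod d / \<eta>) / sqrt (\<beta> / 2 * \<eta> * real n)"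
      have EQ: "E = Q / sqrt (real n)" by (simp only: E_def Q_def real_sqrt_mult divide_divide_eq_left)
      have c00: "c0 \<ge> 0" using L J(1) m by (auto simp: c0_def intro!: divide_nonneg_nonneg add_nonneg_nonneg mult_nonneg_nonneg)
      have \<beta>n: "\<beta> / 2 * \<eta> * real n \<ge> 2" using m0(3) \<beta> \<eta> by (simp add: field_simps)
      have "measure (CJ n (of_real (\<beta> / 2 * real n) * d) \<beta>) bad \<le> (c0 + (\<Sum>j<J. 2 * L / real n * E)) / \<kappa>"
        unfolding m
      proof (rule VL.CJ_markov_bound[where g = "\<lambda>j. limit_coeff (s j)"])
        show "0 \<le> Re (of_real (\<beta> / 2 * real (Suc m)) * d)" using \<beta> d by simp
        show "prob_space (CJ (Suc m) (of_real (\<beta> / 2 * real (Suc m)) * d) \<beta>)" using prob m by simp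
        show "bad \<in> sets (unitary_borel (Suc m))" by (rule badm)
        show "{..<J} \<subseteq> {..<Suc m}" using J by auto
        show "0 \<le> c0" by (rule c00)
        show "0 \<le> 2 * L / real (Suc m)" if "j \<in> {..<J}" for j using L by simp
        show "0 \<le> E" if "j \<in> {..<J}" for j using Q by (simp add: EQ)
        show "0 < \<kappa>" by (rule \<kappa>)
        show "(\<integral>\<^sup>+z. ennreal (cmod (z - limit_coeff (s j))) * ennreal (jacobi_weight (of_real (\<beta> / 2 * real (Suc m)) * d) z) \<partial>VL.coeff_law j)
            \<le> ennreal E * (\<integral>\<^sup>+z. ennreal (jacobi_weight (of_real (\<beta> / 2 * real (Suc m)) * d) z) \<partial>VL.coeff_law j)" if "j \<in> {..<J}" for j
          unfolding E_def m by (rule coefficient_concentration[OF \<beta> _ s_def s\<eta> \<eta>(1)]) (use that J \<beta>n m in auto)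
        show "\<kappa> \<le> c0 + (\<Sum>j\<in>{..<J}. 2 * L / real (Suc m) * cmod (deformed a j - limit_coeff (s j)))"
          if v: "verblunsky m a" and b: "GGT (Suc m) a \<in> bad" for a
        proof -
          interpret V: verblunsky m a by (rule v)
          interpret ch: jacobi_chain d m a by unfold_locales
          have "esd (GGT (Suc m) a) \<in> circle_probs" using b m by (intro esd_circle_probs[of _ n]) (auto simp: bad_def)
          moreover have "D (esd (GGT (Suc m) a)) (\<mu>\<^sub>d d) > \<epsilon>" using b by (simp add: bad_def)
          ultimately obtain k where k: "1 \<le> k" "k \<le> K" "cmod (moment (esd (GGT (Suc m) a)) k - moment (\<mu>\<^sub>d d) k) > \<eta>0"
            using K(2) by (meson not_le)
          define R where "R = (2 + 2 * L * L * (cmod d / \<eta>\<^sup>2) + (\<Sum>j<J. 2 * L * cmod (deformed a j - limit_coeff (s j))) + (real (Suc m) - real J)) / real (Suc m)"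
          have R: "R = c0 + (\<Sum>j\<in>{..<J}. 2 * L / real (Suc m) * cmod (deformed a j - limit_coeff (s j)))"
            unfolding R_def c0_def m by (simp add: add_divide_distrib sum_divide_distrib)
          have R0: "R \<ge> 0" unfolding R using c00 L by (intro add_nonneg_nonneg sum_nonneg mult_nonneg_nonneg) auto
          have "\<eta>0 < 8 ^ k * (R + \<kappa>)"
            using k(3) ch.moment_distance[OF \<eta>(1) J(1) _ N0[OF m0(1)] k(1)] r(1) J(2) m
            unfolding R_def L_def s_def ch.scale_def by simp
          also have "\<dots> \<le> 8 ^ K * (R + \<kappa>)" using k(2) R0 \<kappa> by (intro mult_right_mono power_increasing) auto
          finally have "\<eta>0 / 8 ^ K < R + \<kappa>" by (simp add: field_simps)
          then show ?thesis unfolding R[symmetric] by (simp add: \<kappa>_def)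
        qed
      qed
      also have "\<dots> \<le> (\<eta> + C / real n + 2 * L * Q / sqrt (real n)) / \<kappa>"
      proof (intro divide_right_mono add_mono)
        have "real n - real J \<le> \<eta> * real n + 2" using J(2) r(2) m by simp
        then have "c0 \<le> (2 + 2 * L * L * (cmod d / \<eta>\<^sup>2) + (\<eta> * real n + 2)) / real n"
          unfolding c0_def by (intro divide_right_mono) auto
        also have "\<dots> = \<eta> + C / real n" using m by (simp add: C_def add_divide_distrib)
        finally show "c0 \<le> \<eta> + C / real n" .
        have "(\<Sum>j<J. 2 * L / real n * E) = real J * (2 * L / real n * E)" by simp
        also have "\<dots> \<le> real n * (2 * L / real n * E)" using J m L Q by (intro mult_right_mono) (auto simp: EQ)
        also have "\<dots> = 2 * L * Q / sqrt (real n)" using m by (simp add: EQ)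
        finally show "(\<Sum>j<J. 2 * L / real n * E) \<le> 2 * L * Q / sqrt (real n)" .
      qed (use \<kappa> in auto)
      finally show "measure (CJ n (of_real (\<beta> / 2 * real n) * d) \<beta>) {A \<in> unitary_mats n. D (esd A) (\<mu>\<^sub>d d) > \<epsilon>} \<le> (\<eta> + C / real n + 2 * L * Q / sqrt (real n)) / \<kappa>"
        unfolding bad_def .
    qed
  qed
qed

lemma jacobi_ensemble_limit:
  assumes \<beta>: "\<beta> > 0" and D: "metrizes_circle_weak_conv D" and \<epsilon>: "\<epsilon> > 0"
    and prob: "\<And>n. n \<ge> 1 \<Longrightarrow> prob_space (CJ n (of_real (\<beta> / 2 * real n) * d) \<beta>)"
  shows "(\<lambda>n. measure (CJ n (of_real (\<beta> / 2 * real n) * d) \<beta>) {A \<in> unitary_mats n. D (esd A) (\<mu>\<^sub>d d) > \<epsilon>}) \<longlonglongrightarrow> 0"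
proof -
  define P where "P n = measure (CJ n (of_real (\<beta> / 2 * real n) * d) \<beta>) {A \<in> unitary_mats n. D (esd A) (\<mu>\<^sub>d d) > \<epsilon>}" for n
  from jacobi_ensemble_bound[OF \<beta> D \<epsilon>, folded P_def]
  obtain \<kappa> where \<kappa>: "\<kappa> > 0" and B: "\<forall>\<eta>. 0 < \<eta> \<and> \<eta> \<le> 1/2 \<longrightarrow> (\<exists>N C C'. \<forall>n\<ge>N. prob_space (CJ n (of_real (\<beta> / 2 * real n) * d) \<beta>) \<longrightarrow>
      P n \<le> (\<eta> + C / real n + C' / sqrt (real n)) / \<kappa>)"
    by (elim exE conjE) (rule that)
  have "P \<longlonglongrightarrow> 0"
  proof (rule order_tendstoI)
    show "eventually (\<lambda>n. a < P n) sequentially" if "a < 0" for a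
      using that by (intro always_eventually allI) (auto simp: P_def intro: less_le_trans)
    show "eventually (\<lambda>n. P n < e) sequentially" if e: "0 < e" for e
    proof -
      define \<eta> where "\<eta> = min (1/2) (e * \<kappa> / 2)"
      have \<eta>: "0 < \<eta>" "\<eta> \<le> 1/2" "\<eta> / \<kappa> < e" using e \<kappa> by (auto simp: \<eta>_def field_simps min_def)
      obtain N C C' where N: "\<And>n. n \<ge> N \<Longrightarrow> prob_space (CJ n (of_real (\<beta> / 2 * real n) * d) \<beta>) \<Longrightarrow> P n \<le> (\<eta> + C / real n + C' / sqrt (real n)) / \<kappa>"
        using B[THEN spec, THEN mp, OF conjI[OF \<eta>(1,2)]] by (elim exE) (rule that, blast)
      have "(\<lambda>n. (\<eta> + C / real n + C' / sqrt (real n)) / \<kappa>) \<longlonglongrightarrow> (\<eta> + 0 + 0) / \<kappa>"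
        by (intro tendsto_intros lim_const_over_n tendsto_divide_0[OF tendsto_const]
          filterlim_at_top_imp_at_infinity filterlim_compose[OF sqrt_at_top filterlim_real_sequentially]) (use \<kappa> in auto)
      then have "eventually (\<lambda>n. (\<eta> + C / real n + C' / sqrt (real n)) / \<kappa> < e) sequentially"
        using \<eta>(3) by (intro order_tendstoD) auto
      then show ?thesis
        using eventually_ge_at_top[of "max 1 N"]
      proof eventually_elim
        case (elim n)
        then show ?case using N[of n] prob[of n] by auto
      qed
    qed
  qed
  then show ?thesis unfolding P_def .
qed

end

theorem theorem5p4:
  fixes \<beta> :: real and d :: complex
    and M :: "nat \<Rightarrow> 'a measure" and U :: "nat \<Rightarrow> 'a \<Rightarrow> complex mat"
  assumes "\<beta> > 0" and "Re d \<ge> 0"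
    and "\<And>n. n \<ge> 1 \<Longrightarrow> prob_space (M n)"
    and "\<And>n. n \<ge> 1 \<Longrightarrow> U n \<in> M n \<rightarrow>\<^sub>M unitary_borel n"
    and "\<And>n. n \<ge> 1 \<Longrightarrow>
           distr (M n) (unitary_borel n) (U n) = CJ n (complex_of_real (\<beta> / 2 * real n) * d) \<beta>"
  shows "circle_weak_conv_in_prob M (\<lambda>n \<omega>. esd (U n \<omega>)) (\<mu>\<^sub>d d)"
proof -
  interpret hua_pickrell d by unfold_locales (rule assms(2))
  let ?CJ = "\<lambda>n. CJ n (complex_of_real (\<beta> / 2 * real n) * d) \<beta>"
  have prob: "prob_space (?CJ n)" if "n \<ge> 1" for n
    using prob_space.prob_space_distr[OF assms(3)[OF that] assms(4)[OF that]] assms(5)[OF that] by simp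
  have Um: "U n \<omega> \<in> unitary_mats n" if "n \<ge> 1" "\<omega> \<in> space (M n)" for n \<omega>
    using measurable_space[OF assms(4)[OF that(1)] that(2)] by simp
  have ev1: "eventually (\<lambda>n. n \<ge> 1) sequentially" by (rule eventually_ge_at_top)
  show ?thesis
    unfolding circle_weak_conv_in_prob_def
  proof (intro conjI allI impI)
    show "\<mu>\<^sub>d d \<in> circle_probs" by (rule mu_d_circle_probs)
    show "\<forall>\<^sub>F n in sequentially. \<forall>\<omega>\<in>space (M n). esd (U n \<omega>) \<in> circle_probs"
      using ev1 by eventually_elim (use Um esd_circle_probs in blast)
    fix D assume D: "metrizes_circle_weak_conv D"
    have m: "(\<lambda>\<omega>. D (esd (U n \<omega>)) (\<mu>\<^sub>d d)) \<in> borel_measurable (M n)" if "n \<ge> 1" for n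
      by (rule measurable_compose[OF assms(4)[OF that] measurable_esd_distance[OF that D]])
    show "\<forall>\<^sub>F n in sequentially. (\<lambda>\<omega>. D (esd (U n \<omega>)) (\<mu>\<^sub>d d)) \<in> borel_measurable (M n)"
      using ev1 by eventually_elim (rule m)
    fix \<epsilon> :: real assume \<epsilon>: "\<epsilon> > 0"
    have "eventually (\<lambda>n. measure (?CJ n) {A \<in> unitary_mats n. D (esd A) (\<mu>\<^sub>d d) > \<epsilon>}
        = measure (M n) {\<omega> \<in> space (M n). D (esd (U n \<omega>)) (\<mu>\<^sub>d d) > \<epsilon>}) sequentially"
      using ev1
    proof eventually_elim
      case (elim n)
      have s: "{A \<in> unitary_mats n. D (esd A) (\<mu>\<^sub>d d) > \<epsilon>} \<in> sets (unitary_borel n)"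
        using measurable_sets[OF measurable_esd_distance[OF elim D], of "{\<epsilon><..}"]
        by (simp add: vimage_def Int_def conj_commute)
      have "U n -` {A \<in> unitary_mats n. D (esd A) (\<mu>\<^sub>d d) > \<epsilon>} \<inter> space (M n) = {\<omega> \<in> space (M n). D (esd (U n \<omega>)) (\<mu>\<^sub>d d) > \<epsilon>}"
        using Um[OF elim] by auto
      then show ?case
        unfolding assms(5)[OF elim, symmetric] measure_distr[OF assms(4)[OF elim] s] by simp
    qed
    with jacobi_ensemble_limit[OF assms(1) D \<epsilon> prob]
    show "(\<lambda>n. measure (M n) {\<omega> \<in> space (M n). D (esd (U n \<omega>)) (\<mu>\<^sub>d d) > \<epsilon>}) \<longlonglongrightarrow> 0"
      by (rule Lim_transform_eventually)
  qed
qed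

end
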